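(* Let $p\ge 1$ and $n\ge 2$. If $K\subset\mathbb{R}^n$ is an $L_{n+p}$-star with $V(K)>0$, then $$V(K)\,V(\Lambda_p^{\circ}K)\le \omega_n^{2},$$ with equality if and only if $K$, up to sets of (Lebesgue) measure $0$, is an origin-symmetric ellipsoid when $n=2$, and is an origin-symmetric Euclidean ball when $n\ge 3$.
   Context: $V$ denotes $n$-dimensional Lebesgue measure (volume), $B^n$ the Euclidean unit ball, $S^{n-1}$ the unit sphere, and $\omega_s=\pi^{s/2}/\Gamma(1+s/2)$ for $s\ge 0$ (so $\omega_n=V(B^n)$). For $x,y\in\mathbb{R}^n$ let $[x,y]=\sqrt{|x|^2|y|^2-(x\cdot y)^2}$ (the area of the parallelogram spanned by $x,y$). Let $du$ denote the rotation-invariant probability measure on $S^{n-1}$. A set $L\subset\mathbb{R}^n$ is an $L_{n+p}$-star if $L=\{ru:\ u\in S^{n-1},\ 0\le r\le \rho(u)\}$ for a measurable function $\rho:S^{n-1}\to[0,\infty)$ with $\int_{S^{n-1}}\rho(u)^{n+p}\,du<\infty$; $\rho=\rho_L$ is its radial function. For an $L_{n+p}$-star $K$ with $V(K)>0$ and $p\ge1$, the $L_p$-sine centroid body $\Lambda_pK$ is the (origin-symmetric) convex body with support function $$h_{\Lambda_pK}(x)^p=\frac{1}{\widetilde c_{n,p}V(K)}\int_K [x,y]^p\,dy,\qquad \widetilde c_{n,p}=\frac{(n-1)\omega_{n-1}\omega_{n+p-2}}{(n+p)\omega_n\omega_{n+p-3}},$$ and $\Lambda_p^{\circ}K=\{x\in\mathbb{R}^n: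 x\cdot y\le 1 \text{ for all } y\in\Lambda_pK\}$ is its polar body. *)

theory Defs
  imports "HOL-Analysis.Analysis"
begin

text \<open>omega s = pi^(s/2) / Gamma(1 + s/2); omega n is the volume of the unit ball.\<close>
definition omega :: "real \<Rightarrow> real" where
  "omega s = pi powr (s / 2) / Gamma (1 + s / 2)"

definition vol :: "'a::euclidean_space set \<Rightarrow> real" where
  "vol K = measure lebesgue K"

text \<open>[x,y]: area of the parallelogram spanned by x and y.\<close>
definition pgram :: "'a::euclidean_space \<Rightarrow> 'a \<Rightarrow> real" where
  "pgram x y = sqrt ((norm x)\<^sup>2 * (norm y)\<^sup>2 - (x \<bullet> y)\<^sup>2)"

definition radial_set :: "('a::euclidean_space \<Rightarrow> real) \<Rightarrow> 'a set" where
  "radial_set \<rho> = {r *\<^sub>R u | u r. u \<in> sphere 0 1 \<and> 0 \<le> r \<and> r \<le> \<rho> u}"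

text \<open>Integration against the rotation-invariant probability measure du on the sphere is
  expressed via polar coordinates: int f du = (1 / V(B^n)) * int_{B^n} f(x/|x|) dx.
  Measurability of rho on the sphere corresponds to measurability of x |-> rho(x/|x|).
  L_q-star (q = n + p): K = radial_set rho, rho >= 0 measurable with int rho^q du < infinity.\<close>
definition Lq_star :: "real \<Rightarrow> 'a::euclidean_space set \<Rightarrow> bool" where
  "Lq_star q K \<longleftrightarrow> (\<exists>\<rho>. (\<forall>u\<in>sphere 0 1. 0 \<le> \<rho> u) \<and>
      integrable (lebesgue_on (cball 0 1)) (\<lambda>x. \<rho> (sgn x) powr q) \<and>
      (\<lambda>x. \<rho> (sgn x)) \<in> borel_measurable (lebesgue_on (cball 0 1)) \<and>
      K = radial_set \<rho>)"

definition ctilde :: "nat \<Rightarrow> real \<Rightarrow> real" where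
  "ctilde n p = ((real n - 1) * omega (real n - 1) * omega (real n + p - 2)) /
                ((real n + p) * omega (real n) * omega (real n + p - 3))"

definition sine_support :: "real \<Rightarrow> 'a::euclidean_space set \<Rightarrow> 'a \<Rightarrow> real" where
  "sine_support p K x =
     ((1 / (ctilde DIM('a) p * vol K)) * (\<integral>y. pgram x y powr p \<partial>(lebesgue_on K))) powr (1 / p)"

definition sine_centroid :: "real \<Rightarrow> 'a::euclidean_space set \<Rightarrow> 'a set" where
  "sine_centroid p K = {z. \<forall>x. z \<bullet> x \<le> sine_support p K x}"

definition polar :: "'a::euclidean_space set \<Rightarrow> 'a set" where
  "polar L = {x. \<forall>y\<in>L. x \<bullet> y \<le> 1}"

definition origin_ellipsoid :: "'a::euclidean_space set \<Rightarrow> bool" where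
  "origin_ellipsoid B \<longleftrightarrow> (\<exists>T::'a \<Rightarrow> 'a. linear T \<and> inj T \<and> B = T ` cball 0 1)"

definition origin_ball :: "'a::euclidean_space set \<Rightarrow> bool" where
  "origin_ball B \<longleftrightarrow> (\<exists>r>0. B = cball 0 r)"

definition ae_eq_set :: "'a::euclidean_space set \<Rightarrow> 'a set \<Rightarrow> bool" where
  "ae_eq_set A B \<longleftrightarrow> (A - B) \<union> (B - A) \<in> null_sets lebesgue"

end

theory Submission
  imports Defs "HOL-Complex_Analysis.Great_Picard"
begin

text \<open>Let \<open>H\<close> and \<open>S\<close> be the moments of order \<open>p\<close> over \<open>K\<close> of \<open>|x \<bullet> y|\<close> and of \<open>[x,y]\<close>. The polar of the sine centroid
  body is a sublevel set of \<open>S\<close>, so the product \<open>V(K)\<^sup>1\<^sup>+\<^sup>n\<^sup>/\<^sup>p |{S \<le> 1}|\<close> has to be maximised.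

  With \<open>H\<close> in place of \<open>S\<close> this is the inequality of Lutwak and Zhang, with ellipsoids as maximisers. Replacing \<open>K\<close> by
  \<open>{H \<le> 1}\<close> does not decrease the product (bathtub principle), so \<open>K\<close> may be taken to be the unit ball of a norm. Neither does a Steiner
  symmetrization, by a Prekopa-Leindler argument. Symmetrizing in all coordinate directions and rescaling leaves a
  compact family of norms, hence a maximiser exists. Equality in a Steiner step produces a linear
  reflection that preserves the body; a maximiser has one in every direction, and its inertia
  form then shows that it is an ellipsoid.

  In the plane \<open>S\<close> is \<open>H\<close> composed with a rotation. In dimension at least 3, \<open>S(x)/|x|\<^sup>p\<close> is a multiple of the limit, as \<open>e \<rightarrow> 0\<close>, of
  the averages of \<open>H(y)/|y|\<^sup>p\<close> over the bands \<open>|x \<bullet> y| \<le> e|x||y|\<close>. Jensen's inequality for \<open>t \<mapsto> t\<^sup>-\<^sup>n\<^sup>/\<^sup>p\<close> gives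
  the inequality for \<open>S\<close>. Two bands overlap in a set of measure of order \<open>e\<^sup>2\<close> or more, so the variance
  term in Jensen's inequality survives the limit, and equality forces \<open>H(y)/|y|\<^sup>p\<close> to be constant.\<close>

section \<open>Linear changes of variables\<close>

text \<open>Determinants and surface measure are avoided. A linear map enters through the factor
  \<open>lscale\<close>, and functions on the sphere are treated as functions of degree 0 on the
  punctured unit ball. Great subspheres are null sets there, hence bands of positive width.

  What must grow under symmetrization is the volume of the dual set {H <= 1}. Take y, z in it at the
  same height t in the direction b. Reflecting every chord of the body in its midpoint preserves
  volume, and this puts (y - z)/2 + t b into the dual set of the symmetral. The difference, in place
  of the usual midpoint, is the reason for an adapted Prekopa-Leindler inequality.

  Strict convexity fails for p = 1, so the equality case of a Steiner step rests on strictness in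
  the triangle inequality.

  A band has mass at most 2^n e. Dividing an overlap of order \<open>e\<^sup>2\<close> by the
  squared mass leaves a bound free of e; in the plane, bands about distinct axes stop meeting as e
  shrinks, so no such uniform bound exists there.

  The constant in the definition of the sine centroid body is the one for which the unit ball has
  moment c omega_n |x|^p; this produces the bound \<open>omega_n\<^sup>2\<close>.\<close>

definition mpres :: "('a::euclidean_space \<Rightarrow> 'a) \<Rightarrow> bool" where
  "mpres U \<longleftrightarrow> U \<in> borel_measurable borel \<and> distr lborel borel U = lborel"

lemma mpres_measurable: "mpres U \<Longrightarrow> U \<in> borel_measurable borel"
  by (simp add: mpres_def)

lemma mpres_integral:
  fixes f :: "'a::euclidean_space \<Rightarrow> real"
  assumes "mpres U" "f \<in> borel_measurable borel"
  shows "(\<integral>x. f (U x) \<partial>lborel) = (\<integral>x. f x \<partial>lborel)"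
  using integral_distr[of U lborel borel f] assms by (simp add: mpres_def)

lemma mpres_integrable:
  fixes f :: "'a::euclidean_space \<Rightarrow> real"
  assumes "mpres U" "integrable lborel f"
  shows "integrable lborel (\<lambda>x. f (U x))"
  using integrable_distr_eq[of U lborel borel f] assms
  by (simp add: mpres_def borel_measurable_integrable)

lemma mpres_nn_integral:
  assumes "mpres U" "f \<in> borel_measurable borel"
  shows "(\<integral>\<^sup>+x. f (U x) \<partial>lborel) = (\<integral>\<^sup>+x. f x \<partial>lborel)"
  using nn_integral_distr[of U lborel borel f] assms by (simp add: mpres_def)

lemma mpres_emeasure:
  assumes "mpres U" "A \<in> sets borel"
  shows "emeasure lborel (U -` A) = emeasure lborel A"
  using emeasure_distr[of U lborel borel A] assms by (simp add: mpres_def)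

lemma mpres_measure:
  assumes "mpres U" "A \<in> sets borel"
  shows "measure lborel (U -` A) = measure lborel A"
  using mpres_emeasure[OF assms] by (simp add: measure_def)

lemma mpres_compose:
  assumes "mpres U" "mpres V" shows "mpres (\<lambda>x. U (V x))"
proof -
  have "distr lborel borel (\<lambda>x. U (V x)) = distr (distr lborel borel V) borel U"
    using assms by (subst distr_distr) (auto simp: mpres_def comp_def)
  thus ?thesis using assms by (auto simp: mpres_def)
qed

lemma mpresI_nn:
  assumes "U \<in> borel_measurable borel"
    and "\<And>A. A \<in> sets borel \<Longrightarrow> (\<integral>\<^sup>+x. indicator A (U x) \<partial>lborel) = emeasure lborel A"
  shows "mpres U"
  unfolding mpres_def
proof (intro conjI assms(1) measure_eqI)
  fix A assume "A \<in> sets (distr lborel borel U)"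
  hence A: "A \<in> sets borel" by simp
  have "(\<integral>\<^sup>+x. indicator A (U x) \<partial>lborel) = (\<integral>\<^sup>+x. indicator (U -` A) x \<partial>lborel)"
    by (simp add: indicator_def vimage_def)
  also have "\<dots> = emeasure lborel (U -` A)"
    using A measurable_sets[OF assms(1) A] by (intro nn_integral_indicator) simp
  finally show "emeasure (distr lborel borel U) A = emeasure lborel A"
    using A assms by (simp add: emeasure_distr)
qed simp

lemma mpres_translate: "mpres (\<lambda>x. x + a)"
proof -
  have "(\<lambda>x. x + a) = (+) a" by (auto simp: add.commute)
  thus ?thesis using lborel_distr_plus[of a] by (simp add: mpres_def)
qed

lemma mpres_uminus: "mpres (\<lambda>x. - x)"
proof -
  have "lborel = distr lborel borel (\<lambda>x::'a. - x)"
    using lborel_affine[of "-1::real" "0::'a"] by (simp add: density_1)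
  thus ?thesis by (simp add: mpres_def)
qed

text \<open>This is 1/|det T|, read off from the preimage of the unit ball.\<close>

definition lscale :: "('a::euclidean_space \<Rightarrow> 'a) \<Rightarrow> real" where
  "lscale T = measure lborel (T -` cball 0 1) / measure lborel (cball 0 1 :: 'a set)"

lemma linear_borel: "linear T \<Longrightarrow> (T :: 'a::euclidean_space \<Rightarrow> 'b::euclidean_space) \<in> borel_measurable borel"
  by (intro borel_measurable_continuous_onI linear_continuous_on linear_conv_bounded_linear[THEN iffD1])

lemma linear_inj_inverse:
  fixes T :: "'a::euclidean_space \<Rightarrow> 'a"
  assumes "linear T" "inj T"
  obtains S where "linear S" "inj S" "\<And>x. S (T x) = x" "\<And>x. T (S x) = x"
proof -
  obtain S where S: "linear S" "\<forall>x. S (T x) = x" "\<forall>x. T (S x) = x"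
    using linear_injective_isomorphism[OF assms] by blast
  moreover have "inj S" by (metis S(3) injI)
  ultimately show ?thesis using that by blast
qed

lemma inj_linear_lower_bound:
  fixes T :: "'a::euclidean_space \<Rightarrow> 'a"
  assumes "linear T" "inj T"
  obtains c where "c > 0" "\<And>x. norm x \<le> c * norm (T x)"
proof -
  obtain S where S: "linear S" "\<And>x. S (T x) = x" using linear_inj_inverse[OF assms] by metis
  have bl: "bounded_linear S" using S(1) linear_conv_bounded_linear by blast
  have "norm (S y) \<le> (onorm S + 1) * norm y" for y
    using onorm[OF bl, of y] norm_ge_zero[of y] unfolding distrib_right by linarith
  moreover have "onorm S + 1 > 0" using onorm_pos_le[OF bl] by simp
  ultimately show ?thesis using that[of "onorm S + 1"] S(2) by metis
qed

text \<open>The measure \<open>A \<mapsto> |T\<^sup>-\<^sup>1 A|\<close> is translation invariant; Tonelli then shows that it is a multiple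
  of Lebesgue measure.\<close>
lemma linear_vimage_emeasure_proportional:
  fixes T :: "'a::euclidean_space \<Rightarrow> 'a"
  assumes T: "linear T" "inj T" and A: "A \<in> sets borel" and B: "B \<in> sets borel"
  shows "emeasure lborel (T -` A) * emeasure lborel B = emeasure lborel A * emeasure lborel (T -` B)"
proof -
  note [measurable] = A B linear_borel[OF T(1)]
  obtain S where S: "linear S" "\<And>x. S (T x) = x" "\<And>x. T (S x) = x"
    using linear_inj_inverse[OF T] by metis
  have vA: "T -` A \<in> sets borel" and vB: "T -` B \<in> sets borel"
    using measurable_sets[OF linear_borel[OF T(1)] A] measurable_sets[OF linear_borel[OF T(1)] B] by auto
  have e: "emeasure lborel (T -` C) = (\<integral>\<^sup>+x. indicator C (T x) \<partial>lborel)" if "C \<in> sets borel" for C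
  proof -
    have "T -` C \<in> sets borel" using measurable_sets[OF linear_borel[OF T(1)] that] by simp
    hence "emeasure lborel (T -` C) = (\<integral>\<^sup>+x. indicator (T -` C) x \<partial>lborel)" by simp
    thus ?thesis by (simp add: indicator_def vimage_def)
  qed
  have "emeasure lborel (T -` A) * emeasure lborel B
      = (\<integral>\<^sup>+x. indicator A (T x) * emeasure lborel B \<partial>lborel)"
    by (subst nn_integral_multc) (auto simp: e[OF A])
  also have "\<dots> = (\<integral>\<^sup>+x. (\<integral>\<^sup>+y. indicator A (T x) * indicator B (y + T x) \<partial>lborel) \<partial>lborel)"
  proof (rule nn_integral_cong)
    fix x
    have "(\<integral>\<^sup>+y. indicator B (y + T x) \<partial>lborel) = emeasure lborel B"
      using mpres_nn_integral[OF mpres_translate[of "T x"], of "indicator B"] by simp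
    thus "indicator A (T x) * emeasure lborel B = (\<integral>\<^sup>+y. indicator A (T x) * indicator B (y + T x) \<partial>lborel)"
      by (subst nn_integral_cmult) auto
  qed
  also have "\<dots> = (\<integral>\<^sup>+y. (\<integral>\<^sup>+x. indicator A (T x) * indicator B (y + T x) \<partial>lborel) \<partial>lborel)"
    by (rule lborel_pair.Fubini') measurable
  \<comment> \<open>For fixed \<open>y\<close>, translating \<open>x\<close> by \<open>S y\<close>
    moves \<open>T x\<close> by \<open>y\<close>; the dependence on \<open>y\<close> passes from the
    factor with \<open>B\<close> to the factor with \<open>A\<close>.\<close>
  also have "\<dots> = (\<integral>\<^sup>+y. (\<integral>\<^sup>+x. indicator A (T x - y) * indicator B (T x) \<partial>lborel) \<partial>lborel)"
  proof (rule nn_integral_cong)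
    fix y
    have "(\<integral>\<^sup>+x. indicator A (T x - y) * indicator B (T x) \<partial>lborel)
      = (\<integral>\<^sup>+x. indicator A (T (x + S y) - y) * indicator B (T (x + S y)) \<partial>lborel)"
      by (subst mpres_nn_integral[OF mpres_translate[of "S y"], of "\<lambda>x. indicator A (T x - y) * indicator B (T x)", symmetric])
         auto
    also have "\<dots> = (\<integral>\<^sup>+x. indicator A (T x) * indicator B (y + T x) \<partial>lborel)"
      by (simp add: linear_add[OF T(1)] S add.commute)
    finally show "(\<integral>\<^sup>+x. indicator A (T x) * indicator B (y + T x) \<partial>lborel) =
        (\<integral>\<^sup>+x. indicator A (T x - y) * indicator B (T x) \<partial>lborel)" by simp
  qed
  also have "\<dots> = (\<integral>\<^sup>+x. (\<integral>\<^sup>+y. indicator A (T x - y) * indicator B (T x) \<partial>lborel) \<partial>lborel)"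
    by (rule lborel_pair.Fubini') measurable
  also have "\<dots> = (\<integral>\<^sup>+x. emeasure lborel A * indicator B (T x) \<partial>lborel)"
  proof (rule nn_integral_cong)
    fix x
    have "(\<integral>\<^sup>+y. indicator A (T x - y) \<partial>lborel) = (\<integral>\<^sup>+y. (indicator A (T x + y) :: ennreal) \<partial>lborel)"
      using mpres_nn_integral[OF mpres_uminus, of "\<lambda>y. indicator A (T x + y)"] by simp
    also have "\<dots> = emeasure lborel A"
      using mpres_nn_integral[OF mpres_translate[of "T x"], of "indicator A"] by (simp add: add.commute)
    finally show "(\<integral>\<^sup>+y. indicator A (T x - y) * indicator B (T x) \<partial>lborel) = (emeasure lborel A * indicator B (T x) :: ennreal)"
      by (subst nn_integral_multc) auto
  qed
  also have "\<dots> = emeasure lborel A * emeasure lborel (T -` B)"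
    by (subst nn_integral_cmult) (auto simp: e[OF B])
  finally show ?thesis .
qed

lemma emeasure_cball01_pos: "emeasure lborel (cball 0 1 :: 'a::euclidean_space set) = ennreal (measure lborel (cball 0 1 :: 'a set))"
  "measure lborel (cball 0 1 :: 'a::euclidean_space set) > 0"
proof -
  show 1: "emeasure lborel (cball 0 1 :: 'a set) = ennreal (measure lborel (cball 0 1 :: 'a set))"
    using emeasure_bounded_finite[of "cball 0 1 :: 'a set"] by (simp add: emeasure_eq_ennreal_measure)
  show "measure lborel (cball 0 1 :: 'a::euclidean_space set) > 0"
    by (simp add: content_cball)
qed

lemma bounded_emeasure_measure: "bounded (A::'a::euclidean_space set) \<Longrightarrow> emeasure lborel A = ennreal (measure lborel A)"
  using emeasure_bounded_finite[of A] by (simp add: emeasure_eq_ennreal_measure)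

lemma lscale_props:
  fixes T :: "'a::euclidean_space \<Rightarrow> 'a"
  assumes T: "linear T" "inj T"
  shows "lscale T > 0" "distr lborel borel T = density lborel (\<lambda>_. ennreal (lscale T))"
proof -
  let ?B = "cball 0 1 :: 'a set"
  obtain c where c: "c > 0" "\<And>x. norm x \<le> c * norm (T x)" using inj_linear_lower_bound[OF T] by blast
  have bd: "bounded (T -` ?B)"
    unfolding bounded_iff using c by (intro exI[of _ c]) (force intro: order_trans)
  have fin: "emeasure lborel (T -` ?B) = ennreal (measure lborel (T -` ?B))"
    by (rule bounded_emeasure_measure[OF bd])
  have eq: "emeasure lborel (T -` A) = ennreal (lscale T) * emeasure lborel A" if A: "A \<in> sets borel" for A
  proof -
    have "emeasure lborel (T -` A) * ennreal (measure lborel ?B) = emeasure lborel A * ennreal (measure lborel (T -` ?B))"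
      using linear_vimage_emeasure_proportional[OF T A, of ?B] by (simp add: fin emeasure_cball01_pos(1))
    hence "emeasure lborel (T -` A) * ennreal (measure lborel ?B) * ennreal (1 / measure lborel ?B)
      = emeasure lborel A * ennreal (measure lborel (T -` ?B)) * ennreal (1 / measure lborel ?B)" by simp
    thus ?thesis using emeasure_cball01_pos(2)[where 'a='a]
      by (simp add: lscale_def mult.assoc flip: ennreal_mult) (simp add: mult.commute)
  qed
  show "distr lborel borel T = density lborel (\<lambda>_. ennreal (lscale T))"
  proof (rule measure_eqI)
    fix A assume "A \<in> sets (distr lborel borel T)"
    hence A: "A \<in> sets borel" by simp
    show "emeasure (distr lborel borel T) A = emeasure (density lborel (\<lambda>_. ennreal (lscale T))) A"
      using A eq[OF A] linear_borel[OF T(1)] by (simp add: emeasure_distr emeasure_density_const)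
  qed simp
  have "lscale T \<ge> 0" by (simp add: lscale_def)
  moreover have "lscale T \<noteq> 0"
  proof
    assume "lscale T = 0"
    hence "emeasure lborel (T -` UNIV) = 0" using eq[of UNIV] by simp
    thus False by simp
  qed
  ultimately show "lscale T > 0" by simp
qed

lemma linear_integral:
  fixes f :: "'a::euclidean_space \<Rightarrow> real" and T :: "'a \<Rightarrow> 'a"
  assumes T: "linear T" "inj T" and f: "f \<in> borel_measurable borel"
  shows "(\<integral>x. f (T x) \<partial>lborel) = lscale T * (\<integral>x. f x \<partial>lborel)"
proof -
  have "(\<integral>x. f (T x) \<partial>lborel) = (\<integral>x. f x \<partial>(distr lborel borel T))"
    using linear_borel[OF T(1)] f by (subst integral_distr) auto
  thus ?thesis using lscale_props[OF T] f by (simp add: integral_density)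
qed

lemma linear_integrable:
  fixes f :: "'a::euclidean_space \<Rightarrow> real" and T :: "'a \<Rightarrow> 'a"
  assumes T: "linear T" "inj T" and f: "integrable lborel f"
  shows "integrable lborel (\<lambda>x. f (T x))"
proof -
  have fm: "f \<in> borel_measurable borel" using f by auto
  have "integrable (distr lborel borel T) f"
    using lscale_props[OF T] f fm by (simp add: integrable_density)
  thus ?thesis using linear_borel[OF T(1)] fm by (simp add: integrable_distr_eq)
qed

lemma linear_vimage_emeasure:
  fixes T :: "'a::euclidean_space \<Rightarrow> 'a"
  assumes T: "linear T" "inj T" and A: "A \<in> sets borel"
  shows "emeasure lborel (T -` A) = ennreal (lscale T) * emeasure lborel A"
    "measure lborel (T -` A) = lscale T * measure lborel A"
proof -
  have "emeasure (distr lborel borel T) A = emeasure (density lborel (\<lambda>_. ennreal (lscale T))) A"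
    using lscale_props[OF T] by simp
  thus 1: "emeasure lborel (T -` A) = ennreal (lscale T) * emeasure lborel A"
    using A linear_borel[OF T(1)] by (simp add: emeasure_distr emeasure_density_const)
  show "measure lborel (T -` A) = lscale T * measure lborel A"
    using lscale_props(1)[OF T] unfolding measure_def 1 by (simp add: enn2real_mult)
qed

lemma mpres_of_lscale_1:
  assumes "linear T" "inj T" "lscale T = 1" shows "mpres T"
  using lscale_props[OF assms(1,2)] assms linear_borel by (simp add: mpres_def density_1)

lemma mpres_orthogonal:
  fixes T :: "'a::euclidean_space \<Rightarrow> 'a"
  assumes "orthogonal_transformation T" shows "mpres T"
proof (rule mpres_of_lscale_1)
  show "linear T" "inj T"
    using assms orthogonal_transformation_linear orthogonal_transformation_inj by auto
  have "T -` cball 0 1 = cball 0 1"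
    using assms by (auto simp: orthogonal_transformation_norm)
  thus "lscale T = 1" using emeasure_cball01_pos(2)[where 'a='a] by (simp add: lscale_def)
qed

text \<open>Applying \<open>T\<close> twice shows that the square of \<open>lscale T\<close> is 1,
  and the factor is positive.\<close>

lemma mpres_involution:
  fixes T :: "'a::euclidean_space \<Rightarrow> 'a"
  assumes T: "linear T" and inv: "\<And>x. T (T x) = x" shows "mpres T"
proof (rule mpres_of_lscale_1)
  show "linear T" by fact
  show i: "inj T" by (metis inv injI)
  have v: "T -` cball 0 1 \<in> sets borel" using measurable_sets[OF linear_borel[OF T], of "cball 0 1"] by simp
  have "measure lborel (T -` (T -` cball 0 1)) = lscale T * (lscale T * measure lborel (cball 0 1 :: 'a set))"
    using linear_vimage_emeasure(2)[OF T i v] linear_vimage_emeasure(2)[OF T i, of "cball 0 1"] by simp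
  moreover have "T -` (T -` cball 0 1) = cball 0 1" using inv by auto
  ultimately have "lscale T * lscale T * measure lborel (cball 0 1 :: 'a set) = 1 * measure lborel (cball 0 1 :: 'a set)"
    by simp
  hence "lscale T * lscale T = 1"
    using emeasure_cball01_pos(2)[where 'a='a] by (simp only: mult_cancel_right) auto
  thus "lscale T = 1" using lscale_props(1)[OF T i]
    by (metis abs_of_pos power2_eq_square real_sqrt_abs real_sqrt_one)
qed

lemma nn_integral_lborel_coord:
  fixes f :: "'a::euclidean_space \<Rightarrow> ennreal"
  assumes b: "b \<in> Basis" and f [measurable]: "f \<in> borel_measurable borel"
  shows "(\<integral>\<^sup>+x. f x \<partial>lborel) = (\<integral>\<^sup>+z. (\<integral>\<^sup>+t. f ((\<Sum>c\<in>Basis-{b}. z c *\<^sub>R c) + t *\<^sub>R b) \<partial>lborel)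
      \<partial>Pi\<^sub>M (Basis - {b}) (\<lambda>_. lborel))"
proof -
  interpret product_sigma_finite "\<lambda>_::'a. lborel :: real measure" by standard
  have ins: "insert b (Basis - {b}) = Basis" using b by auto
  have m: "(\<lambda>g. \<Sum>c\<in>Basis. g c *\<^sub>R c) \<in> Pi\<^sub>M Basis (\<lambda>_. lborel) \<rightarrow>\<^sub>M (borel :: 'a measure)"
    by measurable
  have "(\<integral>\<^sup>+x. f x \<partial>lborel) = (\<integral>\<^sup>+g. f (\<Sum>c\<in>Basis. g c *\<^sub>R c) \<partial>Pi\<^sub>M Basis (\<lambda>_. lborel))"
    by (subst lborel_eq, subst nn_integral_distr) auto
  also have "\<dots> = (\<integral>\<^sup>+g. f (\<Sum>c\<in>Basis. g c *\<^sub>R c) \<partial>Pi\<^sub>M (insert b (Basis - {b})) (\<lambda>_. lborel))"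
    by (simp only: ins)
  also have "\<dots> = (\<integral>\<^sup>+z. (\<integral>\<^sup>+t. f (\<Sum>c\<in>Basis. (z(b := t)) c *\<^sub>R c) \<partial>lborel) \<partial>Pi\<^sub>M (Basis - {b}) (\<lambda>_. lborel))"
    using m by (subst product_nn_integral_insert) (auto simp: ins)
  also have "\<dots> = (\<integral>\<^sup>+z. (\<integral>\<^sup>+t. f ((\<Sum>c\<in>Basis-{b}. z c *\<^sub>R c) + t *\<^sub>R b) \<partial>lborel)
      \<partial>Pi\<^sub>M (Basis - {b}) (\<lambda>_. lborel))"
  proof (intro nn_integral_cong arg_cong[where f=f])
    fix z t
    have "(\<Sum>c\<in>Basis. (z(b := t)) c *\<^sub>R c) = t *\<^sub>R b + (\<Sum>c\<in>Basis-{b}. (z(b := t)) c *\<^sub>R c)"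
      using b by (subst sum.remove[of _ b]) auto
    also have "(\<Sum>c\<in>Basis-{b}. (z(b := t)) c *\<^sub>R c) = (\<Sum>c\<in>Basis-{b}. z c *\<^sub>R c)"
      by (intro sum.cong) auto
    finally show "(\<Sum>c\<in>Basis. (z(b := t)) c *\<^sub>R c) = (\<Sum>c\<in>Basis-{b}. z c *\<^sub>R c) + t *\<^sub>R b"
      by (simp add: add.commute)
  qed
  finally show ?thesis .
qed

text \<open>On each line parallel to \<open>b\<close> the map is a translation, so Tonelli over
  these lines suffices; no linearity of \<open>m\<close> is involved.\<close>

lemma mpres_shear:
  fixes m :: "'a::euclidean_space \<Rightarrow> real"
  assumes b: "b \<in> Basis" and m [measurable]: "m \<in> borel_measurable borel"
    and inv: "\<And>x t. m (x + t *\<^sub>R b) = m x"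
  shows "mpres (\<lambda>x. x + m x *\<^sub>R b)"
proof (rule mpresI_nn)
  show "(\<lambda>x. x + m x *\<^sub>R b) \<in> borel_measurable borel" by measurable
  fix A :: "'a set" assume A [measurable]: "A \<in> sets borel"
  let ?w = "\<lambda>z. (\<Sum>c\<in>Basis-{b}. z c *\<^sub>R c)"
  have "(\<integral>\<^sup>+x. indicator A (x + m x *\<^sub>R b) \<partial>lborel)
    = (\<integral>\<^sup>+z. (\<integral>\<^sup>+t. indicator A (?w z + t *\<^sub>R b + m (?w z + t *\<^sub>R b) *\<^sub>R b) \<partial>lborel) \<partial>Pi\<^sub>M (Basis - {b}) (\<lambda>_. lborel))"
    by (rule nn_integral_lborel_coord[OF b]) measurable
  also have "\<dots> = (\<integral>\<^sup>+z. (\<integral>\<^sup>+t. indicator A (?w z + t *\<^sub>R b) \<partial>lborel) \<partial>Pi\<^sub>M (Basis - {b}) (\<lambda>_. lborel))"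
  proof (rule nn_integral_cong)
    fix z
    have "(\<integral>\<^sup>+t. indicator A (?w z + t *\<^sub>R b + m (?w z + t *\<^sub>R b) *\<^sub>R b) \<partial>lborel)
      = (\<integral>\<^sup>+t. indicator A (?w z + (t + m (?w z)) *\<^sub>R b) \<partial>lborel)"
      by (simp add: inv scaleR_add_left add.assoc)
    also have "\<dots> = (\<integral>\<^sup>+t. indicator A (?w z + t *\<^sub>R b) \<partial>lborel)"
      by (rule mpres_nn_integral[OF mpres_translate]) measurable
    finally show "(\<integral>\<^sup>+t. indicator A (?w z + t *\<^sub>R b + m (?w z + t *\<^sub>R b) *\<^sub>R b) \<partial>lborel)
      = (\<integral>\<^sup>+t. indicator A (?w z + t *\<^sub>R b) \<partial>lborel)" .
  qed
  also have "\<dots> = (\<integral>\<^sup>+x. indicator A x \<partial>lborel)"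
    by (rule nn_integral_lborel_coord[OF b, of "indicator A", symmetric]) measurable
  finally show "(\<integral>\<^sup>+x. indicator A (x + m x *\<^sub>R b) \<partial>lborel) = emeasure lborel A" by simp
qed

section \<open>Homogeneous functions and their sublevel sets\<close>

text \<open>The p-th power of the gauge of a symmetric star body with continuous boundary. Moments
  of sets are of this kind, and volumes of sublevel sets follow from homogeneity alone.\<close>

definition phom :: "real \<Rightarrow> ('a::euclidean_space \<Rightarrow> real) \<Rightarrow> bool" where
  "phom p N \<longleftrightarrow> continuous_on UNIV N \<and> (\<forall>x. x \<noteq> 0 \<longrightarrow> N x > 0) \<and>
     (\<forall>c x. N (c *\<^sub>R x) = \<bar>c\<bar> powr p * N x)"

definition lvol :: "('a::euclidean_space \<Rightarrow> real) \<Rightarrow> real" where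
  "lvol N = measure lborel {x. N x \<le> 1}"

lemma phom_cont: "phom p N \<Longrightarrow> continuous_on S N"
  by (auto simp: phom_def intro: continuous_on_subset)

lemma phom_borel [measurable_dest]: "phom p N \<Longrightarrow> N \<in> borel_measurable borel"
  by (intro borel_measurable_continuous_onI phom_cont)

lemma phom_scale: "phom p N \<Longrightarrow> N (c *\<^sub>R x) = \<bar>c\<bar> powr p * N x"
  by (simp add: phom_def)

lemma phom_pos: "phom p N \<Longrightarrow> x \<noteq> 0 \<Longrightarrow> N x > 0"
  by (simp add: phom_def)

lemma phom_zero: "phom p N \<Longrightarrow> N 0 = 0"
  using phom_scale[of p N 0 0] by simp

lemma phom_nonneg: "phom p N \<Longrightarrow> N x \<ge> 0"
  using phom_pos[of p N x] phom_zero[of p N] by (cases "x = 0") auto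

lemma phom_sgn: "phom p N \<Longrightarrow> N x = norm x powr p * N (sgn x)"
  using phom_scale[of p N "norm x" "sgn x"] by (cases "x = 0") (auto simp: sgn_div_norm phom_zero)

lemma phom_bounds:
  fixes N :: "'a::euclidean_space \<Rightarrow> real"
  assumes N: "phom p N"
  obtains a b where "a > 0" "b > 0" "\<And>x. a * norm x powr p \<le> N x" "\<And>x. N x \<le> b * norm x powr p"
proof -
  have c: "compact (sphere 0 1 :: 'a set)" by simp
  have ne: "sphere (0::'a) 1 \<noteq> {}" by simp
  obtain u where u: "u \<in> sphere 0 1" "\<And>x. x \<in> sphere 0 1 \<Longrightarrow> N u \<le> N x"
    using continuous_attains_inf[OF c ne phom_cont[OF N]] by blast
  obtain v where v: "v \<in> sphere 0 1" "\<And>x. x \<in> sphere 0 1 \<Longrightarrow> N x \<le> N v"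
    using continuous_attains_sup[OF c ne phom_cont[OF N]] by blast
  have 1: "N u > 0" "N v > 0" using u(1) v(1) by (auto intro!: phom_pos[OF N])
  have "N u * norm x powr p \<le> N x \<and> N x \<le> N v * norm x powr p" for x
  proof (cases "x = 0")
    case False
    hence "sgn x \<in> sphere 0 1" by (simp add: norm_sgn)
    hence "N u \<le> N (sgn x)" "N (sgn x) \<le> N v" using u v by auto
    thus ?thesis using phom_sgn[OF N, of x] by (auto simp: mult.commute[of "norm x powr p"] intro!: mult_right_mono)
  qed (auto simp: phom_zero[OF N])
  thus ?thesis using that[of "N u" "N v"] 1 by blast
qed

lemma sublevel_bounded:
  fixes N :: "'a::euclidean_space \<Rightarrow> real"
  assumes "p > 0" "a > 0" "\<And>x. a * norm x powr p \<le> N x"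
  shows "{x. N x \<le> r} \<subseteq> cball 0 ((\<bar>r\<bar> / a) powr (1 / p))"
proof
  fix x assume "x \<in> {x. N x \<le> r}"
  hence "a * norm x powr p \<le> \<bar>r\<bar>" using assms(3)[of x] by auto
  hence "norm x powr p \<le> \<bar>r\<bar> / a" using assms by (simp add: field_simps)
  hence "(norm x powr p) powr (1/p) \<le> (\<bar>r\<bar> / a) powr (1/p)"
    using assms by (intro powr_mono2) auto
  thus "x \<in> cball 0 ((\<bar>r\<bar> / a) powr (1 / p))" using assms by (simp add: powr_powr)
qed

lemma phom_sublevel_compact:
  fixes N :: "'a::euclidean_space \<Rightarrow> real"
  assumes N: "phom p N" and p: "p > 0"
  shows "compact {x. N x \<le> r}"
proof -
  obtain a where a: "a > 0" "\<And>x. a * norm x powr p \<le> N x" using phom_bounds[OF N] by metis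
  have "bounded {x. N x \<le> r}" using sublevel_bounded[OF p a(1), of N r] a(2) bounded_subset bounded_cball by blast
  moreover have "closed {x. N x \<le> r}"
    by (intro closed_Collect_le phom_cont[OF N] continuous_intros)
  ultimately show ?thesis by (simp add: compact_eq_bounded_closed)
qed

lemma phom_sublevel_borel: "phom p N \<Longrightarrow> {x. N x \<le> r} \<in> sets borel"
  using phom_borel[of p N] by measurable

lemma phom_sublevel_emeasure:
  fixes N :: "'a::euclidean_space \<Rightarrow> real"
  assumes N: "phom p N" and p: "p > 0"
  shows "emeasure lborel {x. N x \<le> r} = ennreal (measure lborel {x. N x \<le> r})"
  by (intro bounded_emeasure_measure compact_imp_bounded phom_sublevel_compact[OF N p])

lemma lscale_scaleR:
  assumes "c > 0" shows "lscale (\<lambda>x::'a::euclidean_space. c *\<^sub>R x) = c powr (- real DIM('a))"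
proof -
  have "(\<lambda>x::'a. c *\<^sub>R x) -` cball 0 1 = cball 0 (1/c)"
    using assms by (auto simp: field_simps)
  moreover have "measure lborel (cball (0::'a) (1/c)) = c powr (- real DIM('a)) * measure lborel (cball (0::'a) 1)"
    using assms by (simp add: content_cball powr_minus powr_realpow field_simps)
  ultimately show ?thesis using emeasure_cball01_pos(2)[where 'a='a] by (simp add: lscale_def)
qed

lemma linear_scaleR_inj: "c \<noteq> 0 \<Longrightarrow> linear (\<lambda>x::'a::euclidean_space. c *\<^sub>R x)" "c \<noteq> 0 \<Longrightarrow> inj (\<lambda>x::'a. c *\<^sub>R x)"
  by (auto intro: linear_scaleR injI)

lemma phom_sublevel_measure:
  fixes N :: "'a::euclidean_space \<Rightarrow> real"
  assumes N: "phom p N" and p: "p > 0" and r: "r > 0"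
  shows "measure lborel {x. N x \<le> r} = r powr (real DIM('a) / p) * lvol N"
proof -
  define c where "c = r powr (-1/p)"
  have c: "c > 0" using r by (simp add: c_def)
  have "c powr p = r powr (-1)" unfolding c_def powr_powr using p by simp
  hence cp: "c powr p = 1 / r" using r by (simp add: powr_minus_divide)
  have "{x. N x \<le> r} = (\<lambda>x. c *\<^sub>R x) -` {x. N x \<le> 1}"
    using c r by (auto simp: phom_scale[OF N] cp field_simps)
  hence "measure lborel {x. N x \<le> r} = c powr (- real DIM('a)) * lvol N"
    using linear_vimage_emeasure(2)[OF linear_scaleR_inj, of c "{x. N x \<le> 1}"] c phom_sublevel_borel[OF N]
    by (simp add: lscale_scaleR lvol_def)
  thus ?thesis using r by (simp add: c_def powr_powr)
qed

lemma lvol_pos: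
  fixes N :: "'a::euclidean_space \<Rightarrow> real"
  assumes N: "phom p N" and p: "p > 0" shows "lvol N > 0"
proof -
  obtain b where b: "b > 0" "\<And>x. N x \<le> b * norm x powr p" using phom_bounds[OF N] by metis
  define s where "s = (1/b) powr (1/p)"
  have s: "s > 0" "b * s powr p = 1" using b p by (simp_all add: s_def powr_powr)
  have sub: "cball 0 s \<subseteq> {x. N x \<le> 1}"
  proof
    fix x :: 'a assume "x \<in> cball 0 s"
    hence "b * norm x powr p \<le> b * s powr p" using b p by (intro mult_left_mono powr_mono2) auto
    thus "x \<in> {x. N x \<le> 1}" using b(2)[of x] s by simp
  qed
  have "0 < measure lborel (cball (0::'a) s)" using s by (simp add: content_cball)
  also have "\<dots> \<le> lvol N" unfolding lvol_def
    using sub phom_sublevel_borel[OF N] phom_sublevel_emeasure[OF N p, of 1]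
    by (intro measure_mono_fmeasurable) (auto simp: fmeasurable_def)
  finally show ?thesis .
qed

text \<open>The level set is disjoint from every sublevel set with \<open>t < r\<close> and lies in
  the one at \<open>r\<close>; the gap between their volumes tends to 0 as \<open>t\<close>
  increases to \<open>r\<close>.\<close>

lemma phom_level_null:
  fixes N :: "'a::euclidean_space \<Rightarrow> real"
  assumes N: "phom p N" and p: "p > 0" and r: "r > 0"
  shows "AE x in lborel. N x \<noteq> r"
proof -
  let ?S = "{x. N x = r}"
  have Sb: "?S \<in> sets borel" using phom_borel[OF N] by measurable
  have fin: "emeasure lborel {x. N x \<le> t} \<noteq> \<infinity>" for t
    using phom_sublevel_emeasure[OF N p] by simp
  have "emeasure lborel ?S \<le> emeasure lborel {x. N x \<le> r}"
    using phom_sublevel_borel[OF N] by (intro emeasure_mono) auto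
  hence finS: "emeasure lborel ?S \<noteq> \<infinity>" using fin[of r] by (auto simp: top.extremum_unique)
  have "measure lborel ?S \<le> (r powr (real DIM('a)/p) - t powr (real DIM('a)/p)) * lvol N" if t: "0 < t" "t < r" for t
  proof -
    have "measure lborel ?S + measure lborel {x. N x \<le> t} = measure lborel (?S \<union> {x. N x \<le> t})"
      using Sb phom_sublevel_borel[OF N] fin t finS by (intro measure_Union[symmetric]) auto
    also have "\<dots> \<le> measure lborel {x. N x \<le> r}"
      using t fin[of r] Sb phom_sublevel_borel[OF N] by (intro measure_mono_fmeasurable) (auto simp: fmeasurable_def top.not_eq_extremum)
    finally show ?thesis using phom_sublevel_measure[OF N p] t r by (simp add: algebra_simps)
  qed
  hence ev: "eventually (\<lambda>t. measure lborel ?S \<le> (r powr (real DIM('a)/p) - t powr (real DIM('a)/p)) * lvol N) (at_left r)"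
    using r by (auto simp: eventually_at_left intro!: exI[of _ 0])
  have "((\<lambda>t. (r powr (real DIM('a)/p) - t powr (real DIM('a)/p)) * lvol N) \<longlongrightarrow> (r powr (real DIM('a)/p) - r powr (real DIM('a)/p)) * lvol N) (at_left r)"
    using r by (intro tendsto_intros) auto
  hence "measure lborel ?S \<le> (r powr (real DIM('a)/p) - r powr (real DIM('a)/p)) * lvol N"
    by (rule tendsto_lowerbound[OF _ ev]) simp
  hence "measure lborel ?S = 0" by (simp add: antisym)
  hence "emeasure lborel ?S = 0" using finS by (simp add: measure_def enn2real_eq_0_iff)
  hence "?S \<in> null_sets lborel" using Sb by (simp add: null_sets_def)
  thus ?thesis by (rule AE_I'[of ?S]) auto
qed

text \<open>One-sided derivatives at the end points suffice; this matters for real powers at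
  0.\<close>

lemma nn_integral_FTC_within:
  fixes f F :: "real \<Rightarrow> real"
  assumes "\<And>x. x \<in> {a..b} \<Longrightarrow> (F has_real_derivative f x) (at x within {a..b})"
    and nonneg: "\<And>x. x \<in> {a..b} \<Longrightarrow> 0 \<le> f x" and "a \<le> b"
  shows "(\<integral>\<^sup>+x. ennreal (f x) * indicator {a..b} x \<partial>lborel) = ennreal (F b - F a)"
proof -
  have "(f has_integral (F b - F a)) {a..b}"
    using assms by (intro fundamental_theorem_of_calculus)
      (auto simp: has_real_derivative_iff_has_vector_derivative)
  thus ?thesis using nonneg by (rule nn_integral_has_integral_lebesgue'[rotated])
qed

lemma powr_Suc_derivative:
  fixes q t :: real
  assumes q: "q > 0" and t: "t \<ge> 0"
  shows "((\<lambda>t. t powr (q + 1)) has_real_derivative (q + 1) * t powr q) (at t within {0..r})"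
proof (cases "t = 0")
  case False
  hence "((\<lambda>t. t powr (q + 1)) has_real_derivative (q + 1) * t powr (q + 1 - 1)) (at t)"
    using t by (intro has_real_derivative_powr) simp
  thus ?thesis by (simp add: has_field_derivative_at_within)
next
  case True
  have "((\<lambda>y. y powr q) \<longlongrightarrow> 0 powr q) (at 0 within {0..r})"
    by (rule tendsto_powr2[OF tendsto_ident_at tendsto_const _ q]) (auto simp: eventually_at_filter)
  hence l: "((\<lambda>y. y powr q) \<longlongrightarrow> 0) (at 0 within {0..r})" using q by simp
  have "y powr q = (y powr (q + 1) - 0 powr (q + 1)) / (y - 0)" if "y \<noteq> 0" "y \<in> {0..r}" for y
  proof -
    have "y powr (q + 1) = y powr q * y" using that by (simp add: powr_add)
    thus ?thesis using that by simp
  qed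
  hence "\<forall>\<^sub>F y in at 0 within {0..r}. y powr q = (y powr (q + 1) - 0 powr (q + 1)) / (y - 0)"
    unfolding eventually_at_filter by (intro always_eventually) blast
  hence "((\<lambda>y. (y powr (q + 1) - 0 powr (q + 1)) / (y - 0)) \<longlongrightarrow> 0) (at 0 within {0..r})"
    by (rule Lim_transform_eventually[OF l])
  moreover have "(q + 1) * 0 powr q = 0" by simp
  ultimately show ?thesis unfolding True has_field_derivative_iff by simp
qed

text \<open>Layer cake: \<open>N x\<close> is the length of the interval of \<open>t\<close> with
  \<open>0 <= t < N x\<close>, and the volume of a sublevel set is a power of its level. The factor
  n/(n + p) is 1 minus the integral of t^(n/p) over [0,1].\<close>

lemma phom_integral_sublevel:
  fixes N :: "'a::euclidean_space \<Rightarrow> real"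
  assumes N: "phom p N" and p: "p > 0" and r: "r > 0"
  shows "set_integrable lborel {x. N x \<le> r} N"
    "(LINT x:{x. N x \<le> r}|lborel. N x) = real DIM('a) / (real DIM('a) + p) * r * measure lborel {x. N x \<le> r}"
proof -
  note [measurable] = phom_borel[OF N]
  let ?S = "{x. N x \<le> r}" and ?n = "real DIM('a)"
  show int: "set_integrable lborel ?S N"
    using phom_sublevel_compact[OF N p] phom_cont[OF N] by (rule borel_integrable_compact[unfolded set_integrable_def[symmetric]])
  have "ennreal (LINT x:?S|lborel. N x) = (\<integral>\<^sup>+x. ennreal (indicator ?S x * N x) \<partial>lborel)"
    using int phom_nonneg[OF N] unfolding set_lebesgue_integral_def set_integrable_def
    by (subst nn_integral_eq_integral) (auto simp: indicator_def)
  also have "\<dots> = (\<integral>\<^sup>+x. (\<integral>\<^sup>+t. indicator {0..r} t * indicator {x. t < N x \<and> N x \<le> r} x \<partial>lborel) \<partial>lborel)"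
  proof (rule nn_integral_cong)
    fix x
    have "(\<integral>\<^sup>+t. indicator {0..r} t * indicator {x. t < N x \<and> N x \<le> r} x \<partial>lborel)
       = (\<integral>\<^sup>+t. indicator ?S x * indicator {0..<N x} t \<partial>lborel)"
      by (intro nn_integral_cong) (auto simp: indicator_def)
    also have "\<dots> = indicator ?S x * ennreal (N x)"
      using phom_nonneg[OF N, of x] by (subst nn_integral_cmult) auto
    finally show "ennreal (indicator ?S x * N x) = (\<integral>\<^sup>+t. indicator {0..r} t * indicator {x. t < N x \<and> N x \<le> r} x \<partial>lborel)"
      by (auto simp: indicator_def)
  qed
  also have "\<dots> = (\<integral>\<^sup>+t. (\<integral>\<^sup>+x. indicator {0..r} t * indicator {x. t < N x \<and> N x \<le> r} x \<partial>lborel) \<partial>lborel)"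
    by (rule lborel_pair.Fubini') (simp add: indicator_def, measurable)
  \<comment> \<open>The formula for sublevel volumes is available for positive levels, so the single
    level 0 is discarded.\<close>
  also have "\<dots> = (\<integral>\<^sup>+t. ennreal ((r powr (?n/p) - t powr (?n/p)) * lvol N) * indicator {0..r} t \<partial>lborel)"
  proof (rule nn_integral_cong_AE, rule AE_I'[of "{0}"])
    show "{t \<in> space lborel. \<not> (\<integral>\<^sup>+x. indicator {0..r} t * indicator {x. t < N x \<and> N x \<le> r} x \<partial>lborel)
      = ennreal ((r powr (?n/p) - t powr (?n/p)) * lvol N) * indicator {0..r} t} \<subseteq> {0}"
    proof clarify
      fix t :: real
      assume neq: "(\<integral>\<^sup>+x. indicator {0..r} t * indicator {x. t < N x \<and> N x \<le> r} x \<partial>lborel)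
      \<noteq> ennreal ((r powr (?n/p) - t powr (?n/p)) * lvol N) * indicator {0..r} t"
      show "t = 0"
      proof (rule ccontr)
        assume t0: "t \<noteq> 0"
        show False
        proof (cases "t \<in> {0..r}")
          case True
          hence t: "0 < t" "t \<le> r" using t0 by auto
          have seq: "{x. t < N x \<and> N x \<le> r} = ?S - {x. N x \<le> t}" by auto
          have "emeasure lborel {x. t < N x \<and> N x \<le> r} = emeasure lborel ?S - emeasure lborel {x. N x \<le> t}"
            unfolding seq using t phom_sublevel_borel[OF N] phom_sublevel_emeasure[OF N p, of t]
            by (intro emeasure_Diff) auto
          also have "\<dots> = ennreal ((r powr (?n/p) - t powr (?n/p)) * lvol N)"
            using t r unfolding phom_sublevel_emeasure[OF N p]
            by (subst ennreal_minus) (auto simp: phom_sublevel_measure[OF N p] algebra_simps less_imp_le[OF lvol_pos[OF N p]])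
          finally have "emeasure lborel {x. t < N x \<and> N x \<le> r} = ennreal ((r powr (?n/p) - t powr (?n/p)) * lvol N)" .
          moreover have "(\<integral>\<^sup>+x. indicator {x. t < N x \<and> N x \<le> r} x \<partial>lborel) = emeasure lborel {x. t < N x \<and> N x \<le> r}"
            by (rule nn_integral_indicator) measurable
          ultimately show False using neq True by simp
        qed (use neq in simp)
      qed
    qed
  qed (simp add: countable_imp_null_set_lborel)
  also have "\<dots> = ennreal ((r * r powr (?n/p) * lvol N - r powr (?n/p + 1) / (?n/p + 1) * lvol N) -
       (0 * r powr (?n/p) * lvol N - 0 powr (?n/p + 1) / (?n/p + 1) * lvol N))"
  proof (rule nn_integral_FTC_within)
    show "0 \<le> r" using r by simp
    fix t assume t: "t \<in> {0..r}"
    show "0 \<le> (r powr (?n/p) - t powr (?n/p)) * lvol N"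
      using t p lvol_pos[OF N p] by (intro mult_nonneg_nonneg) (auto intro!: powr_mono2)
    have q: "?n/p > 0" using p by simp
    have "((\<lambda>t. t * r powr (?n/p) * lvol N - t powr (?n/p + 1) / (?n/p + 1) * lvol N) has_real_derivative
       1 * r powr (?n/p) * lvol N - ((?n/p + 1) * t powr (?n/p)) / (?n/p + 1) * lvol N) (at t within {0..r})"
      using t by (intro DERIV_diff DERIV_cmult_right DERIV_cdivide DERIV_ident powr_Suc_derivative[OF q]) auto
    moreover have "1 * r powr (?n/p) * lvol N - ((?n/p + 1) * t powr (?n/p)) / (?n/p + 1) * lvol N
       = (r powr (?n/p) - t powr (?n/p)) * lvol N"
      using q by (simp add: left_diff_distrib)
    ultimately show "((\<lambda>t. t * r powr (?n/p) * lvol N - t powr (?n/p + 1) / (?n/p + 1) * lvol N) has_real_derivative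
       (r powr (?n/p) - t powr (?n/p)) * lvol N) (at t within {0..r})" by simp
  qed
  also have "r * r powr (?n/p) * lvol N - r powr (?n/p + 1) / (?n/p + 1) * lvol N - (0 * r powr (?n/p) * lvol N - 0 powr (?n/p + 1) / (?n/p + 1) * lvol N)
     = ?n / (?n + p) * r * measure lborel ?S"
  proof -
    have "1 / (?n/p + 1) = p / (?n + p)" using p by (simp add: field_simps)
    hence e: "x / (?n/p + 1) = x * (p / (?n + p))" for x by (metis divide_inverse inverse_eq_divide)
    have "1 - p / (?n + p) = ?n / (?n + p)" using p by (simp add: field_simps add_pos_pos)
    hence e2: "?n / (?n + p) = 1 - p / (?n + p)" by simp
    show ?thesis unfolding e e2 phom_sublevel_measure[OF N p r] using r p
      by (simp add: powr_add left_diff_distrib right_diff_distrib)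
  qed
  finally show "(LINT x:?S|lborel. N x) = ?n / (?n + p) * r * measure lborel ?S"
    using r p phom_nonneg[OF N] by (subst (asm) ennreal_inj)
      (auto intro!: mult_nonneg_nonneg divide_nonneg_nonneg integral_nonneg_AE simp: set_lebesgue_integral_def)
qed

text \<open>The product of (indicator of \<open>K\<close> minus indicator of the sublevel set) and
  \<open>N - r\<close> is pointwise nonnegative, and because the volumes agree its integral is the
  difference of the two integrals.\<close>

lemma bathtub:
  fixes N :: "'a::euclidean_space \<Rightarrow> real"
  assumes N: "phom p N" and p: "p > 0" and r: "r > 0"
    and K: "K \<in> sets borel" "emeasure lborel K = emeasure lborel {x. N x \<le> r}" "set_integrable lborel K N"
  shows "(LINT x:{x. N x \<le> r}|lborel. N x) \<le> (LINT x:K|lborel. N x)"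
    "(LINT x:{x. N x \<le> r}|lborel. N x) = (LINT x:K|lborel. N x) \<Longrightarrow> AE x in lborel. x \<in> K \<longleftrightarrow> N x \<le> r"
proof -
  note [measurable] = phom_borel[OF N] K(1)
  let ?S = "{x. N x \<le> r}"
  define f where "f x = (indicator K x - indicator ?S x) * (N x - r)" for x
  have Sb: "?S \<in> sets borel" by (rule phom_sublevel_borel[OF N])
  have iS: "integrable lborel (indicator ?S :: 'a \<Rightarrow> real)"
    using phom_sublevel_emeasure[OF N p, of r] Sb by (simp add: integrable_indicator_iff)
  have iK: "integrable lborel (indicator K :: 'a \<Rightarrow> real)"
    using K phom_sublevel_emeasure[OF N p, of r] by (simp add: integrable_indicator_iff)
  have i1: "integrable lborel (\<lambda>x. indicator K x * N x)" "integrable lborel (\<lambda>x. indicator ?S x * N x)"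
    using K(3) phom_integral_sublevel(1)[OF N p r] by (auto simp: set_integrable_def)
  have feq: "f x = indicator K x * N x - indicator ?S x * N x - r * indicator K x + r * indicator ?S x" for x
    by (simp add: f_def algebra_simps)
  have fi: "integrable lborel f" unfolding feq[abs_def] using i1 iS iK by auto
  have mK: "measure lborel K = measure lborel ?S" using K(2) by (simp add: measure_def)
  have fI: "(\<integral>x. f x \<partial>lborel) = (LINT x:K|lborel. N x) - (LINT x:?S|lborel. N x)"
    unfolding feq[abs_def] using i1 iS iK mK by (simp add: set_lebesgue_integral_def)
  have f0: "f x \<ge> 0" for x by (auto simp: f_def indicator_def)
  have "(\<integral>x. f x \<partial>lborel) \<ge> 0" using f0 by (intro integral_nonneg_AE) auto
  thus "(LINT x:?S|lborel. N x) \<le> (LINT x:K|lborel. N x)" using fI by simp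
  assume "(LINT x:?S|lborel. N x) = (LINT x:K|lborel. N x)"
  hence "(\<integral>x. f x \<partial>lborel) = 0" using fI by simp
  hence "AE x in lborel. f x = 0" using integral_nonneg_eq_0_iff_AE[OF fi] f0 by simp
  \<comment> \<open>Only this difference can be read off directly, since \<open>N > r\<close> holds
    on it; on the other one the integrand also vanishes where \<open>N = r\<close>. The other
    difference is null because the volumes agree.\<close>
  hence "AE x in lborel. x \<notin> K - ?S" by eventually_elim (auto simp: f_def indicator_def)
  hence n1: "emeasure lborel (K - ?S) = 0"
    using Sb by (subst (asm) AE_iff_measurable[of "K - ?S"]) auto
  have fin: "emeasure lborel (K \<inter> ?S) \<noteq> \<infinity>"
    using phom_sublevel_emeasure[OF N p, of r] emeasure_mono[of "K \<inter> ?S" ?S lborel] Sb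
    by (auto simp: top.extremum_unique)
  have "emeasure lborel K = emeasure lborel (K \<inter> ?S) + emeasure lborel (K - ?S)"
    using Sb by (subst plus_emeasure) (auto intro!: arg_cong[where f="emeasure lborel"])
  moreover have "emeasure lborel ?S = emeasure lborel (K \<inter> ?S) + emeasure lborel (?S - K)"
    using Sb by (subst plus_emeasure) (auto intro!: arg_cong[where f="emeasure lborel"])
  ultimately have "emeasure lborel (?S - K) = 0"
    using K(2) n1 fin by (metis add.right_neutral ennreal_add_left_cancel infinity_ennreal_def)
  hence "AE x in lborel. x \<notin> ?S - K" using Sb by (subst AE_iff_measurable[of "?S - K"]) auto
  with \<open>AE x in lborel. x \<notin> K - ?S\<close> show "AE x in lborel. x \<in> K \<longleftrightarrow> N x \<le> r"
    by eventually_elim auto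
qed

lemma convex_abs_powr_ineq:
  fixes x y u v p :: real
  assumes p: "p \<ge> 1" and uv: "u \<ge> 0" "v \<ge> 0" "u + v = 1"
  shows "\<bar>u * x + v * y\<bar> powr p \<le> u * \<bar>x\<bar> powr p + v * \<bar>y\<bar> powr p"
proof -
  have small: "(w * a) powr p \<le> w * a powr p" if "0 \<le> w" "w \<le> 1" "0 \<le> a" for w a :: real
  proof -
    have "w powr p \<le> w powr 1" by (rule powr_mono') (use that p in auto)
    thus ?thesis using that by (simp add: powr_mult mult_right_mono)
  qed
  have "\<bar>u * x + v * y\<bar> \<le> u * \<bar>x\<bar> + v * \<bar>y\<bar>"
    using uv by (intro order_trans[OF abs_triangle_ineq]) (simp add: abs_mult)
  hence "\<bar>u * x + v * y\<bar> powr p \<le> (u * \<bar>x\<bar> + v * \<bar>y\<bar>) powr p"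
    using p by (intro powr_mono2) auto
  also have "\<dots> \<le> u * \<bar>x\<bar> powr p + v * \<bar>y\<bar> powr p"
  \<comment> \<open>With a zero argument the claim reduces to w^p <= w for a weight w in [0,1];
    otherwise it is convexity on the positive reals.\<close>
  proof (cases "x = 0 \<or> y = 0")
    case True
    thus ?thesis using small[of v "\<bar>y\<bar>"] small[of u "\<bar>x\<bar>"] uv by auto
  next
    case False
    have u: "u = 1 - v" using uv by simp
    show ?thesis unfolding u using convex_onD[OF powr_convex[OF p], of v "\<bar>x\<bar>" "\<bar>y\<bar>"] False uv by auto
  qed
  finally show ?thesis .
qed

section \<open>Norms and moment functions\<close>

definition nrm :: "('a::euclidean_space \<Rightarrow> real) \<Rightarrow> bool" where
  "nrm h \<longleftrightarrow> (\<forall>x y. h (x + y) \<le> h x + h y) \<and> (\<forall>c x. h (c *\<^sub>R x) = \<bar>c\<bar> * h x) \<and> (\<forall>x. x \<noteq> 0 \<longrightarrow> h x > 0)"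

lemma nrm_add: "nrm h \<Longrightarrow> h (x + y) \<le> h x + h y" by (simp add: nrm_def)
lemma nrm_scale: "nrm h \<Longrightarrow> h (c *\<^sub>R x) = \<bar>c\<bar> * h x" by (simp add: nrm_def)
lemma nrm_pos: "nrm h \<Longrightarrow> x \<noteq> 0 \<Longrightarrow> h x > 0" by (simp add: nrm_def)
lemma nrm_zero: "nrm h \<Longrightarrow> h 0 = 0" using nrm_scale[of h 0 0] by simp
lemma nrm_uminus: "nrm h \<Longrightarrow> h (- x) = h x" using nrm_scale[of h "-1" x] by simp
lemma nrm_nonneg: "nrm h \<Longrightarrow> h x \<ge> 0" using nrm_pos[of h x] nrm_zero[of h] by (cases "x = 0") auto

lemma nrm_convex: "nrm h \<Longrightarrow> convex_on UNIV h"
proof (rule convex_onI)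
  fix t :: real and x y :: 'a assume h: "nrm h" and t: "0 < t" "t < 1"
  show "h ((1 - t) *\<^sub>R x + t *\<^sub>R y) \<le> (1 - t) * h x + t * h y"
    using nrm_add[OF h, of "(1 - t) *\<^sub>R x" "t *\<^sub>R y"] t by (simp add: nrm_scale[OF h])
qed simp

lemma nrm_cont: "nrm h \<Longrightarrow> continuous_on UNIV h"
  using nrm_convex convex_on_continuous by blast

lemma nrm_phom:
  assumes "nrm h" "p > 0" shows "phom p (\<lambda>x. h x powr p)"
  unfolding phom_def
proof (intro conjI allI impI)
  show "continuous_on UNIV (\<lambda>x. h x powr p)"
    using assms nrm_nonneg[OF assms(1)] by (intro continuous_on_powr' nrm_cont continuous_intros) auto
  show "h x powr p > 0" if "x \<noteq> 0" for x
    using nrm_pos[OF assms(1) that] by simp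
qed (use assms nrm_nonneg[OF assms(1)] in \<open>simp add: nrm_scale powr_mult\<close>)

lemma nrm_sublevel: "nrm h \<Longrightarrow> p > 0 \<Longrightarrow> {x. h x powr p \<le> 1} = {x. h x \<le> 1}"
proof -
  assume h: "nrm h" and p: "p > 0"
  have "h x powr p \<le> 1 \<longleftrightarrow> h x \<le> 1" for x
    using powr_less_mono2[of p 1 "h x"] powr_mono2[of p "h x" 1] nrm_nonneg[OF h, of x] p
    by (auto simp: not_le[symmetric])
  thus ?thesis by simp
qed

text \<open>For the triangle inequality, scale both vectors to the level \<open>N = 1\<close> and
  apply convexity with weights proportional to their gauges.\<close>

lemma phom_root_nrm:
  fixes N :: "'a::euclidean_space \<Rightarrow> real"
  assumes N: "phom p N" and p: "p \<ge> 1" and c_UNIV: "convex_on UNIV N"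
  shows "nrm (\<lambda>x. N x powr (1/p))"
  unfolding nrm_def
proof (intro conjI allI impI)
  fix x y :: 'a
  let ?h = "\<lambda>x. N x powr (1/p)"
  have hp: "?h z powr p = N z" for z using p phom_nonneg[OF N, of z] by (simp add: powr_powr)
  show "?h (x + y) \<le> ?h x + ?h y"
  proof (cases "x = 0 \<or> y = 0")
    case True thus ?thesis by (auto simp: phom_zero[OF N])
  next
    case False
    hence hx: "?h x > 0" and hy: "?h y > 0" using phom_pos[OF N, of x] phom_pos[OF N, of y] by auto
    define a b where "a = ?h x" and "b = ?h y"
    have ab: "a > 0" "b > 0" using hx hy by (auto simp: a_def b_def)
    have one: "N ((1/?h z) *\<^sub>R z) = 1" if "?h z > 0" for z
    proof -
      have "N ((1/?h z) *\<^sub>R z) = (1 / ?h z) powr p * N z"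
        using that phom_scale[OF N, of "1/?h z" z] by simp
      also have "(1 / ?h z) powr p = 1 / (?h z powr p)" by (simp only: powr_divide powr_one_eq_one)
      also have "\<dots> * N z = 1" using that by (simp only: hp) auto
      finally show ?thesis .
    qed
    have c: "(1 - b/(a+b)) * (1/a) = 1/(a+b)" "(b/(a+b)) * (1/b) = 1/(a+b)"
      using ab by (simp_all add: field_simps)
    have "N ((1/(a+b)) *\<^sub>R (x + y)) = N ((1 - b/(a+b)) *\<^sub>R ((1/a) *\<^sub>R x) + (b/(a+b)) *\<^sub>R ((1/b) *\<^sub>R y))"
      by (simp only: scaleR_scaleR c scaleR_add_right)
    also have "\<dots> \<le> (1 - b/(a+b)) * N ((1/a) *\<^sub>R x) + (b/(a+b)) * N ((1/b) *\<^sub>R y)"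
      using ab by (intro convex_onD[OF c_UNIV]) auto
    also have "\<dots> = 1" using one[OF hx] one[OF hy] by (simp add: a_def b_def)
    finally have "(1/(a+b)) powr p * N (x + y) \<le> 1" using ab phom_scale[OF N, of "1/(a+b)" "x+y"] by simp
    moreover have "(1/(a+b)) powr p = 1 / (a+b) powr p" by (simp only: powr_divide powr_one_eq_one)
    ultimately have "N (x + y) \<le> (a+b) powr p" using ab by (simp add: divide_le_eq)
    hence "?h (x + y) \<le> ((a+b) powr p) powr (1/p)" using p phom_nonneg[OF N] by (intro powr_mono2) auto
    also have "\<dots> = a + b" using p ab by (simp add: powr_powr)
    finally show ?thesis by (simp add: a_def b_def)
  qed
next
  fix c x show "N (c *\<^sub>R x) powr (1 / p) = \<bar>c\<bar> * N x powr (1 / p)"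
    using p phom_nonneg[OF N] by (simp add: phom_scale[OF N] powr_mult powr_powr)
next
  fix x :: 'a assume "x \<noteq> 0" thus "N x powr (1/p) > 0" using phom_pos[OF N] by force
qed

text \<open>The common properties of |x . y| and [x,y]. Being a seminorm in \<open>y\<close> makes
  moments convex and homogeneous, the almost-everywhere clause makes them positive off 0, and
  symmetry gives the duality between a set and the sublevel set of its moment.\<close>

definition kernel :: "('a::euclidean_space \<Rightarrow> 'a \<Rightarrow> real) \<Rightarrow> bool" where
  "kernel k \<longleftrightarrow> (\<lambda>z. k (fst z) (snd z)) \<in> borel_measurable borel \<and> (\<forall>x y. 0 \<le> k x y) \<and>
     (\<forall>x y. k x y \<le> norm x * norm y) \<and> (\<forall>x c y. k x (c *\<^sub>R y) = \<bar>c\<bar> * k x y) \<and>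
     (\<forall>x y z. k x (y + z) \<le> k x y + k x z) \<and> (\<forall>y. y \<noteq> 0 \<longrightarrow> (AE x in lborel. k x y \<noteq> 0)) \<and>
     (\<forall>x y. k x y = k y x)"

text \<open>The class in which the maximisation takes place. Up to null sets it contains the stars
  of the theorem, and it also contains the sublevel sets, Steiner symmetrals and linear preimages
  that arise from its members.\<close>

definition adm :: "real \<Rightarrow> 'a::euclidean_space set \<Rightarrow> bool" where
  "adm p K \<longleftrightarrow> K \<in> sets borel \<and> emeasure lborel K \<noteq> \<infinity> \<and> emeasure lborel K \<noteq> 0 \<and>
     set_integrable lborel K (\<lambda>x. norm x powr p)"

definition mom :: "real \<Rightarrow> ('a::euclidean_space \<Rightarrow> 'a \<Rightarrow> real) \<Rightarrow> 'a set \<Rightarrow> 'a \<Rightarrow> real" where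
  "mom p k K y = (LINT x:K|lborel. k x y powr p)"

lemma adm_borel: "adm p K \<Longrightarrow> K \<in> sets borel" by (simp add: adm_def)
lemma adm_emeasure: "adm p K \<Longrightarrow> emeasure lborel K = ennreal (measure lborel K)"
  by (simp add: adm_def emeasure_eq_ennreal_measure)
lemma adm_measure_pos: "adm p K \<Longrightarrow> measure lborel K > 0"
proof -
  assume K: "adm p K"
  have "measure lborel K \<noteq> 0"
  proof
    assume "measure lborel K = 0"
    hence "emeasure lborel K = 0" unfolding adm_emeasure[OF K] by (simp only: ennreal_0)
    thus False using K by (simp add: adm_def)
  qed
  thus ?thesis using measure_nonneg[of lborel K] by linarith
qed

lemma kernelD:
  assumes "kernel k"
  shows "(\<lambda>z. k (fst z) (snd z)) \<in> borel_measurable borel" "0 \<le> k x y" "k x y \<le> norm x * norm y"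
    "k x (c *\<^sub>R y) = \<bar>c\<bar> * k x y" "k x (y + z) \<le> k x y + k x z"
    "y \<noteq> 0 \<Longrightarrow> AE x in lborel. k x y \<noteq> 0" "k x y = k y x"
  using assms unfolding kernel_def by blast+

lemma kernel_measurable:
  assumes "kernel k" shows "case_prod k \<in> borel_measurable (borel \<Otimes>\<^sub>M borel)" "(\<lambda>x. k x y) \<in> borel_measurable borel"
    "(\<lambda>y. k x y) \<in> borel_measurable borel"
proof -
  show 1: "case_prod k \<in> borel_measurable (borel \<Otimes>\<^sub>M borel)"
    using kernelD(1)[OF assms] by (simp add: borel_prod case_prod_beta')
  show "(\<lambda>x. k x y) \<in> borel_measurable borel" "(\<lambda>y. k x y) \<in> borel_measurable borel"
    using 1 by measurable
qed

lemma kernel_powr_bound: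
  assumes "kernel k" "p > 0" shows "k x y powr p \<le> norm x powr p * norm y powr p"
  using kernelD(2,3)[OF assms(1), of x y] assms(2) by (auto simp flip: powr_mult intro!: powr_mono2)

lemma mom_integrable:
  fixes K :: "'a::euclidean_space set"
  assumes k: "kernel k" and p: "p > 0" and K: "adm p K"
  shows "set_integrable lborel K (\<lambda>x. k x y powr p)"
proof -
  note [measurable] = kernel_measurable[OF k] adm_borel[OF K]
  have "integrable lborel (\<lambda>x. norm y powr p * (indicator K x *\<^sub>R norm x powr p))"
    using K by (intro integrable_mult_right) (auto simp: adm_def set_integrable_def)
  thus ?thesis unfolding set_integrable_def
    by (rule Bochner_Integration.integrable_bound)
       (use kernel_powr_bound[OF k p] in \<open>auto simp: indicator_def mult.commute intro!: AE_I2\<close>)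
qed

text \<open>Continuity comes from convexity on the whole space. Positivity off 0 holds because the
  integrand vanishes almost nowhere on a set of positive volume.\<close>

lemma mom_phom_convex:
  fixes K :: "'a::euclidean_space set"
  assumes k: "kernel k" and p: "p \<ge> 1" and K: "adm p K"
  shows "phom p (mom p k K)" "convex_on UNIV (mom p k K)"
proof -
  have p0: "p > 0" using p by simp
  note int = mom_integrable[OF k p0 K]
  note [measurable] = kernel_measurable[OF k] adm_borel[OF K]
  show c: "convex_on UNIV (mom p k K)"
  proof (rule convex_onI)
    fix t :: real and y z :: 'a assume t: "0 < t" "t < 1"
    have "k x ((1-t) *\<^sub>R y + t *\<^sub>R z) powr p \<le> (1-t) * k x y powr p + t * k x z powr p" for x
    proof -
      have "k x ((1-t) *\<^sub>R y + t *\<^sub>R z) \<le> \<bar>(1-t) * k x y + t * k x z\<bar>"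
        using kernelD(5)[OF k, of x "(1-t) *\<^sub>R y" "t *\<^sub>R z"] t by (auto simp: kernelD(4)[OF k])
      hence "k x ((1-t) *\<^sub>R y + t *\<^sub>R z) powr p \<le> \<bar>(1-t) * k x y + t * k x z\<bar> powr p"
        using p kernelD(2)[OF k] by (intro powr_mono2) auto
      also have "\<dots> \<le> (1-t) * \<bar>k x y\<bar> powr p + t * \<bar>k x z\<bar> powr p"
        using t by (intro convex_abs_powr_ineq[OF p]) auto
      finally show ?thesis using kernelD(2)[OF k] by simp
    qed
    hence "mom p k K ((1-t) *\<^sub>R y + t *\<^sub>R z) \<le> (LINT x:K|lborel. (1-t) * k x y powr p + t * k x z powr p)"
      unfolding mom_def using int by (intro set_integral_mono set_integral_add set_integrable_mult_right) auto
    also have "\<dots> = (1-t) * mom p k K y + t * mom p k K z"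
      using int by (subst set_integral_add) (auto simp: mom_def)
    finally show "mom p k K ((1-t) *\<^sub>R y + t *\<^sub>R z) \<le> (1-t) * mom p k K y + t * mom p k K z" .
  qed simp
  show "phom p (mom p k K)" unfolding phom_def
  proof (intro conjI allI impI)
    show "continuous_on UNIV (mom p k K)" using c convex_on_continuous by blast
    show "mom p k K (a *\<^sub>R y) = \<bar>a\<bar> powr p * mom p k K y" for a y
      using kernelD(2)[OF k] by (simp add: mom_def kernelD(4)[OF k] powr_mult)
    fix y :: 'a assume y: "y \<noteq> 0"
    have nn: "0 \<le> indicator K x *\<^sub>R k x y powr p" for x by simp
    have "mom p k K y \<noteq> 0"
    proof
      assume "mom p k K y = 0"
      hence "AE x in lborel. indicator K x *\<^sub>R k x y powr p = 0"
        using integral_nonneg_eq_0_iff_AE[OF int[of y, unfolded set_integrable_def]] nn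
        by (simp add: mom_def set_lebesgue_integral_def)
      hence "AE x in lborel. x \<notin> K"
        using kernelD(6)[OF k y] by eventually_elim (auto simp: indicator_def)
      hence "emeasure lborel K = 0" by (subst (asm) AE_iff_measurable[of K]) auto
      thus False using K by (simp add: adm_def)
    qed
    moreover have "mom p k K y \<ge> 0" unfolding mom_def set_lebesgue_integral_def using nn by (intro integral_nonneg_AE) auto
    ultimately show "0 < mom p k K y" by simp
  qed
qed

lemma phom_integrable_adm:
  fixes K :: "'a::euclidean_space set"
  assumes N: "phom p N" and K: "adm p K"
  shows "set_integrable lborel K N"
proof -
  note [measurable] = phom_borel[OF N] adm_borel[OF K]
  obtain b where b: "\<And>x. N x \<le> b * norm x powr p" using phom_bounds[OF N] by metis
  have "integrable lborel (\<lambda>x. b * (indicator K x *\<^sub>R norm x powr p))"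
    using K by (intro integrable_mult_right) (auto simp: adm_def set_integrable_def)
  thus ?thesis unfolding set_integrable_def
    by (rule Bochner_Integration.integrable_bound)
       (use b phom_nonneg[OF N] in \<open>auto simp: indicator_def intro!: AE_I2 order_trans[OF _ abs_ge_self]\<close>)
qed

lemma adm_bounded:
  fixes K :: "'a::euclidean_space set"
  assumes "K \<in> sets borel" "bounded K" "measure lborel K > 0" "p > 0"
  shows "adm p K"
proof -
  obtain R where R: "\<And>x. x \<in> K \<Longrightarrow> norm x \<le> R" using assms(2) by (auto simp: bounded_iff)
  have fin: "emeasure lborel K = ennreal (measure lborel K)" by (rule bounded_emeasure_measure[OF assms(2)])
  have "integrable lborel (\<lambda>x. R powr p * indicator K x)"
    using assms(1) fin by (intro integrable_mult_right) (simp add: integrable_indicator_iff)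
  hence "set_integrable lborel K (\<lambda>x. norm x powr p)" unfolding set_integrable_def
    by (rule Bochner_Integration.integrable_bound)
       (use assms R in \<open>auto simp: indicator_def intro!: AE_I2 powr_mono2\<close>)
  thus ?thesis using assms fin by (simp add: adm_def)
qed

lemma adm_sublevel:
  assumes N: "phom p N" and p: "p > 0" and r: "r > 0" shows "adm p {x. N x \<le> r}"
  using phom_sublevel_measure[OF N p r] lvol_pos[OF N p] r
  by (intro adm_bounded phom_sublevel_borel[OF N] compact_imp_bounded[OF phom_sublevel_compact[OF N p]] p) auto

text \<open>Both sides are the double integral of \<open>k x y powr p\<close> over the product of
  the two sets, by symmetry of the kernel.\<close>

lemma mom_Fubini:
  fixes K L :: "'a::euclidean_space set"
  assumes k: "kernel k" and p: "p \<ge> 1" and K: "adm p K" and L: "adm p L"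
  shows "(LINT y:L|lborel. mom p k K y) = (LINT x:K|lborel. mom p k L x)"
proof -
  have p0: "p > 0" using p by simp
  note [measurable] = kernel_measurable[OF k] adm_borel[OF K] adm_borel[OF L]
  have *: "ennreal (LINT y:B|lborel. mom p k A y)
      = (\<integral>\<^sup>+y. (\<integral>\<^sup>+x. indicator B y * (indicator A x * ennreal (k x y powr p)) \<partial>lborel) \<partial>lborel)"
    if A: "adm p A" and B: "adm p B" for A B
  proof -
    note [measurable] = adm_borel[OF A] adm_borel[OF B]
    note N = mom_phom_convex(1)[OF k p A]
    have "ennreal (LINT y:B|lborel. mom p k A y) = (\<integral>\<^sup>+y. ennreal (indicator B y *\<^sub>R mom p k A y) \<partial>lborel)"
      unfolding set_lebesgue_integral_def
      by (rule nn_integral_eq_integral[symmetric])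
         (use phom_integrable_adm[OF N B] phom_nonneg[OF N] in \<open>auto simp: set_integrable_def indicator_def\<close>)
    also have "\<dots> = (\<integral>\<^sup>+y. indicator B y * (\<integral>\<^sup>+x. indicator A x * ennreal (k x y powr p) \<partial>lborel) \<partial>lborel)"
    proof (rule nn_integral_cong)
      fix y
      have "ennreal (mom p k A y) = (\<integral>\<^sup>+x. ennreal (indicator A x *\<^sub>R k x y powr p) \<partial>lborel)"
        unfolding mom_def set_lebesgue_integral_def
        by (rule nn_integral_eq_integral[symmetric])
           (use mom_integrable[OF k p0 A] in \<open>auto simp: set_integrable_def\<close>)
      also have "\<dots> = (\<integral>\<^sup>+x. indicator A x * ennreal (k x y powr p) \<partial>lborel)"
        by (intro nn_integral_cong) (auto simp: indicator_def)
      finally show "ennreal (indicator B y *\<^sub>R mom p k A y) = indicator B y * (\<integral>\<^sup>+x. indicator A x * ennreal (k x y powr p) \<partial>lborel)"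
        by (auto simp: indicator_def)
    qed
    also have "\<dots> = (\<integral>\<^sup>+y. (\<integral>\<^sup>+x. indicator B y * (indicator A x * ennreal (k x y powr p)) \<partial>lborel) \<partial>lborel)"
      by (intro nn_integral_cong nn_integral_cmult[symmetric]) measurable
    finally show ?thesis .
  qed
  have "ennreal (LINT y:L|lborel. mom p k K y)
      = (\<integral>\<^sup>+y. (\<integral>\<^sup>+x. indicator L y * (indicator K x * ennreal (k x y powr p)) \<partial>lborel) \<partial>lborel)"
    by (rule *[OF K L])
  also have "\<dots> = (\<integral>\<^sup>+x. (\<integral>\<^sup>+y. indicator L y * (indicator K x * ennreal (k x y powr p)) \<partial>lborel) \<partial>lborel)"
    by (rule lborel_pair.Fubini') measurable
  also have "\<dots> = (\<integral>\<^sup>+x. (\<integral>\<^sup>+y. indicator K x * (indicator L y * ennreal (k y x powr p)) \<partial>lborel) \<partial>lborel)"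
    by (intro nn_integral_cong) (simp add: mult_ac kernelD(7)[OF k, of _ "_::'a"])
  also have "\<dots> = ennreal (LINT x:K|lborel. mom p k L x)"
    by (rule *[OF L K, symmetric])
  finally show ?thesis
    by (subst (asm) ennreal_inj) (auto intro!: integral_nonneg_AE simp: set_lebesgue_integral_def
        phom_nonneg[OF mom_phom_convex(1)[OF k p K]] phom_nonneg[OF mom_phom_convex(1)[OF k p L]])
qed

section \<open>The kernel |x . y| and the volume product\<close>

definition dotk :: "'a::euclidean_space \<Rightarrow> 'a \<Rightarrow> real" where "dotk x y = \<bar>x \<bullet> y\<bar>"

lemma kernel_dotk: "kernel (dotk :: 'a::euclidean_space \<Rightarrow> _)"
  unfolding kernel_def dotk_def
proof (intro conjI allI impI)
  fix y :: 'a assume "y \<noteq> 0"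
  hence "negligible {x. y \<bullet> x = 0}" by (intro negligible_hyperplane) simp
  hence "{x. y \<bullet> x = 0} \<in> null_sets lborel"
    using null_sets_completionI by (auto simp: negligible_iff_null_sets null_sets_def)
  thus "AE x in lborel. \<bar>x \<bullet> y\<bar> \<noteq> 0" by (rule AE_I') (auto simp: inner_commute)
next
  show "(\<lambda>z::'a \<times> 'a. \<bar>fst z \<bullet> snd z\<bar>) \<in> borel_measurable borel"
    by (intro borel_measurable_continuous_onI continuous_intros)
qed (auto simp: Cauchy_Schwarz_ineq2 abs_mult inner_add_right inner_commute abs_triangle_ineq)

text \<open>The exponent makes the product invariant under dilations: replacing K by rK multiplies
  the moment by r^(n+p), hence the volume of its unit sublevel set by r^(-n(n+p)/p).\<close>

definition Qf :: "real \<Rightarrow> ('a::euclidean_space \<Rightarrow> 'a \<Rightarrow> real) \<Rightarrow> 'a set \<Rightarrow> real" where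
  "Qf p k K = measure lborel K powr (1 + real DIM('a) / p) * lvol (mom p k K)"

lemma Qf_pos:
  assumes "kernel k" "p \<ge> 1" "adm p K" shows "Qf p k K > 0"
  unfolding Qf_def using adm_measure_pos[OF assms(3)] lvol_pos[OF mom_phom_convex(1)[OF assms]] assms(2) by simp

text \<open>By duality the integral over \<open>K\<close> of the moment of \<open>L\<close> equals
  the integral over \<open>L\<close> of the moment of \<open>K\<close>, which is n/(n+p) times |L|.
  With \<open>r\<close> chosen so that the sublevel set at \<open>r\<close> of the moment of
  \<open>L\<close> has volume |K|, the bathtub principle gives r |K| <= |L|, and this is the claim
  raised to the power n/p. Equality is equality in the bathtub principle.\<close>

lemma Qf_polar:
  fixes K :: "'a::euclidean_space set"
  assumes k: "kernel k" and p: "p \<ge> 1" and K: "adm p K"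
  defines "L \<equiv> {x. mom p k K x \<le> 1}"
  shows "Qf p k K \<le> Qf p k L"
    "Qf p k K = Qf p k L \<Longrightarrow> \<exists>r>0. AE x in lborel. x \<in> K \<longleftrightarrow> mom p k L x \<le> r"
proof -
  have p0: "p > 0" using p by simp
  let ?n = "real DIM('a)"
  note N = mom_phom_convex(1)[OF k p K]
  have L: "adm p L" unfolding L_def by (rule adm_sublevel[OF N p0]) simp
  note M = mom_phom_convex(1)[OF k p L]
  define r where "r = (measure lborel K / lvol (mom p k L)) powr (p / ?n)"
  have K0: "measure lborel K > 0" and v0: "lvol (mom p k L) > 0" and l0: "measure lborel L > 0"
    using adm_measure_pos[OF K] lvol_pos[OF M p0] adm_measure_pos[OF L] by auto
  have r: "r > 0" using K0 v0 by (simp add: r_def)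
  have rn: "r powr (?n/p) = measure lborel K / lvol (mom p k L)"
    using K0 v0 p0 by (simp add: r_def powr_powr)
  have mr: "measure lborel {x. mom p k L x \<le> r} = measure lborel K"
    using v0 by (simp add: phom_sublevel_measure[OF M p0 r] rn)
  have em: "emeasure lborel K = emeasure lborel {x. mom p k L x \<le> r}"
    by (simp add: adm_emeasure[OF K] adm_emeasure[OF adm_sublevel[OF M p0 r]] mr)
  define kap where "kap = ?n / (?n + p)"
  have kap: "kap > 0" using p0 by (simp add: kap_def)
  have I1: "(LINT x:K|lborel. mom p k L x) = kap * measure lborel L"
    using mom_Fubini[OF k p L K] phom_integral_sublevel(2)[OF N p0, of 1]
    by (simp add: mom_Fubini[OF k p K L, symmetric] L_def kap_def)
  have I2: "(LINT x:{x. mom p k L x \<le> r}|lborel. mom p k L x) = kap * r * measure lborel K"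
    using phom_integral_sublevel(2)[OF M p0 r] by (simp add: kap_def mr)
  note bt = bathtub[OF M p0 r adm_borel[OF K] em phom_integrable_adm[OF M K]]
  have QK: "Qf p k K = measure lborel K powr (1 + ?n/p) * measure lborel L"
    by (simp add: Qf_def L_def lvol_def)
  have QL: "Qf p k L = measure lborel L powr (1 + ?n/p) * lvol (mom p k L)"
    by (simp add: Qf_def)
  have eqK: "(r * measure lborel K) powr (?n/p) * lvol (mom p k L) = measure lborel K powr (1 + ?n/p)"
    using r K0 v0 by (simp add: powr_mult rn powr_add)
  have QK': "Qf p k K = (r * measure lborel K) powr (?n/p) * lvol (mom p k L) * measure lborel L"
    by (simp add: QK eqK)
  have QL': "Qf p k L = measure lborel L powr (?n/p) * lvol (mom p k L) * measure lborel L"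
    using l0 by (simp add: QL powr_add)
  have le: "r * measure lborel K \<le> measure lborel L"
    using bt(1) kap by (simp add: I1 I2 mult.assoc)
  thus "Qf p k K \<le> Qf p k L"
    unfolding QK' QL' using r K0 l0 v0 p0 by (intro mult_right_mono powr_mono2) auto
  assume "Qf p k K = Qf p k L"
  hence "(r * measure lborel K) powr (?n/p) = measure lborel L powr (?n/p)"
    unfolding QK' QL' using v0 l0 by simp
  hence "r * measure lborel K = measure lborel L"
    using r K0 l0 p0 powr_less_mono2[of "?n/p" "r * measure lborel K" "measure lborel L"] le by fastforce
  hence "(LINT x:{x. mom p k L x \<le> r}|lborel. mom p k L x) = (LINT x:K|lborel. mom p k L x)"
    by (simp add: I1 I2)
  from bt(2)[OF this] r show "\<exists>r>0. AE x in lborel. x \<in> K \<longleftrightarrow> mom p k L x \<le> r" by blast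
qed

section \<open>A twisted Prekopa-Leindler inequality\<close>

lemma lborel_half_affine:
  fixes A :: "real set"
  assumes "A \<in> sets borel" "s = 1 \<or> s = - 1"
  shows "2 * emeasure lborel {z. s * (2 * z - c) \<in> A} = emeasure lborel A"
proof -
  have "emeasure lborel A = (\<integral>\<^sup>+x. indicator A x \<partial>lborel)" using assms by simp
  also have "\<dots> = ennreal \<bar>2 * s\<bar> * (\<integral>\<^sup>+x. indicator A (- s * c + 2 * s * x) \<partial>lborel)"
    by (rule nn_integral_real_affine) (use assms in auto)
  also have "(\<integral>\<^sup>+x. indicator A (- s * c + 2 * s * x) \<partial>lborel) = (\<integral>\<^sup>+x. indicator {z. s * (2 * z - c) \<in> A} x \<partial>lborel)"
    by (intro nn_integral_cong) (auto simp: indicator_def algebra_simps)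
  also have "\<dots> = emeasure lborel {z. s * (2 * z - c) \<in> A}"
  proof (rule nn_integral_indicator)
    have "(\<lambda>z::real. s * (2 * z - c)) -` A \<inter> space borel \<in> sets borel"
      by (rule measurable_sets[OF _ assms(1)]) measurable
    thus "{z. s * (2 * z - c) \<in> A} \<in> sets lborel" by (simp add: vimage_def)
  qed
  finally show ?thesis using assms(2) by auto
qed

text \<open>With a = max A and b = max B, the sets (A - b)/2 and (a - B)/2 lie in C, have half the
  measures of A and B, and are separated by the point (a - b)/2, where alone they can meet.\<close>

lemma BM_diff_compact:
  fixes A B C :: "real set"
  assumes "compact A" "A \<noteq> {}" "compact B" "B \<noteq> {}" and C: "C \<in> sets borel"
    and sub: "\<And>x y. x \<in> A \<Longrightarrow> y \<in> B \<Longrightarrow> (x - y) / 2 \<in> C"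
  shows "emeasure lborel A + emeasure lborel B \<le> 2 * emeasure lborel C"
proof -
  obtain a where a: "a \<in> A" "\<And>x. x \<in> A \<Longrightarrow> x \<le> a" using compact_attains_sup[OF assms(1,2)] by blast
  obtain b where b: "b \<in> B" "\<And>x. x \<in> B \<Longrightarrow> x \<le> b" using compact_attains_sup[OF assms(3,4)] by blast
  have bo: "A \<in> sets borel" "B \<in> sets borel" using assms by (auto intro: borel_compact)
  note [measurable] = bo C
  let ?A = "{z. 1 * (2 * z - (- b)) \<in> A}" and ?B = "{z. - 1 * (2 * z - a) \<in> B}"
  have m: "?A \<in> sets lborel" "?B \<in> sets lborel" by measurable
  have "emeasure lborel A + emeasure lborel B = 2 * (emeasure lborel ?A + emeasure lborel ?B)"
    unfolding distrib_left using lborel_half_affine[OF bo(1), of 1 "-b"] lborel_half_affine[OF bo(2), of "-1" a] by simp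
  also have "emeasure lborel ?A + emeasure lborel ?B = emeasure lborel ?A + emeasure lborel (?B - {(a - b)/2})"
    by (subst emeasure_Diff_null_set[of "{(a - b)/2}"]) (use m in \<open>auto intro: countable_imp_null_set_lborel\<close>)
  also have "\<dots> = emeasure lborel (?A \<union> (?B - {(a - b)/2}))"
  proof (rule plus_emeasure)
    show "?A \<inter> (?B - {(a - b)/2}) = {}"
    proof (rule ccontr)
      assume "?A \<inter> (?B - {(a - b)/2}) \<noteq> {}"
      then obtain z where "z \<in> ?A \<inter> (?B - {(a - b)/2})" by blast
      hence z: "2 * z + b \<in> A" "a - 2 * z \<in> B" "z \<noteq> (a - b)/2"
        by simp_all
      show False using a(2)[OF z(1)] b(2)[OF z(2)] z(3) by simp
    qed
  qed (use m in auto)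
  also have "\<dots> \<le> emeasure lborel C"
  proof (rule emeasure_mono)
    have "z \<in> C" if "2 * z + b \<in> A" for z using sub[OF that b(1)] by simp
    moreover have "z \<in> C" if "a - 2 * z \<in> B" for z using sub[OF a(1) that] by simp
    ultimately show "?A \<union> (?B - {(a - b)/2}) \<subseteq> C" by auto
  qed (use C in auto)
  finally show ?thesis by (simp add: mult_left_mono)
qed

lemma inner_compact_approx:
  fixes A :: "real set"
  assumes A: "A \<in> sets borel" and c: "c < emeasure lborel A"
  obtains K where "compact K" "K \<subseteq> A" "c < emeasure lborel K"
proof -
  have Al: "A \<in> sets lebesgue" using A by auto
  have cfin: "c < \<infinity>" using c by (auto intro: order_less_le_trans)
  obtain d where d: "c < d" "d < emeasure lborel A" using dense[OF c] by blast
  obtain e where e: "0 < e" "c + ennreal e \<le> d"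
  proof -
    obtain c' where c': "c = ennreal c'" "c' \<ge> 0" using cfin by (cases c) auto
    show ?thesis
    proof (cases d)
      case (real d')
      thus ?thesis using c' d(1) by (intro that[of "d' - c'"]) (auto simp: ennreal_less_iff simp flip: ennreal_plus)
    qed (use that[of 1] in auto)
  qed
  obtain T where T: "closed T" "T \<subseteq> A" "A - T \<in> lmeasurable" "emeasure lebesgue (A - T) < ennreal e"
    using sets_lebesgue_inner_closed[OF Al e(1)] by blast
  have Tb: "T \<in> sets borel" using T by auto
  have "emeasure lborel A \<le> emeasure lborel T + emeasure lborel (A - T)"
    using A Tb T(2) by (subst plus_emeasure) (auto intro!: emeasure_mono)
  moreover have "emeasure lborel (A - T) < ennreal e" using T(4) A Tb by simp
  ultimately have "emeasure lborel A \<le> emeasure lborel T + ennreal e"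
    by (meson add_left_mono less_imp_le order_trans)
  hence "c + ennreal e < emeasure lborel T + ennreal e" using d e(2) by (meson le_less_trans less_le_trans)
  hence cT: "c < emeasure lborel T" by (metis add_right_mono not_le)
  have "(\<lambda>k. emeasure lborel (T \<inter> cball 0 (real k))) \<longlonglongrightarrow> emeasure lborel (\<Union>k. T \<inter> cball 0 (real k))"
    using Tb by (intro Lim_emeasure_incseq) (auto simp: incseq_def)
  also have "(\<Union>k. T \<inter> cball 0 (real k)) = T"
    using real_arch_simple by auto
  finally have "\<forall>\<^sub>F k in sequentially. c < emeasure lborel (T \<inter> cball 0 (real k))"
    using cT by (rule order_tendstoD)
  then obtain k where "c < emeasure lborel (T \<inter> cball 0 (real k))" by (auto simp: eventually_sequentially)
  moreover have "compact (T \<inter> cball 0 (real k))" using T(1) by (intro closed_Int_compact) auto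
  ultimately show ?thesis using that[of "T \<inter> cball 0 (real k)"] T(2) by blast
qed

text \<open>Reduces a bound for \<open>a\<close> to strict lower approximations. The alternative
  \<open>c = 0\<close> keeps the hypothesis meaningful when \<open>a = 0\<close>.\<close>

lemma ennreal_add_le_approx:
  fixes a d e :: ennreal
  assumes "\<And>c. c < a \<or> c = 0 \<Longrightarrow> c + d \<le> e"
  shows "a + d \<le> e"
proof (cases "e = top \<or> a = 0")
  case True
  thus ?thesis using assms[of 0] by auto
next
  case False
  then obtain e' where e': "e = ennreal e'" "e' \<ge> 0" by (cases e) auto
  have "d \<le> e" using assms[of 0] by simp
  then obtain d' where d': "d = ennreal d'" "d' \<ge> 0" using e' by (cases d) (auto simp: top_unique)
  show ?thesis
  proof (cases a)
    case top
    hence "ennreal (e' + 1) + d \<le> e" using assms[of "ennreal (e' + 1)"] by simp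
    thus ?thesis using e' d' by (simp flip: ennreal_plus)
  next
    case (real a')
    show ?thesis
    proof (rule ccontr)
      assume "\<not> a + d \<le> e"
      hence gt: "e' < a' + d'" using real e' d' by (simp add: not_le ennreal_less_iff flip: ennreal_plus)
      have a0: "a' > 0" using False real by (auto intro: ccontr)
      define c where "c = max 0 ((e' - d' + a') / 2)"
      have "(e' - d' + a') / 2 < a'" "(e' - d' + a') / 2 + d' > e'" using gt \<open>d \<le> e\<close> e' d'
        by (simp_all add: field_simps)
      hence c: "c \<ge> 0" "c < a'" "c + d' > e'" using a0 by (auto simp: c_def max_def)
      hence "ennreal c + d \<le> e" using real by (intro assms) (simp add: ennreal_less_iff)
      thus False using c e' d' by (simp flip: ennreal_plus)
    qed
  qed
qed

lemma BM_diff: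
  fixes A B C :: "real set"
  assumes A: "A \<in> sets borel" "A \<noteq> {}" and B: "B \<in> sets borel" "B \<noteq> {}" and C: "C \<in> sets borel"
    and sub: "\<And>x y. x \<in> A \<Longrightarrow> y \<in> B \<Longrightarrow> (x - y) / 2 \<in> C"
  shows "emeasure lborel A + emeasure lborel B \<le> 2 * emeasure lborel C"
proof -
  obtain a b where ab: "a \<in> A" "b \<in> B" using A B by auto
  have cpt: "\<exists>K. compact K \<and> K \<noteq> {} \<and> K \<subseteq> S \<and> c \<le> emeasure lborel K"
    if S: "S \<in> sets borel" "S \<noteq> {}" and c: "c < emeasure lborel S \<or> c = 0" for S :: "real set" and c
  proof (cases "c = 0")
    case True
    obtain s where "s \<in> S" using S by auto
    thus ?thesis using True by (intro exI[of _ "{s}"]) auto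
  next
    case False
    then obtain K where "compact K" "K \<subseteq> S" "c < emeasure lborel K"
      using inner_compact_approx[OF S(1)] c by blast
    thus ?thesis by (intro exI[of _ K]) auto
  qed
  have *: "c + d \<le> 2 * emeasure lborel C"
    if c: "c < emeasure lborel A \<or> c = 0" and d: "d < emeasure lborel B \<or> d = 0" for c d
  proof -
    obtain K where K: "compact K" "K \<noteq> {}" "K \<subseteq> A" "c \<le> emeasure lborel K" using cpt[OF A c] by blast
    obtain M where M: "compact M" "M \<noteq> {}" "M \<subseteq> B" "d \<le> emeasure lborel M" using cpt[OF B d] by blast
    have "c + d \<le> emeasure lborel K + emeasure lborel M" using K M by (intro add_mono)
    also have "\<dots> \<le> 2 * emeasure lborel C"
      using K M sub by (intro BM_diff_compact C) auto
    finally show ?thesis .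
  qed
  show ?thesis
    by (rule ennreal_add_le_approx, subst add.commute, rule ennreal_add_le_approx)
       (use * in \<open>simp add: add.commute\<close>)
qed

lemma ennreal_AM_GM: "4 * (a * b) \<le> (a + b)\<^sup>2" for a b :: ennreal
proof (cases a; cases b)
  fix x y assume xy: "a = ennreal x" "0 \<le> x" "b = ennreal y" "0 \<le> y"
  have "4 * (x * y) \<le> (x + y)\<^sup>2" using zero_le_power2[of "x - y"] by (simp add: power2_eq_square algebra_simps)
  hence le: "ennreal (4 * (x * y)) \<le> ennreal ((x + y)\<^sup>2)" by (rule ennreal_leI)
  have e1: "ennreal (4 * (x * y)) = 4 * (ennreal x * ennreal y)"
    using xy by (simp only: ennreal_mult ennreal_numeral mult_nonneg_nonneg zero_le_numeral)
  have e2: "ennreal ((x + y)\<^sup>2) = (ennreal x + ennreal y)\<^sup>2"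
    using xy by (simp only: ennreal_power[symmetric] ennreal_plus add_nonneg_nonneg)
  show ?thesis using le unfolding e1 e2 xy(1,3) .
qed (auto simp: power2_eq_square ennreal_mult_top ennreal_top_mult top_unique)

text \<open>Levels are measured in units of \<open>a\<close>, so that functions with different
  suprema can be compared at the same parameter \<open>t\<close> in (0,1).\<close>

lemma layer_cake_unit:
  fixes f :: "real \<Rightarrow> ennreal"
  assumes [measurable]: "f \<in> borel_measurable borel" and le: "\<And>x. f x \<le> ennreal a" and a: "a > 0"
  shows "(\<integral>\<^sup>+x. f x \<partial>lborel) = ennreal a * (\<integral>\<^sup>+t. indicator {0<..<1} t * emeasure lborel {x. ennreal (t * a) < f x} \<partial>lborel)"
proof -
  have fx: "f x = ennreal a * (\<integral>\<^sup>+t. indicator {0<..<1} t * indicator {x. ennreal (t * a) < f x} x \<partial>lborel)" for x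
  proof -
    have "f x < top" using le[of x] ennreal_less_top le_less_trans by blast
    then obtain y where y: "f x = ennreal y" "y \<ge> 0" by (cases "f x") auto
    have ya: "y \<le> a" using le[of x] y a by simp
    have "(\<integral>\<^sup>+t. indicator {0<..<1} t * indicator {x. ennreal (t * a) < f x} x \<partial>lborel)
      = (\<integral>\<^sup>+t. indicator {0<..<y/a} t \<partial>lborel)"
    proof (rule nn_integral_cong)
      fix t :: real
      have 1: "y / a \<le> 1" using ya a by simp
      have "ennreal (t * a) < f x \<longleftrightarrow> t < y / a" if "0 < t"
        using y a that by (simp add: ennreal_less_iff pos_less_divide_eq)
      thus "(indicator {0<..<1} t * indicator {x. ennreal (t * a) < f x} x :: ennreal) = indicator {0<..<y/a} t"
        using 1 by (cases "0 < t") (auto simp: indicator_def)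
    qed
    also have "\<dots> = ennreal (y / a)" using y a by simp
    finally show ?thesis using y a by (simp flip: ennreal_mult)
  qed
  have m: "{x. ennreal (t * a) < f x} \<in> sets borel" for t by measurable
  have "(\<integral>\<^sup>+x. f x \<partial>lborel) = (\<integral>\<^sup>+x. ennreal a * (\<integral>\<^sup>+t. indicator {0<..<1} t * indicator {x. ennreal (t * a) < f x} x \<partial>lborel) \<partial>lborel)"
    by (subst fx) (rule refl)
  also have "\<dots> = ennreal a * (\<integral>\<^sup>+x. (\<integral>\<^sup>+t. indicator {0<..<1} t * indicator {x. ennreal (t * a) < f x} x \<partial>lborel) \<partial>lborel)"
    by (rule nn_integral_cmult) (simp add: indicator_def, measurable)
  also have "(\<integral>\<^sup>+x. (\<integral>\<^sup>+t. indicator {0<..<1} t * indicator {x. ennreal (t * a) < f x} x \<partial>lborel) \<partial>lborel)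
     = (\<integral>\<^sup>+t. (\<integral>\<^sup>+x. indicator {0<..<1} t * indicator {x. ennreal (t * a) < f x} x \<partial>lborel) \<partial>lborel)"
    by (rule lborel_pair.Fubini') (simp add: indicator_def, measurable)
  also have "\<dots> = (\<integral>\<^sup>+t. indicator {0<..<1} t * emeasure lborel {x. ennreal (t * a) < f x} \<partial>lborel)"
    using m by (intro nn_integral_cong) (simp add: nn_integral_cmult_indicator nn_integral_cmult)
  finally show ?thesis .
qed

text \<open>Let a, b be the suprema of f, g and c = sqrt(ab). If f(x) > ta and g(y) > tb then h > tc
  at (x - y)/2, and both sets are nonempty for t < 1, so the one-dimensional Brunn-Minkowski
  inequality applies level by level. AM-GM turns the resulting sum into a product.\<close>

lemma PL_diff_bounded:
  fixes f g h :: "real \<Rightarrow> ennreal"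
  assumes [measurable]: "f \<in> borel_measurable borel" "g \<in> borel_measurable borel" "h \<in> borel_measurable borel"
    and bd: "\<And>x. f x \<le> ennreal M" "\<And>x. g x \<le> ennreal M"
    and H: "\<And>x y. f x * g y \<le> (h ((x - y) / 2))\<^sup>2"
  shows "(\<integral>\<^sup>+x. f x \<partial>lborel) * (\<integral>\<^sup>+x. g x \<partial>lborel) \<le> (\<integral>\<^sup>+x. h x \<partial>lborel)\<^sup>2"
proof -
  have Sf: "(SUP x. f x) \<le> ennreal M" "(SUP x. g x) \<le> ennreal M" using bd by (auto intro: SUP_least)
  obtain a where a: "(SUP x. f x) = ennreal a" "a \<ge> 0" using Sf(1) by (cases "SUP x. f x") (auto simp: top_unique)
  obtain b where b: "(SUP x. g x) = ennreal b" "b \<ge> 0" using Sf(2) by (cases "SUP x. g x") (auto simp: top_unique)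
  have fa: "f x \<le> ennreal a" and gb: "g x \<le> ennreal b" for x
    using SUP_upper[of x UNIV f] SUP_upper[of x UNIV g] a b by auto
  show ?thesis
  proof (cases "a = 0 \<or> b = 0")
    case True
    hence "(\<forall>x. f x = 0) \<or> (\<forall>x. g x = 0)" using fa gb by auto
    thus ?thesis by auto
  next
    case False
    hence a0: "a > 0" and b0: "b > 0" using a b by auto
    define c where "c = sqrt (a * b)"
    have c0: "c > 0" and cc: "c * c = a * b" using a0 b0 by (auto simp: c_def)
    \<comment> \<open>Truncation at \<open>c\<close> makes \<open>h\<close> accessible to the layer
      cake formula with unit \<open>c\<close>; levels below \<open>c\<close> are unaffected.\<close>
    define h' where "h' x = min (h x) (ennreal c)" for x
    have [measurable]: "h' \<in> borel_measurable borel" unfolding h'_def by measurable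
    let ?F = "\<lambda>t. {x. ennreal (t * a) < f x}" and ?G = "\<lambda>t. {x. ennreal (t * b) < g x}" and ?H = "\<lambda>t. {x. ennreal (t * c) < h' x}"
    have m: "?F t \<in> sets borel" "?G t \<in> sets borel" "?H t \<in> sets borel" for t by measurable
    have BM: "emeasure lborel (?F t) + emeasure lborel (?G t) \<le> 2 * emeasure lborel (?H t)" if t: "0 < t" "t < 1" for t
    proof (rule BM_diff[OF m(1) _ m(2) _ m(3)])
      have "ennreal (t * a) < (SUP x. f x)" "ennreal (t * b) < (SUP x. g x)"
        using a b a0 b0 t by (auto simp: ennreal_less_iff)
      thus "?F t \<noteq> {}" "?G t \<noteq> {}" by (auto simp: less_SUP_iff)
      fix x y assume "x \<in> ?F t" "y \<in> ?G t"
      hence x: "ennreal (t * a) < f x" and y: "ennreal (t * b) < g y" by auto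
      have "ennreal (t * c) < h ((x - y)/2)"
      proof (rule ccontr)
        assume "\<not> ennreal (t * c) < h ((x - y)/2)"
        hence "(h ((x - y)/2))\<^sup>2 \<le> (ennreal (t * c))\<^sup>2" by (intro power_mono) auto
        hence "f x * g y \<le> ennreal (t * c) * ennreal (t * c)" using H[of x y] by (simp add: power2_eq_square)
        also have "\<dots> = ennreal (t * a) * ennreal (t * b)"
        proof -
          have "t * c * (t * c) = t * a * (t * b)" using cc by (metis mult.assoc mult.left_commute)
          thus ?thesis using t a0 b0 c0 by (simp flip: ennreal_mult)
        qed
        also have "\<dots> < f x * g y"
        proof -
          obtain u where u: "f x = ennreal u" "u \<ge> 0" using fa[of x] by (cases "f x") (auto simp: top_unique)
          obtain v where v: "g y = ennreal v" "v \<ge> 0" using gb[of y] by (cases "g y") (auto simp: top_unique)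
          have "t * a < u" "t * b < v" using x y u v t a0 b0 by (simp_all add: ennreal_less_iff)
          moreover have "0 < t * a" "0 < t * b" using t a0 b0 by simp_all
          ultimately have "t * a * (t * b) < u * v" by (intro mult_strict_mono) auto
          thus ?thesis using u v t a0 b0 by (simp add: ennreal_less_iff flip: ennreal_mult)
        qed
        finally show False by simp
      qed
      moreover have "ennreal (t * c) < ennreal c" using t c0 by (simp add: ennreal_less_iff)
      ultimately show "(x - y)/2 \<in> ?H t" by (simp add: h'_def)
    qed
    let ?I = "\<lambda>A. (\<integral>\<^sup>+t. indicator {0<..<1} t * emeasure lborel (A t :: real set) \<partial>lborel)"
    have mF: "(\<lambda>t. emeasure lborel {x. ennreal (t * a') < f' x}) \<in> borel_measurable lborel"
      if [measurable]: "f' \<in> borel_measurable borel" for f' :: "real \<Rightarrow> ennreal" and a'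
    proof -
      have "(\<lambda>t. emeasure lborel {x. ennreal (t * a') < f' x}) = (\<lambda>t. \<integral>\<^sup>+x. indicator {x. ennreal (t * a') < f' x} x \<partial>lborel)"
        by (intro ext nn_integral_indicator[symmetric]) measurable
      also have "\<dots> \<in> borel_measurable lborel" unfolding indicator_def mem_Collect_eq by measurable
      finally show ?thesis .
    qed
    have "?I ?F + ?I ?G = (\<integral>\<^sup>+t. indicator {0<..<1} t * emeasure lborel (?F t) + indicator {0<..<1} t * emeasure lborel (?G t) \<partial>lborel)"
      using mF[of f a] mF[of g b] by (intro nn_integral_add[symmetric]) auto
    also have "\<dots> \<le> (\<integral>\<^sup>+t. 2 * (indicator {0<..<1} t * emeasure lborel (?H t)) \<partial>lborel)"
      using BM by (intro nn_integral_mono) (auto simp: indicator_def)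
    also have "\<dots> = 2 * ?I ?H" using mF[of h' c] by (intro nn_integral_cmult) auto
    finally have I: "?I ?F + ?I ?G \<le> 2 * ?I ?H" .
    have "(\<integral>\<^sup>+x. f x \<partial>lborel) * (\<integral>\<^sup>+x. g x \<partial>lborel) = (ennreal a * ?I ?F) * (ennreal b * ?I ?G)"
      using layer_cake_unit[OF _ fa a0] layer_cake_unit[OF _ gb b0] by simp
    also have "\<dots> = (ennreal a * ennreal b) * (?I ?F * ?I ?G)" by (simp add: mult_ac)
    also have "ennreal a * ennreal b = ennreal c * ennreal c" using a0 b0 c0 cc by (simp flip: ennreal_mult)
    also have "\<dots> * (?I ?F * ?I ?G) \<le> ennreal c * ennreal c * (?I ?H)\<^sup>2"
    proof (rule mult_left_mono)
      have "4 * (?I ?F * ?I ?G) \<le> (?I ?F + ?I ?G)\<^sup>2" by (rule ennreal_AM_GM)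
      also have "\<dots> \<le> (2 * ?I ?H)\<^sup>2" using I by (intro power_mono) auto
      also have "\<dots> = 4 * (?I ?H)\<^sup>2" by (simp add: power_mult_distrib)
      finally show "?I ?F * ?I ?G \<le> (?I ?H)\<^sup>2"
        by (subst (asm) ennreal_mult_le_mult_iff) auto
    qed simp
    also have "\<dots> = (ennreal c * ?I ?H)\<^sup>2" by (simp add: power2_eq_square mult_ac)
    also have "ennreal c * ?I ?H = (\<integral>\<^sup>+x. h' x \<partial>lborel)"
      by (rule layer_cake_unit[symmetric]) (auto simp: h'_def c0)
    also have "(\<integral>\<^sup>+x. h' x \<partial>lborel)\<^sup>2 \<le> (\<integral>\<^sup>+x. h x \<partial>lborel)\<^sup>2"
      by (intro power_mono nn_integral_mono) (auto simp: h'_def)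
    finally show ?thesis .
  qed
qed

lemma PL_diff:
  fixes f g h :: "real \<Rightarrow> ennreal"
  assumes [measurable]: "f \<in> borel_measurable borel" "g \<in> borel_measurable borel" "h \<in> borel_measurable borel"
    and H: "\<And>x y. f x * g y \<le> (h ((x - y) / 2))\<^sup>2"
  shows "(\<integral>\<^sup>+x. f x \<partial>lborel) * (\<integral>\<^sup>+x. g x \<partial>lborel) \<le> (\<integral>\<^sup>+x. h x \<partial>lborel)\<^sup>2"
proof -
  have lim: "(SUP k. \<integral>\<^sup>+x. min (f' x) (ennreal (real k)) \<partial>lborel) = (\<integral>\<^sup>+x. f' x \<partial>lborel)"
    if [measurable]: "f' \<in> borel_measurable borel" for f' :: "real \<Rightarrow> ennreal"
  proof (subst nn_integral_monotone_convergence_SUP[symmetric])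
    show inc: "incseq (\<lambda>k x. min (f' x) (ennreal (real k)))"
      by (auto simp: incseq_def le_fun_def intro: min.coboundedI2 ennreal_leI)
    have "(SUP k. min (f' x) (ennreal (real k))) = f' x" for x
    proof (rule LIMSEQ_unique[OF LIMSEQ_SUP])
      show "incseq (\<lambda>k. min (f' x) (ennreal (real k)))" using inc by (auto simp: incseq_def le_fun_def)
      show "(\<lambda>k. min (f' x) (ennreal (real k))) \<longlonglongrightarrow> f' x"
    proof (cases "f' x")
      case (real r)
      obtain k0 where "r \<le> real k0" using real_arch_simple by blast
      hence "\<forall>\<^sub>F k in sequentially. min (f' x) (ennreal (real k)) = f' x"
        using real by (intro eventually_sequentiallyI[of k0]) (auto intro!: min_absorb1 ennreal_leI)
      thus ?thesis by (rule tendsto_eventually)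
    next
      case top
      thus ?thesis using of_nat_tendsto_top_ennreal by (simp add: ennreal_of_nat_eq_real_of_nat)
    qed
    qed
    thus "(\<integral>\<^sup>+x. (SUP k. min (f' x) (ennreal (real k))) \<partial>lborel) = (\<integral>\<^sup>+x. f' x \<partial>lborel)" by simp
  qed measurable
  have "(\<integral>\<^sup>+x. min (f x) (ennreal (real k)) \<partial>lborel) * (\<integral>\<^sup>+x. min (g x) (ennreal (real l)) \<partial>lborel) \<le> (\<integral>\<^sup>+x. h x \<partial>lborel)\<^sup>2" for k l
  proof (rule PL_diff_bounded[where M="real (max k l)"])
    fix x y
    show "min (f x) (ennreal (real k)) * min (g y) (ennreal (real l)) \<le> (h ((x - y) / 2))\<^sup>2"
      by (rule order_trans[OF mult_mono H]) auto
  qed (auto intro: min.coboundedI2 ennreal_leI)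
  hence "(SUP k. \<integral>\<^sup>+x. min (f x) (ennreal (real k)) \<partial>lborel) * (SUP l. \<integral>\<^sup>+x. min (g x) (ennreal (real l)) \<partial>lborel) \<le> (\<integral>\<^sup>+x. h x \<partial>lborel)\<^sup>2"
    unfolding SUP_mult_right_ennreal SUP_mult_left_ennreal by (intro SUP_least)
  thus ?thesis using lim[of f] lim[of g] by simp
qed

text \<open>Induction on the number of coordinates: by the induction hypothesis the integrals over
  the old coordinates satisfy, as functions of the new one, the hypothesis of the one-dimensional
  inequality.\<close>

lemma PL_diff_PiM:
  fixes f g h :: "('i \<Rightarrow> real) \<Rightarrow> ennreal"
  assumes "finite I"
    and "f \<in> borel_measurable (Pi\<^sub>M I (\<lambda>_. lborel))" "g \<in> borel_measurable (Pi\<^sub>M I (\<lambda>_. lborel))"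
      "h \<in> borel_measurable (Pi\<^sub>M I (\<lambda>_. lborel))"
    and "\<And>x y. x \<in> space (Pi\<^sub>M I (\<lambda>_. lborel :: real measure)) \<Longrightarrow> y \<in> space (Pi\<^sub>M I (\<lambda>_. lborel :: real measure)) \<Longrightarrow>
      f x * g y \<le> (h (\<lambda>i\<in>I. (x i - y i) / 2))\<^sup>2"
  shows "(\<integral>\<^sup>+x. f x \<partial>Pi\<^sub>M I (\<lambda>_. lborel)) * (\<integral>\<^sup>+x. g x \<partial>Pi\<^sub>M I (\<lambda>_. lborel)) \<le> (\<integral>\<^sup>+x. h x \<partial>Pi\<^sub>M I (\<lambda>_. lborel))\<^sup>2"
  using assms
proof (induction I arbitrary: f g h rule: finite_induct)
  case empty
  interpret product_sigma_finite "\<lambda>_::'i. lborel :: real measure" by standard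
  show ?case using empty(4)[of "\<lambda>_. undefined" "\<lambda>_. undefined"]
    by (simp add: PiM_empty nn_integral_count_space_finite restrict_def)
next
  case (insert i I)
  interpret product_sigma_finite "\<lambda>_::'i. lborel :: real measure" by standard
  let ?P = "Pi\<^sub>M I (\<lambda>_. lborel :: real measure)"
  note fm [measurable] = insert.prems(1-3)
  have upd: "(\<lambda>x. F (x(i := t))) \<in> borel_measurable ?P"
    if [measurable]: "F \<in> borel_measurable (Pi\<^sub>M (insert i I) (\<lambda>_. lborel))" for F :: "('i \<Rightarrow> real) \<Rightarrow> ennreal" and t
    by measurable
  have upd2: "(\<lambda>t. \<integral>\<^sup>+x. F (x(i := t)) \<partial>?P) \<in> borel_measurable borel"
    if [measurable]: "F \<in> borel_measurable (Pi\<^sub>M (insert i I) (\<lambda>_. lborel))" for F :: "('i \<Rightarrow> real) \<Rightarrow> ennreal"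
  proof -
    interpret I: finite_product_sigma_finite "\<lambda>_. lborel :: real measure" I by standard (rule insert.hyps(1))
    have "(\<lambda>p. F ((snd p)(i := fst p))) \<in> borel_measurable (lborel \<Otimes>\<^sub>M ?P)" by measurable
    hence "(\<lambda>t. \<integral>\<^sup>+x. F (x(i := t)) \<partial>?P) \<in> borel_measurable lborel"
      by (intro I.borel_measurable_nn_integral) (simp add: case_prod_beta')
    thus ?thesis by simp
  qed
  have "(\<integral>\<^sup>+t. (\<integral>\<^sup>+x. f (x(i := t)) \<partial>?P) \<partial>lborel) * (\<integral>\<^sup>+t. (\<integral>\<^sup>+x. g (x(i := t)) \<partial>?P) \<partial>lborel)
     \<le> (\<integral>\<^sup>+t. (\<integral>\<^sup>+x. h (x(i := t)) \<partial>?P) \<partial>lborel)\<^sup>2"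
  proof (rule PL_diff[OF upd2[OF fm(1)] upd2[OF fm(2)] upd2[OF fm(3)]])
    fix a b :: real
    show "(\<integral>\<^sup>+x. f (x(i := a)) \<partial>?P) * (\<integral>\<^sup>+x. g (x(i := b)) \<partial>?P) \<le> (\<integral>\<^sup>+x. h (x(i := (a - b) / 2)) \<partial>?P)\<^sup>2"
    proof (rule insert.IH[OF upd[OF fm(1)] upd[OF fm(2)] upd[OF fm(3)]])
      fix x y assume xy: "x \<in> space ?P" "y \<in> space ?P"
      have sp: "x(i := a) \<in> space (Pi\<^sub>M (insert i I) (\<lambda>_. lborel))" "y(i := b) \<in> space (Pi\<^sub>M (insert i I) (\<lambda>_. lborel))"
        using xy by (auto simp: space_PiM PiE_def extensional_def)
      have e: "(\<lambda>j\<in>insert i I. ((x(i := a)) j - (y(i := b)) j) / 2) = (\<lambda>j\<in>I. (x j - y j) / 2)(i := (a - b) / 2)"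
        using insert.hyps(2) by (auto simp: fun_eq_iff restrict_def)
      show "f (x(i := a)) * g (y(i := b)) \<le> (h ((\<lambda>j\<in>I. (x j - y j) / 2)(i := (a - b) / 2)))\<^sup>2"
        by (rule insert.prems(4)[OF sp, unfolded e])
    qed
  qed
  thus ?case using insert.hyps fm by (simp add: product_nn_integral_insert_rev)
qed

lemma nn_integral_lborel_coord_rev:
  fixes f :: "'a::euclidean_space \<Rightarrow> ennreal"
  assumes b: "b \<in> Basis" and f [measurable]: "f \<in> borel_measurable borel"
  shows "(\<integral>\<^sup>+x. f x \<partial>lborel) = (\<integral>\<^sup>+t. (\<integral>\<^sup>+z. f ((\<Sum>c\<in>Basis-{b}. z c *\<^sub>R c) + t *\<^sub>R b)
      \<partial>Pi\<^sub>M (Basis - {b}) (\<lambda>_. lborel)) \<partial>lborel)"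
proof -
  interpret product_sigma_finite "\<lambda>_::'a. lborel :: real measure" by standard
  interpret I: finite_product_sigma_finite "\<lambda>_::'a. lborel :: real measure" "Basis - {b}" by standard simp
  interpret P: pair_sigma_finite "Pi\<^sub>M (Basis - {b}) (\<lambda>_::'a. lborel :: real measure)" "lborel :: real measure" ..
  show ?thesis unfolding nn_integral_lborel_coord[OF assms]
    by (rule P.Fubini'[symmetric]) measurable
qed

lemma ennreal_square_le_imp_le:
  fixes a b :: ennreal
  assumes "a * a \<le> b\<^sup>2" shows "a \<le> b"
proof (cases b)
  case (real y)
  have "a \<noteq> top" using assms real by (auto simp: ennreal_power top_unique ennreal_top_mult)
  then obtain x where x: "a = ennreal x" "x \<ge> 0" by (cases a) auto
  have "x\<^sup>2 \<le> y\<^sup>2" using assms x real by (simp add: ennreal_power power2_eq_square flip: ennreal_mult)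
  thus ?thesis using x real power2_le_imp_le[of x y] by simp
qed simp

text \<open>Slice orthogonally to \<open>b\<close>. The operation keeps the height, so at each
  height the previous inequality, with the slice of \<open>L\<close> used twice, bounds the squared
  measure of the slice of \<open>L\<close> by that of the slice of \<open>E\<close>.\<close>

lemma twisted_PL:
  fixes L E :: "'a::euclidean_space set"
  assumes b: "b \<in> Basis" and L: "L \<in> sets borel" and E: "E \<in> sets borel"
    and sub: "\<And>y z. y \<in> L \<Longrightarrow> z \<in> L \<Longrightarrow> y \<bullet> b = z \<bullet> b \<Longrightarrow> (1/2) *\<^sub>R (y - z) + (y \<bullet> b) *\<^sub>R b \<in> E"
  shows "emeasure lborel L \<le> emeasure lborel E"
proof -
  note [measurable] = L E
  let ?P = "Pi\<^sub>M (Basis - {b}) (\<lambda>_. lborel :: real measure)"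
  let ?w = "\<lambda>z. \<Sum>c\<in>Basis-{b}. z c *\<^sub>R c"
  let ?S = "\<lambda>L t. \<integral>\<^sup>+z. indicator L (?w z + t *\<^sub>R b) \<partial>?P"
  have wb: "?w z \<bullet> b = 0" for z
    unfolding inner_sum_left using b by (intro sum.neutral) (auto simp: inner_Basis)
  have bb: "b \<bullet> b = 1" using b by (simp add: inner_Basis)
  have mS: "(\<lambda>z. indicator A (?w z + t *\<^sub>R b) :: ennreal) \<in> borel_measurable ?P"
    if [measurable]: "A \<in> sets borel" for A t
    by measurable
  have S: "?S L t \<le> ?S E t" for t
  proof -
    have "?S L t * ?S L t \<le> (?S E t)\<^sup>2"
    proof (rule PL_diff_PiM[OF _ mS[OF L] mS[OF L] mS[OF E]])
      fix x y assume "x \<in> space ?P" "y \<in> space ?P"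
      let ?m = "\<lambda>i\<in>Basis - {b}. (x i - y i) / 2"
      have wm: "?w ?m = (1/2) *\<^sub>R (?w x - ?w y)"
      proof -
        have "?w ?m = (\<Sum>c\<in>Basis-{b}. (1/2) *\<^sub>R (x c *\<^sub>R c - y c *\<^sub>R c))"
          by (intro sum.cong) (auto simp: scaleR_diff_left diff_divide_distrib scaleR_diff_right)
        thus ?thesis by (simp add: scaleR_sum_right sum_subtractf scaleR_diff_right)
      qed
      show "indicator L (?w x + t *\<^sub>R b) * indicator L (?w y + t *\<^sub>R b) \<le> (indicator E (?w ?m + t *\<^sub>R b) :: ennreal)\<^sup>2"
      proof (cases "?w x + t *\<^sub>R b \<in> L \<and> ?w y + t *\<^sub>R b \<in> L")
        case True
        have "?w ?m + t *\<^sub>R b \<in> E"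
          using sub[of "?w x + t *\<^sub>R b" "?w y + t *\<^sub>R b"] True unfolding wm by (simp add: inner_add_left wb bb)
        thus ?thesis by (simp add: indicator_def)
      qed (auto simp: indicator_def)
    qed simp
    thus ?thesis by (rule ennreal_square_le_imp_le)
  qed
  have "(\<integral>\<^sup>+t. ?S L t \<partial>lborel) \<le> (\<integral>\<^sup>+t. ?S E t \<partial>lborel)" by (rule nn_integral_mono, rule S)
  moreover have "(\<integral>\<^sup>+t. ?S A t \<partial>lborel) = emeasure lborel A" if "A \<in> sets borel" for A
    using nn_integral_lborel_coord_rev[OF b, of "indicator A"] that by simp
  ultimately show ?thesis using L E by simp
qed

section \<open>Steiner symmetrization\<close>

definition reflect :: "'a::euclidean_space \<Rightarrow> 'a \<Rightarrow> 'a" where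
  "reflect c x = x - (2 * (x \<bullet> c)) *\<^sub>R c"

lemma reflect_linear: "linear (reflect c)"
  by (rule linearI) (simp_all add: reflect_def inner_add_left algebra_simps scaleR_add_left)

lemma reflect_reflect: "norm c = 1 \<Longrightarrow> reflect c (reflect c x) = x"
  by (simp add: reflect_def inner_diff_left dot_square_norm algebra_simps flip: scaleR_add_left)

lemma reflect_inner: "reflect c x \<bullet> y = x \<bullet> reflect c y"
  by (simp add: reflect_def inner_diff_left inner_diff_right inner_commute)

lemma reflect_mpres: "norm c = 1 \<Longrightarrow> mpres (reflect c)"
  by (intro mpres_involution reflect_linear reflect_reflect)

lemma open_emeasure_neq_0:
  fixes U :: "'a::euclidean_space set"
  assumes "open U" "U \<noteq> {}" shows "emeasure lborel U \<noteq> 0"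
proof
  assume "emeasure lborel U = 0"
  hence "U \<in> null_sets lborel" using assms by (auto simp: null_sets_def)
  hence "negligible U" using null_sets_completionI by (auto simp: negligible_iff_null_sets)
  thus False using open_not_negligible[OF assms] by simp
qed

text \<open>The body is open so that its chords are open intervals and the cylinder over its
  projection is open; the end points of the chords are then continuous, being concave and convex
  functions there.\<close>

locale steiner =
  fixes G :: "'a::euclidean_space set" and b :: 'a and p :: real
  assumes G: "open G" "convex G" "bounded G" "G \<noteq> {}" and sym: "\<And>x. x \<in> G \<Longrightarrow> - x \<in> G"
    and b: "b \<in> Basis" and p: "p \<ge> 1"
begin

lemma bb: "b \<bullet> b = 1" "norm b = 1" using b by (auto simp: inner_Basis)

definition pr :: "'a \<Rightarrow> 'a" where "pr x = x - (x \<bullet> b) *\<^sub>R b"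

text \<open>The chord through \<open>x\<close> in direction \<open>b\<close>, parametrised by the
  height over the hyperplane orthogonal to \<open>b\<close>.\<close>

definition fib :: "'a \<Rightarrow> real set" where "fib x = {s. pr x + s *\<^sub>R b \<in> G}"

definition cyl :: "'a set" where "cyl = {x. fib x \<noteq> {}}"

definition mid :: "'a \<Rightarrow> real" where
  "mid x = (if x \<in> cyl then (Sup (fib x) + Inf (fib x)) / 2 else 0)"

text \<open>Reflects each chord in its own midpoint. This preserves the body and volume but is in
  general not linear; linearity is what the equality case will produce.\<close>

definition sig :: "'a \<Rightarrow> 'a" where "sig x = x + (2 * (mid x - x \<bullet> b)) *\<^sub>R b"

lemma pr_add [simp]: "pr (x + t *\<^sub>R b) = pr x" by (simp add: pr_def inner_add_left bb algebra_simps)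
lemma pr_diff [simp]: "pr (x - t *\<^sub>R b) = pr x" using pr_add[of x "-t"] by simp
lemma pr_b: "pr x \<bullet> b = 0" by (simp add: pr_def inner_diff_left bb)
lemma pr_eq: "pr x + (x \<bullet> b) *\<^sub>R b = x" by (simp add: pr_def)
lemma fib_add [simp]: "fib (x + t *\<^sub>R b) = fib x" "fib (x - t *\<^sub>R b) = fib x" by (simp_all add: fib_def)
lemma mid_add [simp]: "mid (x + t *\<^sub>R b) = mid x" "mid (x - t *\<^sub>R b) = mid x" by (simp_all add: mid_def cyl_def)
lemma mem_fib: "x \<in> G \<longleftrightarrow> x \<bullet> b \<in> fib x" by (simp add: fib_def pr_eq)
lemma G_cyl: "x \<in> G \<Longrightarrow> x \<in> cyl" using mem_fib by (auto simp: cyl_def)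

lemma G_bound: obtains R where "R > 0" "\<And>x. x \<in> G \<Longrightarrow> norm x \<le> R"
  using G(3) bounded_pos by blast

lemma fib_bounded: "bounded (fib x)" "bdd_above (fib x)" "bdd_below (fib x)"
proof -
  obtain R where R: "\<And>x. x \<in> G \<Longrightarrow> norm x \<le> R" using G_bound by metis
  have "\<bar>s\<bar> \<le> R" if "s \<in> fib x" for s
  proof -
    have "\<bar>(pr x + s *\<^sub>R b) \<bullet> b\<bar> \<le> norm (pr x + s *\<^sub>R b)" using Basis_le_norm[OF b] by blast
    also have "\<dots> \<le> R" using that R by (auto simp: fib_def)
    finally show ?thesis by (simp add: inner_add_left pr_b bb)
  qed
  thus "bounded (fib x)" unfolding bounded_iff by auto
  thus "bdd_above (fib x)" "bdd_below (fib x)" by (auto intro: bounded_imp_bdd_above bounded_imp_bdd_below)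
qed

lemma fib_open: "open (fib x)"
proof -
  have "open ((\<lambda>s. pr x + s *\<^sub>R b) -` G)" by (intro open_vimage G continuous_intros)
  thus ?thesis by (simp add: fib_def vimage_def)
qed

lemma fib_convex_comb:
  assumes "s \<in> fib x" "r \<in> fib y" "0 \<le> t" "t \<le> 1"
  shows "(1 - t) * s + t * r \<in> fib ((1 - t) *\<^sub>R x + t *\<^sub>R y)"
proof -
  have "(1 - t) *\<^sub>R (pr x + s *\<^sub>R b) + t *\<^sub>R (pr y + r *\<^sub>R b) \<in> G"
    using assms G(2) by (intro convexD) (auto simp: fib_def)
  also have "(1 - t) *\<^sub>R (pr x + s *\<^sub>R b) + t *\<^sub>R (pr y + r *\<^sub>R b)
     = pr ((1 - t) *\<^sub>R x + t *\<^sub>R y) + ((1 - t) * s + t * r) *\<^sub>R b"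
    by (simp add: pr_def inner_add_left algebra_simps)
  finally show ?thesis by (simp add: fib_def)
qed

lemma fib_interval:
  assumes "x \<in> cyl" shows "fib x = {Inf (fib x)<..<Sup (fib x)}"
proof -
  have ne: "fib x \<noteq> {}" using assms by (simp add: cyl_def)
  show ?thesis
  proof (intro equalityI subsetI)
    fix s assume s: "s \<in> fib x"
    obtain e where e: "e > 0" "ball s e \<subseteq> fib x" using fib_open s open_contains_ball by blast
    have "s + e/2 \<in> fib x" "s - e/2 \<in> fib x" using e by (auto simp: subset_iff dist_real_def)
    hence "s + e/2 \<le> Sup (fib x)" "Inf (fib x) \<le> s - e/2" using fib_bounded by (auto intro: cSup_upper cInf_lower)
    thus "s \<in> {Inf (fib x)<..<Sup (fib x)}" using e by auto
  next
    fix s assume "s \<in> {Inf (fib x)<..<Sup (fib x)}"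
    then obtain r q where rq: "r \<in> fib x" "q \<in> fib x" "r < s" "s < q"
      using less_cSup_iff[OF ne fib_bounded(2)] cInf_less_iff[OF ne fib_bounded(3)] by auto
    define t where "t = (s - r) / (q - r)"
    have t: "0 \<le> t" "t \<le> 1" using rq by (auto simp: t_def)
    have "(1 - t) * r + t * q = r + t * (q - r)" by (simp add: algebra_simps)
    also have "\<dots> = s" using rq by (simp add: t_def)
    finally show "s \<in> fib x" using fib_convex_comb[OF rq(1,2) t] by (simp flip: scaleR_add_left)
  qed
qed

lemma mid_mem: "x \<in> cyl \<Longrightarrow> mid x \<in> fib x"
proof -
  assume x: "x \<in> cyl"
  hence "{Inf (fib x)<..<Sup (fib x)} \<noteq> {}" using fib_interval[OF x] by (simp add: cyl_def)
  hence "Inf (fib x) < Sup (fib x)" by auto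
  hence "mid x \<in> {Inf (fib x)<..<Sup (fib x)}" using x by (simp add: mid_def)
  thus ?thesis using fib_interval[OF x] by simp
qed

lemma mid_reflect: "2 * mid x - s \<in> fib x \<longleftrightarrow> s \<in> fib x"
proof (cases "x \<in> cyl")
  case True
  have "2 * mid x = Sup (fib x) + Inf (fib x)" using True by (simp add: mid_def)
  hence "2 * mid x - s \<in> {Inf (fib x)<..<Sup (fib x)} \<longleftrightarrow> s \<in> {Inf (fib x)<..<Sup (fib x)}" by auto
  thus ?thesis using fib_interval[OF True] by simp
qed (simp add: cyl_def)

lemma sig_b: "sig x \<bullet> b = 2 * mid x - x \<bullet> b"
  by (simp add: sig_def inner_add_left bb)

lemma sig_mem: "sig x \<in> G \<longleftrightarrow> x \<in> G"
  unfolding mem_fib sig_b unfolding sig_def fib_add mid_reflect ..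

lemma sig_mid: "mid (sig x) = mid x" by (simp add: sig_def)

lemma cyl_open: "open cyl"
proof -
  have "cyl = (\<Union>s. {x. pr x + s *\<^sub>R b \<in> G})" by (auto simp: cyl_def fib_def)
  moreover have "open ((\<lambda>x. pr x + s *\<^sub>R b) -` G)" for s
    unfolding pr_def by (intro open_vimage G continuous_intros)
  ultimately show ?thesis by (auto simp: vimage_def)
qed

lemma cyl_convex: "convex cyl"
  unfolding convex_alt using fib_convex_comb by (fastforce simp: cyl_def)

text \<open>By convexity of the body the upper end of the chord is a concave and the lower end a
  convex function on the open convex set \<open>cyl\<close>, hence both are continuous.\<close>

lemma mid_cont: "continuous_on cyl mid"
proof -
  have cvx: "convex_on cyl (\<lambda>x. - Sup (fib x))"
  proof (rule convex_onI)
    fix t x y assume t: "0 < t" "t < (1::real)" and xy: "x \<in> cyl" "y \<in> cyl"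
    let ?z = "(1 - t) *\<^sub>R x + t *\<^sub>R y"
    have le: "(1 - t) * s + t * r \<le> Sup (fib ?z)" if "s \<in> fib x" "r \<in> fib y" for s r
      using fib_convex_comb[OF that, of t] t fib_bounded by (intro cSup_upper) auto
    have "Sup (fib x) \<le> (Sup (fib ?z) - t * r) / (1 - t)" if r: "r \<in> fib y" for r
      using xy t le[OF _ r] by (intro cSup_least) (auto simp: cyl_def field_simps)
    hence "r \<le> (Sup (fib ?z) - (1 - t) * Sup (fib x)) / t" if r: "r \<in> fib y" for r
      using r t by (auto simp: field_simps)
    hence "Sup (fib y) \<le> (Sup (fib ?z) - (1 - t) * Sup (fib x)) / t"
      using xy by (intro cSup_least) (auto simp: cyl_def)
    hence "t * Sup (fib y) \<le> Sup (fib ?z) - (1 - t) * Sup (fib x)" using t by (simp add: pos_le_divide_eq mult.commute)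
    thus "- Sup (fib ?z) \<le> (1 - t) * - Sup (fib x) + t * - Sup (fib y)" by simp
  qed (rule cyl_convex)
  have cvx2: "convex_on cyl (\<lambda>x. Inf (fib x))"
  proof (rule convex_onI)
    fix t x y assume t: "0 < t" "t < (1::real)" and xy: "x \<in> cyl" "y \<in> cyl"
    let ?z = "(1 - t) *\<^sub>R x + t *\<^sub>R y"
    have le: "Inf (fib ?z) \<le> (1 - t) * s + t * r" if "s \<in> fib x" "r \<in> fib y" for s r
      using fib_convex_comb[OF that, of t] t fib_bounded by (intro cInf_lower) auto
    have "(Inf (fib ?z) - t * r) / (1 - t) \<le> Inf (fib x)" if r: "r \<in> fib y" for r
      using xy t le[OF _ r] by (intro cInf_greatest) (auto simp: cyl_def field_simps)
    hence "(Inf (fib ?z) - (1 - t) * Inf (fib x)) / t \<le> r" if r: "r \<in> fib y" for r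
      using r t by (auto simp: field_simps)
    hence "(Inf (fib ?z) - (1 - t) * Inf (fib x)) / t \<le> Inf (fib y)"
      using xy by (intro cInf_greatest) (auto simp: cyl_def)
    hence "Inf (fib ?z) - (1 - t) * Inf (fib x) \<le> t * Inf (fib y)" using t by (simp add: pos_divide_le_eq mult.commute)
    thus "Inf (fib ?z) \<le> (1 - t) * Inf (fib x) + t * Inf (fib y)" by simp
  qed (rule cyl_convex)
  have "continuous_on cyl (\<lambda>x. (- (- Sup (fib x)) + Inf (fib x)) / 2)"
    by (intro continuous_on_divide continuous_on_add continuous_on_minus[OF convex_on_continuous[OF cyl_open cvx]]
      convex_on_continuous[OF cyl_open cvx2] continuous_on_const) simp
  thus ?thesis by (rule continuous_on_eq) (simp add: mid_def)
qed

lemma mid_borel [measurable]: "mid \<in> borel_measurable borel"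
proof -
  have "(\<lambda>x. if x \<in> cyl then mid x else 0) \<in> borel_measurable borel"
    using mid_cont cyl_open by (intro borel_measurable_continuous_on_if) auto
  also have "(\<lambda>x. if x \<in> cyl then mid x else 0) = mid" by (auto simp: mid_def)
  finally show ?thesis .
qed

lemma shear_mpres: "mpres (\<lambda>x. x + mid x *\<^sub>R b)" "mpres (\<lambda>x. x + (- mid x) *\<^sub>R b)"
  by (rule mpres_shear[OF b]; simp)+

text \<open>Shear the midpoints into the hyperplane orthogonal to \<open>b\<close>, reflect in it,
  and shear back.\<close>

lemma sig_mpres: "mpres sig"
proof -
  have "sig = (\<lambda>x. (\<lambda>x. x + mid x *\<^sub>R b) (reflect b ((\<lambda>x. x + (- mid x) *\<^sub>R b) x)))"
  proof
    fix x
    have e: "reflect b (x + (- mid x) *\<^sub>R b) = x + (mid x - 2 * (x \<bullet> b)) *\<^sub>R b"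
      by (simp add: reflect_def inner_diff_left bb algebra_simps flip: scaleR_add_left)
    show "sig x = (\<lambda>x. x + mid x *\<^sub>R b) (reflect b ((\<lambda>x. x + (- mid x) *\<^sub>R b) x))"
      unfolding e by (simp only: mid_add sig_def) (simp add: algebra_simps flip: scaleR_add_left)
  qed
  moreover have "mpres \<dots>"
    by (intro mpres_compose[OF shear_mpres(1)] mpres_compose[OF reflect_mpres] shear_mpres(2) bb)
  ultimately show ?thesis by simp
qed

text \<open>The Steiner symmetral: every chord is shifted so that its midpoint has height 0.\<close>

definition stn :: "'a set" where "stn = {x. x + mid x *\<^sub>R b \<in> G}"

lemma G_borel [measurable]: "G \<in> sets borel" using G by auto

lemma G_measure_pos: "measure lborel G > 0"
proof -
  have "ennreal (measure lborel G) \<noteq> 0"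
    using open_emeasure_neq_0[OF G(1,4)] unfolding bounded_emeasure_measure[OF G(3)] .
  thus ?thesis using measure_nonneg[of lborel G] by (metis ennreal_0 less_le)
qed

lemma G_adm: "adm p G"
  using G G_measure_pos p by (intro adm_bounded) auto

lemma stn_borel: "stn \<in> sets borel" unfolding stn_def by measurable

lemma stn_measure: "measure lborel stn = measure lborel G"
  using mpres_measure[OF shear_mpres(1) G_borel] by (simp add: stn_def vimage_def)

lemma stn_adm: "adm p stn"
proof (rule adm_bounded[OF stn_borel])
  obtain R where R: "\<And>x. x \<in> G \<Longrightarrow> norm x \<le> R" using G_bound by metis
  have "norm x \<le> 2 * R" if "x \<in> stn" for x
  proof -
    have g: "x + mid x *\<^sub>R b \<in> G" using that by (simp add: stn_def)
    hence "x \<in> cyl" using G_cyl[OF g] by (simp add: cyl_def)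
    hence "pr x + mid x *\<^sub>R b \<in> G" using mid_mem by (simp add: fib_def)
    hence "\<bar>(pr x + mid x *\<^sub>R b) \<bullet> b\<bar> \<le> R" using Basis_le_norm[OF b] R order_trans by blast
    hence "\<bar>mid x\<bar> \<le> R" by (simp add: inner_add_left pr_b bb)
    moreover have "norm x \<le> norm (x + mid x *\<^sub>R b) + norm (mid x *\<^sub>R b)"
      by (metis add_diff_cancel_right' norm_triangle_ineq4)
    ultimately show ?thesis using R[OF g] by (simp add: bb)
  qed
  thus "bounded stn" unfolding bounded_iff by blast
qed (use stn_measure G_measure_pos p in auto)

text \<open>Pulling the integral back to \<open>G\<close> lets the moments of the body and of its
  symmetral be compared pointwise over one domain.\<close>

lemma mom_stn: "mom p dotk stn y = (LINT x:G|lborel. \<bar>(x - mid x *\<^sub>R b) \<bullet> y\<bar> powr p)"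
proof -
  have "(\<integral>x. indicator G (x + mid x *\<^sub>R b) *\<^sub>R \<bar>((x + mid x *\<^sub>R b) - mid (x + mid x *\<^sub>R b) *\<^sub>R b) \<bullet> y\<bar> powr p \<partial>lborel)
    = (\<integral>x. indicator G x *\<^sub>R \<bar>(x - mid x *\<^sub>R b) \<bullet> y\<bar> powr p \<partial>lborel)"
    by (rule mpres_integral[OF shear_mpres(1), of "\<lambda>x. indicator G x *\<^sub>R \<bar>(x - mid x *\<^sub>R b) \<bullet> y\<bar> powr p"]) measurable
  thus ?thesis by (simp add: mom_def set_lebesgue_integral_def stn_def indicator_def dotk_def)
qed

lemma sig_integral:
  assumes [measurable]: "f \<in> borel_measurable borel"
  shows "(LINT x:G|lborel. f (sig x)) = (LINT x:G|lborel. (f x :: real))"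
proof -
  have "(\<integral>x. indicator G (sig x) *\<^sub>R f (sig x) \<partial>lborel) = (\<integral>x. indicator G x *\<^sub>R f x \<partial>lborel)"
    by (rule mpres_integral[OF sig_mpres, of "\<lambda>x. indicator G x *\<^sub>R f x"]) measurable
  thus ?thesis by (simp add: set_lebesgue_integral_def indicator_def sig_mem)
qed

lemma sig_measurable [measurable]: "sig \<in> borel_measurable borel" using sig_mpres mpres_measurable by blast

text \<open>Reflecting the argument has the same effect as reflecting all chords of
  \<open>G\<close>, and the latter is a volume preserving substitution.\<close>

lemma mom_stn_refl_b: "mom p dotk stn (reflect b y) = mom p dotk stn y"
proof -
  have "(x - mid x *\<^sub>R b) \<bullet> reflect b y = (sig x - mid (sig x) *\<^sub>R b) \<bullet> y" for x
    unfolding sig_mid reflect_inner[symmetric]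
    by (simp add: reflect_def sig_def inner_diff_left bb algebra_simps flip: scaleR_add_left)
  hence "mom p dotk stn (reflect b y) = (LINT x:G|lborel. \<bar>(sig x - mid (sig x) *\<^sub>R b) \<bullet> y\<bar> powr p)"
    by (simp add: mom_stn)
  also have "\<dots> = (LINT x:G|lborel. \<bar>(x - mid x *\<^sub>R b) \<bullet> y\<bar> powr p)"
    by (rule sig_integral[of "\<lambda>x. \<bar>(x - mid x *\<^sub>R b) \<bullet> y\<bar> powr p"]) measurable
  finally show ?thesis by (simp add: mom_stn)
qed

text \<open>A symmetry in another coordinate direction maps chords in direction \<open>b\<close> to
  such chords at the same heights, so it survives. This is what allows all coordinate symmetries to
  be produced one after another.\<close>

lemma mom_stn_refl:
  assumes c: "c \<in> Basis" "c \<noteq> b" and inv: "\<And>x. x \<in> G \<Longrightarrow> reflect c x \<in> G"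
  shows "mom p dotk stn (reflect c y) = mom p dotk stn y"
proof -
  have cb: "c \<bullet> b = 0" "norm c = 1" using b c by (auto simp: inner_Basis)
  have iG: "reflect c x \<in> G \<longleftrightarrow> x \<in> G" for x using inv[of x] inv[of "reflect c x"] reflect_reflect[OF cb(2), of x] by auto
  have rb: "reflect c x \<bullet> b = x \<bullet> b" for x by (simp add: reflect_def inner_diff_left cb)
  have rbb: "reflect c b = b" using cb by (simp add: reflect_def inner_commute)
  have prr: "pr (reflect c x) + s *\<^sub>R b = reflect c (pr x + s *\<^sub>R b)" for x s
    unfolding pr_def rb using reflect_linear[of c] by (simp add: linear_add linear_diff linear_cmul rbb)
  have fibr: "fib (reflect c x) = fib x" for x unfolding fib_def prr iG ..
  have midr: "mid (reflect c x) = mid x" for x by (simp add: mid_def cyl_def fibr)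
  have "(x - mid x *\<^sub>R b) \<bullet> reflect c y = (reflect c x - mid (reflect c x) *\<^sub>R b) \<bullet> y" for x
    unfolding midr reflect_inner[symmetric] using reflect_linear[of c] by (simp add: linear_diff linear_cmul rbb)
  hence "mom p dotk stn (reflect c y) = (\<integral>x. indicator G (reflect c x) *\<^sub>R \<bar>(reflect c x - mid (reflect c x) *\<^sub>R b) \<bullet> y\<bar> powr p \<partial>lborel)"
    by (simp add: mom_stn set_lebesgue_integral_def indicator_def iG)
  also have "\<dots> = (\<integral>x. indicator G x *\<^sub>R \<bar>(x - mid x *\<^sub>R b) \<bullet> y\<bar> powr p \<partial>lborel)"
    by (rule mpres_integral[OF reflect_mpres[OF cb(2)], of "\<lambda>x. indicator G x *\<^sub>R \<bar>(x - mid x *\<^sub>R b) \<bullet> y\<bar> powr p"]) measurable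
  finally show ?thesis by (simp add: mom_stn set_lebesgue_integral_def)
qed

text \<open>The origin of the twisted midpoint: paired with a point of the symmetral, it gives the
  mean of x . y and -(sig x . z). As \<open>sig\<close> preserves volume on \<open>G\<close>,
  convexity then separates the moments at y and z.\<close>

lemma inner_twist:
  assumes "y \<bullet> b = z \<bullet> b"
  shows "(x - mid x *\<^sub>R b) \<bullet> ((1/2) *\<^sub>R (y - z) + (y \<bullet> b) *\<^sub>R b) = (1/2) * (x \<bullet> y) + (1/2) * (- (sig x \<bullet> z))"
proof -
  have 1: "b \<bullet> y = z \<bullet> b" "b \<bullet> z = z \<bullet> b" using assms by (simp_all add: inner_commute)
  show ?thesis
    unfolding sig_def inner_diff_left inner_diff_right inner_add_left inner_add_right inner_scaleR_left inner_scaleR_right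
      bb 1 assms by algebra
qed

lemma int_dot: "set_integrable lborel G (\<lambda>x. \<bar>x \<bullet> y\<bar> powr p)"
  using mom_integrable[OF kernel_dotk _ G_adm] p by (simp add: dotk_def)

lemma int_sig: "set_integrable lborel G (\<lambda>x. \<bar>sig x \<bullet> y\<bar> powr p)"
proof -
  have "integrable lborel (\<lambda>x. indicator G (sig x) *\<^sub>R \<bar>sig x \<bullet> y\<bar> powr p)"
    using mpres_integrable[OF sig_mpres int_dot[unfolded set_integrable_def]] .
  thus ?thesis by (simp add: set_integrable_def indicator_def sig_mem)
qed

lemma int_stn: "set_integrable lborel G (\<lambda>x. \<bar>(x - mid x *\<^sub>R b) \<bullet> y\<bar> powr p)"
proof -
  have "integrable lborel (\<lambda>x. indicator stn x *\<^sub>R \<bar>x \<bullet> y\<bar> powr p)"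
    using mom_integrable[OF kernel_dotk _ stn_adm] p by (simp add: dotk_def set_integrable_def)
  hence "integrable lborel (\<lambda>x. indicator stn (x + (- mid x) *\<^sub>R b) *\<^sub>R \<bar>(x + (- mid x) *\<^sub>R b) \<bullet> y\<bar> powr p)"
    by (rule mpres_integrable[OF shear_mpres(2)])
  moreover have "indicator stn (x + (- mid x) *\<^sub>R b) = (indicator G x :: real)" for x
    using mid_add(2)[of x "mid x"] by (simp add: stn_def indicator_def)
  ultimately show ?thesis by (simp add: set_integrable_def)
qed

lemma mom_sig: "(LINT x:G|lborel. \<bar>sig x \<bullet> z\<bar> powr p) = mom p dotk G z"
  using sig_integral[of "\<lambda>x. \<bar>x \<bullet> z\<bar> powr p"] by (simp add: mom_def dotk_def)

lemma twist_pointwise: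
  "\<bar>(1/2) * u + (1/2) * (- v)\<bar> powr p \<le> (1/2) * \<bar>u\<bar> powr p + (1/2) * \<bar>v\<bar> powr p" for u v :: real
  using convex_abs_powr_ineq[OF p, of "1/2" "1/2" u "-v"] by simp

lemma mom_twist:
  assumes "y \<bullet> b = z \<bullet> b"
  shows "mom p dotk stn ((1/2) *\<^sub>R (y - z) + (y \<bullet> b) *\<^sub>R b) \<le> (mom p dotk G y + mom p dotk G z) / 2"
proof -
  have "mom p dotk stn ((1/2) *\<^sub>R (y - z) + (y \<bullet> b) *\<^sub>R b)
    \<le> (LINT x:G|lborel. (1/2) * \<bar>x \<bullet> y\<bar> powr p + (1/2) * \<bar>sig x \<bullet> z\<bar> powr p)"
    unfolding mom_stn
    by (intro set_integral_mono int_stn set_integral_add set_integrable_mult_right int_dot int_sig)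
       (simp only: inner_twist[OF assms] twist_pointwise)
  also have "\<dots> = (mom p dotk G y + mom p dotk G z) / 2"
    using int_dot int_sig by (subst set_integral_add) (auto simp: mom_sig mom_def[of _ _ G y] dotk_def)
  finally show ?thesis .
qed

lemma stn_phom: "phom p (mom p dotk stn)" and G_phom: "phom p (mom p dotk G)"
  using mom_phom_convex(1)[OF kernel_dotk p] stn_adm G_adm by auto

text \<open>The twisted midpoint stays at the height of the two points, so the image can be cut off
  at the top of the original set. This extra information is spent in the equality case.\<close>

lemma lvol_slab:
  assumes T: "\<And>y. mom p dotk G y \<le> 1 \<Longrightarrow> y \<bullet> b \<le> T"
  shows "emeasure lborel {y. mom p dotk G y \<le> 1} \<le> emeasure lborel ({y. mom p dotk stn y \<le> 1} \<inter> {y. y \<bullet> b \<le> T})"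
proof (rule twisted_PL[OF b])
  fix y z assume yz: "y \<in> {y. mom p dotk G y \<le> 1}" "z \<in> {y. mom p dotk G y \<le> 1}" "y \<bullet> b = z \<bullet> b"
  have "mom p dotk stn ((1/2) *\<^sub>R (y - z) + (y \<bullet> b) *\<^sub>R b) \<le> 1" using mom_twist[OF yz(3)] yz by simp
  moreover have "((1/2) *\<^sub>R (y - z) + (y \<bullet> b) *\<^sub>R b) \<bullet> b = y \<bullet> b"
    using yz(3) by (simp add: inner_add_left inner_diff_left bb)
  ultimately show "(1/2) *\<^sub>R (y - z) + (y \<bullet> b) *\<^sub>R b \<in> {y. mom p dotk stn y \<le> 1} \<inter> {y. y \<bullet> b \<le> T}"
    using T yz by simp
qed (use phom_sublevel_borel[OF stn_phom] phom_sublevel_borel[OF G_phom] in auto)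

lemma lvol_le: "lvol (mom p dotk G) \<le> lvol (mom p dotk stn)"
proof -
  obtain y0 where y0: "\<And>y. mom p dotk G y \<le> 1 \<Longrightarrow> norm y \<le> y0"
    using compact_imp_bounded[OF phom_sublevel_compact[OF G_phom, of 1]] p by (auto simp: bounded_iff)
  have "y \<bullet> b \<le> y0" if "mom p dotk G y \<le> 1" for y
    using y0[OF that] Basis_le_norm[OF b, of y] by simp
  hence "emeasure lborel {y. mom p dotk G y \<le> 1} \<le> emeasure lborel ({y. mom p dotk stn y \<le> 1} \<inter> {y. y \<bullet> b \<le> y0})"
    by (rule lvol_slab)
  also have "\<dots> \<le> emeasure lborel {y. mom p dotk stn y \<le> 1}"
    using phom_sublevel_borel[OF stn_phom] by (intro emeasure_mono) auto
  finally show ?thesis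
    using p by (simp add: phom_sublevel_emeasure[OF stn_phom] phom_sublevel_emeasure[OF G_phom] lvol_def)
qed

text \<open>Equality is detected at the highest point of the sublevel set in direction \<open>b\<close>.\<close>
lemma lvol_eq_imp_reflection:
  assumes eq: "lvol (mom p dotk G) = lvol (mom p dotk stn)"
  obtains a where "a \<bullet> b = 1" "\<And>x. x \<in> G \<Longrightarrow> x - (2 * (a \<bullet> x)) *\<^sub>R b \<in> G"
proof -
  let ?L = "{y. mom p dotk G y \<le> 1}" and ?E = "{y. mom p dotk stn y \<le> 1}"
  have p0: "p > 0" using p by simp
  have ne: "?L \<noteq> {}" using phom_zero[OF G_phom] by (auto intro!: exI[of _ 0])
  obtain y where y: "y \<in> ?L" "\<And>z. z \<in> ?L \<Longrightarrow> z \<bullet> b \<le> y \<bullet> b"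
    using continuous_attains_sup[OF phom_sublevel_compact[OF G_phom p0] ne continuous_on_inner[OF continuous_on_id continuous_on_const, of _ b]]
    by blast
  define t where "t = y \<bullet> b"
  have t: "t > 0"
  proof -
    have Hb: "mom p dotk G b > 0" using bb by (intro phom_pos[OF G_phom]) auto
    define c where "c = (1 / mom p dotk G b) powr (1/p)"
    have c: "c > 0" "c powr p = 1 / mom p dotk G b" unfolding c_def powr_powr using Hb p0 by simp_all
    have "mom p dotk G (c *\<^sub>R b) = 1" unfolding phom_scale[OF G_phom] abs_of_pos[OF c(1)] c(2) using Hb by simp
    hence "c *\<^sub>R b \<in> ?L" by simp
    from y(2)[OF this] c show ?thesis by (simp add: t_def bb)
  qed
  \<comment> \<open>Otherwise a neighbourhood of t b lies in the sublevel set of the symmetral and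
    contains an open set above height \<open>t\<close>. That volume comes on top of the part counted
    by \<open>lvol_slab\<close>, contradicting equality.\<close>
  have ge: "mom p dotk stn (t *\<^sub>R b) \<ge> 1"
  proof (rule ccontr)
    assume "\<not> mom p dotk stn (t *\<^sub>R b) \<ge> 1"
    hence lt: "t *\<^sub>R b \<in> {y. mom p dotk stn y < 1}" by simp
    have op: "open {y. mom p dotk stn y < 1}"
      by (intro open_Collect_less phom_cont[OF stn_phom] continuous_intros)
    obtain e where e: "e > 0" "ball (t *\<^sub>R b) e \<subseteq> {y. mom p dotk stn y < 1}"
      using openE[OF op lt] by blast
    let ?U = "{y. mom p dotk stn y < 1} \<inter> {y. y \<bullet> b > t}"
    have Uo: "open ?U" by (intro open_Int op open_Collect_less continuous_intros)
    have "(t + e/2) *\<^sub>R b \<in> ?U"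
      using e t by (auto simp: bb dist_norm subset_iff simp flip: scaleR_diff_left)
    hence Une: "?U \<noteq> {}" by blast
    have Upos: "emeasure lborel ?U \<noteq> 0" by (rule open_emeasure_neq_0[OF Uo Une])
    have "emeasure lborel ?L + emeasure lborel ?U \<le> emeasure lborel (?E \<inter> {y. y \<bullet> b \<le> t}) + emeasure lborel ?U"
      using lvol_slab[of t] y(2) by (intro add_right_mono) (auto simp: t_def)
    also have "\<dots> = emeasure lborel ((?E \<inter> {y. y \<bullet> b \<le> t}) \<union> ?U)"
      using Uo phom_sublevel_borel[OF stn_phom] by (intro plus_emeasure) auto
    also have "\<dots> \<le> emeasure lborel ?E"
      using phom_sublevel_borel[OF stn_phom] by (intro emeasure_mono) auto
    also have "\<dots> = emeasure lborel ?L"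
      using eq by (simp add: phom_sublevel_emeasure[OF stn_phom p0] phom_sublevel_emeasure[OF G_phom p0] lvol_def)
    finally have "emeasure lborel ?L + emeasure lborel ?U \<le> emeasure lborel ?L + 0" by simp
    hence "emeasure lborel ?U \<le> 0"
      using phom_sublevel_emeasure[OF G_phom p0, of 1] by (subst (asm) ennreal_add_left_cancel_le) auto
    thus False using Upos by simp
  qed
  have tw: "(1/2) *\<^sub>R (y - y) + (y \<bullet> b) *\<^sub>R b = t *\<^sub>R b" by (simp add: t_def)
  \<comment> \<open>The pointwise loss in the convexity estimate for z = y, the top point. Its
    integral is at most 1 - 1 by \<open>ge\<close>, so the loss vanishes almost everywhere on
    \<open>G\<close>.\<close>
  define D where "D x = (1/2) * \<bar>x \<bullet> y\<bar> powr p + (1/2) * \<bar>sig x \<bullet> y\<bar> powr p - \<bar>(1/2) * (x \<bullet> y) + (1/2) * (- (sig x \<bullet> y))\<bar> powr p" for x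
  have D0: "D x \<ge> 0" for x using twist_pointwise[of "x \<bullet> y" "sig x \<bullet> y"] by (simp add: D_def)
  have Deq: "D x = (1/2) * \<bar>x \<bullet> y\<bar> powr p + (1/2) * \<bar>sig x \<bullet> y\<bar> powr p - \<bar>(x - mid x *\<^sub>R b) \<bullet> (t *\<^sub>R b)\<bar> powr p" for x
    unfolding D_def using inner_twist[of y y x] unfolding tw by simp
  have Dint: "set_integrable lborel G D"
    unfolding Deq[abs_def] by (intro set_integral_diff set_integral_add set_integrable_mult_right int_dot int_sig int_stn)
  have "(LINT x:G|lborel. D x) = mom p dotk G y - mom p dotk stn (t *\<^sub>R b)"
  proof -
    have "(LINT x:G|lborel. D x) = (LINT x:G|lborel. (1/2) * \<bar>x \<bullet> y\<bar> powr p + (1/2) * \<bar>sig x \<bullet> y\<bar> powr p)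
        - (LINT x:G|lborel. \<bar>(x - mid x *\<^sub>R b) \<bullet> (t *\<^sub>R b)\<bar> powr p)"
      unfolding Deq by (intro set_integral_diff(2) set_integral_add(1) set_integrable_mult_right int_dot int_sig int_stn)
    also have "(LINT x:G|lborel. (1/2) * \<bar>x \<bullet> y\<bar> powr p + (1/2) * \<bar>sig x \<bullet> y\<bar> powr p)
        = (LINT x:G|lborel. (1/2) * \<bar>x \<bullet> y\<bar> powr p) + (LINT x:G|lborel. (1/2) * \<bar>sig x \<bullet> y\<bar> powr p)"
      by (intro set_integral_add(2) set_integrable_mult_right int_dot int_sig)
    also have "\<dots> = mom p dotk G y"
      unfolding set_integral_mult_right mom_sig by (simp add: mom_def dotk_def)
    finally show ?thesis unfolding mom_stn .
  qed
  hence "(LINT x:G|lborel. D x) \<le> 0" using y(1) ge by simp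
  moreover have "(LINT x:G|lborel. D x) \<ge> 0"
    unfolding set_lebesgue_integral_def using D0 by (intro integral_nonneg_AE) auto
  ultimately have "(\<integral>x. indicator G x *\<^sub>R D x \<partial>lborel) = 0" by (simp add: set_lebesgue_integral_def)
  hence AE0: "AE x in lborel. indicator G x *\<^sub>R D x = 0"
    using integral_nonneg_eq_0_iff_AE[OF Dint[unfolded set_integrable_def]] D0 by simp
  \<comment> \<open>The value of the functional y at the midpoint of the chord through
    \<open>x\<close>; it is constant along chords. Passing from \<open>x\<close> to
    \<open>sig x\<close> keeps this part of x . y and changes the sign of the rest.\<close>
  define c where "c x = pr x \<bullet> y + mid x * t" for x
  have xy: "x \<bullet> y = c x + (x \<bullet> b - mid x) * t" and sxy: "sig x \<bullet> y = c x - (x \<bullet> b - mid x) * t" for x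
  proof -
    have 1: "x \<bullet> y = pr x \<bullet> y + (x \<bullet> b) * t"
      unfolding t_def by (subst pr_eq[symmetric, of x]) (simp only: inner_add_left inner_scaleR_left inner_commute[of b y])
    thus "x \<bullet> y = c x + (x \<bullet> b - mid x) * t" by (simp add: c_def algebra_simps)
    have "sig x \<bullet> y = x \<bullet> y + 2 * (mid x - x \<bullet> b) * t"
      by (simp only: sig_def inner_add_left inner_scaleR_left t_def inner_commute[of b y])
    thus "sig x \<bullet> y = c x - (x \<bullet> b - mid x) * t" using 1 by (simp add: c_def algebra_simps)
  qed
  \<comment> \<open>For |d| < |c| the mean of |c + d| and |c - d| strictly exceeds |d|. Strictness
    comes from the absolute value and not from the power, so p = 1 is included.\<close>
  have Dpos: "D x > 0" if "\<bar>(x \<bullet> b - mid x) * t\<bar> < \<bar>c x\<bar>" for x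
  proof -
    let ?d = "(x \<bullet> b - mid x) * t"
    have "\<bar>?d\<bar> < (\<bar>x \<bullet> y\<bar> + \<bar>sig x \<bullet> y\<bar>) / 2"
    proof -
      have aux: "\<bar>d\<bar> < (\<bar>c + d\<bar> + \<bar>c - d\<bar>) / 2" if "\<bar>d\<bar> < \<bar>c\<bar>" for c d :: real
        using that by (simp add: abs_if split: if_splits)
      show ?thesis using aux[OF that] unfolding xy[of x] sxy[of x] .
    qed
    hence "\<bar>?d\<bar> powr p < ((\<bar>x \<bullet> y\<bar> + \<bar>sig x \<bullet> y\<bar>) / 2) powr p" using p0 by (intro powr_less_mono2) auto
    also have "\<dots> = \<bar>(1/2) * \<bar>x \<bullet> y\<bar> + (1/2) * \<bar>sig x \<bullet> y\<bar>\<bar> powr p" by (simp add: add_divide_distrib)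
    also have "\<dots> \<le> (1/2) * \<bar>x \<bullet> y\<bar> powr p + (1/2) * \<bar>sig x \<bullet> y\<bar> powr p"
      using convex_abs_powr_ineq[OF p, of "1/2" "1/2" "\<bar>x \<bullet> y\<bar>" "\<bar>sig x \<bullet> y\<bar>"] by simp
    finally have "\<bar>?d\<bar> powr p < (1/2) * \<bar>x \<bullet> y\<bar> powr p + (1/2) * \<bar>sig x \<bullet> y\<bar> powr p" .
    moreover have "(1/2) * (x \<bullet> y) + (1/2) * (- (sig x \<bullet> y)) = ?d" unfolding xy[of x] sxy[of x] by (simp add: field_simps)
    ultimately show ?thesis unfolding D_def by (simp only:)
  qed
  let ?B = "{x \<in> G. \<bar>(x \<bullet> b - mid x) * t\<bar> < \<bar>c x\<bar>}"
  have midG: "continuous_on G mid" using mid_cont G_cyl by (meson continuous_on_subset subsetI)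
  have "?B = {}"
  proof (rule ccontr)
    assume ne: "?B \<noteq> {}"
    have op: "open ?B"
    proof -
      have "continuous_on G (\<lambda>x. \<bar>c x\<bar> - \<bar>(x \<bullet> b - mid x) * t\<bar>)"
        unfolding c_def pr_def by (intro continuous_intros midG)
      hence "open (G \<inter> (\<lambda>x. \<bar>c x\<bar> - \<bar>(x \<bullet> b - mid x) * t\<bar>) -` {0<..})"
        by (rule continuous_open_preimage[OF _ G(1)]) simp
      also have "G \<inter> (\<lambda>x. \<bar>c x\<bar> - \<bar>(x \<bullet> b - mid x) * t\<bar>) -` {0<..} = ?B" by auto
      finally show ?thesis .
    qed
    have "AE x in lborel. x \<notin> ?B" using AE0
    proof eventually_elim
      case (elim x)
      thus ?case using Dpos[of x] by (auto simp: indicator_def)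
    qed
    hence "emeasure lborel ?B = 0" using op by (subst (asm) AE_iff_measurable[of ?B]) auto
    thus False using open_emeasure_neq_0[OF op ne] by simp
  qed
  \<comment> \<open>At the midpoint of a chord d = 0, so emptiness of the open set \<open>?B\<close>
    forces c = 0 there and hence along the chord. All midpoints then lie in the hyperplane
    orthogonal to y, which makes \<open>sig\<close> a linear reflection on \<open>G\<close>.\<close>
  have c0: "c x = 0" if x: "x \<in> G" for x
  proof -
    let ?z = "pr x + mid x *\<^sub>R b"
    have "x \<in> cyl" by (rule G_cyl[OF x])
    hence zG: "?z \<in> G" using mid_mem by (simp add: fib_def)
    have zx: "?z = x + (mid x - x \<bullet> b) *\<^sub>R b" by (simp add: pr_def algebra_simps flip: scaleR_add_left)
    have mz: "mid ?z = mid x" unfolding zx by simp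
    have prz: "pr ?z = pr x" unfolding zx by simp
    have zb: "?z \<bullet> b = mid x" by (simp add: inner_add_left pr_b bb)
    have "?z \<notin> ?B" using \<open>?B = {}\<close> by blast
    hence "\<not> \<bar>(?z \<bullet> b - mid ?z) * t\<bar> < \<bar>c ?z\<bar>" using zG by blast
    hence "c ?z = 0" unfolding mz zb by simp
    thus ?thesis unfolding c_def mz prz .
  qed
  show ?thesis
  proof (rule that[of "(1/t) *\<^sub>R y"])
    show "((1/t) *\<^sub>R y) \<bullet> b = 1" using t by (simp add: t_def)
    fix x assume x: "x \<in> G"
    have "x \<bullet> y = (x \<bullet> b - mid x) * t" using xy[of x] c0[OF x] by simp
    hence "((1/t) *\<^sub>R y) \<bullet> x = x \<bullet> b - mid x" using t by (simp add: inner_commute)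
    hence e: "2 * (((1/t) *\<^sub>R y) \<bullet> x) = - (2 * (mid x - x \<bullet> b))" by simp
    have "x - (2 * (((1/t) *\<^sub>R y) \<bullet> x)) *\<^sub>R b = sig x"
      unfolding e sig_def scaleR_minus_left by simp
    thus "x - (2 * (((1/t) *\<^sub>R y) \<bullet> x)) *\<^sub>R b \<in> G" using sig_mem x by simp
  qed
qed

lemma Qf_stn:
  shows "Qf p dotk G \<le> Qf p dotk stn"
    "Qf p dotk G = Qf p dotk stn \<Longrightarrow> lvol (mom p dotk G) = lvol (mom p dotk stn)"
  unfolding Qf_def stn_measure using lvol_le G_measure_pos by (auto intro: mult_left_mono)

end

section \<open>Existence of a maximizer\<close>

lemma AE_eq_emeasure:
  assumes "K \<in> sets borel" "L \<in> sets borel" "AE x in lborel. x \<in> K \<longleftrightarrow> x \<in> L"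
  shows "emeasure lborel K = emeasure lborel (L :: 'a::euclidean_space set)"
  using assms by (intro emeasure_eq_AE) auto

lemma mom_cong_AE:
  fixes K L :: "'a::euclidean_space set"
  assumes k: "kernel k" and K: "K \<in> sets borel" and L: "L \<in> sets borel" and e: "AE x in lborel. x \<in> K \<longleftrightarrow> x \<in> L"
  shows "mom p k K = mom p k L"
proof
  fix y
  note [measurable] = K L kernel_measurable[OF k]
  show "mom p k K y = mom p k L y"
    unfolding mom_def set_lebesgue_integral_def
  proof (rule integral_cong_AE)
    show "AE x in lborel. indicator K x *\<^sub>R k x y powr p = indicator L x *\<^sub>R k x y powr p"
      using e by eventually_elim (auto simp: indicator_def)
  qed measurable
qed

lemma Qf_cong_AE:
  fixes K L :: "'a::euclidean_space set"
  assumes "kernel k" "K \<in> sets borel" "L \<in> sets borel" "AE x in lborel. x \<in> K \<longleftrightarrow> x \<in> L"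
  shows "Qf p k K = Qf p k L"
  unfolding Qf_def mom_cong_AE[OF assms] using AE_eq_emeasure[OF assms(2-4)] by (simp add: measure_def)

lemma nrm_borel: "nrm h \<Longrightarrow> h \<in> borel_measurable borel"
  by (intro borel_measurable_continuous_onI nrm_cont)

lemma nrm_ball_adm:
  assumes "nrm h" "p > 0" shows "adm p {x. h x \<le> 1}"
  using adm_sublevel[OF nrm_phom[OF assms] assms(2), of 1] nrm_sublevel[OF assms] by simp

lemma nrm_level_null:
  fixes h :: "'a::euclidean_space \<Rightarrow> real"
  assumes "nrm h" shows "AE x in lborel. h x \<noteq> 1"
  using phom_level_null[OF nrm_phom[OF assms, of 1], of 1] nrm_nonneg[OF assms] by simp

lemma nrm_open_ball:
  fixes h :: "'a::euclidean_space \<Rightarrow> real"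
  assumes h: "nrm h" and p: "p \<ge> 1"
  shows "Qf p dotk {x. h x < 1} = Qf p dotk {x. h x \<le> 1}"
proof (rule Qf_cong_AE[OF kernel_dotk])
  note [measurable] = nrm_borel[OF h]
  show "{x. h x < 1} \<in> sets borel" "{x. h x \<le> 1} \<in> sets borel" by measurable
  show "AE x in lborel. x \<in> {x. h x < 1} \<longleftrightarrow> x \<in> {x. h x \<le> 1}"
    using nrm_level_null[OF h] by eventually_elim auto
qed

lemma steiner_nrm:
  fixes h :: "'a::euclidean_space \<Rightarrow> real"
  assumes h: "nrm h" and b: "b \<in> Basis" and p: "p \<ge> 1"
  shows "steiner {x. h x < 1} b p"
proof
  show "open {x. h x < 1}" by (intro open_Collect_less nrm_cont[OF h] continuous_intros)
  show "convex {x. h x < 1}"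
    unfolding convex_alt
  proof (clarsimp)
    fix x y :: 'a and t :: real assume a: "h x < 1" "h y < 1" "0 \<le> t" "t \<le> 1"
    have "h ((1 - t) *\<^sub>R x + t *\<^sub>R y) \<le> (1 - t) * h x + t * h y"
      using nrm_add[OF h, of "(1 - t) *\<^sub>R x" "t *\<^sub>R y"] a by (simp add: nrm_scale[OF h])
    also have "\<dots> < 1"
      using a convex_bound_lt[of "h x" 1 "h y" "1 - t" t] by simp
    finally show "h ((1 - t) *\<^sub>R x + t *\<^sub>R y) < 1" .
  qed
  have "bounded {x. h x powr 1 \<le> 1}"
    by (rule compact_imp_bounded[OF phom_sublevel_compact[OF nrm_phom[OF h, of 1]]]) simp_all
  thus "bounded {x. h x < 1}" by (rule bounded_subset) (auto simp: nrm_nonneg[OF h])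
  show "{x. h x < 1} \<noteq> {}" using nrm_zero[OF h] by (auto intro!: exI[of _ 0])
  show "- x \<in> {x. h x < 1}" if "x \<in> {x. h x < 1}" for x using that by (simp add: nrm_uminus[OF h])
qed (use assms in auto)

lemma polar_nrm:
  fixes K :: "'a::euclidean_space set"
  assumes p: "p \<ge> 1" and K: "adm p K"
  defines "h \<equiv> \<lambda>x. mom p dotk K x powr (1/p)"
  shows "nrm h" "{x. h x \<le> 1} = {x. mom p dotk K x \<le> 1}" "Qf p dotk K \<le> Qf p dotk {x. h x \<le> 1}"
proof -
  note N = mom_phom_convex[OF kernel_dotk p K]
  show h: "nrm h" unfolding h_def by (rule phom_root_nrm[OF N(1) p N(2)])
  have p0: "p > 0" using p by simp
  have "h x powr p = mom p dotk K x" for x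
    using p phom_nonneg[OF N(1), of x] by (simp add: h_def powr_powr)
  thus 2: "{x. h x \<le> 1} = {x. mom p dotk K x \<le> 1}" using nrm_sublevel[OF h p0] by simp
  show "Qf p dotk K \<le> Qf p dotk {x. h x \<le> 1}" unfolding 2 by (rule Qf_polar(1)[OF kernel_dotk p K])
qed

text \<open>The induction works with unit balls of norms. After each symmetrization it passes to the
  sublevel set of the moment, which is again such a ball and inherits the reflections collected so
  far.\<close>

lemma unconditional_steps:
  fixes K :: "'a::euclidean_space set"
  assumes p: "p \<ge> 1" and K: "adm p K" and B: "finite B" "B \<subseteq> Basis"
  shows "\<exists>h :: 'a \<Rightarrow> real. nrm h \<and> Qf p dotk K \<le> Qf p dotk {x. h x \<le> 1} \<and> (\<forall>c\<in>B. \<forall>x. h (reflect c x) = h x)"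
  using B
proof (induction B rule: finite_induct)
  case empty
  show ?case using polar_nrm(1,3)[OF p K]
    by (intro exI[of _ "\<lambda>x. mom p dotk K x powr (1/p)"]) simp
next
  case (insert b B)
  then obtain h where h: "nrm h" "Qf p dotk K \<le> Qf p dotk {x. h x \<le> 1}" "\<And>c x. c \<in> B \<Longrightarrow> h (reflect c x) = h x"
    by auto
  have b: "b \<in> Basis" using insert by auto
  interpret S: steiner "{x. h x < 1}" b p by (rule steiner_nrm[OF h(1) b p])
  let ?h = "\<lambda>x. mom p dotk S.stn x powr (1/p)"
  have "Qf p dotk K \<le> Qf p dotk {x. h x < 1}" using h(2) nrm_open_ball[OF h(1) p] by simp
  also have "\<dots> \<le> Qf p dotk S.stn" by (rule S.Qf_stn(1))
  also have "\<dots> \<le> Qf p dotk {x. ?h x \<le> 1}" by (rule polar_nrm(3)[OF p S.stn_adm])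
  finally have "Qf p dotk K \<le> Qf p dotk {x. ?h x \<le> 1}" .
  moreover have "?h (reflect c x) = ?h x" if "c \<in> insert b B" for c x
  proof (cases "c = b")
    case False
    hence c: "c \<in> B" "c \<in> Basis" using that insert by auto
    show ?thesis using S.mom_stn_refl[OF c(2) False] h(3)[OF c(1)] by simp
  qed (simp add: S.mom_stn_refl_b)
  ultimately show ?case using polar_nrm(1)[OF p S.stn_adm] by blast
qed

section \<open>Linear maps and normalisation\<close>

lemma adm_vimage:
  fixes T :: "'a::euclidean_space \<Rightarrow> 'a"
  assumes T: "linear T" "inj T" and K: "adm p K" and p: "p > 0"
  shows "adm p (T -` K)"
proof -
  note [measurable] = adm_borel[OF K] linear_borel[OF T(1)]
  have b: "T -` K \<in> sets borel" using measurable_sets[OF linear_borel[OF T(1)] adm_borel[OF K]] by simp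
  have em: "emeasure lborel (T -` K) = ennreal (lscale T) * emeasure lborel K"
    by (rule linear_vimage_emeasure[OF T adm_borel[OF K]])
  obtain c where c: "c > 0" "\<And>x. norm x \<le> c * norm (T x)" using inj_linear_lower_bound[OF T] by blast
  have i: "integrable lborel (\<lambda>x. c powr p * (indicator K (T x) *\<^sub>R norm (T x) powr p))"
    using linear_integrable[OF T, of "\<lambda>x. indicator K x *\<^sub>R norm x powr p"] K
    by (intro integrable_mult_right) (simp add: adm_def set_integrable_def)
  have le: "norm x powr p \<le> c powr p * norm (T x) powr p" for x
    using powr_mono2[of p "norm x" "c * norm (T x)"] c(2)[of x] c(1) p by (simp add: powr_mult)
  have "integrable lborel (\<lambda>x. indicator K (T x) *\<^sub>R norm x powr p)"
  proof (rule Bochner_Integration.integrable_bound[OF i])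
    show "AE x in lborel. norm (indicator K (T x) *\<^sub>R norm x powr p) \<le> norm (c powr p * (indicator K (T x) *\<^sub>R norm (T x) powr p))"
    proof (rule AE_I2)
      fix x
      show "norm (indicator K (T x) *\<^sub>R norm x powr p) \<le> norm (c powr p * (indicator K (T x) *\<^sub>R norm (T x) powr p))"
        using le[of x] by (cases "T x \<in> K") (simp_all add: abs_mult)
    qed
  qed measurable
  hence "set_integrable lborel (T -` K) (\<lambda>x. norm x powr p)" by (simp add: set_integrable_def indicator_def)
  thus ?thesis using K b em lscale_props(1)[OF T] by (auto simp: adm_def ennreal_mult_eq_top_iff)
qed

lemma lscale_inverse:
  fixes T S :: "'a::euclidean_space \<Rightarrow> 'a"
  assumes T: "linear T" "inj T" and S: "linear S" "inj S" and ST: "\<And>x. S (T x) = x"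
  shows "lscale T * lscale S = 1"
proof -
  let ?B = "cball 0 1 :: 'a set"
  have b: "S -` ?B \<in> sets borel" using measurable_sets[OF linear_borel[OF S(1)], of ?B] by simp
  have "measure lborel (T -` (S -` ?B)) = lscale T * (lscale S * measure lborel ?B)"
    using linear_vimage_emeasure(2)[OF T b] linear_vimage_emeasure(2)[OF S, of ?B] by simp
  moreover have "T -` (S -` ?B) = ?B" using ST by auto
  ultimately have "lscale T * lscale S * measure lborel ?B = 1 * measure lborel ?B" by simp
  thus ?thesis using emeasure_cball01_pos(2)[where 'a='a] by (simp only: mult_cancel_right) auto
qed

lemma Qf_vimage:
  fixes T S :: "'a::euclidean_space \<Rightarrow> 'a"
  assumes T: "linear T" "inj T" and S: "linear S" "\<And>x. S (T x) = x"
    and A: "linear A" "inj A" "\<And>x y. S x \<bullet> y = x \<bullet> A y" and K: "adm p K" and p: "p \<ge> 1"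
  shows "Qf p dotk (T -` K) = lscale T * lscale A * Qf p dotk K"
proof -
  let ?n = "real DIM('a)"
  have p0: "p > 0" using p by simp
  note [measurable] = adm_borel[OF K]
  note N = mom_phom_convex(1)[OF kernel_dotk p K]
  have l0: "lscale T > 0" by (rule lscale_props(1)[OF T])
  have mom: "mom p dotk (T -` K) y = lscale T * mom p dotk K (A y)" for y
  proof -
    have "mom p dotk (T -` K) y = (\<integral>x. indicator K (T x) *\<^sub>R \<bar>T x \<bullet> A y\<bar> powr p \<partial>lborel)"
      by (simp add: mom_def set_lebesgue_integral_def indicator_def dotk_def A(3)[symmetric] S(2))
    also have "\<dots> = lscale T * (\<integral>x. indicator K x *\<^sub>R \<bar>x \<bullet> A y\<bar> powr p \<partial>lborel)"
      by (rule linear_integral[OF T, of "\<lambda>x. indicator K x *\<^sub>R \<bar>x \<bullet> A y\<bar> powr p"]) measurable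
    finally show ?thesis by (simp add: mom_def set_lebesgue_integral_def dotk_def)
  qed
  have "{y. mom p dotk (T -` K) y \<le> 1} = A -` {y. mom p dotk K y \<le> 1 / lscale T}"
    using l0 by (auto simp: mom field_simps)
  hence "lvol (mom p dotk (T -` K)) = lscale A * ((1 / lscale T) powr (?n/p) * lvol (mom p dotk K))"
    using linear_vimage_emeasure(2)[OF A(1,2) phom_sublevel_borel[OF N]] phom_sublevel_measure[OF N p0, of "1 / lscale T"] l0
    by (simp add: lvol_def)
  moreover have "measure lborel (T -` K) = lscale T * measure lborel K"
    by (rule linear_vimage_emeasure(2)[OF T adm_borel[OF K]])
  moreover have "lscale T powr (1 + ?n/p) * (1 / lscale T) powr (?n/p) = lscale T"
    using l0 by (simp add: powr_add powr_divide)
  ultimately show ?thesis unfolding Qf_def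
    by (simp add: powr_mult mult_ac)
qed

lemma adjoint_inverse:
  fixes T S :: "'a::euclidean_space \<Rightarrow> 'a"
  assumes T: "linear T" and S: "linear S" and ST: "\<And>x. S (T x) = x"
  shows "adjoint T (adjoint S x) = x"
proof -
  have "adjoint T (adjoint S x) \<bullet> y = x \<bullet> y" for y
    using adjoint_works[OF T, of y "adjoint S x"] adjoint_works[OF S, of "T y" x] ST by (simp add: inner_commute)
  thus ?thesis using vector_eq_rdot by blast
qed

lemma nrm_comp:
  fixes T :: "'a::euclidean_space \<Rightarrow> 'a"
  assumes "nrm h" "linear T" "inj T" shows "nrm (\<lambda>x. h (T x))"
  using assms linear_injective_0[OF assms(2)]
  by (auto simp: nrm_def linear_add linear_cmul)

text \<open>Norms whose unit ball lies between the cross-polytope and the cube. These bounds keep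
  volumes and moments away from 0 and infinity and pass to pointwise limits.\<close>

definition nclass :: "('a::euclidean_space \<Rightarrow> real) \<Rightarrow> bool" where
  "nclass h \<longleftrightarrow> nrm h \<and> (\<forall>x. h x \<le> (\<Sum>b\<in>Basis. \<bar>x \<bullet> b\<bar>)) \<and> (\<forall>x. \<forall>b\<in>Basis. \<bar>x \<bullet> b\<bar> \<le> h x)"

text \<open>Rescaling the axes gives every basis vector norm 1. The triangle inequality yields the
  upper bound; the lower one holds because twice the component along b is x minus its reflection.
  The rescaling is self-adjoint, so here the volume factors of the map and its inverse cancel
  directly.\<close>

lemma normalize_unconditional:
  fixes h :: "'a::euclidean_space \<Rightarrow> real"
  assumes h: "nrm h" and u: "\<And>c x. c \<in> Basis \<Longrightarrow> h (reflect c x) = h x" and p: "p \<ge> 1"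
  shows "\<exists>h' :: 'a \<Rightarrow> real. nclass h' \<and> Qf p dotk {x. h' x \<le> 1} = Qf p dotk {x. h x \<le> 1}"
proof -
  have p0: "p > 0" using p by simp
  define D where "D x = (\<Sum>b\<in>Basis. ((x \<bullet> b) / h b) *\<^sub>R b)" for x :: 'a
  define S where "S x = (\<Sum>b\<in>Basis. ((x \<bullet> b) * h b) *\<^sub>R b)" for x :: 'a
  have hb: "h b > 0" if "b \<in> Basis" for b using nrm_pos[OF h, of b] that nonzero_Basis by blast
  have Db: "D x \<bullet> b = (x \<bullet> b) / h b" "S x \<bullet> b = (x \<bullet> b) * h b" if "b \<in> Basis" for x b
    using that by (simp_all add: D_def S_def)
  have SD: "S (D x) = x" "D (S x) = x" for x
  proof -
    have "S (D x) \<bullet> b = x \<bullet> b" "D (S x) \<bullet> b = x \<bullet> b" if "b \<in> Basis" for b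
      using hb[OF that] by (simp_all add: Db[OF that])
    thus "S (D x) = x" "D (S x) = x" by (auto intro: euclidean_eqI)
  qed
  have lin: "linear D" "linear S"
    unfolding D_def S_def
    by (auto intro!: linearI simp: inner_add_left add_divide_distrib distrib_right scaleR_add_left sum.distrib
        scaleR_sum_right mult.assoc)
  have inj: "inj D" "inj S" using SD by (metis injI)+
  have adj: "S x \<bullet> y = x \<bullet> S y" for x y
    by (subst (1 2) euclidean_inner) (simp add: Db mult_ac)
  let ?h = "\<lambda>x. h (D x)"
  have n: "nrm ?h" by (rule nrm_comp[OF h lin(1) inj(1)])
  have "{x. ?h x \<le> 1} = D -` {x. h x \<le> 1}" by auto
  hence "Qf p dotk {x. ?h x \<le> 1} = lscale D * lscale S * Qf p dotk {x. h x \<le> 1}"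
    using Qf_vimage[OF lin(1) inj(1) lin(2) SD(1) lin(2) inj(2) adj nrm_ball_adm[OF h p0] p] by simp
  also have "lscale D * lscale S = 1" by (rule lscale_inverse[OF lin(1) inj(1) lin(2) inj(2) SD(1)])
  finally have Q: "Qf p dotk {x. ?h x \<le> 1} = Qf p dotk {x. h x \<le> 1}" by simp
  have sum_le: "h (\<Sum>b\<in>B. f b) \<le> (\<Sum>b\<in>B. h (f b))" if "finite B" for B :: "'a set" and f
    using that
  proof (induction B rule: finite_induct)
    case (insert b B)
    thus ?case using nrm_add[OF h, of "f b" "sum f B"] by simp
  qed (simp add: nrm_zero[OF h])
  have "?h x \<le> (\<Sum>b\<in>Basis. \<bar>x \<bullet> b\<bar>)" for x
  proof -
    have "?h x \<le> (\<Sum>b\<in>Basis. h (((x \<bullet> b) / h b) *\<^sub>R b))" unfolding D_def by (rule sum_le) simp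
    also have "\<dots> = (\<Sum>b\<in>Basis. \<bar>x \<bullet> b\<bar>)"
    proof (rule sum.cong)
      fix b :: 'a assume "b \<in> Basis"
      thus "h (((x \<bullet> b) / h b) *\<^sub>R b) = \<bar>x \<bullet> b\<bar>" using hb[of b] by (simp add: nrm_scale[OF h])
    qed simp
    finally show ?thesis .
  qed
  moreover have "\<bar>x \<bullet> b\<bar> \<le> ?h x" if b: "b \<in> Basis" for x b
  proof -
    have "(2 * (D x \<bullet> b)) *\<^sub>R b = D x + (- reflect b (D x))" by (simp add: reflect_def)
    hence "h ((2 * (D x \<bullet> b)) *\<^sub>R b) \<le> h (D x) + h (- reflect b (D x))" using nrm_add[OF h] by metis
    hence "\<bar>2 * (D x \<bullet> b)\<bar> * h b \<le> 2 * h (D x)"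
      by (simp add: nrm_scale[OF h] nrm_uminus[OF h] u[OF b])
    thus ?thesis using hb[OF b] by (simp add: Db[OF b] abs_mult)
  qed
  ultimately show ?thesis using n Q by (auto simp: nclass_def)
qed

lemma Qf_le_nclass:
  fixes K :: "'a::euclidean_space set"
  assumes p: "p \<ge> 1" and K: "adm p K"
  shows "\<exists>h :: 'a \<Rightarrow> real. nclass h \<and> Qf p dotk K \<le> Qf p dotk {x. h x \<le> 1}"
  using unconditional_steps[OF p K finite_Basis subset_refl] normalize_unconditional[OF _ _ p] by metis

section \<open>Compactness and continuity of the functional\<close>

text \<open>Off the null set \<open>N0 = 1\<close>, the condition \<open>N k x <= 1\<close> is
  eventually the limiting one, and the fixed set \<open>W\<close> provides the dominating
  function.\<close>

lemma sublevel_integral_tendsto: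
  fixes N :: "nat \<Rightarrow> 'a::euclidean_space \<Rightarrow> real" and N0 f :: "'a \<Rightarrow> real"
  assumes [measurable]: "\<And>k. N k \<in> borel_measurable borel" "N0 \<in> borel_measurable borel" "f \<in> borel_measurable borel" "W \<in> sets borel"
    and lim: "\<And>x. (\<lambda>k. N k x) \<longlonglongrightarrow> N0 x" and ne: "AE x in lborel. N0 x \<noteq> 1"
    and sub: "\<And>k. {x. N k x \<le> 1} \<subseteq> W" and int: "set_integrable lborel W f"
  shows "(\<lambda>k. LINT x:{x. N k x \<le> 1}|lborel. f x) \<longlonglongrightarrow> (LINT x:{x. N0 x \<le> 1}|lborel. f x)"
  unfolding set_lebesgue_integral_def
proof (rule integral_dominated_convergence[where w="\<lambda>x. norm (indicator W x *\<^sub>R f x)"])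
  show "integrable lborel (\<lambda>x. norm (indicator W x *\<^sub>R f x))" using int by (simp add: set_integrable_def)
  show "AE x in lborel. (\<lambda>k. indicator {x. N k x \<le> 1} x *\<^sub>R f x) \<longlonglongrightarrow> indicator {x. N0 x \<le> 1} x *\<^sub>R f x"
    using ne
  proof eventually_elim
    case (elim x)
    have "\<forall>\<^sub>F k in sequentially. (N k x \<le> 1) = (N0 x \<le> 1)"
    proof (cases "N0 x < 1")
      case True
      from order_tendstoD(2)[OF lim True] show ?thesis by eventually_elim (use True in auto)
    next
      case False
      hence "1 < N0 x" using elim by simp
      from order_tendstoD(1)[OF lim this] show ?thesis by eventually_elim (use \<open>1 < N0 x\<close> in auto)
    qed
    hence "\<forall>\<^sub>F k in sequentially. indicator {x. N k x \<le> 1} x *\<^sub>R f x = indicator {x. N0 x \<le> 1} x *\<^sub>R f x"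
      by eventually_elim (simp add: indicator_def)
    thus ?case by (rule tendsto_eventually)
  qed
  show "AE x in lborel. norm (indicator {x. N k x \<le> 1} x *\<^sub>R f x) \<le> norm (indicator W x *\<^sub>R f x)" for k
    using sub[of k] by (intro AE_I2) (auto simp: indicator_def)
qed measurable

lemma L1_nrm: "nrm (\<lambda>x::'a::euclidean_space. \<Sum>b\<in>Basis. \<bar>x \<bullet> b\<bar>)"
  unfolding nrm_def
proof (intro conjI allI impI)
  fix x y :: 'a
  show "(\<Sum>b\<in>Basis. \<bar>(x + y) \<bullet> b\<bar>) \<le> (\<Sum>b\<in>Basis. \<bar>x \<bullet> b\<bar>) + (\<Sum>b\<in>Basis. \<bar>y \<bullet> b\<bar>)"
    by (simp add: inner_add_left abs_triangle_ineq sum_mono flip: sum.distrib)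
next
  fix x :: 'a assume "x \<noteq> 0"
  then obtain b where "b \<in> Basis" "x \<bullet> b \<noteq> 0" using euclidean_all_zero_iff by blast
  thus "(\<Sum>b\<in>Basis. \<bar>x \<bullet> b\<bar>) > 0" by (intro sum_pos2[of _ b]) auto
qed (simp add: abs_mult sum_distrib_left)

lemma mom_mono:
  fixes K L :: "'a::euclidean_space set"
  assumes "kernel k" "p > 0" "adm p K" "adm p L" "K \<subseteq> L" shows "mom p k K y \<le> mom p k L y"
  unfolding mom_def set_lebesgue_integral_def
  using mom_integrable[OF assms(1,2,3)] mom_integrable[OF assms(1,2,4)] assms(5)
  by (intro integral_mono) (auto simp: set_integrable_def indicator_def)

lemma lvol_antimono:
  fixes N M :: "'a::euclidean_space \<Rightarrow> real"
  assumes "phom p N" "phom p M" "p > 0" "\<And>x. N x \<le> M x" shows "lvol M \<le> lvol N"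
  unfolding lvol_def
proof (rule measure_mono_fmeasurable)
  show "{x. M x \<le> 1} \<subseteq> {x. N x \<le> 1}" using assms(4) order_trans by blast
  show "{x. M x \<le> 1} \<in> sets lborel" using phom_sublevel_borel[OF assms(2)] by simp
  show "{x. N x \<le> 1} \<in> fmeasurable lborel"
    using phom_sublevel_emeasure[OF assms(1,3), of 1] phom_sublevel_borel[OF assms(1)] by (auto simp: fmeasurable_def)
qed

definition cross :: "'a::euclidean_space set" where "cross = {x. (\<Sum>b\<in>Basis. \<bar>x \<bullet> b\<bar>) \<le> 1}"
definition cube :: "'a::euclidean_space set" where "cube = {x. \<forall>b\<in>Basis. \<bar>x \<bullet> b\<bar> \<le> 1}"

lemma cube_bounded: "bounded (cube :: 'a::euclidean_space set)" "cube \<in> sets (borel :: 'a measure)"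
proof -
  have e: "cube = cbox (- One) (One :: 'a)" by (auto simp: cube_def cbox_def abs_le_iff)
  show "bounded (cube :: 'a set)" "cube \<in> sets (borel :: 'a measure)" unfolding e by auto
qed

lemma cube_fmeasurable: "(cube :: 'a::euclidean_space set) \<in> fmeasurable lborel"
  using cube_bounded[where 'a='a] emeasure_bounded_finite[OF cube_bounded(1)[where 'a='a]]
  by (simp add: fmeasurable_def)

lemma nclass_ball:
  assumes "nclass h" shows "cross \<subseteq> {x. h x \<le> 1}" "{x. h x \<le> 1} \<subseteq> cube"
  using assms by (auto simp: nclass_def cross_def cube_def intro: order_trans)

text \<open>The cube bounds the volume from above. The cross-polytope bounds the moment from below,
  hence the volume of its sublevel set from above.\<close>

lemma Qf_nclass_bdd:
  assumes p: "p \<ge> 1"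
  shows "\<exists>C. \<forall>h :: 'a::euclidean_space \<Rightarrow> real. nclass h \<longrightarrow> Qf p dotk {x. h x \<le> 1} \<le> C"
proof (intro exI allI impI)
  fix h :: "'a \<Rightarrow> real" assume h: "nclass h"
  have p0: "p > 0" using p by simp
  have nh: "nrm h" using h by (simp add: nclass_def)
  have ac: "adm p (cross :: 'a set)" unfolding cross_def by (rule nrm_ball_adm[OF L1_nrm p0])
  have ah: "adm p {x. h x \<le> 1}" by (rule nrm_ball_adm[OF nh p0])
  have "measure lborel {x. h x \<le> 1} \<le> measure lborel (cube :: 'a set)"
    using nclass_ball(2)[OF h] adm_borel[OF ah] by (intro measure_mono_fmeasurable cube_fmeasurable) auto
  moreover have "lvol (mom p dotk {x. h x \<le> 1}) \<le> lvol (mom p dotk (cross :: 'a set))"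
    using nclass_ball(1)[OF h]
    by (intro lvol_antimono[of p] mom_phom_convex(1) kernel_dotk p ac ah mom_mono p0)
  ultimately show "Qf p dotk {x. h x \<le> 1} \<le> measure lborel (cube :: 'a set) powr (1 + real DIM('a)/p) * lvol (mom p dotk (cross :: 'a set))"
    unfolding Qf_def using p0 by (intro mult_mono powr_mono2) (auto simp: lvol_def)
qed

lemma Qf_nclass_tendsto:
  fixes h :: "nat \<Rightarrow> 'a::euclidean_space \<Rightarrow> real"
  assumes p: "p \<ge> 1" and h: "\<And>k. nclass (h k)" and h0: "nclass h0" and lim: "\<And>x. (\<lambda>k. h k x) \<longlonglongrightarrow> h0 x"
  shows "(\<lambda>k. Qf p dotk {x. h k x \<le> 1}) \<longlonglongrightarrow> Qf p dotk {x. h0 x \<le> 1}"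
proof -
  have p0: "p > 0" using p by simp
  have nh: "nrm (h k)" "nrm h0" for k using h h0 by (auto simp: nclass_def)
  note [measurable] = nrm_borel[OF nh(1)] nrm_borel[OF nh(2)]
  have a: "adm p {x. h k x \<le> 1}" "adm p {x. h0 x \<le> 1}" "adm p (cross :: 'a set)" for k
    unfolding cross_def by (intro nrm_ball_adm nh p0 L1_nrm)+
  have acube: "adm p (cube :: 'a set)"
  proof (rule adm_bounded[OF cube_bounded(2,1) _ p0])
    have "measure lborel {x. h0 x \<le> 1} \<le> measure lborel (cube :: 'a set)"
      using nclass_ball(2)[OF h0] adm_borel[OF a(2)] by (intro measure_mono_fmeasurable cube_fmeasurable) auto
    thus "measure lborel (cube :: 'a set) > 0" using adm_measure_pos[OF a(2)] by simp
  qed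
  have st: "(\<lambda>k. LINT x:{x. h k x \<le> 1}|lborel. f x) \<longlonglongrightarrow> (LINT x:{x. h0 x \<le> 1}|lborel. f x)"
    if [measurable]: "f \<in> borel_measurable borel" and "set_integrable lborel cube f" for f :: "'a \<Rightarrow> real"
    by (rule sublevel_integral_tendsto[where W=cube])
       (use lim nrm_level_null[OF nh(2)] nclass_ball(2)[OF h] that cube_bounded in auto)
  have one: "measure lborel K = (LINT x:K|lborel. 1)" if "K \<in> sets borel" for K :: "'a set"
    using that by (simp add: set_lebesgue_integral_def)
  have int1: "set_integrable lborel (cube :: 'a set) (\<lambda>_. 1 :: real)"
    using cube_fmeasurable[where 'a='a] by (simp add: set_integrable_def integrable_indicator_iff fmeasurable_def)
  have m: "(\<lambda>k. measure lborel {x. h k x \<le> 1}) \<longlonglongrightarrow> measure lborel {x. h0 x \<le> 1}"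
    using st[OF _ int1] unfolding one[OF adm_borel[OF a(1)]] one[OF adm_borel[OF a(2)]] by simp
  have mm: "(\<lambda>k. mom p dotk {x. h k x \<le> 1} y) \<longlonglongrightarrow> mom p dotk {x. h0 x \<le> 1} y" for y
  proof -
    note [measurable] = kernel_measurable[OF kernel_dotk]
    show ?thesis unfolding mom_def by (rule st[OF _ mom_integrable[OF kernel_dotk p0 acube]]) measurable
  qed
  note ph = mom_phom_convex(1)[OF kernel_dotk p]
  have W: "{y :: 'a. mom p dotk cross y \<le> 1} \<in> sets borel" by (rule phom_sublevel_borel[OF ph[OF a(3)]])
  have intW: "set_integrable lborel {y :: 'a. mom p dotk cross y \<le> 1} (\<lambda>_. 1 :: real)"
    using W phom_sublevel_emeasure[OF ph[OF a(3)] p0, of 1] by (simp add: set_integrable_def integrable_indicator_iff)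
  have "(\<lambda>k. LINT y:{y. mom p dotk {x. h k x \<le> 1} y \<le> 1}|lborel. 1) \<longlonglongrightarrow> (LINT y:{y. mom p dotk {x. h0 x \<le> 1} y \<le> 1}|lborel. (1::real))"
  proof (rule sublevel_integral_tendsto[OF _ _ _ W mm _ _ intW])
    show "{y. mom p dotk {x. h k x \<le> 1} y \<le> 1} \<subseteq> {y. mom p dotk cross y \<le> 1}" for k
      using mom_mono[OF kernel_dotk p0 a(3) a(1) nclass_ball(1)[OF h]] order_trans by blast
    show "AE y in lborel. mom p dotk {x. h0 x \<le> 1} y \<noteq> 1" by (rule phom_level_null[OF ph[OF a(2)] p0]) simp
  qed (use phom_borel[OF ph[OF a(1)]] phom_borel[OF ph[OF a(2)]] in auto)
  hence "(\<lambda>k. lvol (mom p dotk {x. h k x \<le> 1})) \<longlonglongrightarrow> lvol (mom p dotk {x. h0 x \<le> 1})"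
    unfolding lvol_def using one[OF phom_sublevel_borel[OF ph[OF a(1)]]] one[OF phom_sublevel_borel[OF ph[OF a(2)]]] by simp
  thus ?thesis unfolding Qf_def using m adm_measure_pos[OF a(2)]
    by (intro tendsto_mult tendsto_powr tendsto_const) auto
qed

text \<open>The Lipschitz constant is common to the whole class, which is the equicontinuity needed
  for the Arzela-Ascoli theorem.\<close>

lemma nclass_Lipschitz:
  fixes h :: "'a::euclidean_space \<Rightarrow> real"
  assumes "nclass h" shows "\<bar>h x - h y\<bar> \<le> real DIM('a) * norm (x - y)"
proof -
  have n: "nrm h" using assms by (simp add: nclass_def)
  have le: "h z \<le> real DIM('a) * norm z" for z
  proof -
    have "h z \<le> (\<Sum>b\<in>Basis. \<bar>z \<bullet> b\<bar>)" using assms by (simp add: nclass_def)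
    also have "\<dots> \<le> (\<Sum>b\<in>(Basis :: 'a set). norm z)" by (intro sum_mono Basis_le_norm)
    finally show ?thesis by simp
  qed
  have "h x \<le> h y + h (x - y)" "h y \<le> h x + h (x - y)"
    using nrm_add[OF n, of y "x - y"] nrm_add[OF n, of x "- (x - y)"] nrm_uminus[OF n, of "x - y"] by auto
  thus ?thesis using le[of "x - y"] by linarith
qed

lemma nclass_maximizer:
  assumes p: "p \<ge> 1"
  shows "\<exists>h0 :: 'a::euclidean_space \<Rightarrow> real. nclass h0 \<and> (\<forall>h :: 'a \<Rightarrow> real. nclass h \<longrightarrow> Qf p dotk {x. h x \<le> 1} \<le> Qf p dotk {x. h0 x \<le> 1})"
proof -
  let ?n = "real DIM('a)"
  define V where "V = (\<lambda>h :: 'a \<Rightarrow> real. Qf p dotk {x. h x \<le> 1}) ` {h. nclass h}"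
  have "nclass (\<lambda>x::'a. \<Sum>b\<in>Basis. \<bar>x \<bullet> b\<bar>)"
    using L1_nrm by (auto simp: nclass_def intro: member_le_sum)
  hence Vne: "V \<noteq> {}" by (auto simp: V_def)
  have Vbdd: "bdd_above V" using Qf_nclass_bdd[OF p, where 'a='a] by (auto simp: V_def bdd_above_def)
  have "\<exists>h. nclass h \<and> Sup V - 1 / real (Suc k) < Qf p dotk {x :: 'a. h x \<le> 1}" for k
    using less_cSup_iff[OF Vne Vbdd, of "Sup V - 1 / real (Suc k)"] by (auto simp: V_def)
  then obtain h where h: "\<And>k. nclass (h k)" "\<And>k. Sup V - 1 / real (Suc k) < Qf p dotk {x :: 'a. h k x \<le> 1}"
    by metis
  have hn: "nrm (h k)" for k using h(1) by (simp add: nclass_def)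
  have le: "norm (h k x) \<le> ?n" if "x \<in> cball 0 1" for k x
  proof -
    have "\<bar>h k x - h k 0\<bar> \<le> ?n * norm (x - 0)" by (rule nclass_Lipschitz[OF h(1)])
    also have "\<dots> \<le> ?n * 1" using that by (intro mult_left_mono) auto
    finally show ?thesis by (simp add: nrm_zero[OF hn])
  qed
  have eq: "\<exists>d>0. \<forall>k y. y \<in> cball 0 1 \<and> norm (x - y) < d \<longrightarrow> norm (h k x - h k y) < e" if e: "0 < e" for x e
  proof (intro exI[of _ "e / ?n"] conjI allI impI)
    fix k y assume a: "y \<in> cball 0 1 \<and> norm (x - y) < e / ?n"
    have "\<bar>h k x - h k y\<bar> \<le> ?n * norm (x - y)" by (rule nclass_Lipschitz[OF h(1)])
    also have "\<dots> < ?n * (e / ?n)" using a by (intro mult_strict_left_mono) auto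
    finally show "norm (h k x - h k y) < e" by simp
  qed (use e in simp)
  obtain g r where gr: "strict_mono (r :: nat \<Rightarrow> nat)"
    "\<And>e. 0 < e \<Longrightarrow> \<exists>N. \<forall>n x. n \<ge> N \<and> x \<in> cball 0 1 \<longrightarrow> norm (h (r n) x - g x) < e"
    using Arzela_Ascoli[of "cball 0 1" h, OF compact_cball le eq] by metis
  have l1: "(\<lambda>k. h (r k) x) \<longlonglongrightarrow> g x" if "x \<in> cball 0 1" for x
    using gr(2) that unfolding LIMSEQ_iff by blast
  \<comment> \<open>The uniform limit is available on the unit ball only; elsewhere it is extended
    by homogeneity.\<close>
  define h0 where "h0 x = norm x * g (sgn x)" for x
  have lim: "(\<lambda>k. h (r k) x) \<longlonglongrightarrow> h0 x" for x
  proof -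
    have "h k x = norm x * h k (sgn x)" for k
      using nrm_scale[OF hn[of k], of "norm x" "sgn x"] by (cases "x = 0") (auto simp: sgn_div_norm nrm_zero[OF hn])
    moreover have "(\<lambda>k. norm x * h (r k) (sgn x)) \<longlonglongrightarrow> norm x * g (sgn x)"
      by (intro tendsto_mult tendsto_const l1) (simp add: norm_sgn)
    ultimately show ?thesis by (simp add: h0_def)
  qed
  have b1: "h0 x \<le> (\<Sum>b\<in>Basis. \<bar>x \<bullet> b\<bar>)" for x
    by (rule LIMSEQ_le_const2[OF lim]) (use h(1) in \<open>auto simp: nclass_def\<close>)
  have b2: "\<bar>x \<bullet> b\<bar> \<le> h0 x" if "b \<in> Basis" for x b
    by (rule LIMSEQ_le_const[OF lim]) (use h(1) that in \<open>auto simp: nclass_def\<close>)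
  have "nrm h0" unfolding nrm_def
  proof (intro conjI allI impI)
    fix x y
    show "h0 (x + y) \<le> h0 x + h0 y"
      by (rule LIMSEQ_le[OF lim tendsto_add[OF lim lim]]) (use nrm_add[OF hn] in auto)
    show "h0 (c *\<^sub>R x) = \<bar>c\<bar> * h0 x" for c
      by (rule LIMSEQ_unique[OF lim]) (simp add: nrm_scale[OF hn] tendsto_mult[OF tendsto_const lim])
  next
    fix x :: 'a assume "x \<noteq> 0"
    then obtain b where "b \<in> Basis" "x \<bullet> b \<noteq> 0" using euclidean_all_zero_iff by blast
    thus "h0 x > 0" using b2[of b x] by linarith
  qed
  hence n0: "nclass h0" using b1 b2 by (simp add: nclass_def)
  have "(\<lambda>k. Qf p dotk {x. h (r k) x \<le> 1}) \<longlonglongrightarrow> Qf p dotk {x. h0 x \<le> 1}"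
    by (rule Qf_nclass_tendsto[OF p h(1) n0 lim])
  moreover have "(\<lambda>k. Sup V - 1 / real (Suc k)) \<longlonglongrightarrow> Sup V - 0"
    by (intro tendsto_diff tendsto_const LIMSEQ_Suc lim_inverse_n'[unfolded inverse_eq_divide])
  hence "(\<lambda>k. Sup V - 1 / real (Suc (r k))) \<longlonglongrightarrow> Sup V - 0"
    using LIMSEQ_subseq_LIMSEQ[OF _ gr(1)] by (fastforce simp: comp_def)
  ultimately have "Sup V - 0 \<le> Qf p dotk {x. h0 x \<le> 1}"
    using h(2) less_imp_le by (intro LIMSEQ_le[of "\<lambda>k. Sup V - 1 / real (Suc (r k))" _ "\<lambda>k. Qf p dotk {x. h (r k) x \<le> 1}"]) blast+
  moreover have "Qf p dotk {x. h' x \<le> 1} \<le> Sup V" if "nclass h'" for h' :: "'a \<Rightarrow> real"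
  proof -
    have "Qf p dotk {x. h' x \<le> 1} \<in> V" unfolding V_def using that by (intro image_eqI[of _ _ h']) auto
    thus ?thesis by (rule cSup_upper[OF _ Vbdd])
  qed
  ultimately have "Qf p dotk {x. h' x \<le> 1} \<le> Qf p dotk {x. h0 x \<le> 1}" if "nclass h'" for h' :: "'a \<Rightarrow> real"
    using that by fastforce
  thus ?thesis using n0 by blast
qed

section \<open>The Lutwak-Zhang inequality\<close>

lemma Qf_le_max:
  assumes p: "p \<ge> 1"
  obtains h0 :: "'a::euclidean_space \<Rightarrow> real"
  where "nrm h0" "\<And>K :: 'a set. adm p K \<Longrightarrow> Qf p dotk K \<le> Qf p dotk {x. h0 x \<le> 1}"
proof -
  obtain h0 :: "'a \<Rightarrow> real" where h0: "nclass h0" "\<And>h :: 'a \<Rightarrow> real. nclass h \<Longrightarrow> Qf p dotk {x. h x \<le> 1} \<le> Qf p dotk {x. h0 x \<le> 1}"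
    using nclass_maximizer[OF p] by blast
  have "Qf p dotk K \<le> Qf p dotk {x. h0 x \<le> 1}" if "adm p K" for K :: "'a set"
    using Qf_le_nclass[OF p that] h0(2) order_trans by blast
  thus ?thesis using that h0(1) by (auto simp: nclass_def)
qed

text \<open>Iterating \<open>T\<close> multiplies the functional by a power of a constant; boundedness makes that constant 1.\<close>
lemma Qf_linear_invariant:
  fixes T :: "'a::euclidean_space \<Rightarrow> 'a"
  assumes T: "linear T" "inj T" and K: "adm p K" and p: "p \<ge> 1"
  shows "Qf p dotk (T -` K) = Qf p dotk K"
proof -
  have p0: "p > 0" using p by simp
  obtain h0 :: "'a \<Rightarrow> real" where h0: "\<And>K :: 'a set. adm p K \<Longrightarrow> Qf p dotk K \<le> Qf p dotk {x. h0 x \<le> 1}"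
    using Qf_le_max[OF p] by metis
  obtain S where S: "linear S" "inj S" "\<And>x. S (T x) = x" "\<And>x. T (S x) = x" using linear_inj_inverse[OF T] by metis
  have adj: "linear (adjoint T)" "linear (adjoint S)" using T(1) S(1) by (auto intro: adjoint_linear)
  have inv: "adjoint T (adjoint S x) = x" "adjoint S (adjoint T x) = x" for x
    using adjoint_inverse[OF T(1) S(1) S(3)] adjoint_inverse[OF S(1) T(1) S(4)] by auto
  have inj: "inj (adjoint T)" "inj (adjoint S)" using inv by (metis injI)+
  have le1: "lscale U * lscale A \<le> 1"
    if U: "linear U" "inj U" "linear V" "\<And>x. V (U x) = x" and A: "linear A" "inj A" "\<And>x y. V x \<bullet> y = x \<bullet> A y"
    for U V A :: "'a \<Rightarrow> 'a"
  proof (rule ccontr)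
    let ?c = "lscale U * lscale A"
    assume "\<not> ?c \<le> 1"
    hence c: "1 < ?c" by simp
    have it: "adm p (((-`) U ^^ k) K) \<and> Qf p dotk (((-`) U ^^ k) K) = ?c ^ k * Qf p dotk K" for k
    proof (induction k)
      case (Suc k)
      thus ?case using adm_vimage[OF U(1,2) _ p0] Qf_vimage[OF U(1-4) A _ p] by (simp add: mult_ac)
    qed (use K in simp)
    have pos: "Qf p dotk K > 0" by (rule Qf_pos[OF kernel_dotk p K])
    obtain k where "Qf p dotk {x. h0 x \<le> 1} / Qf p dotk K < ?c ^ k" using real_arch_pow[OF c] by blast
    hence "Qf p dotk {x. h0 x \<le> 1} < ?c ^ k * Qf p dotk K" using pos by (simp add: pos_divide_less_eq)
    thus False using h0[of "((-`) U ^^ k) K"] it[of k] by simp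
  qed
  have wS: "S x \<bullet> y = x \<bullet> adjoint S y" and wT: "T x \<bullet> y = x \<bullet> adjoint T y" for x y
    using adjoint_works[OF S(1)] adjoint_works[OF T(1)] by (simp_all add: inner_commute)
  \<comment> \<open>The factors belonging to \<open>T\<close> and to its inverse are both at most 1,
    and their product is 1.\<close>
  have 1: "lscale T * lscale (adjoint S) \<le> 1" by (rule le1[OF T S(1) S(3) adj(2) inj(2) wS])
  have 2: "lscale S * lscale (adjoint T) \<le> 1" by (rule le1[OF S(1,2) T(1) S(4) adj(1) inj(1) wT])
  have 3: "lscale T * lscale S = 1" "lscale (adjoint S) * lscale (adjoint T) = 1"
    using lscale_inverse[OF T S(1,2,3)] lscale_inverse[OF adj(2) inj(2) adj(1) inj(1) inv(1)] by auto
  let ?c = "lscale T * lscale (adjoint S)" and ?d = "lscale S * lscale (adjoint T)"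
  have "?c * ?d = (lscale T * lscale S) * (lscale (adjoint S) * lscale (adjoint T))" by (simp add: mult_ac)
  hence cd: "?c * ?d = 1" using 3 by simp
  have c0: "?c > 0" using lscale_props(1)[OF T] lscale_props(1)[OF adj(2) inj(2)] by simp
  have "?c * ?d \<le> ?c * 1" using c0 2 by (intro mult_left_mono) auto
  hence "?c = 1" using cd 1 by simp
  thus ?thesis using Qf_vimage[OF T S(1) S(3) adj(2) inj(2) wS K p] by simp
qed

definition maxi :: "real \<Rightarrow> ('a::euclidean_space \<Rightarrow> real) \<Rightarrow> bool" where
  "maxi p h \<longleftrightarrow> nrm h \<and> (\<forall>K :: 'a set. adm p K \<longrightarrow> Qf p dotk K \<le> Qf p dotk {x. h x \<le> 1})"

lemma maxi_reflection_Basis: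
  fixes h :: "'a::euclidean_space \<Rightarrow> real"
  assumes h: "maxi p h" and p: "p \<ge> 1" and b: "b \<in> Basis"
  obtains a where "a \<bullet> b = 1" "\<And>x. h x < 1 \<Longrightarrow> h (x - (2 * (a \<bullet> x)) *\<^sub>R b) < 1"
proof -
  have n: "nrm h" using h by (simp add: maxi_def)
  interpret S: steiner "{x. h x < 1}" b p by (rule steiner_nrm[OF n b p])
  have "Qf p dotk S.stn \<le> Qf p dotk {x. h x < 1}"
    using h S.stn_adm nrm_open_ball[OF n p] by (simp add: maxi_def)
  hence "Qf p dotk {x. h x < 1} = Qf p dotk S.stn" using S.Qf_stn(1) by (rule order_antisym[rotated])
  from S.lvol_eq_imp_reflection[OF S.Qf_stn(2)[OF this]] show ?thesis using that by auto
qed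

lemma reflect_orthogonal: "norm c = 1 \<Longrightarrow> orthogonal_transformation (reflect c)"
  unfolding orthogonal_transformation_def by (simp add: reflect_linear reflect_inner reflect_reflect)

lemma orthogonal_transformation_exists_euclidean:
  fixes x y :: "'a::euclidean_space"
  assumes "norm x = norm y"
  obtains U where "orthogonal_transformation U" "U x = y"
proof (cases "x = y")
  case True
  thus ?thesis using that[of "\<lambda>x. x"] by simp
next
  case False
  define c where "c = (1 / norm (x - y)) *\<^sub>R (x - y)"
  have nc: "norm c = 1" using False by (simp add: c_def)
  have "x \<bullet> x = y \<bullet> y" using assms by (simp add: dot_square_norm)
  hence "2 * (x \<bullet> (x - y)) = (x - y) \<bullet> (x - y)"
    by (simp add: inner_diff_left inner_diff_right inner_commute)
  hence "2 * (x \<bullet> (x - y)) = norm (x - y) * norm (x - y)" by (simp add: dot_square_norm power2_eq_square)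
  hence "2 * (x \<bullet> c) = norm (x - y)" using False by (simp add: c_def)
  hence "reflect c x = y" unfolding reflect_def using False by (simp add: c_def)
  thus ?thesis using that reflect_orthogonal[OF nc] by blast
qed

text \<open>Composition with a rotation gives another maximiser, so any direction can be turned into
  a coordinate direction.\<close>

lemma maxi_reflection:
  fixes h :: "'a::euclidean_space \<Rightarrow> real"
  assumes h: "maxi p h" and p: "p \<ge> 1" and e: "e \<noteq> 0"
  obtains a where "a \<bullet> e = 1" "\<And>x. h x < 1 \<Longrightarrow> h (x - (2 * (a \<bullet> x)) *\<^sub>R e) < 1"
proof -
  have p0: "p > 0" using p by simp
  have n: "nrm h" using h by (simp add: maxi_def)
  obtain b :: 'a where b: "b \<in> Basis" using nonempty_Basis by blast
  have "norm b = norm (sgn e)" using b e by (simp add: norm_sgn)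
  then obtain U where U: "orthogonal_transformation U" "U b = sgn e"
    using orthogonal_transformation_exists_euclidean by metis
  have Ul: "linear U" "inj U" using U(1) orthogonal_transformation_linear orthogonal_transformation_inj by auto
  have "{x. h (U x) \<le> 1} = U -` {x. h x \<le> 1}" by auto
  hence "Qf p dotk {x. h (U x) \<le> 1} = Qf p dotk {x. h x \<le> 1}"
    using Qf_linear_invariant[OF Ul nrm_ball_adm[OF n p0] p] by simp
  hence "maxi p (\<lambda>x. h (U x))" using h nrm_comp[OF n Ul] by (simp add: maxi_def)
  then obtain a where a: "a \<bullet> b = 1" "\<And>x. h (U x) < 1 \<Longrightarrow> h (U (x - (2 * (a \<bullet> x)) *\<^sub>R b)) < 1"
    using maxi_reflection_Basis[OF _ p b] by metis
  have ip: "U x \<bullet> U y = x \<bullet> y" for x y using U(1) by (simp add: orthogonal_transformation_def)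
  have sg: "norm e *\<^sub>R sgn e = e" using e by (simp add: sgn_div_norm)
  show ?thesis
  proof (rule that[of "(1 / norm e) *\<^sub>R U a"])
    have "U a \<bullet> sgn e = 1" using ip[of a b] a(1) U(2) by simp
    hence "U a \<bullet> (norm e *\<^sub>R sgn e) = norm e" by simp
    thus "(1 / norm e) *\<^sub>R U a \<bullet> e = 1" using e unfolding sg by simp
    fix z assume z: "h z < 1"
    obtain x where x: "z = U x" using orthogonal_transformation_surj[OF U(1)] by (metis surjD)
    have "h (U (x - (2 * (a \<bullet> x)) *\<^sub>R b)) < 1" using a(2) z x by simp
    also have "U (x - (2 * (a \<bullet> x)) *\<^sub>R b) = z - (2 * (a \<bullet> x)) *\<^sub>R sgn e"
      using Ul(1) by (simp add: linear_diff linear_cmul U(2) x)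
    also have "\<dots> = z - (2 * ((1 / norm e) *\<^sub>R U a \<bullet> z)) *\<^sub>R e"
      using ip[of a x] e by (simp add: x sgn_div_norm divide_inverse)
    finally show "h (z - (2 * ((1 / norm e) *\<^sub>R U a \<bullet> z)) *\<^sub>R e) < 1" .
  qed
qed

section \<open>The inertia form of a maximiser\<close>

text \<open>Gram-Schmidt for an arbitrary inner product. The span clause serves the induction: it
  shows that the next vector is nonzero, because \<open>b\<close> is independent of
  \<open>B\<close>.\<close>

lemma gram_schmidt_form:
  fixes M :: "'a::euclidean_space \<Rightarrow> 'a \<Rightarrow> real"
  assumes add: "\<And>x y z. M (x + y) z = M x z + M y z" and sc: "\<And>c x z. M (c *\<^sub>R x) z = c * M x z"
    and sym: "\<And>x y. M x y = M y x" and pos: "\<And>x. x \<noteq> 0 \<Longrightarrow> M x x > 0"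
    and B: "finite B" "B \<subseteq> Basis"
  shows "\<exists>v. (\<forall>b\<in>B. \<forall>c\<in>B. M (v b) (v c) = (if b = c then 1 else 0)) \<and> v ` B \<subseteq> span B"
  using B
proof (induction B rule: finite_induct)
  case (insert b B)
  then obtain v where v: "\<And>x y. x \<in> B \<Longrightarrow> y \<in> B \<Longrightarrow> M (v x) (v y) = (if x = y then 1 else 0)" "v ` B \<subseteq> span B"
    by auto
  have M0: "M 0 z = 0" for z using sc[of 0 0 z] by simp
  have Msum: "M (\<Sum>c\<in>A. f c) z = (\<Sum>c\<in>A. M (f c) z)" if "finite A" for A and f :: "'a \<Rightarrow> 'a" and z
    using that by (induction A rule: finite_induct) (simp_all add: M0 add)
  define w where "w = b + (\<Sum>c\<in>B. (- M b (v c)) *\<^sub>R v c)"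
  have sp: "(\<Sum>c\<in>B. (- M b (v c)) *\<^sub>R v c) \<in> span B"
    using v(2) by (intro span_sum span_mul) auto
  have w0: "w \<noteq> 0"
  proof
    assume "w = 0"
    hence "b = - (\<Sum>c\<in>B. (- M b (v c)) *\<^sub>R v c)" by (simp add: w_def eq_neg_iff_add_eq_0)
    hence "b \<in> span B" using sp span_neg by metis
    moreover have "independent (insert b B)" using independent_Basis insert.prems by (rule independent_mono)
    ultimately show False using insert.hyps(2) independent_insert[of b B] by simp
  qed
  have wv: "M w (v c) = 0" if c: "c \<in> B" for c
  proof -
    have "M w (v c) = M b (v c) + (\<Sum>d\<in>B. - M b (v d) * M (v d) (v c))"
      by (simp only: w_def add Msum[OF insert.hyps(1)] sc)
    also have "(\<Sum>d\<in>B. - M b (v d) * M (v d) (v c)) = (\<Sum>d\<in>B. if d = c then - M b (v c) else 0)"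
      by (rule sum.cong) (use v(1) c in auto)
    finally show ?thesis using insert.hyps(1) c by simp
  qed
  let ?s = "1 / sqrt (M w w)"
  define v' where "v' = v(b := ?s *\<^sub>R w)"
  have "M (v' x) (v' y) = (if x = y then 1 else 0)" if "x \<in> insert b B" "y \<in> insert b B" for x y
  proof -
    have "M (?s *\<^sub>R w) (?s *\<^sub>R w) = 1"
    proof -
      have "M (?s *\<^sub>R w) (?s *\<^sub>R w) = ?s * (?s * M w w)" by (simp only: sc sym[of w "?s *\<^sub>R w"])
      thus ?thesis using pos[OF w0] by simp
    qed
    moreover have "M (?s *\<^sub>R w) (v c) = 0" "M (v c) (?s *\<^sub>R w) = 0" if "c \<in> B" for c
      using wv[OF that] sym[of "v c" "?s *\<^sub>R w"] by (simp_all add: sc)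
    ultimately show ?thesis using that v(1) insert.hyps(2) by (auto simp: v'_def)
  qed
  moreover have "v' ` insert b B \<subseteq> span (insert b B)"
  proof -
    have s: "span B \<subseteq> span (insert b B)" by (intro span_mono) auto
    have "b \<in> span (insert b B)" by (intro span_base) simp
    hence "w \<in> span (insert b B)" unfolding w_def using subsetD[OF s sp] by (rule span_add)
    thus ?thesis using v(2) s insert.hyps(2) by (auto simp: v'_def intro: span_mul)
  qed
  ultimately show ?case by blast
qed simp

definition inertia :: "'a::euclidean_space set \<Rightarrow> 'a \<Rightarrow> 'a \<Rightarrow> real" where
  "inertia G x y = (LINT z:G|lborel. (x \<bullet> z) * (y \<bullet> z))"

lemma inertia_integrable:
  fixes G :: "'a::euclidean_space set"
  assumes "G \<in> sets borel" "bounded G"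
  shows "set_integrable lborel G (\<lambda>z. (x \<bullet> z) * (y \<bullet> z))"
proof -
  note [measurable] = assms(1)
  obtain R where R: "\<And>z. z \<in> G \<Longrightarrow> norm z \<le> R" "R > 0" using assms(2) bounded_pos by metis
  have "integrable lborel (\<lambda>z. (norm x * R * (norm y * R)) * indicator G z)"
    using assms emeasure_bounded_finite[OF assms(2)] by (intro integrable_mult_right) (simp add: integrable_indicator_iff)
  thus ?thesis unfolding set_integrable_def
  proof (rule Bochner_Integration.integrable_bound)
    show "AE z in lborel. norm (indicator G z *\<^sub>R ((x \<bullet> z) * (y \<bullet> z))) \<le> norm ((norm x * R * (norm y * R)) * indicator G z)"
    proof (rule AE_I2)
      fix z
      have "\<bar>x \<bullet> z\<bar> * \<bar>y \<bullet> z\<bar> \<le> (norm x * R) * (norm y * R)" if "z \<in> G"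
        using R(1)[OF that] R(2)
        by (intro mult_mono order_trans[OF Cauchy_Schwarz_ineq2] mult_left_mono) auto
      thus "norm (indicator G z *\<^sub>R ((x \<bullet> z) * (y \<bullet> z))) \<le> norm ((norm x * R * (norm y * R)) * indicator G z)"
        using R(2) by (cases "z \<in> G") (auto simp: abs_mult)
    qed
  qed measurable
qed

text \<open>In the coordinates given by the inertia operator \<open>S\<close>, the reflections of
  the maximiser carry any vector to any other of the same inertia length. The gauge therefore
  depends on that length only, and the body is an ellipsoid.\<close>

lemma maxi_ellipsoid:
  fixes h :: "'a::euclidean_space \<Rightarrow> real"
  assumes h: "maxi p h" and p: "p \<ge> 1"
  obtains T :: "'a \<Rightarrow> 'a" where "linear T" "inj T" "{x. h x \<le> 1} = T ` cball 0 1"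
proof -
  have n: "nrm h" using h by (simp add: maxi_def)
  define G where "G = {x. h x < 1}"
  obtain b0 :: 'a where b0: "b0 \<in> Basis" using nonempty_Basis by blast
  interpret S0: steiner G b0 p unfolding G_def by (rule steiner_nrm[OF n b0 p])
  have Gb: "G \<in> sets borel" by (rule S0.G_borel)
  note [measurable] = Gb
  let ?M = "inertia G"
  note int = inertia_integrable[OF Gb S0.G(3)]
  have Madd: "?M (x + y) z = ?M x z + ?M y z" for x y z
    unfolding inertia_def using int by (simp add: inner_add_left distrib_right set_integral_add)
  have Msc: "?M (c *\<^sub>R x) z = c * ?M x z" for c x z
    unfolding inertia_def by (simp add: mult.assoc)
  have Msym: "?M x y = ?M y x" for x y by (simp add: inertia_def mult.commute)
  have Mpos: "?M x x > 0" if x: "x \<noteq> 0" for x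
  proof -
    have nn: "0 \<le> indicator G z *\<^sub>R ((x \<bullet> z) * (x \<bullet> z))" for z by simp
    have "?M x x \<noteq> 0"
    proof
      assume "?M x x = 0"
      hence "AE z in lborel. indicator G z *\<^sub>R ((x \<bullet> z) * (x \<bullet> z)) = 0"
        using integral_nonneg_eq_0_iff_AE[OF int[of x x, unfolded set_integrable_def]] nn
        by (simp add: inertia_def set_lebesgue_integral_def)
      moreover have "AE z in lborel. dotk z x \<noteq> 0" by (rule kernelD(6)[OF kernel_dotk x])
      ultimately have "AE z in lborel. z \<notin> G"
        by eventually_elim (auto simp: indicator_def dotk_def inner_commute)
      hence "emeasure lborel G = 0" by (subst (asm) AE_iff_measurable[of G]) auto
      thus False using open_emeasure_neq_0[OF S0.G(1,4)] by simp
    qed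
    moreover have "?M x x \<ge> 0" unfolding inertia_def set_lebesgue_integral_def using nn by (intro integral_nonneg_AE) auto
    ultimately show ?thesis by simp
  qed
  have M0: "?M 0 z = 0" for z using Msc[of 0 0 z] by simp
  have Mneg: "?M (- x) z = - ?M x z" for x z using Msc[of "-1" x z] by simp
  have Mdiff: "?M (x - y) z = ?M x z - ?M y z" for x y z using Madd[of x "-y" z] Mneg[of y z] by simp
  have Msum: "?M (\<Sum>c\<in>A. f c) z = (\<Sum>c\<in>A. ?M (f c) z)" if "finite A" for A :: "'a set" and f z
    using that by (induction A rule: finite_induct) (simp_all add: M0 Madd)
  define S where "S x = (\<Sum>b\<in>Basis. ?M x b *\<^sub>R b)" for x
  have Sin: "S x \<bullet> y = ?M x y" for x y
  proof -
    have "?M x y = ?M y x" by (rule Msym)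
    also have "\<dots> = ?M (\<Sum>b\<in>Basis. (y \<bullet> b) *\<^sub>R b) x" by (simp only: euclidean_representation)
    also have "\<dots> = (\<Sum>b\<in>Basis. (y \<bullet> b) * ?M b x)" by (simp only: Msum[OF finite_Basis] Msc)
    also have "\<dots> = S x \<bullet> y" unfolding S_def inner_sum_left inner_scaleR_left
      by (intro sum.cong refl) (metis Msym inner_commute mult.commute)
    finally show ?thesis by simp
  qed
  have Slin: "linear S"
    by (rule linearI; rule vector_eq_rdot[THEN iffD1]) (auto simp: Sin inner_add_left Madd Msc)
  have Sinj: "inj S"
    unfolding linear_injective_0[OF Slin] using Sin Mpos by (metis inner_zero_left less_irrefl)
  \<comment> \<open>The reflection to use is the one in direction \<open>?e\<close>, the difference
    of the two points; what remains is that its functional \<open>a\<close> takes the value 1/2 at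
    \<open>S \<xi>\<close>.\<close>
  have key: "S \<eta> \<in> G" if q: "?M \<xi> \<xi> = ?M \<eta> \<eta>" and g: "S \<xi> \<in> G" for \<xi> \<eta>
  proof (cases "\<xi> = \<eta>")
    case False
    let ?d = "\<xi> - \<eta>" and ?e = "S (\<xi> - \<eta>)"
    have e0: "?e \<noteq> 0" using False Sinj linear_injective_0[OF Slin] by auto
    obtain a where a: "a \<bullet> ?e = 1" "\<And>x. h x < 1 \<Longrightarrow> h (x - (2 * (a \<bullet> x)) *\<^sub>R ?e) < 1"
      using maxi_reflection[OF h p e0] by metis
    define R where "R x = x - (2 * (a \<bullet> x)) *\<^sub>R ?e" for x
    have RG: "R x \<in> G" if "x \<in> G" for x using a(2) that by (simp add: R_def G_def)
    have Rlin: "linear R" by (rule linearI) (simp_all add: R_def inner_add_right algebra_simps scaleR_add_left)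
    have RR: "R (R x) = x" for x
    proof -
      have "a \<bullet> R x = - (a \<bullet> x)" by (simp add: R_def inner_diff_right a(1))
      thus ?thesis unfolding R_def[of "R x"] by (simp add: R_def)
    qed
    have RGi: "R x \<in> G \<longleftrightarrow> x \<in> G" for x using RG[of x] RG[of "R x"] RR by auto
    \<comment> \<open>The adjoint of \<open>R\<close>. Since \<open>R\<close> preserves
      \<open>G\<close> and volume, \<open>Rt\<close> preserves the inertia form.\<close>
    define Rt where "Rt x = x - (2 * (?e \<bullet> x)) *\<^sub>R a" for x
    have Rt: "Rt x \<bullet> z = x \<bullet> R z" for x z
      by (simp add: R_def Rt_def inner_diff_left inner_diff_right inner_commute)
    have MRt: "?M (Rt x) (Rt y) = ?M x y" for x y
    proof -
      have "?M (Rt x) (Rt y) = (\<integral>z. indicator G (R z) *\<^sub>R ((x \<bullet> R z) * (y \<bullet> R z)) \<partial>lborel)"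
        by (simp add: inertia_def set_lebesgue_integral_def Rt RGi indicator_def)
      also have "\<dots> = (\<integral>z. indicator G z *\<^sub>R ((x \<bullet> z) * (y \<bullet> z)) \<partial>lborel)"
        by (rule mpres_integral[OF mpres_involution[OF Rlin RR], of "\<lambda>z. indicator G z *\<^sub>R ((x \<bullet> z) * (y \<bullet> z))"]) measurable
      finally show ?thesis by (simp add: inertia_def set_lebesgue_integral_def)
    qed
    have Rta: "Rt a = - a"
    proof -
      have "?e \<bullet> a = 1" using a(1) by (simp add: inner_commute)
      thus ?thesis unfolding Rt_def by (simp flip: scaleR_left_diff_distrib add: scaleR_2)
    qed
    \<comment> \<open>The isometry \<open>Rt\<close> of the form negates \<open>a\<close>; comparing
      the two values of the form at (x, a) determines it. It follows that \<open>S a\<close> is a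
      multiple of \<open>?e\<close>, so \<open>a\<close> is a multiple of \<open>?d\<close>.\<close>
    have Sa: "?M x a = (?e \<bullet> x) * ?M a a" for x
    proof -
      have "?M x a = ?M (Rt x) (- a)" using MRt[of x a] Rta by simp
      also have "\<dots> = - ?M (Rt x) a" using Msym Mneg by metis
      also have "?M (Rt x) a = ?M x a - 2 * (?e \<bullet> x) * ?M a a" by (simp only: Rt_def Mdiff Msc)
      finally show ?thesis by simp
    qed
    have "S a = S (?M a a *\<^sub>R ?d)"
    proof (rule vector_eq_rdot[THEN iffD1], rule allI)
      fix z
      have "S a \<bullet> z = (?e \<bullet> z) * ?M a a" using Sa[of z] by (simp add: Sin Msym)
      thus "S a \<bullet> z = S (?M a a *\<^sub>R ?d) \<bullet> z" using Slin by (simp add: linear_cmul mult.commute)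
    qed
    hence ad: "a = ?M a a *\<^sub>R ?d" using Sinj by (simp add: inj_eq)
    have dd: "?M ?d ?d = 2 * ?M ?d \<xi>"
    proof -
      have "?M ?d ?d = ?M \<xi> \<xi> - ?M \<eta> \<xi> - (?M \<xi> \<eta> - ?M \<eta> \<eta>)"
        by (metis Mdiff Msym)
      thus ?thesis using q Msym[of \<xi> \<eta>] by (simp add: Mdiff)
    qed
    have "1 = a \<bullet> ?e" using a(1) by simp
    also have "\<dots> = ?M a a * (?e \<bullet> ?d)" by (subst ad) (simp add: inner_commute)
    also have "\<dots> = ?M a a * ?M ?d ?d" by (simp add: Sin)
    finally have "?M a a * (2 * ?M ?d \<xi>) = 1" using dd by simp
    moreover have "a \<bullet> S \<xi> = ?M a a * ?M ?d \<xi>"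
      by (subst ad) (simp add: inner_commute Sin Msym)
    ultimately have "2 * (a \<bullet> S \<xi>) = 1" by simp
    hence "R (S \<xi>) = S \<xi> - ?e" by (simp add: R_def)
    also have "\<dots> = S \<eta>" using Slin by (simp add: linear_diff)
    finally show ?thesis using RG[OF g] by simp
  qed (use g in simp)
  obtain v :: "'a \<Rightarrow> 'a" where v: "\<And>b c. b \<in> Basis \<Longrightarrow> c \<in> Basis \<Longrightarrow> ?M (v b) (v c) = (if b = c then 1 else 0)"
    using gram_schmidt_form[of ?M Basis, OF Madd Msc Msym Mpos] by auto
  define X where "X x = (\<Sum>b\<in>Basis. (x \<bullet> b) *\<^sub>R v b)" for x
  have MXv: "?M (X x) (v c) = x \<bullet> c" if "c \<in> Basis" for x c
    using that by (simp add: X_def Msum Msc v if_distrib[of "\<lambda>t. _ * t"] sum.delta' cong: if_cong)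
  have MX: "?M (X x) (X x) = (norm x)\<^sup>2" for x
  proof -
    have "?M (X x) (X x) = (\<Sum>b\<in>Basis. (x \<bullet> b) * ?M (v b) (X x))"
      by (subst X_def) (simp only: Msum[OF finite_Basis] Msc)
    also have "\<dots> = (\<Sum>b\<in>Basis. (x \<bullet> b) * (x \<bullet> b))"
      by (intro sum.cong refl) (metis MXv Msym)
    also have "\<dots> = (norm x)\<^sup>2" by (metis euclidean_inner power2_norm_eq_inner)
    finally show ?thesis .
  qed
  have Xlin: "linear X"
    by (rule linearI) (simp_all add: X_def inner_add_left scaleR_add_left sum.distrib scaleR_sum_right)
  have Xinj: "inj X"
    unfolding linear_injective_0[OF Xlin] using MX M0 by (metis norm_eq_zero power_eq_0_iff)
  define T0 where "T0 x = S (X x)" for x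
  have T0: "linear T0" "inj T0"
    unfolding T0_def using linear_compose[OF Xlin Slin] inj_compose[OF Sinj Xinj] by (auto simp: comp_def)
  \<comment> \<open>If the gauges differed, scaling by 1/s with \<open>s\<close> strictly between
    them would put exactly one of the two points into \<open>G\<close>, against
    \<open>key\<close>.\<close>
  have le: "h (T0 y) \<le> h (T0 x)" if xy: "norm x = norm y" for x y
  proof (rule ccontr)
    assume "\<not> ?thesis"
    hence lt: "h (T0 x) < h (T0 y)" by simp
    define s where "s = (h (T0 x) + h (T0 y)) / 2"
    have s: "h (T0 x) < s" "s < h (T0 y)" "s > 0" using lt nrm_nonneg[OF n, of "T0 x"] by (auto simp: s_def)
    have hs: "h (T0 ((1/s) *\<^sub>R z)) = h (T0 z) / s" for z
      using s T0(1) by (simp add: linear_cmul nrm_scale[OF n])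
    have "S (X ((1/s) *\<^sub>R x)) \<in> G" using hs[of x] s by (simp add: G_def T0_def)
    hence "S (X ((1/s) *\<^sub>R y)) \<in> G" by (rule key[rotated]) (simp add: MX xy)
    thus False using hs[of y] s by (simp add: G_def T0_def)
  qed
  define k where "k = h (T0 b0)"
  have nb0: "norm b0 = 1" using b0 by simp
  have k: "k > 0"
  proof -
    have "T0 b0 \<noteq> 0" using T0 linear_injective_0[OF T0(1)] nb0 by fastforce
    thus ?thesis unfolding k_def by (rule nrm_pos[OF n])
  qed
  have hT: "h (T0 x) = k * norm x" for x
  proof -
    have "h (T0 x) = h (T0 (norm x *\<^sub>R b0))" using le[of x "norm x *\<^sub>R b0"] le[of "norm x *\<^sub>R b0" x] nb0 by simp
    thus ?thesis using T0(1) by (simp add: linear_cmul nrm_scale[OF n] k_def)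
  qed
  define T where "T x = (1/k) *\<^sub>R T0 x" for x
  have Tl: "linear T" unfolding T_def using T0(1) by (intro linear_compose_scale_right)
  have Ti: "inj T" using T0(2) k by (auto simp: T_def inj_on_def)
  obtain U where U: "\<And>x. T (U x) = x" using linear_inj_inverse[OF Tl Ti] by metis
  have hT': "h (T x) = norm x" for x using k by (simp add: T_def nrm_scale[OF n] hT)
  have "{x. h x \<le> 1} = T ` cball 0 1"
  proof (intro equalityI subsetI)
    fix x assume "x \<in> {x. h x \<le> 1}"
    hence "norm (U x) \<le> 1" using hT'[of "U x"] U by simp
    thus "x \<in> T ` cball 0 1" using U[of x] by (metis imageI mem_cball_0)
  qed (auto simp: hT')
  thus ?thesis using that Tl Ti by blast
qed

lemma Qf_ellipsoid:
  fixes T :: "'a::euclidean_space \<Rightarrow> 'a"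
  assumes T: "linear T" "inj T" and p: "p \<ge> 1"
  shows "Qf p dotk (T ` cball 0 1) = Qf p dotk (cball 0 1 :: 'a set)"
proof -
  obtain S where S: "linear S" "inj S" "\<And>x. S (T x) = x" "\<And>x. T (S x) = x" using linear_inj_inverse[OF T] by metis
  have "T ` cball 0 1 = S -` cball 0 1"
  proof (intro equalityI subsetI)
    fix x assume "x \<in> S -` cball 0 1"
    hence "S x \<in> cball 0 1" by simp
    thus "x \<in> T ` cball 0 1" using S(4)[of x] by (metis imageI)
  qed (auto simp: S(3))
  moreover have "adm p (cball 0 1 :: 'a set)"
    using emeasure_cball01_pos(2)[where 'a='a] p by (intro adm_bounded) auto
  ultimately show ?thesis using Qf_linear_invariant[OF S(1,2) _ p] by simp
qed

text \<open>The abstract maximiser is an ellipsoid, and all ellipsoids give the same value. In the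
  equality case no duality step changes the functional, so \<open>K\<close> is almost everywhere a
  sublevel set of the moment of \<open>L\<close>, a dilate of another maximiser.\<close>

theorem Lutwak_Zhang:
  fixes K :: "'a::euclidean_space set"
  assumes p: "p \<ge> 1" and K: "adm p K"
  shows "Qf p dotk K \<le> Qf p dotk (cball 0 1 :: 'a set)"
    "Qf p dotk K = Qf p dotk (cball 0 1 :: 'a set) \<Longrightarrow>
      \<exists>T :: 'a \<Rightarrow> 'a. linear T \<and> inj T \<and> (AE x in lborel. x \<in> K \<longleftrightarrow> x \<in> T ` cball 0 1)"
proof -
  have p0: "p > 0" using p by simp
  obtain h0 :: "'a \<Rightarrow> real" where h0: "nrm h0" "\<And>K :: 'a set. adm p K \<Longrightarrow> Qf p dotk K \<le> Qf p dotk {x. h0 x \<le> 1}"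
    using Qf_le_max[OF p] by metis
  have "maxi p h0" using h0 by (simp add: maxi_def)
  then obtain T0 :: "'a \<Rightarrow> 'a" where T0: "linear T0" "inj T0" "{x. h0 x \<le> 1} = T0 ` cball 0 1"
    using maxi_ellipsoid[OF _ p] by metis
  have mx: "Qf p dotk K \<le> Qf p dotk (cball 0 1 :: 'a set)" if "adm p K" for K :: "'a set"
    using h0(2)[OF that] Qf_ellipsoid[OF T0(1,2) p] T0(3) by simp
  show "Qf p dotk K \<le> Qf p dotk (cball 0 1 :: 'a set)" by (rule mx[OF K])
  assume eq: "Qf p dotk K = Qf p dotk (cball 0 1 :: 'a set)"
  define L where "L = {x. mom p dotk K x \<le> 1}"
  have L: "adm p L" unfolding L_def by (intro adm_sublevel mom_phom_convex(1) kernel_dotk p K p0) simp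
  note Qp = Qf_polar[OF kernel_dotk p K, folded L_def]
  have QL: "Qf p dotk L = Qf p dotk (cball 0 1 :: 'a set)" using Qp(1) mx[OF L] eq by simp
  then obtain r where r: "r > 0" "AE x in lborel. x \<in> K \<longleftrightarrow> mom p dotk L x \<le> r" using Qp(2) eq by auto
  let ?h = "\<lambda>x. mom p dotk L x powr (1/p)"
  note pn = polar_nrm[OF p L]
  \<comment> \<open>\<open>L\<close> attains the maximum and passing to the sublevel set of its
    moment does not lower the functional, so this unit ball is a maximiser, hence an
    ellipsoid.\<close>
  have "maxi p ?h" unfolding maxi_def using pn(1,3) mx QL by (auto intro: order_trans)
  then obtain T :: "'a \<Rightarrow> 'a" where T: "linear T" "inj T" "{x. ?h x \<le> 1} = T ` cball 0 1"
    using maxi_ellipsoid[OF _ p] by metis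
  define s where "s = r powr (1/p)"
  have s: "s > 0" "s powr p = r" unfolding s_def powr_powr using r(1) p0 by simp_all
  note N = mom_phom_convex(1)[OF kernel_dotk p L]
  have "mom p dotk L x \<le> r \<longleftrightarrow> x \<in> (\<lambda>x. s *\<^sub>R T x) ` cball 0 1" for x
  proof -
    have "mom p dotk L x \<le> r \<longleftrightarrow> mom p dotk L ((1/s) *\<^sub>R x) \<le> 1"
    proof -
      have "\<bar>1/s\<bar> powr p = 1 / r" using s by (simp add: powr_divide)
      hence "mom p dotk L ((1/s) *\<^sub>R x) = mom p dotk L x / r"
        by (simp add: phom_scale[OF N])
      thus ?thesis using r(1) by simp
    qed
    also have "\<dots> \<longleftrightarrow> (1/s) *\<^sub>R x \<in> T ` cball 0 1" using pn(2) T(3) by auto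
    also have "\<dots> \<longleftrightarrow> x \<in> (\<lambda>x. s *\<^sub>R T x) ` cball 0 1"
    proof
      assume "(1/s) *\<^sub>R x \<in> T ` cball 0 1"
      then obtain z where z: "z \<in> cball 0 1" "(1/s) *\<^sub>R x = T z" by auto
      hence "s *\<^sub>R ((1/s) *\<^sub>R x) = s *\<^sub>R T z" by simp
      hence "x = s *\<^sub>R T z" using s(1) by simp
      thus "x \<in> (\<lambda>x. s *\<^sub>R T x) ` cball 0 1" using z by auto
    qed (use s in auto)
    finally show ?thesis .
  qed
  moreover have "linear (\<lambda>x. s *\<^sub>R T x)" using T(1) by (intro linear_compose_scale_right)
  moreover have "inj (\<lambda>x. s *\<^sub>R T x)" using T(2) s(1) by (auto simp: inj_on_def)
  ultimately show "\<exists>T :: 'a \<Rightarrow> 'a. linear T \<and> inj T \<and> (AE x in lborel. x \<in> K \<longleftrightarrow> x \<in> T ` cball 0 1)"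
    using r(2) by (intro exI[of _ "\<lambda>x. s *\<^sub>R T x"]) auto
qed

section \<open>Volume in polar coordinates\<close>

lemma nn_integral_powr_tail:
  fixes c n :: real
  assumes c: "c > 0" and n: "n > 0"
  shows "(\<integral>\<^sup>+t. ennreal (t powr (- n - 1)) * indicator {c..} t \<partial>lborel) = ennreal (c powr (- n) / n)"
proof -
  have "(\<integral>\<^sup>+t. ennreal (t powr (- n - 1)) * indicator {c..} t \<partial>lborel) = ennreal (0 - (- (1 / n) * c powr (- n)))"
  proof (rule nn_integral_FTC_atLeast)
    fix t assume t: "c \<le> t"
    have "((\<lambda>t. t powr (- n)) has_real_derivative (- n) * t powr (- n - 1)) (at t)"
      using t c by (intro has_real_derivative_powr) simp
    hence "((\<lambda>t. - (1 / n) * t powr (- n)) has_real_derivative - (1 / n) * ((- n) * t powr (- n - 1))) (at t)"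
      by (rule DERIV_cmult)
    thus "((\<lambda>t. - (1 / n) * t powr (- n)) has_real_derivative t powr (- n - 1)) (at t)" using n by simp
  next
    have "((\<lambda>t. t powr (- n)) \<longlongrightarrow> 0) at_top" using n by (intro tendsto_neg_powr filterlim_ident) auto
    thus "((\<lambda>t. - (1 / n) * t powr (- n)) \<longlongrightarrow> 0) at_top" by (intro tendsto_mult_right_zero)
  qed auto
  thus ?thesis using n by (simp add: field_simps)
qed

lemma nn_integral_powr_head:
  fixes c n :: real
  assumes c: "c \<ge> 0" and n: "n > 1"
  shows "(\<integral>\<^sup>+t. ennreal (t powr (n - 1)) * indicator {0..c} t \<partial>lborel) = ennreal (c powr n / n)"
proof -
  have "(\<integral>\<^sup>+t. ennreal (t powr (n - 1)) * indicator {0..c} t \<partial>lborel) = ennreal ((1/n) * c powr n - (1/n) * 0 powr n)"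
  proof (rule nn_integral_FTC_within[OF _ _ c])
    fix t assume t: "t \<in> {0..c}"
    have "((\<lambda>t. t powr (n - 1 + 1)) has_real_derivative (n - 1 + 1) * t powr (n - 1)) (at t within {0..c})"
      using t n by (intro powr_Suc_derivative) auto
    hence "((\<lambda>t. (1/n) * t powr n) has_real_derivative (1/n) * (n * t powr (n - 1))) (at t within {0..c})"
      by (intro DERIV_cmult) simp
    thus "((\<lambda>t. (1/n) * t powr n) has_real_derivative t powr (n - 1)) (at t within {0..c})" using n by simp
  qed simp
  thus ?thesis using n by simp
qed

text \<open>Volume in polar coordinates, obtained from Tonelli's theorem on \<open>\<real>\<^sup>n \<times> (0,\<infinity>)\<close> and dilations.\<close>
lemma lvol_polar:
  fixes N :: "'a::euclidean_space \<Rightarrow> real"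
  assumes N: "phom p N" and p: "p > 0" and dim: "DIM('a) \<ge> 2"
  shows "ennreal (lvol N) = (\<integral>\<^sup>+x. indicator (cball 0 1 - {0}) x * ennreal ((norm x powr p / N x) powr (real DIM('a) / p)) \<partial>lborel)"
proof -
  let ?n = "real DIM('a)"
  have n: "?n > 1" using dim by simp
  note [measurable] = phom_borel[OF N]
  \<comment> \<open>The weight integrates to 1/n over t >= |z|, so \<open>F\<close> represents the
    volume of the sublevel set up to this factor. Substituting z = t x turns the condition |z| <= t
    into |x| <= 1 and \<open>N z <= 1\<close> into an upper bound for t, which gives
    \<open>G\<close>.\<close>
  define F where "F z t = ennreal (norm z powr ?n * t powr (- ?n - 1)) * (if 0 < t \<and> N z \<le> 1 \<and> norm z \<le> t \<and> z \<noteq> 0 then 1 else 0)" for z :: 'a and t :: real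
  have Fm [measurable]: "case_prod F \<in> borel_measurable (borel \<Otimes>\<^sub>M borel)" unfolding F_def by measurable
  have I1: "(\<integral>\<^sup>+t. F z t \<partial>lborel) = ennreal (1 / ?n) * indicator {z. N z \<le> 1 \<and> z \<noteq> 0} z" for z
  proof (cases "z = 0 \<or> N z > 1")
    case False
    hence z: "norm z > 0" "N z \<le> 1" by auto
    have pos: "norm z \<le> t \<Longrightarrow> 0 < t" for t using z(1) by linarith
    have "(\<integral>\<^sup>+t. F z t \<partial>lborel) = (\<integral>\<^sup>+t. ennreal (norm z powr ?n) * (ennreal (t powr (- ?n - 1)) * indicator {norm z..} t) \<partial>lborel)"
      using z pos by (intro nn_integral_cong) (auto simp: F_def indicator_def ennreal_mult)
    also have "\<dots> = ennreal (norm z powr ?n) * ennreal (norm z powr (- ?n) / ?n)"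
      using z n by (subst nn_integral_cmult) (auto simp: nn_integral_powr_tail)
    also have "\<dots> = ennreal (norm z powr ?n * (norm z powr (- ?n) / ?n))" by (rule ennreal_mult[symmetric]) (use n in auto)
    also have "norm z powr ?n * (norm z powr (- ?n) / ?n) = 1 / ?n" using z by (simp add: powr_minus)
    finally show ?thesis using False by (simp add: indicator_def)
  qed (auto simp: F_def indicator_def)
  have "(\<integral>\<^sup>+z. (\<integral>\<^sup>+t. F z t \<partial>lborel) \<partial>lborel) = ennreal (1 / ?n) * emeasure lborel {z. N z \<le> 1 \<and> z \<noteq> 0}"
    unfolding I1 by (rule nn_integral_cmult_indicator) measurable
  also have "emeasure lborel {z. N z \<le> 1 \<and> z \<noteq> 0} = emeasure lborel {z. N z \<le> 1}"
    by (rule AE_eq_emeasure) (use AE_lborel_singleton[of 0] in \<open>auto elim!: eventually_mono\<close>)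
  also have "\<dots> = ennreal (lvol N)" by (simp add: lvol_def phom_sublevel_emeasure[OF N p])
  finally have L: "(\<integral>\<^sup>+z. (\<integral>\<^sup>+t. F z t \<partial>lborel) \<partial>lborel) = ennreal (1 / ?n) * ennreal (lvol N)" .
  define G where "G x t = ennreal (norm x powr ?n * t powr (?n - 1)) * (if 0 < t \<and> t \<le> N x powr (- 1/p) \<and> norm x \<le> 1 \<and> x \<noteq> 0 then 1 else 0)" for x :: 'a and t :: real
  have Gm [measurable]: "case_prod G \<in> borel_measurable (borel \<Otimes>\<^sub>M borel)" unfolding G_def by measurable
  have I2: "(\<integral>\<^sup>+z. F z t \<partial>lborel) = (\<integral>\<^sup>+x. G x t \<partial>lborel)" for t
  proof (cases "t > 0")
    case True
    have ex: "emeasure lborel X = emeasure lborel X" for X :: "'a set" ..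
    have "(\<integral>\<^sup>+z. F z t \<partial>lborel) = (\<integral>\<^sup>+z. F z t \<partial>(density (distr lborel borel (\<lambda>x. 0 + t *\<^sub>R x)) (\<lambda>_. ennreal (\<bar>t\<bar> ^ DIM('a)))))"
      using True by (subst lborel_affine[of t "0::'a"]) auto
    also have "\<dots> = (\<integral>\<^sup>+x. ennreal (t ^ DIM('a)) * F (t *\<^sub>R x) t \<partial>lborel)"
      using True by (simp add: nn_integral_density nn_integral_distr)
    also have "\<dots> = (\<integral>\<^sup>+x. G x t \<partial>lborel)"
    proof (rule nn_integral_cong)
      fix x :: 'a
      show "ennreal (t ^ DIM('a)) * F (t *\<^sub>R x) t = G x t"
      proof (cases "x = 0")
        case False
        have N0: "N x > 0" by (rule phom_pos[OF N False])
        have eq: "N (t *\<^sub>R x) \<le> 1 \<longleftrightarrow> t \<le> N x powr (- 1/p)"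
        proof -
          have "N (t *\<^sub>R x) \<le> 1 \<longleftrightarrow> t powr p \<le> 1 / N x" using True N0 by (simp add: phom_scale[OF N] field_simps)
          also have "1 / N x = (N x powr (- 1/p)) powr p"
            unfolding powr_powr using N0 p by (simp add: powr_minus_divide)
          also have "t powr p \<le> (N x powr (- 1/p)) powr p \<longleftrightarrow> t \<le> N x powr (- 1/p)"
            using True N0 p powr_mono2[of p t "N x powr (- 1/p)"] powr_less_mono2[of p "N x powr (- 1/p)" t] by (auto simp: not_le[symmetric])
          finally show ?thesis .
        qed
        have "t ^ DIM('a) * (norm (t *\<^sub>R x) powr ?n * t powr (- ?n - 1)) = norm x powr ?n * t powr (?n - 1)"
        proof -
          have "t powr (- ?n - 1) * t powr ?n * t powr ?n = t powr (?n - 1)"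
            using True by (simp add: powr_diff flip: powr_add)
          moreover have "t ^ DIM('a) = t powr ?n" using True by (simp add: powr_realpow)
          ultimately show ?thesis using True by (simp add: powr_mult mult_ac)
        qed
        thus ?thesis using True False eq by (auto simp: F_def G_def simp flip: ennreal_mult)
      qed (simp add: F_def G_def)
    qed
    finally show ?thesis .
  qed (auto simp: F_def G_def)
  have I3: "(\<integral>\<^sup>+t. G x t \<partial>lborel) = ennreal (1 / ?n) * (indicator (cball 0 1 - {0}) x * ennreal ((norm x powr p / N x) powr (?n / p)))" for x
  proof (cases "x \<in> cball 0 1 - {0}")
    case True
    hence x: "x \<noteq> 0" "norm x \<le> 1" by auto
    have N0: "N x > 0" by (rule phom_pos[OF N x(1)])
    have "(\<integral>\<^sup>+t. G x t \<partial>lborel) = (\<integral>\<^sup>+t. ennreal (norm x powr ?n) * (ennreal (t powr (?n - 1)) * indicator {0..N x powr (- 1/p)} t) \<partial>lborel)"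
      using x by (intro nn_integral_cong) (auto simp: G_def indicator_def ennreal_mult)
    also have "\<dots> = ennreal (norm x powr ?n) * ennreal ((N x powr (- 1/p)) powr ?n / ?n)"
      using n by (subst nn_integral_cmult) (auto simp: nn_integral_powr_head)
    also have "\<dots> = ennreal (norm x powr ?n * ((N x powr (- 1/p)) powr ?n / ?n))" by (rule ennreal_mult[symmetric]) (use n in auto)
    also have "norm x powr ?n * ((N x powr (- 1/p)) powr ?n / ?n) = 1 / ?n * (norm x powr p / N x) powr (?n / p)"
    proof -
      have "(norm x powr p / N x) powr (?n/p) = norm x powr ?n / N x powr (?n/p)"
        using p by (simp add: powr_divide powr_powr)
      moreover have "(N x powr (- 1/p)) powr ?n = 1 / N x powr (?n/p)"
      proof -
        have "- 1 / p * ?n = - (?n / p)" by simp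
        thus ?thesis unfolding powr_powr by (simp only: powr_minus_divide)
      qed
      ultimately show ?thesis by simp
    qed
    also have "ennreal (1 / ?n * (norm x powr p / N x) powr (?n / p)) = ennreal (1 / ?n) * ennreal ((norm x powr p / N x) powr (?n / p))"
      by (rule ennreal_mult) (use n in auto)
    finally show ?thesis using True by simp
  qed (auto simp: G_def)
  have "(\<integral>\<^sup>+z. (\<integral>\<^sup>+t. F z t \<partial>lborel) \<partial>lborel) = (\<integral>\<^sup>+t. (\<integral>\<^sup>+z. F z t \<partial>lborel) \<partial>lborel)"
    by (rule lborel_pair.Fubini'[symmetric]) measurable
  also have "\<dots> = (\<integral>\<^sup>+x. (\<integral>\<^sup>+t. G x t \<partial>lborel) \<partial>lborel)"
    unfolding I2 by (rule lborel_pair.Fubini') measurable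
  also have "\<dots> = ennreal (1 / ?n) * (\<integral>\<^sup>+x. indicator (cball 0 1 - {0}) x * ennreal ((norm x powr p / N x) powr (?n / p)) \<partial>lborel)"
    unfolding I3
  proof (rule nn_integral_cmult)
    have 1: "(\<lambda>x. (norm x powr p / N x) powr (?n / p)) \<in> borel_measurable lborel" by measurable
    have "cball 0 1 - {0 :: 'a} \<in> sets lborel" by auto
    thus "(\<lambda>x. indicator (cball 0 1 - {0}) x * ennreal ((norm x powr p / N x) powr (?n / p))) \<in> borel_measurable lborel"
      by (intro borel_measurable_times_ennreal borel_measurable_indicator measurable_compose[OF 1 measurable_ennreal])
  qed
  finally have eq: "ennreal (1 / ?n) * ennreal (lvol N) = ennreal (1 / ?n) * (\<integral>\<^sup>+x. indicator (cball 0 1 - {0}) x * ennreal ((norm x powr p / N x) powr (?n / p)) \<partial>lborel)"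
    using L by simp
  have "ennreal (1 / ?n) \<noteq> 0" "ennreal (1 / ?n) \<noteq> top" using n by auto
  thus ?thesis using eq by (simp add: ennreal_mult_cancel_left)
qed

section \<open>Rotations and the sine kernel\<close>

text \<open>First move \<open>b\<close> to \<open>a\<close>, then exchange the image of
  \<open>c\<close> and \<open>w\<close> by the reflection along their difference; it fixes
  \<open>a\<close>, which is orthogonal to both.\<close>

lemma orthonormal_pair_rotation:
  fixes a w b c :: "'a::euclidean_space"
  assumes "norm a = 1" "norm w = 1" "a \<bullet> w = 0" "norm b = 1" "norm c = 1" "b \<bullet> c = 0"
  obtains U where "orthogonal_transformation U" "U b = a" "U c = w"
proof -
  obtain U1 where U1: "orthogonal_transformation U1" "U1 b = a"
    using orthogonal_transformation_exists_euclidean[of b a] assms by metis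
  have ip: "U1 x \<bullet> U1 y = x \<bullet> y" for x y using U1(1) by (simp add: orthogonal_transformation_def)
  have n: "norm (U1 c) = norm w" using assms orthogonal_transformation_norm[OF U1(1)] by simp
  show ?thesis
  proof (cases "U1 c = w")
    case True thus ?thesis using that U1 by blast
  next
    case False
    define d where "d = (1 / norm (U1 c - w)) *\<^sub>R (U1 c - w)"
    have nd: "norm d = 1" using False by (simp add: d_def)
    have "a \<bullet> U1 c = 0" using ip[of b c] U1(2) assms by simp
    hence ad: "a \<bullet> d = 0" using assms by (simp add: d_def inner_diff_right)
    hence ra: "reflect d a = a" by (simp add: reflect_def)
    have "U1 c \<bullet> U1 c = w \<bullet> w" using n by (simp add: dot_square_norm)
    hence "2 * (U1 c \<bullet> (U1 c - w)) = (U1 c - w) \<bullet> (U1 c - w)"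
      by (simp add: inner_diff_left inner_diff_right inner_commute)
    hence "2 * (U1 c \<bullet> (U1 c - w)) = norm (U1 c - w) * norm (U1 c - w)" by (simp add: dot_square_norm power2_eq_square)
    hence "2 * (U1 c \<bullet> d) = norm (U1 c - w)" using False by (simp add: d_def)
    hence rc: "reflect d (U1 c) = w" unfolding reflect_def using False by (simp add: d_def)
    have "orthogonal_transformation (reflect d \<circ> U1)"
      using reflect_orthogonal[OF nd] U1(1) orthogonal_transformation_compose by blast
    thus ?thesis using that[of "reflect d \<circ> U1"] U1(2) ra rc by simp
  qed
qed

lemma mom_vimage_orthogonal:
  fixes K :: "'a::euclidean_space set"
  assumes k: "kernel k" and K: "K \<in> sets borel" and U: "orthogonal_transformation U"
    and inv: "\<And>x y. k (U x) (U y) = k x y"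
  shows "mom p k (U -` K) y = mom p k K (U y)"
proof -
  note [measurable] = K kernel_measurable[OF k]
  have "(\<integral>x. indicator K (U x) *\<^sub>R k (U x) (U y) powr p \<partial>lborel) = (\<integral>x. indicator K x *\<^sub>R k x (U y) powr p \<partial>lborel)"
    by (rule mpres_integral[OF mpres_orthogonal[OF U], of "\<lambda>x. indicator K x *\<^sub>R k x (U y) powr p"]) measurable
  thus ?thesis by (simp add: mom_def set_lebesgue_integral_def indicator_def inv)
qed

lemma mom_radial:
  fixes K :: "'a::euclidean_space set"
  assumes k: "kernel k" and inv: "\<And>U x y. orthogonal_transformation U \<Longrightarrow> k (U x) (U y) = k x y"
    and p: "p \<ge> 1" and K: "adm p K" and Kinv: "\<And>U. orthogonal_transformation U \<Longrightarrow> U -` K = K"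
  obtains c where "c > 0" "\<And>x. mom p k K x = c * norm x powr p"
proof -
  obtain b :: 'a where b: "b \<in> Basis" using nonempty_Basis by blast
  note N = mom_phom_convex(1)[OF k p K]
  have "mom p k K x = mom p k K b * norm x powr p" for x
  proof (cases "x = 0")
    case False
    have "norm b = norm (sgn x)" using b False by (simp add: norm_sgn)
    then obtain U where U: "orthogonal_transformation U" "U b = sgn x"
      using orthogonal_transformation_exists_euclidean by metis
    have "mom p k K b = mom p k K (sgn x)"
      using mom_vimage_orthogonal[OF k adm_borel[OF K] U(1), of p b] inv[OF U(1)] Kinv[OF U(1)] U(2) by simp
    thus ?thesis using phom_sgn[OF N, of x] by simp
  qed (simp add: phom_zero[OF N])
  moreover have "mom p k K b > 0" using b by (intro phom_pos[OF N]) auto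
  ultimately show ?thesis using that by blast
qed

lemma dotk_orthogonal: "orthogonal_transformation U \<Longrightarrow> dotk (U x) (U y) = dotk x y"
  by (simp add: dotk_def orthogonal_transformation_def)

lemma pgram_orthogonal: "orthogonal_transformation U \<Longrightarrow> pgram (U x) (U y) = pgram x y"
  by (simp add: pgram_def orthogonal_transformation_norm) (simp add: orthogonal_transformation_def)

text \<open>For fixed \<open>x\<close> this is the norm of a linear function of \<open>y\<close>,
  namely |x| times the component of \<open>y\<close> orthogonal to \<open>x\<close>. Homogeneity and
  the triangle inequality become immediate.\<close>

lemma pgram_eq_norm:
  fixes x y :: "'a::euclidean_space"
  shows "pgram x y = norm (norm x *\<^sub>R y - ((x \<bullet> y) / norm x) *\<^sub>R x)"
proof (cases "x = 0")
  case False
  hence n: "norm x \<noteq> 0" by simp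
  have xx: "x \<bullet> x = norm x * norm x" by (simp add: dot_square_norm power2_eq_square)
  have "(norm (norm x *\<^sub>R y - ((x \<bullet> y) / norm x) *\<^sub>R x))\<^sup>2
    = norm x * (norm x * (y \<bullet> y)) - 2 * (norm x * ((x \<bullet> y) / norm x * (x \<bullet> y))) + (x \<bullet> y) / norm x * ((x \<bullet> y) / norm x * (norm x * norm x))"
    unfolding power2_norm_eq_inner inner_diff_left inner_diff_right inner_scaleR_left inner_scaleR_right xx inner_commute[of y x]
    by (simp add: algebra_simps)
  also have "\<dots> = (norm x)\<^sup>2 * (norm y)\<^sup>2 - (x \<bullet> y)\<^sup>2"
    using n by (simp add: power2_eq_square dot_square_norm field_simps)
  finally have "pgram x y = sqrt ((norm (norm x *\<^sub>R y - ((x \<bullet> y) / norm x) *\<^sub>R x))\<^sup>2)" by (simp add: pgram_def)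
  thus ?thesis by simp
qed (simp add: pgram_def)

lemma pgram_commute: "pgram x y = pgram y x"
  by (simp add: pgram_def inner_commute mult.commute)

text \<open>The kernel vanishes only when \<open>x\<close> lies on the line spanned by
  \<open>y\<close>, and a line is null in dimension at least 2.\<close>

lemma kernel_pgram:
  assumes dim: "DIM('a) \<ge> 2"
  shows "kernel (pgram :: 'a::euclidean_space \<Rightarrow> _)"
  unfolding kernel_def
proof (intro conjI allI impI)
  show "(\<lambda>z::'a \<times> 'a. pgram (fst z) (snd z)) \<in> borel_measurable borel"
    unfolding pgram_def by (intro borel_measurable_continuous_onI continuous_intros)
next
  fix x y z :: 'a
  show "0 \<le> pgram x y" by (simp add: pgram_eq_norm)
  have "pgram x y \<le> sqrt ((norm x * norm y)\<^sup>2)"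
    unfolding pgram_def by (intro real_sqrt_le_mono) (simp add: power_mult_distrib)
  thus "pgram x y \<le> norm x * norm y" by simp
  show "pgram x (c *\<^sub>R y) = \<bar>c\<bar> * pgram x y" for c
  proof -
    have "norm x *\<^sub>R (c *\<^sub>R y) - ((x \<bullet> (c *\<^sub>R y)) / norm x) *\<^sub>R x = c *\<^sub>R (norm x *\<^sub>R y - ((x \<bullet> y) / norm x) *\<^sub>R x)"
      by (simp add: scaleR_diff_right)
    thus ?thesis by (simp only: pgram_eq_norm norm_scaleR)
  qed
  show "pgram x (y + z) \<le> pgram x y + pgram x z"
  proof -
    have "norm x *\<^sub>R (y + z) - ((x \<bullet> (y + z)) / norm x) *\<^sub>R x
       = (norm x *\<^sub>R y - ((x \<bullet> y) / norm x) *\<^sub>R x) + (norm x *\<^sub>R z - ((x \<bullet> z) / norm x) *\<^sub>R x)"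
      by (simp add: inner_add_right add_divide_distrib scaleR_add_left scaleR_add_right)
    thus ?thesis unfolding pgram_eq_norm by (simp only: norm_triangle_ineq)
  qed
  show "pgram x y = pgram y x" by (rule pgram_commute)
next
  fix y :: 'a assume y: "y \<noteq> 0"
  have "dim (span {y}) \<le> 1" using dim_le_card[of "{y}" "{y}"] by (simp add: dim_span)
  hence "negligible (span {y})" using dim by (intro negligible_lowdim) simp
  hence "span {y} \<in> null_sets lborel"
    using null_sets_completion_iff[of "span {y}" lborel] closed_span[of "{y}"] by (simp add: negligible_iff_null_sets)
  moreover have "x \<in> span {y}" if "pgram x y = 0" for x
  proof -
    have "norm y *\<^sub>R x - ((y \<bullet> x) / norm y) *\<^sub>R y = 0" using that pgram_commute[of x y] by (simp add: pgram_eq_norm)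
    hence "norm y *\<^sub>R x = ((y \<bullet> x) / norm y) *\<^sub>R y" by simp
    hence "(1 / norm y) *\<^sub>R (norm y *\<^sub>R x) = (1 / norm y) *\<^sub>R (((y \<bullet> x) / norm y) *\<^sub>R y)" by simp
    hence "x = ((1 / norm y) * ((y \<bullet> x) / norm y)) *\<^sub>R y" using y by simp
    thus ?thesis by (metis span_base span_mul singletonI)
  qed
  ultimately show "AE x in lborel. pgram x y \<noteq> 0" by (intro AE_I'[of "span {y}"]) auto
qed

section \<open>Averages over bands\<close>

definition pball :: "'a::euclidean_space set" where "pball = cball 0 1 - {0}"
text \<open>Replaces the rotation-invariant measure on the sphere when the integrand has degree 0.
  The origin is removed because integrands are divided by powers of the norm.\<close>

definition mu :: "'a::euclidean_space measure" where "mu = restrict_space lborel pball"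

lemma pball_borel: "pball \<in> sets borel" by (simp add: pball_def)
lemma space_mu [simp]: "space mu = pball" by (simp add: mu_def space_restrict_space)

lemma mu_measurable: "f \<in> borel_measurable borel \<Longrightarrow> f \<in> borel_measurable mu"
  unfolding mu_def by (rule measurable_restrict_space1) simp

lemma mu_ident: "(\<lambda>x. x) \<in> mu \<rightarrow>\<^sub>M borel"
  unfolding mu_def by (rule measurable_restrict_space1) simp

lemma mu_pair_left: "case_prod f \<in> borel_measurable (borel \<Otimes>\<^sub>M borel) \<Longrightarrow> case_prod f \<in> borel_measurable (mu \<Otimes>\<^sub>M lborel)"
proof -
  assume f: "case_prod f \<in> borel_measurable (borel \<Otimes>\<^sub>M borel)"
  have "(\<lambda>p. (fst p, snd p)) \<in> mu \<Otimes>\<^sub>M lborel \<rightarrow>\<^sub>M borel \<Otimes>\<^sub>M borel"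
    by (intro measurable_Pair measurable_compose[OF measurable_fst mu_ident]) simp
  from measurable_compose[OF this f] show ?thesis by simp
qed

lemma mu_pair_right: "case_prod f \<in> borel_measurable (borel \<Otimes>\<^sub>M borel) \<Longrightarrow> case_prod f \<in> borel_measurable (borel \<Otimes>\<^sub>M mu)"
proof -
  assume f: "case_prod f \<in> borel_measurable (borel \<Otimes>\<^sub>M borel)"
  have "(\<lambda>p. (fst p, snd p)) \<in> borel \<Otimes>\<^sub>M mu \<rightarrow>\<^sub>M borel \<Otimes>\<^sub>M borel"
    by (intro measurable_Pair measurable_compose[OF measurable_snd mu_ident] measurable_fst)
  from measurable_compose[OF this f] show ?thesis by simp
qed

interpretation mu: finite_measure "mu :: 'a::euclidean_space measure"
proof
  have "emeasure lborel (pball :: 'a set) \<le> emeasure lborel (cball 0 1 :: 'a set)"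
    by (intro emeasure_mono) (auto simp: pball_def)
  also have "\<dots> < \<infinity>" by (simp add: emeasure_cball01_pos(1))
  finally show "emeasure mu (space mu :: 'a set) \<noteq> \<infinity>"
    by (simp add: mu_def space_restrict_space emeasure_restrict_space pball_borel)
qed

interpretation mumu: pair_sigma_finite "mu :: 'a::euclidean_space measure" "mu :: 'a measure" ..
interpretation mulb: pair_sigma_finite "mu :: 'a::euclidean_space measure" "lborel :: 'a measure" ..

lemma mu_integrable:
  fixes f :: "'a::euclidean_space \<Rightarrow> real"
  assumes "f \<in> borel_measurable mu" "\<And>y. y \<in> pball \<Longrightarrow> \<bar>f y\<bar> \<le> C"
  shows "integrable mu f"
  by (rule mu.integrable_const_bound[of f C]) (use assms in \<open>auto intro!: AE_I2\<close>)

lemma mu_integral: "(\<integral>x. f x \<partial>mu) = (\<integral>x. indicator pball x *\<^sub>R (f x :: real) \<partial>lborel)"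
  unfolding mu_def by (rule integral_restrict_space) (simp add: pball_borel)

lemma mu_rotate:
  fixes f :: "'a::euclidean_space \<Rightarrow> real" and U :: "'a \<Rightarrow> 'a"
  assumes U: "orthogonal_transformation U" and f: "f \<in> borel_measurable borel"
  shows "(\<integral>y. f (U y) \<partial>mu) = (\<integral>y. f y \<partial>mu)"
proof -
  note [measurable] = f pball_borel
  have "U y = 0 \<longleftrightarrow> y = 0" for y using orthogonal_transformation_norm[OF U, of y] by (metis norm_eq_zero)
  hence "U y \<in> pball \<longleftrightarrow> y \<in> pball" for y using orthogonal_transformation_norm[OF U, of y] by (simp add: pball_def)
  hence "(\<integral>y. f (U y) \<partial>mu) = (\<integral>y. indicator pball (U y) *\<^sub>R f (U y) \<partial>lborel)"
    unfolding mu_integral by (simp add: indicator_def)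
  also have "\<dots> = (\<integral>y. indicator pball y *\<^sub>R f y \<partial>lborel)"
    by (rule mpres_integral[OF mpres_orthogonal[OF U], of "\<lambda>y. indicator pball y *\<^sub>R f y"]) measurable
  finally show ?thesis by (simp add: mu_integral)
qed

text \<open>A thickened great subsphere orthogonal to \<open>x\<close>. It is symmetric in
  \<open>x\<close> and \<open>y\<close> and of degree 0 in each, so it can be integrated over either
  variable.\<close>

definition band :: "real \<Rightarrow> 'a::euclidean_space \<Rightarrow> 'a \<Rightarrow> real" where
  "band e x y = (if \<bar>x \<bullet> y\<bar> \<le> e * norm x * norm y then 1 else 0)"

lemma band_props: "0 \<le> band e x y" "band e x y \<le> 1" "\<bar>band e x y\<bar> \<le> 1"
  by (simp_all add: band_def)

lemma band_commute: "band e x y = band e y x"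
  by (simp add: band_def inner_commute mult_ac)

lemma band_measurable [measurable]: "case_prod (band e) \<in> borel_measurable (borel \<Otimes>\<^sub>M borel)"
  "(\<lambda>y. band e x y) \<in> borel_measurable borel"
  unfolding band_def by measurable

lemma band_integrable: "integrable mu (band e x)"
  by (rule mu_integrable[where C=1]) (use band_props(3) in \<open>auto intro: mu_measurable band_measurable(2)\<close>)

lemma band_orthogonal: "orthogonal_transformation U \<Longrightarrow> band e (U x) (U y) = band e x y"
  by (simp add: band_def orthogonal_transformation_norm) (simp add: orthogonal_transformation_def)

lemma band_sgn: "x \<noteq> 0 \<Longrightarrow> band e (sgn x) y = band e x y"
proof -
  assume x: "x \<noteq> 0"
  have n: "norm (sgn x) = 1" using x by (simp add: norm_sgn)
  have "\<bar>sgn x \<bullet> y\<bar> = \<bar>x \<bullet> y\<bar> / norm x" by (simp add: sgn_div_norm abs_mult divide_inverse)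
  thus ?thesis using x n by (simp add: band_def pos_divide_le_eq mult_ac)
qed

section \<open>Jensen's inequality with a variance term\<close>

lemma abs_powr_diff_le:
  fixes u v m p :: real
  assumes p: "p \<ge> 1" and "0 \<le> u" "u \<le> m" "0 \<le> v" "v \<le> m"
  shows "\<bar>u powr p - v powr p\<bar> \<le> p * m powr (p - 1) * \<bar>u - v\<bar>"
proof -
  have main: "b powr p - a powr p \<le> p * m powr (p - 1) * (b - a)" if ab: "0 \<le> a" "a < b" "b \<le> m" for a b :: real
  proof -
    have d: "((\<lambda>x. x powr p) has_real_derivative p * x powr (p - 1)) (at x)" if "x > a" for x
      using that ab by (intro has_real_derivative_powr) simp
    have "continuous_on {a..b} (\<lambda>x. x powr p)"
      using ab p by (intro continuous_on_powr' continuous_intros) auto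
    then obtain l z where z: "a < z" "z < b" "DERIV (\<lambda>x. x powr p) z :> l" "b powr p - a powr p = (b - a) * l"
      using MVT[OF ab(2), of "\<lambda>x. x powr p"] d real_differentiable_def by blast
    have l: "l = p * z powr (p - 1)" using DERIV_unique[OF z(3) d[OF z(1)]] .
    have "z powr (p - 1) \<le> m powr (p - 1)" using z ab p by (intro powr_mono2) auto
    hence "(b - a) * (p * z powr (p - 1)) \<le> (b - a) * (p * m powr (p - 1))"
      using ab p by (intro mult_left_mono) auto
    thus ?thesis using z(4) l by (simp add: mult_ac)
  qed
  consider "u < v" | "v < u" | "u = v" by linarith
  thus ?thesis
  proof cases
    case 1
    have "u powr p \<le> v powr p" using 1 assms by (intro powr_mono2) auto
    thus ?thesis using main[of u v] 1 assms by simp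
  next
    case 2
    have "v powr p \<le> u powr p" using 2 assms by (intro powr_mono2) auto
    thus ?thesis using main[of v u] 2 assms by simp
  qed simp
qed

text \<open>The function t^(-s) lies above its tangent at \<open>a\<close>: use exp u >= 1 + u with
  u = -s ln(t/a), and ln(t/a) <= t/a - 1.\<close>

lemma powr_neg_tangent:
  fixes t a s :: real
  assumes "t > 0" "a > 0" "s > 0"
  shows "a powr (- s) * (1 - s * (t / a - 1)) \<le> t powr (- s)"
proof -
  have "1 - s * (t / a - 1) \<le> 1 - s * ln (t / a)"
    using ln_le_minus_one[of "t / a"] assms by (simp add: mult_left_mono)
  also have "\<dots> = 1 + (- s * ln (t / a))" by simp
  also have "\<dots> \<le> exp (- s * ln (t / a))" by (rule exp_ge_add_one_self)
  also have "\<dots> = (t / a) powr (- s)" using assms by (simp add: powr_def)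
  finally have "a powr (- s) * (1 - s * (t / a - 1)) \<le> a powr (- s) * (t / a) powr (- s)"
    by (intro mult_left_mono) auto
  also have "\<dots> = (a * (t / a)) powr (- s)" using assms by (simp only: powr_mult)
  finally show ?thesis using assms by simp
qed

text \<open>The mean of \<open>f\<^sup>2\<close> is the squared mean of \<open>f\<close> plus its
  variance, written as a symmetric double integral. Jensen's inequality is applied only to
  \<open>f\<close>, by integrating the tangent at the mean of \<open>\<phi>\<close>, and is then
  squared; for this reason the exponent is split as 2s.\<close>

lemma weighted_Jensen_variance:
  fixes w \<phi> :: "'a::euclidean_space \<Rightarrow> real"
  assumes wm [measurable]: "w \<in> borel_measurable mu" and pm [measurable]: "\<phi> \<in> borel_measurable mu"
    and w: "\<And>y. 0 \<le> w y" "\<And>y. w y \<le> 1"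
    and phi: "\<And>y. y \<in> pball \<Longrightarrow> a \<le> \<phi> y" "\<And>y. y \<in> pball \<Longrightarrow> \<phi> y \<le> b" and a: "a > 0"
    and c: "c = (\<integral>y. w y \<partial>mu)" "c > 0" and s: "s > 0"
  defines "f \<equiv> \<lambda>y. \<phi> y powr (- s)"
  shows "((\<integral>y. w y * \<phi> y \<partial>mu) / c) powr (- 2 * s) + (1 / (2 * c\<^sup>2)) * (\<integral>y. (\<integral>z. w y * w z * (f y - f z)\<^sup>2 \<partial>mu) \<partial>mu)
    \<le> (1 / c) * (\<integral>y. w y * (f y)\<^sup>2 \<partial>mu)"
proof -
  have fm [measurable]: "f \<in> borel_measurable mu" unfolding f_def by measurable
  have f: "0 \<le> f y" "f y \<le> a powr (- s)" if "y \<in> pball" for y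
    using phi[OF that] a s by (auto simp: f_def powr_minus_divide intro!: divide_left_mono powr_mono2)
  have iw: "integrable mu w" by (rule mu_integrable[where C=1]) (use w in auto)
  have iwp: "integrable mu (\<lambda>y. w y * \<phi> y)"
  proof (rule mu_integrable[where C=b])
    fix y :: 'a assume y: "y \<in> pball"
    have "\<bar>w y * \<phi> y\<bar> = w y * \<phi> y" using w phi[OF y] a by (simp add: abs_mult)
    also have "\<dots> \<le> 1 * b" using w phi[OF y] a by (intro mult_mono) auto
    finally show "\<bar>w y * \<phi> y\<bar> \<le> b" by simp
  qed measurable
  have iwf: "integrable mu (\<lambda>y. w y * f y)"
  proof (rule mu_integrable[where C="a powr (- s)"])
    fix y :: 'a assume y: "y \<in> pball"
    have "\<bar>w y * f y\<bar> = w y * f y" using w f[OF y] by (simp add: abs_mult)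
    also have "\<dots> \<le> 1 * a powr (- s)" using w f[OF y] by (intro mult_mono) auto
    finally show "\<bar>w y * f y\<bar> \<le> a powr (- s)" by simp
  qed measurable
  have iwf2: "integrable mu (\<lambda>y. w y * (f y)\<^sup>2)"
  proof (rule mu_integrable[where C="(a powr (- s))\<^sup>2"])
    fix y :: 'a assume y: "y \<in> pball"
    have "\<bar>w y * (f y)\<^sup>2\<bar> = w y * (f y)\<^sup>2" using w by (simp add: abs_mult)
    also have "\<dots> \<le> 1 * (a powr (- s))\<^sup>2" using w f[OF y] by (intro mult_mono power_mono) auto
    finally show "\<bar>w y * (f y)\<^sup>2\<bar> \<le> (a powr (- s))\<^sup>2" by simp
  qed measurable
  define F1 F2 where "F1 = (\<integral>y. w y * f y \<partial>mu)" and "F2 = (\<integral>y. w y * (f y)\<^sup>2 \<partial>mu)"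
  define A where "A = (\<integral>y. w y * \<phi> y \<partial>mu) / c"
  have A: "A > 0"
  proof -
    have "a * c = (\<integral>y. w y * a \<partial>mu)" using c(1) by simp
    also have "\<dots> \<le> (\<integral>y. w y * \<phi> y \<partial>mu)"
      using iw iwp w phi by (intro integral_mono) (auto intro: mult_left_mono)
    finally have "a * c \<le> (\<integral>y. w y * \<phi> y \<partial>mu)" .
    moreover have "0 < a * c" using a c(2) by simp
    ultimately have "0 < (\<integral>y. w y * \<phi> y \<partial>mu)" by linarith
    thus ?thesis unfolding A_def using c(2) by (rule divide_pos_pos)
  qed
  have "A powr (- s) \<le> F1 / c"
  proof -
    have i2: "integrable mu (\<lambda>y. A powr (- s) * (1 + s) * w y - A powr (- s) * s / A * (w y * \<phi> y))"
      using iw iwp by auto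
    have "(\<integral>y. A powr (- s) * (1 + s) * w y - A powr (- s) * s / A * (w y * \<phi> y) \<partial>mu) \<le> F1"
      unfolding F1_def
    proof (rule integral_mono[OF i2 iwf])
      fix y assume "y \<in> space (mu :: 'a measure)"
      hence y: "y \<in> pball" by simp
      have "w y * (A powr (- s) * (1 - s * (\<phi> y / A - 1))) \<le> w y * f y"
        unfolding f_def using powr_neg_tangent[of "\<phi> y" A s] A s phi(1)[OF y] a w by (intro mult_left_mono) auto
      thus "A powr (- s) * (1 + s) * w y - A powr (- s) * s / A * (w y * \<phi> y) \<le> w y * f y"
        by (simp add: algebra_simps)
    qed
    moreover have "(\<integral>y. A powr (- s) * (1 + s) * w y - A powr (- s) * s / A * (w y * \<phi> y) \<partial>mu)
      = A powr (- s) * (1 + s) * c - A powr (- s) * s / A * (A * c)"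
      using iw iwp c by (simp add: A_def)
    moreover have "\<dots> = A powr (- s) * c" using A by (simp add: algebra_simps)
    ultimately show ?thesis using c(2) by (simp add: pos_le_divide_eq)
  qed
  hence "(A powr (- s))\<^sup>2 \<le> (F1 / c)\<^sup>2" by (intro power_mono) auto
  moreover have "(A powr (- s))\<^sup>2 = A powr (- 2 * s)"
    by (simp add: power2_eq_square flip: powr_add)
  ultimately have J: "A powr (- 2 * s) \<le> (F1 / c)\<^sup>2" by simp
  have inner: "(\<integral>z. w y * w z * (f y - f z)\<^sup>2 \<partial>mu) = c * (w y * (f y)\<^sup>2) - 2 * F1 * (w y * f y) + F2 * w y" for y
  proof -
    have "w y * w z * (f y - f z)\<^sup>2 = (w y * (f y)\<^sup>2) * w z - (2 * (w y * f y)) * (w z * f z) + w y * (w z * (f z)\<^sup>2)" for z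
      by (simp add: power2_eq_square algebra_simps)
    hence "(\<integral>z. w y * w z * (f y - f z)\<^sup>2 \<partial>mu)
      = (\<integral>z. (w y * (f y)\<^sup>2) * w z - (2 * (w y * f y)) * (w z * f z) + w y * (w z * (f z)\<^sup>2) \<partial>mu)" by presburger
    also have "\<dots> = (w y * (f y)\<^sup>2) * c - (2 * (w y * f y)) * F1 + w y * F2"
      using iw iwf iwf2 c(1) by (simp add: F1_def F2_def)
    finally show ?thesis by (simp add: mult_ac)
  qed
  have "(\<integral>y. (\<integral>z. w y * w z * (f y - f z)\<^sup>2 \<partial>mu) \<partial>mu) = c * F2 - 2 * F1 * F1 + F2 * c"
    unfolding inner using iw iwf iwf2 c(1) by (simp add: F1_def F2_def)
  hence "(1 / (2 * c\<^sup>2)) * (\<integral>y. (\<integral>z. w y * w z * (f y - f z)\<^sup>2 \<partial>mu) \<partial>mu) = F2 / c - (F1 / c)\<^sup>2"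
    using c(2) by (simp add: power2_eq_square field_simps)
  thus ?thesis using J by (simp add: A_def F2_def)
qed

section \<open>Means over one band\<close>

text \<open>The two basis vectors serve as a reference pair: masses and moments of all bands are
  reduced to theirs by rotation.\<close>

locale bands =
  fixes b0 b1 :: "'a::euclidean_space"
  assumes b: "b0 \<in> Basis" "b1 \<in> Basis" "b0 \<noteq> b1"
begin

lemma axes_unit: "norm b0 = 1" "norm b1 = 1" "b0 \<bullet> b1 = 0" "b1 \<bullet> b0 = 0" using b by (auto simp: inner_Basis)

lemma dim2: "DIM('a) \<ge> 2"
proof -
  have "card {b0, b1} \<le> DIM('a)" using b by (intro card_mono) auto
  thus ?thesis using b by simp
qed

definition band_mass :: "real \<Rightarrow> real" where "band_mass e = (\<integral>y. band e b0 y \<partial>mu)"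

lemma band_integral:
  fixes x :: 'a
  assumes x: "x \<noteq> 0" shows "(\<integral>y. band e x y \<partial>mu) = band_mass e"
proof -
  from x
  have "norm b0 = norm (sgn x)" by (simp add: norm_sgn axes_unit)
  then obtain U where U: "orthogonal_transformation U" "U b0 = sgn x"
    using orthogonal_transformation_exists_euclidean by metis
  have "band_mass e = (\<integral>y. band e (U b0) (U y) \<partial>mu)" by (simp add: band_mass_def band_orthogonal[OF U(1)])
  also have "\<dots> = (\<integral>y. band e (U b0) y \<partial>mu)" by (rule mu_rotate[OF U(1)]) measurable
  finally show ?thesis by (simp add: U(2) band_sgn[OF x])
qed

lemma band_mass_pos: "e > 0 \<Longrightarrow> band_mass e > 0"
proof -
  assume e: "e > 0"
  let ?O = "{y. norm y < 1} \<inter> {y. \<bar>b0 \<bullet> y\<bar> < e * norm y}"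
  have Oo: "open ?O" by (intro open_Int open_Collect_less continuous_intros)
  have "(1/2) *\<^sub>R b1 \<in> ?O" using e by (simp add: axes_unit)
  hence One: "?O \<noteq> {}" by blast
  have "AE y in mu. 0 \<le> band e b0 y" by (simp add: band_props)
  hence "band_mass e \<ge> 0" unfolding band_mass_def by (rule integral_nonneg_AE)
  moreover have "band_mass e \<noteq> 0"
  proof
    assume "band_mass e = 0"
    hence "AE y in mu. band e b0 y = 0"
      using integral_nonneg_eq_0_iff_AE[OF band_integrable[of e b0]] by (simp add: band_mass_def band_props)
    hence "AE y in lborel. y \<in> pball \<longrightarrow> band e b0 y = 0"
      unfolding mu_def using pball_borel by (subst (asm) AE_restrict_space_iff) auto
    hence "AE y in lborel. y \<notin> ?O"
    proof eventually_elim
      case (elim y)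
      show ?case
      proof
        assume y: "y \<in> ?O"
        hence "y \<noteq> 0" by auto
        hence "y \<in> pball" using y by (simp add: pball_def)
        hence "band e b0 y = 0" using elim by simp
        thus False using y by (simp add: band_def axes_unit split: if_splits)
      qed
    qed
    hence "emeasure lborel ?O = 0" using Oo by (subst (asm) AE_iff_measurable[of ?O]) auto
    thus False using open_emeasure_neq_0[OF Oo One] by simp
  qed
  ultimately show ?thesis by simp
qed

text \<open>The mean over the band of \<open>x\<close> of the degree 0 function (|y . k| /
  |y|)^p.\<close>

definition band_moment :: "real \<Rightarrow> real \<Rightarrow> 'a \<Rightarrow> 'a \<Rightarrow> real" where
  "band_moment p e x k = (\<integral>y. band e x y * (\<bar>y \<bullet> k\<bar> powr p / norm y powr p) \<partial>mu) / band_mass e"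

definition axis_moment :: "real \<Rightarrow> real \<Rightarrow> real" where "axis_moment p e = band_moment p e b0 b1"

lemma ratio_le:
  assumes "p \<ge> 1" "y \<in> pball"
  shows "0 \<le> \<bar>y \<bullet> k\<bar> powr p / norm y powr p" "\<bar>y \<bullet> k\<bar> powr p / norm y powr p \<le> norm k powr p"
proof -
  have y: "norm y > 0" using assms by (simp add: pball_def)
  have "\<bar>y \<bullet> k\<bar> powr p \<le> (norm y * norm k) powr p"
    using assms by (intro powr_mono2 Cauchy_Schwarz_ineq2) auto
  thus "\<bar>y \<bullet> k\<bar> powr p / norm y powr p \<le> norm k powr p"
    using y by (simp add: powr_mult pos_divide_le_eq mult.commute)
qed simp

lemma band_moment_integrable:
  assumes "p \<ge> 1"
  shows "integrable mu (\<lambda>y::'a. band e x y * (\<bar>y \<bullet> k\<bar> powr p / norm y powr p))"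
proof (rule mu_integrable[where C="norm k powr p"])
  show "(\<lambda>y. band e x y * (\<bar>y \<bullet> k\<bar> powr p / norm y powr p)) \<in> borel_measurable mu"
    by (rule mu_measurable) measurable
  fix y :: 'a assume y: "y \<in> pball"
  have "\<bar>band e x y * (\<bar>y \<bullet> k\<bar> powr p / norm y powr p)\<bar> \<le> 1 * norm k powr p"
    unfolding abs_mult using ratio_le[OF assms y, of k] band_props by (intro mult_mono) auto
  thus "\<bar>band e x y * (\<bar>y \<bullet> k\<bar> powr p / norm y powr p)\<bar> \<le> norm k powr p" by simp
qed

text \<open>A rotation takes the reference pair to the directions of \<open>x\<close> and
  \<open>k\<close>, so only the length of \<open>k\<close> remains.\<close>

lemma band_moment_perp:
  assumes p: "p \<ge> 1" and x: "x \<noteq> 0" and k: "x \<bullet> k = 0"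
  shows "band_moment p e x k = axis_moment p e * norm k powr p"
proof (cases "k = 0")
  case False
  have "norm (sgn x) = 1" "norm (sgn k) = 1" "sgn x \<bullet> sgn k = 0"
    using x False k by (auto simp: norm_sgn sgn_div_norm)
  then obtain U where U: "orthogonal_transformation U" "U b0 = sgn x" "U b1 = sgn k"
    using orthonormal_pair_rotation axes_unit by metis
  have ip: "U x \<bullet> U y = x \<bullet> y" for x y using U(1) by (simp add: orthogonal_transformation_def)
  have "(\<integral>y. band e b0 y * (\<bar>y \<bullet> b1\<bar> powr p / norm y powr p) \<partial>mu)
     = (\<integral>y. band e (U b0) (U y) * (\<bar>U y \<bullet> U b1\<bar> powr p / norm (U y) powr p) \<partial>mu)"
    by (simp add: band_orthogonal[OF U(1)] ip orthogonal_transformation_norm[OF U(1)])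
  also have "\<dots> = (\<integral>y. band e (U b0) y * (\<bar>y \<bullet> U b1\<bar> powr p / norm y powr p) \<partial>mu)"
    by (rule mu_rotate[OF U(1), of "\<lambda>y. band e (U b0) y * (\<bar>y \<bullet> U b1\<bar> powr p / norm y powr p)"]) measurable
  finally have D: "axis_moment p e = (\<integral>y. band e x y * (\<bar>y \<bullet> sgn k\<bar> powr p / norm y powr p) \<partial>mu) / band_mass e"
    by (simp add: axis_moment_def band_moment_def U band_sgn[OF x])
  have "\<bar>y \<bullet> k\<bar> powr p = norm k powr p * \<bar>y \<bullet> sgn k\<bar> powr p" for y
  proof -
    have "y \<bullet> k = norm k * (y \<bullet> sgn k)" using False by (simp add: sgn_div_norm)
    thus ?thesis by (simp add: abs_mult powr_mult)
  qed
  hence "band_moment p e x k = (\<integral>y. norm k powr p * (band e x y * (\<bar>y \<bullet> sgn k\<bar> powr p / norm y powr p)) \<partial>mu) / band_mass e"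
    by (simp add: band_moment_def mult_ac)
  thus ?thesis unfolding D integral_mult_right_zero by simp
qed (use p in \<open>simp add: band_moment_def\<close>)

text \<open>Split k into a part along x and a part j orthogonal to x, of length [x,k]/|x|. The part
  j is covered exactly by rotation invariance. On the band the other part changes y . k by at most e
  |k| |y|, and the p-th powers by at most p times that, up to the common scale.\<close>

lemma band_moment_approx:
  assumes p: "p \<ge> 1" and x: "x \<noteq> 0" and e: "e > 0"
  shows "\<bar>band_moment p e x k - axis_moment p e * (pgram x k powr p / norm x powr p)\<bar> \<le> p * e * norm k powr p"
proof -
  define j where "j = k - ((x \<bullet> k) / (norm x)\<^sup>2) *\<^sub>R x"
  have nx: "norm x > 0" using x by simp
  have xx: "x \<bullet> x = (norm x)\<^sup>2" by (simp add: dot_square_norm)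
  have perp: "x \<bullet> j = 0" using nx by (simp add: j_def inner_diff_right xx)
  have nj: "norm j = pgram x k / norm x"
  proof -
    have "norm x *\<^sub>R j = norm x *\<^sub>R k - ((x \<bullet> k) / norm x) *\<^sub>R x"
      using nx by (simp add: j_def scaleR_diff_right power2_eq_square)
    hence "norm x * norm j = pgram x k" by (metis abs_norm_cancel norm_scaleR pgram_eq_norm)
    thus ?thesis using nx by (simp add: field_simps)
  qed
  have pk: "pgram x k \<le> norm x * norm k" by (rule kernelD(3)[OF kernel_pgram[OF dim2]])
  have njk: "norm j \<le> norm k" using pk nx by (simp add: nj pos_divide_le_eq mult.commute)
  have pt: "\<bar>band e x y * (\<bar>y \<bullet> k\<bar> powr p / norm y powr p) - band e x y * (\<bar>y \<bullet> j\<bar> powr p / norm y powr p)\<bar> \<le> (p * e * norm k powr p) * band e x y"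
    if y: "y \<in> pball" for y
  proof (cases "\<bar>x \<bullet> y\<bar> \<le> e * norm x * norm y")
    case True
    have ny: "norm y > 0" using y by (simp add: pball_def)
    have d: "\<bar>\<bar>y \<bullet> k\<bar> - \<bar>y \<bullet> j\<bar>\<bar> \<le> e * (norm k * norm y)"
    proof -
      have "\<bar>\<bar>y \<bullet> k\<bar> - \<bar>y \<bullet> j\<bar>\<bar> \<le> \<bar>y \<bullet> k - y \<bullet> j\<bar>" by linarith
      also have "y \<bullet> k - y \<bullet> j = ((x \<bullet> k) / (norm x)\<^sup>2) * (x \<bullet> y)" by (simp add: j_def inner_diff_right inner_commute)
      also have "\<bar>\<dots>\<bar> = \<bar>x \<bullet> k\<bar> / (norm x)\<^sup>2 * \<bar>x \<bullet> y\<bar>" by (simp add: abs_mult)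
      also have "\<dots> \<le> (norm x * norm k) / (norm x)\<^sup>2 * (e * norm x * norm y)"
        using True Cauchy_Schwarz_ineq2[of x k] by (intro mult_mono divide_right_mono) auto
      also have "\<dots> = e * (norm k * norm y)" using nx by (simp add: power2_eq_square field_simps)
      finally show ?thesis .
    qed
    have "\<bar>\<bar>y \<bullet> k\<bar> powr p - \<bar>y \<bullet> j\<bar> powr p\<bar> \<le> p * (norm y * norm k) powr (p - 1) * \<bar>\<bar>y \<bullet> k\<bar> - \<bar>y \<bullet> j\<bar>\<bar>"
    proof (rule abs_powr_diff_le[OF p])
      show "\<bar>y \<bullet> j\<bar> \<le> norm y * norm k"
        using Cauchy_Schwarz_ineq2[of y j] njk by (meson mult_left_mono norm_ge_zero order_trans)
    qed (auto simp: Cauchy_Schwarz_ineq2)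
    also have "\<dots> \<le> p * (norm y * norm k) powr (p - 1) * (e * (norm k * norm y))"
      using d p by (intro mult_left_mono) auto
    also have "\<dots> = (p * e) * ((norm y * norm k) powr (p - 1) * (norm y * norm k))" by (simp add: mult_ac)
    also have "(norm y * norm k) powr (p - 1) * (norm y * norm k) = (norm y * norm k) powr p"
      using powr_add[of "norm y * norm k" "p - 1" 1] by simp
    also have "\<dots> = norm y powr p * norm k powr p" by (simp add: powr_mult)
    finally have "\<bar>\<bar>y \<bullet> k\<bar> powr p - \<bar>y \<bullet> j\<bar> powr p\<bar> \<le> (p * e * norm k powr p) * norm y powr p" by (simp add: mult_ac)
    hence "\<bar>\<bar>y \<bullet> k\<bar> powr p - \<bar>y \<bullet> j\<bar> powr p\<bar> / norm y powr p \<le> p * e * norm k powr p"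
      using ny by (simp add: pos_divide_le_eq)
    moreover have "\<bar>\<bar>y \<bullet> k\<bar> powr p / norm y powr p - \<bar>y \<bullet> j\<bar> powr p / norm y powr p\<bar> = \<bar>\<bar>y \<bullet> k\<bar> powr p - \<bar>y \<bullet> j\<bar> powr p\<bar> / norm y powr p"
      by (simp flip: diff_divide_distrib)
    ultimately show ?thesis using True by (simp add: band_def)
  qed (simp add: band_def)
  have iW: "integrable mu (band e x)" by (rule band_integrable)
  note i1 = band_moment_integrable[OF p, of e x k] and i2 = band_moment_integrable[OF p, of e x j]
  have "band_moment p e x k - band_moment p e x j = (\<integral>y. band e x y * (\<bar>y \<bullet> k\<bar> powr p / norm y powr p) - band e x y * (\<bar>y \<bullet> j\<bar> powr p / norm y powr p) \<partial>mu) / band_mass e"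
    unfolding band_moment_def by (simp only: Bochner_Integration.integral_diff[OF i1 i2] diff_divide_distrib)
  hence "\<bar>band_moment p e x k - band_moment p e x j\<bar> = \<bar>\<integral>y. band e x y * (\<bar>y \<bullet> k\<bar> powr p / norm y powr p) - band e x y * (\<bar>y \<bullet> j\<bar> powr p / norm y powr p) \<partial>mu\<bar> / band_mass e"
    using band_mass_pos[OF e] by simp
  also have "\<dots> \<le> (\<integral>y. \<bar>band e x y * (\<bar>y \<bullet> k\<bar> powr p / norm y powr p) - band e x y * (\<bar>y \<bullet> j\<bar> powr p / norm y powr p)\<bar> \<partial>mu) / band_mass e"
    using band_mass_pos[OF e] by (intro divide_right_mono integral_abs_bound) auto
  also have "\<dots> \<le> (\<integral>y. (p * e * norm k powr p) * band e x y \<partial>mu) / band_mass e"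
  proof (rule divide_right_mono[OF integral_mono])
    show "integrable mu (\<lambda>y. \<bar>band e x y * (\<bar>y \<bullet> k\<bar> powr p / norm y powr p) - band e x y * (\<bar>y \<bullet> j\<bar> powr p / norm y powr p)\<bar>)"
      using i1 i2 by auto
    show "integrable mu (\<lambda>y. (p * e * norm k powr p) * band e x y)" using iW by auto
    show "0 \<le> band_mass e" using band_mass_pos[OF e] by simp
  qed (use pt in simp)
  also have "\<dots> = p * e * norm k powr p" using band_integral[OF x, of e] band_mass_pos[OF e] by simp
  finally have "\<bar>band_moment p e x k - band_moment p e x j\<bar> \<le> p * e * norm k powr p" .
  moreover have "band_moment p e x j = axis_moment p e * (pgram x k powr p / norm x powr p)"
    using band_moment_perp[OF p x perp, of e] nj by (simp add: powr_divide)
  ultimately show ?thesis by simp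
qed

definition band_mean :: "real \<Rightarrow> 'a set \<Rightarrow> real \<Rightarrow> 'a \<Rightarrow> real" where
  "band_mean p K e x = (\<integral>y. band e x y * (mom p dotk K y / norm y powr p) \<partial>mu) / band_mass e"

lemma mom_ratio_bounds:
  assumes p: "p \<ge> 1" and K: "adm p K"
  obtains a c where "a > 0" "c > 0" "\<And>y. y \<in> pball \<Longrightarrow> a \<le> mom p dotk K y / norm y powr p"
    "\<And>y. y \<in> pball \<Longrightarrow> mom p dotk K y / norm y powr p \<le> c"
proof -
  obtain a c where ac: "a > 0" "c > 0" "\<And>x. a * norm x powr p \<le> mom p dotk K x" "\<And>x. mom p dotk K x \<le> c * norm x powr p"
    using phom_bounds[OF mom_phom_convex(1)[OF kernel_dotk p K]] by metis
  show ?thesis by (rule that[OF ac(1,2)]) (use ac(3,4) in \<open>auto simp: pball_def pos_le_divide_eq pos_divide_le_eq\<close>)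
qed

text \<open>The pointwise estimate for [x,k] integrated over k in \<open>K\<close>; Tonelli
  exchanges the mean over the band with the integral defining the moment.\<close>

lemma band_mean_approx:
  assumes p: "p \<ge> 1" and K: "adm p K" and x: "x \<noteq> 0" and e: "e > 0"
  shows "\<bar>band_mean p K e x - axis_moment p e * (mom p pgram K x / norm x powr p)\<bar> \<le> p * e * (LINT k:K|lborel. norm k powr p)"
proof -
  have p0: "p > 0" using p by simp
  note [measurable] = adm_borel[OF K] kernel_measurable[OF kernel_dotk]
  note N = mom_phom_convex(1)[OF kernel_dotk p K]
  note Nm [measurable] = phom_borel[OF N]
  have c: "band_mass e > 0" by (rule band_mass_pos[OF e])
  obtain a d where ad: "a > 0" "d > 0" "\<And>y. y \<in> pball \<Longrightarrow> a \<le> mom p dotk K y / norm y powr p"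
    "\<And>y. y \<in> pball \<Longrightarrow> mom p dotk K y / norm y powr p \<le> d" using mom_ratio_bounds[OF p K] by metis
  let ?w = "\<lambda>y. band e x y * (mom p dotk K y / norm y powr p)"
  have iA: "integrable mu ?w"
  proof (rule mu_integrable[where C=d])
    show "?w \<in> borel_measurable mu" by (rule mu_measurable) measurable
    fix y :: 'a assume y: "y \<in> pball"
    have "\<bar>?w y\<bar> \<le> 1 * d" unfolding abs_mult using ad(1) ad(3)[OF y] ad(4)[OF y] band_props by (intro mult_mono) auto
    thus "\<bar>?w y\<bar> \<le> d" by simp
  qed
  have w0: "0 \<le> ?w y" for y
    by (intro mult_nonneg_nonneg divide_nonneg_nonneg band_props(1) phom_nonneg[OF N]) simp
  have al0: "0 \<le> band_moment p e x k" for k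
    unfolding band_moment_def using c by (intro divide_nonneg_nonneg integral_nonneg_AE AE_I2 mult_nonneg_nonneg band_props) auto
  let ?F = "\<lambda>y k. ennreal (indicator K k * (band e x y * (\<bar>y \<bullet> k\<bar> powr p / norm y powr p)))"
  have Fm: "case_prod ?F \<in> borel_measurable (mu \<Otimes>\<^sub>M lborel)"
    by (rule mu_pair_left) measurable
  have "ennreal (\<integral>y. ?w y \<partial>mu) = (\<integral>\<^sup>+y. ennreal (?w y) \<partial>mu)"
    using iA w0 by (intro nn_integral_eq_integral[symmetric]) auto
  also have "\<dots> = (\<integral>\<^sup>+y. (\<integral>\<^sup>+k. ?F y k \<partial>lborel) \<partial>mu)"
  proof (rule nn_integral_cong)
    fix y :: 'a
    have i: "integrable lborel (\<lambda>k. indicator K k * \<bar>k \<bullet> y\<bar> powr p)"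
      using mom_integrable[OF kernel_dotk p0 K, of y] by (simp add: set_integrable_def dotk_def)
    have "(\<integral>\<^sup>+k. ?F y k \<partial>lborel) = (\<integral>\<^sup>+k. ennreal ((band e x y / norm y powr p) * (indicator K k * \<bar>k \<bullet> y\<bar> powr p)) \<partial>lborel)"
      by (intro nn_integral_cong arg_cong[where f=ennreal]) (simp add: inner_commute)
    also have "\<dots> = ennreal (\<integral>k. (band e x y / norm y powr p) * (indicator K k * \<bar>k \<bullet> y\<bar> powr p) \<partial>lborel)"
      by (intro nn_integral_eq_integral integrable_mult_right i AE_I2 mult_nonneg_nonneg divide_nonneg_nonneg band_props(1)) auto
    also have "(\<integral>k. (band e x y / norm y powr p) * (indicator K k * \<bar>k \<bullet> y\<bar> powr p) \<partial>lborel) = ?w y"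
      by (simp add: mom_def dotk_def set_lebesgue_integral_def)
    finally show "ennreal (?w y) = (\<integral>\<^sup>+k. ?F y k \<partial>lborel)" by simp
  qed
  also have "\<dots> = (\<integral>\<^sup>+k. (\<integral>\<^sup>+y. ?F y k \<partial>mu) \<partial>lborel)"
    by (rule mulb.Fubini'[symmetric, OF Fm])
  also have "\<dots> = (\<integral>\<^sup>+k. ennreal (indicator K k * (band_moment p e x k * band_mass e)) \<partial>lborel)"
  proof (rule nn_integral_cong)
    fix k :: 'a
    have "(\<integral>\<^sup>+y. ?F y k \<partial>mu) = ennreal (\<integral>y. indicator K k * (band e x y * (\<bar>y \<bullet> k\<bar> powr p / norm y powr p)) \<partial>mu)"
      by (intro nn_integral_eq_integral integrable_mult_right band_moment_integrable[OF p] AE_I2 mult_nonneg_nonneg divide_nonneg_nonneg band_props(1)) auto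
    thus "(\<integral>\<^sup>+y. ?F y k \<partial>mu) = ennreal (indicator K k * (band_moment p e x k * band_mass e))"
      unfolding integral_mult_right_zero band_moment_def using c by simp
  qed
  finally have nn: "(\<integral>\<^sup>+k. ennreal (indicator K k * (band_moment p e x k * band_mass e)) \<partial>lborel) = ennreal (\<integral>y. ?w y \<partial>mu)" by simp
  have am: "(\<lambda>k. band_moment p e x k) \<in> borel_measurable borel"
  proof -
    have "(\<lambda>(k,y). band e x y * (\<bar>y \<bullet> k\<bar> powr p / norm y powr p)) \<in> borel_measurable (borel \<Otimes>\<^sub>M mu)"
      by (rule mu_pair_right) measurable
    hence "(\<lambda>k. \<integral>y. band e x y * (\<bar>y \<bullet> k\<bar> powr p / norm y powr p) \<partial>mu) \<in> borel_measurable borel"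
      by (rule mu.borel_measurable_lebesgue_integral)
    thus ?thesis unfolding band_moment_def by measurable
  qed
  note [measurable] = am
  have ia: "integrable lborel (\<lambda>k. indicator K k * (band_moment p e x k * band_mass e))"
    by (rule integrableI_nonneg) (use nn al0 c in auto)
  have Ia: "(\<integral>k. indicator K k * (band_moment p e x k * band_mass e) \<partial>lborel) = (\<integral>y. ?w y \<partial>mu)"
    by (rule integral_eq_nn_integral[THEN trans]) (use nn al0 c w0 in \<open>auto intro!: integral_nonneg_AE\<close>)
  have ia': "set_integrable lborel K (\<lambda>k. band_moment p e x k)"
    using integrable_mult_left[OF ia, of "1 / band_mass e"] c by (simp add: set_integrable_def)
  have AAeq: "band_mean p K e x = (LINT k:K|lborel. band_moment p e x k)"
  proof -
    have "(\<integral>k. indicator K k * (band_moment p e x k * band_mass e) \<partial>lborel) = (LINT k:K|lborel. band_moment p e x k) * band_mass e"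
      by (simp add: set_lebesgue_integral_def flip: integral_mult_left_zero mult.assoc)
    thus ?thesis using c Ia by (simp add: band_mean_def)
  qed
  have ip: "set_integrable lborel K (\<lambda>k. axis_moment p e * (pgram x k powr p / norm x powr p))"
    using mom_integrable[OF kernel_pgram[OF dim2] p0 K, of x]
    by (intro set_integrable_mult_right) (simp add: pgram_commute[of x] )
  have Hs: "axis_moment p e * (mom p pgram K x / norm x powr p) = (LINT k:K|lborel. axis_moment p e * (pgram x k powr p / norm x powr p))"
    by (simp add: mom_def pgram_commute[of x])
  have "\<bar>band_mean p K e x - axis_moment p e * (mom p pgram K x / norm x powr p)\<bar>
     = \<bar>LINT k:K|lborel. band_moment p e x k - axis_moment p e * (pgram x k powr p / norm x powr p)\<bar>"
    unfolding AAeq Hs by (simp only: set_integral_diff(2)[OF ia' ip])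
  also have "\<dots> \<le> (LINT k:K|lborel. \<bar>band_moment p e x k - axis_moment p e * (pgram x k powr p / norm x powr p)\<bar>)"
    using set_integral_norm_bound[OF set_integral_diff(1)[OF ia' ip]] by simp
  also have "\<dots> \<le> (LINT k:K|lborel. p * e * norm k powr p)"
  proof (rule set_integral_mono)
    show "set_integrable lborel K (\<lambda>k. \<bar>band_moment p e x k - axis_moment p e * (pgram x k powr p / norm x powr p)\<bar>)"
      using set_integrable_abs[OF set_integral_diff(1)[OF ia' ip]] .
    show "set_integrable lborel K (\<lambda>k. p * e * norm k powr p)"
      using K by (intro set_integrable_mult_right) (simp add: adm_def)
  qed (rule band_moment_approx[OF p x e])
  finally show ?thesis by simp
qed

end

lemma band_measurable_mu [measurable (raw)]:
  assumes "g \<in> M \<rightarrow>\<^sub>M mu" "h \<in> M \<rightarrow>\<^sub>M mu"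
  shows "(\<lambda>z. band e (g z) (h z)) \<in> borel_measurable M"
proof -
  have "(\<lambda>z. (g z, h z)) \<in> M \<rightarrow>\<^sub>M borel \<Otimes>\<^sub>M borel"
    by (intro measurable_Pair measurable_compose[OF assms(1) mu_ident] measurable_compose[OF assms(2) mu_ident])
  from measurable_compose[OF this band_measurable(1)] show ?thesis by simp
qed

context bands
begin

text \<open>Within the unit ball the band lies in a box of half-width \<open>e\<close> along
  \<open>b0\<close> and 1 along the other axes.\<close>

lemma band_mass_le:
  assumes e: "e > 0" shows "band_mass e \<le> 2 ^ DIM('a) * e"
proof -
  define u where "u = (\<Sum>i\<in>Basis. (if i = b0 then e else 1) *\<^sub>R i)"
  have ui: "u \<bullet> i = (if i = b0 then e else 1)" if "i \<in> Basis" for i using that by (simp add: u_def)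
  let ?C = "cbox (- u) u"
  have iC: "integrable lborel (indicator ?C :: 'a \<Rightarrow> real)"
    by (simp add: integrable_indicator_iff emeasure_lborel_cbox_eq)
  have iW: "integrable lborel (\<lambda>y. indicator pball y *\<^sub>R band e b0 y)"
    using band_integrable[of e b0] unfolding mu_def by (subst (asm) integrable_restrict_space) (auto simp: pball_borel)
  have "band_mass e = (\<integral>y. indicator pball y *\<^sub>R band e b0 y \<partial>lborel)" unfolding band_mass_def by (rule mu_integral)
  also have "\<dots> \<le> (\<integral>y. indicator ?C y \<partial>lborel)"
  proof (rule integral_mono[OF iW iC])
    fix y :: 'a
    show "indicator pball y *\<^sub>R band e b0 y \<le> (indicator ?C y :: real)"
    proof (cases "y \<in> pball \<and> \<bar>b0 \<bullet> y\<bar> \<le> e * norm y")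
      case True
      hence ny: "norm y \<le> 1" by (simp add: pball_def)
      have "\<bar>y \<bullet> i\<bar> \<le> u \<bullet> i" if i: "i \<in> Basis" for i
      proof (cases "i = b0")
        case True
        have "\<bar>b0 \<bullet> y\<bar> \<le> e * norm y" using \<open>y \<in> pball \<and> \<bar>b0 \<bullet> y\<bar> \<le> e * norm y\<close> by simp
        also have "\<dots> \<le> e * 1" using ny e by (intro mult_left_mono) auto
        finally show ?thesis using True ui[OF i] by (simp add: inner_commute)
      next
        case False
        thus ?thesis using Basis_le_norm[OF i, of y] ny ui[OF i] by simp
      qed
      hence "y \<in> ?C" by (force simp: mem_box abs_le_iff)
      thus ?thesis using True by (simp add: band_def axes_unit)
    next
      case False
      hence z: "indicator pball y *\<^sub>R band e b0 y = 0" by (auto simp: band_def axes_unit)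
      show ?thesis unfolding z by simp
    qed
  qed
  also have "\<dots> = measure lborel ?C" by simp
  also have "\<dots> = (\<Prod>i\<in>Basis. u \<bullet> i - (- u) \<bullet> i)"
    by (rule content_cbox) (use e in \<open>simp add: ui\<close>)
  also have "\<dots> = (\<Prod>i\<in>Basis. 2 * (if i = b0 then e else 1))"
    by (intro prod.cong refl) (simp add: ui)
  also have "\<dots> = 2 ^ DIM('a) * (\<Prod>i\<in>Basis. if i = b0 then e else 1)" by (simp add: prod.distrib)
  also have "(\<Prod>i\<in>Basis. if i = b0 then e else 1) = e" using b by simp
  finally show ?thesis .
qed

end

section \<open>Overlap of two bands\<close>

locale bands3 = bands b0 b1 for b0 b1 :: "'a::euclidean_space" +
  fixes b2 :: 'a
  assumes b2: "b2 \<in> Basis" "b2 \<noteq> b0" "b2 \<noteq> b1"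
begin

text \<open>The volume, up to the factor \<open>e\<^sup>2\<close>, of the box in the next lemma: all
  sides are 1/n, except two of length e/n.\<close>

definition pair_const :: real where "pair_const = (1 / real DIM('a)) ^ DIM('a)"

lemma pair_const_pos: "pair_const > 0" by (simp add: pair_const_def)

text \<open>A box inside both bands: thin along \<open>b0\<close> and \<open>b1\<close>, and shifted
  along \<open>b2\<close> so that all its points have norm at least 1/n, which keeps the thin sides
  below the allowed fraction of the norm.\<close>

lemma pair_base:
  assumes e: "0 < e" "e \<le> 1"
  shows "pair_const * e\<^sup>2 \<le> (\<integral>x. band (e/2) b0 x * band (e/2) b1 x \<partial>mu)"
proof -
  let ?n = "real DIM('a)"
  define s where "s = 1 / ?n"
  have s: "s > 0" "?n * s = 1" by (simp_all add: s_def)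
  define h where "h = e * s / 2"
  have h: "0 < h" "h \<le> s / 2" using e s by (simp_all add: h_def)
  define lo where "lo i = (if i \<in> {b0, b1} then - h else if i = b2 then s else 0)" for i
  define hi where "hi i = (if i \<in> {b0, b1} then h else if i = b2 then 2 * s else s)" for i
  define l u where "l = (\<Sum>i\<in>Basis. lo i *\<^sub>R i)" and "u = (\<Sum>i\<in>Basis. hi i *\<^sub>R i)"
  have lu: "l \<bullet> i = lo i" "u \<bullet> i = hi i" if "i \<in> Basis" for i using that by (simp_all add: l_def u_def)
  let ?C = "cbox l u"
  have C: "x \<in> pball \<and> \<bar>b0 \<bullet> x\<bar> \<le> e/2 * norm x \<and> \<bar>b1 \<bullet> x\<bar> \<le> e/2 * norm x" if x: "x \<in> ?C" for x
  proof -
    have xi: "lo i \<le> x \<bullet> i" "x \<bullet> i \<le> hi i" if "i \<in> Basis" for i using x lu[OF that] that by (auto simp: mem_box)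
    have x2: "s \<le> x \<bullet> b2" using xi(1)[OF b2(1)] b2 by (simp add: lo_def)
    have n1: "s \<le> norm x" using x2 Basis_le_norm[OF b2(1), of x] by linarith
    have x01: "\<bar>b0 \<bullet> x\<bar> \<le> h" "\<bar>b1 \<bullet> x\<bar> \<le> h"
      using xi[OF b(1)] xi[OF b(2)] by (auto simp: lo_def hi_def inner_commute abs_le_iff)
    have "h \<le> e / 2 * norm x" using n1 e by (simp add: h_def mult_left_mono)
    hence 1: "\<bar>b0 \<bullet> x\<bar> \<le> e/2 * norm x" "\<bar>b1 \<bullet> x\<bar> \<le> e/2 * norm x" using x01 by auto
    \<comment> \<open>Bounds for the l1 norm: \<open>b2\<close> contributes 2s, \<open>b0\<close>
      and \<open>b1\<close> at most s/2 each, every other axis s. The total is n s = 1, so the box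
      lies in the unit ball.\<close>
    have "\<bar>x \<bullet> i\<bar> \<le> s + (if i = b2 then s else 0) - (if i = b0 then s/2 else 0) - (if i = b1 then s/2 else 0)" if i: "i \<in> Basis" for i
      using xi[OF i] b b2 s h by (auto simp: lo_def hi_def abs_le_iff split: if_splits)
    hence "(\<Sum>i\<in>Basis. \<bar>x \<bullet> i\<bar>) \<le> (\<Sum>i\<in>Basis. s + (if i = b2 then s else 0) - (if i = b0 then s/2 else 0) - (if i = b1 then s/2 else 0))"
      by (rule sum_mono)
    also have "\<dots> = ?n * s" using b b2 by (simp add: sum.distrib sum_subtractf)
    finally have "norm x \<le> 1" using norm_le_l1[of x] s by simp
    moreover have "x \<noteq> 0" using n1 s by auto
    ultimately show ?thesis using 1 by (simp add: pball_def)
  qed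
  have iW: "integrable mu (\<lambda>x. band (e/2) b0 x * band (e/2) b1 x)"
  proof (rule mu_integrable[where C=1])
    show "(\<lambda>x. band (e/2) b0 x * band (e/2) b1 x) \<in> borel_measurable mu" by (rule mu_measurable) measurable
  qed (simp add: band_def)
  have iW': "integrable lborel (\<lambda>x. indicator pball x *\<^sub>R (band (e/2) b0 x * band (e/2) b1 x))"
    using iW unfolding mu_def by (subst (asm) integrable_restrict_space) (auto simp: pball_borel)
  have iC: "integrable lborel (indicator ?C :: 'a \<Rightarrow> real)"
    by (simp add: integrable_indicator_iff emeasure_lborel_cbox_eq)
  have lohi: "lo i \<le> hi i" for i using h s by (auto simp: lo_def hi_def)
  have "pair_const * e\<^sup>2 = (\<Prod>i\<in>Basis. s * (if i \<in> {b0, b1} then e else 1))"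
  proof -
    have "(\<Prod>i\<in>Basis. if i \<in> {b0, b1} then e else 1) = (\<Prod>i\<in>{b0, b1}. e)"
      using b by (intro prod.mono_neutral_cong_right) auto
    also have "\<dots> = e\<^sup>2" using b by (simp add: power2_eq_square)
    finally show ?thesis by (simp only: prod.distrib prod_constant pair_const_def s_def)
  qed
  also have "\<dots> = (\<Prod>i\<in>Basis. u \<bullet> i - l \<bullet> i)"
  proof (rule prod.cong)
    fix i :: 'a assume "i \<in> Basis"
    thus "s * (if i \<in> {b0, b1} then e else 1) = u \<bullet> i - l \<bullet> i" using b2 by (auto simp: lu lo_def hi_def h_def)
  qed simp
  also have "\<dots> = measure lborel ?C" by (rule content_cbox[symmetric]) (simp add: lu lohi)
  also have "\<dots> = (\<integral>x. indicator ?C x \<partial>lborel)" by simp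
  also have "\<dots> \<le> (\<integral>x. indicator pball x *\<^sub>R (band (e/2) b0 x * band (e/2) b1 x) \<partial>lborel)"
  proof (rule integral_mono[OF iC iW'])
    fix x :: 'a
    show "(indicator ?C x :: real) \<le> indicator pball x *\<^sub>R (band (e/2) b0 x * band (e/2) b1 x)"
      using C[of x] by (cases "x \<in> ?C") (auto simp: band_def axes_unit indicator_def)
  qed
  also have "\<dots> = (\<integral>x. band (e/2) b0 x * band (e/2) b1 x \<partial>mu)" by (rule mu_integral[symmetric])
  finally show ?thesis .
qed

text \<open>Two directions always have enough common almost-orthogonal directions: this is where dimension 3 is needed.\<close>
lemma pair_lower:
  fixes y z :: 'a
  assumes e: "0 < e" "e \<le> 1" and y: "y \<noteq> 0" and z: "z \<noteq> 0"
  shows "pair_const * e\<^sup>2 \<le> (\<integral>x. band e x y * band e x z \<partial>mu)"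
proof -
  let ?y = "sgn y"
  have ny: "norm ?y = 1" using y by (simp add: norm_sgn)
  have yy: "?y \<bullet> ?y = 1" using ny by (simp add: dot_square_norm)
  \<comment> \<open>A unit vector orthogonal to \<open>y\<close> such that \<open>z\<close> lies in
    the plane of the two; if \<open>z\<close> is parallel to \<open>y\<close>, any orthogonal unit
    vector serves.\<close>
  obtain w where w: "norm w = 1" "?y \<bullet> w = 0" "\<exists>\<beta>. z = (z \<bullet> ?y) *\<^sub>R ?y + \<beta> *\<^sub>R w \<and> \<bar>\<beta>\<bar> \<le> norm z"
  proof -
    define zp where "zp = z - (z \<bullet> ?y) *\<^sub>R ?y"
    have perp: "?y \<bullet> zp = 0" by (simp add: zp_def inner_diff_right yy inner_commute)
    show ?thesis
    proof (cases "zp = 0")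
      case True
      have "norm b0 = norm ?y" by (simp add: axes_unit ny)
      then obtain U where U: "orthogonal_transformation U" "U b0 = ?y"
        using orthogonal_transformation_exists_euclidean by metis
      have "norm (U b1) = 1" "?y \<bullet> U b1 = 0"
        using orthogonal_transformation_norm[OF U(1)] U(1) axes_unit unfolding U(2)[symmetric] orthogonal_transformation_def by auto
      moreover have "z = (z \<bullet> ?y) *\<^sub>R ?y + 0 *\<^sub>R U b1 \<and> \<bar>0\<bar> \<le> norm z" using True by (simp add: zp_def)
      ultimately show ?thesis using that by blast
    next
      case False
      have n: "norm (sgn zp) = 1" using False by (simp add: norm_sgn)
      have p: "?y \<bullet> sgn zp = 0" using perp by (simp add: sgn_div_norm)
      have "z = (z \<bullet> ?y) *\<^sub>R ?y + norm zp *\<^sub>R sgn zp" using False by (simp add: sgn_div_norm zp_def)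
      moreover have "norm zp \<le> norm z"
      proof -
        have "zp \<bullet> zp = z \<bullet> zp" using perp by (simp add: zp_def inner_diff_left)
        hence "norm zp * norm zp \<le> norm z * norm zp"
          using norm_cauchy_schwarz[of z zp] by (simp add: dot_square_norm power2_eq_square)
        thus ?thesis using False by simp
      qed
      ultimately show ?thesis using that[OF n p] by (metis abs_norm_cancel)
    qed
  qed
  obtain \<beta> where \<beta>: "z = (z \<bullet> ?y) *\<^sub>R ?y + \<beta> *\<^sub>R w" "\<bar>\<beta>\<bar> \<le> norm z" using w(3) by blast
  obtain U where U: "orthogonal_transformation U" "U b0 = ?y" "U b1 = w"
    using orthonormal_pair_rotation[OF ny w(1,2) axes_unit(1,2,3)] by metis
  \<comment> \<open>Half the width is used because \<open>z\<close> has components along both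
    \<open>?y\<close> and \<open>w\<close>, each of size at most |z|, and their two errors add
    up.\<close>
  have "pair_const * e\<^sup>2 \<le> (\<integral>x. band (e/2) b0 x * band (e/2) b1 x \<partial>mu)" by (rule pair_base[OF e])
  also have "\<dots> = (\<integral>x. band (e/2) (U b0) (U x) * band (e/2) (U b1) (U x) \<partial>mu)" by (simp add: band_orthogonal[OF U(1)])
  also have "\<dots> = (\<integral>x. band (e/2) ?y x * band (e/2) w x \<partial>mu)"
    unfolding U by (rule mu_rotate[OF U(1), of "\<lambda>x. band (e/2) ?y x * band (e/2) w x"]) measurable
  also have "\<dots> \<le> (\<integral>x. band e x y * band e x z \<partial>mu)"
  proof (rule integral_mono)
    have m: "(\<lambda>x. band (e/2) ?y x * band (e/2) w x) \<in> borel_measurable borel" "(\<lambda>x. band e y x * band e z x) \<in> borel_measurable borel"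
      by measurable
    show "integrable mu (\<lambda>x. band (e/2) ?y x * band (e/2) w x)"
      by (rule mu_integrable[where C=1], rule mu_measurable[OF m(1)], simp add: band_def)
    show "integrable mu (\<lambda>x. band e x y * band e x z)"
      unfolding band_commute[of e _ y] band_commute[of e _ z]
      by (rule mu_integrable[where C=1], rule mu_measurable[OF m(2)], simp add: band_def)
    fix x :: 'a
    show "band (e/2) ?y x * band (e/2) w x \<le> band e x y * band e x z"
    proof (cases "\<bar>?y \<bullet> x\<bar> \<le> e/2 * norm x \<and> \<bar>w \<bullet> x\<bar> \<le> e/2 * norm x")
      case True
      have "0 \<le> e * norm x" using e by simp
      hence "\<bar>?y \<bullet> x\<bar> \<le> e * norm x" using True by linarith
      hence "band e ?y x = 1" by (simp add: band_def ny)
      hence 1: "band e x y = 1" using band_sgn[OF y] band_commute[of e x y] by simp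
      have "x \<bullet> z = (z \<bullet> ?y) * (?y \<bullet> x) + \<beta> * (w \<bullet> x)"
        by (subst \<beta>(1)) (simp add: inner_add_right inner_commute)
      hence "\<bar>x \<bullet> z\<bar> \<le> \<bar>z \<bullet> ?y\<bar> * \<bar>?y \<bullet> x\<bar> + \<bar>\<beta>\<bar> * \<bar>w \<bullet> x\<bar>" by (metis abs_mult abs_triangle_ineq)
      also have "\<dots> \<le> norm z * (e/2 * norm x) + norm z * (e/2 * norm x)"
        using True \<beta>(2) Cauchy_Schwarz_ineq2[of z ?y] ny by (intro add_mono mult_mono) auto
      also have "\<dots> = e * norm x * norm z" by simp
      finally have "band e x z = 1" by (simp add: band_def)
      thus ?thesis using 1 band_props(2)[of "e/2" ?y x] band_props(2)[of "e/2" w x] band_props(1)[of "e/2" ?y x] band_props(1)[of "e/2" w x]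
        by (simp add: mult_le_one)
    next
      case False
      hence z0: "band (e/2) ?y x * band (e/2) w x = 0" by (auto simp: band_def ny w(1))
      show ?thesis unfolding z0 by (intro mult_nonneg_nonneg band_props(1))
    qed
  qed
  finally show ?thesis .
qed

text \<open>The square root of the density whose integral over the unit ball is the volume of the
  unit sublevel set of the moment; the root is the function whose variance enters.\<close>

definition ratio_root :: "real \<Rightarrow> 'a set \<Rightarrow> 'a \<Rightarrow> real" where
  "ratio_root p K y = (mom p dotk K y / norm y powr p) powr (- (real DIM('a) / (2 * p)))"

text \<open>Up to a constant factor the variance of \<open>ratio_root\<close> under
  \<open>mu\<close>.\<close>

definition ratio_variation :: "real \<Rightarrow> 'a set \<Rightarrow> ennreal" where
  "ratio_variation p K = (\<integral>\<^sup>+y. (\<integral>\<^sup>+z. ennreal ((ratio_root p K y - ratio_root p K z)\<^sup>2) \<partial>mu) \<partial>mu)"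

text \<open>Jensen's inequality on the band of each \<open>x\<close>, integrated over
  \<open>x\<close>. Tonelli turns the right side into the volume and the variance terms into
  overlaps of bands; dividing by the squared band mass cancels the dependence on
  \<open>e\<close>.\<close>

lemma integrated_Jensen:
  assumes p: "p \<ge> 1" and K: "adm p K" and e: "0 < e" "e \<le> 1"
  shows "(\<integral>\<^sup>+x. ennreal (band_mean p K e x powr (- (real DIM('a) / p))) \<partial>mu) + ennreal (pair_const / (2 * (2 ^ DIM('a))\<^sup>2)) * ratio_variation p K
    \<le> ennreal (lvol (mom p dotk K))"
proof -
  let ?n = "real DIM('a)" and ?f = "ratio_root p K" and ?c = "band_mass e"
  define s where "s = ?n / (2 * p)"
  have p0: "p > 0" using p by simp
  have s: "s > 0" using p0 by (simp add: s_def)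
  have s2: "- 2 * s = - (?n / p)" by (simp add: s_def)
  note N = mom_phom_convex(1)[OF kernel_dotk p K]
  note Nm [measurable] = phom_borel[OF N]
  define \<phi> where "\<phi> y = mom p dotk K y / norm y powr p" for y
  have \<phi>m: "\<phi> \<in> borel_measurable mu" by (rule mu_measurable) (simp add: \<phi>_def[abs_def])
  have fdef: "?f = (\<lambda>y. \<phi> y powr (- s))" by (simp add: ratio_root_def[abs_def] \<phi>_def s_def)
  have fm [measurable]: "?f \<in> borel_measurable mu" unfolding fdef using \<phi>m by measurable
  obtain a d where ad: "a > 0" "d > 0" "\<And>y. y \<in> pball \<Longrightarrow> a \<le> \<phi> y" "\<And>y. y \<in> pball \<Longrightarrow> \<phi> y \<le> d"
    using mom_ratio_bounds[OF p K] unfolding \<phi>_def by metis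
  define B where "B = a powr (- s)"
  have f0: "0 \<le> ?f y" for y by (simp add: ratio_root_def)
  have fB: "?f y \<le> B" if "y \<in> pball" for y
    unfolding fdef B_def using ad(1) ad(3)[OF that] s by (intro powr_mono2') auto
  have c: "?c > 0" by (rule band_mass_pos[OF e(1)])
  have c2: "?c\<^sup>2 \<le> (2 ^ DIM('a))\<^sup>2 * e\<^sup>2"
    using power_mono[OF band_mass_le[OF e(1)], of 2] c by (simp add: power_mult_distrib)
  have fsq: "(?f y - ?f z)\<^sup>2 \<le> B\<^sup>2" if "y \<in> pball" "z \<in> pball" for y z
  proof -
    have "\<bar>?f y - ?f z\<bar> \<le> \<bar>B\<bar>" using f0[of y] f0[of z] fB[OF that(1)] fB[OF that(2)] by linarith
    thus ?thesis by (rule abs_le_square_iff[THEN iffD1])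
  qed
  have gB: "\<bar>band e x y * band e x z * (?f y - ?f z)\<^sup>2\<bar> \<le> B\<^sup>2" if "y \<in> pball" "z \<in> pball" for x y z
    using fsq[OF that] by (simp add: band_def)
  have g0: "0 \<le> band e x y * band e x z * (?f y - ?f z)\<^sup>2" for x y z by (simp add: band_def)
  have Wm [measurable]: "(\<lambda>y. band e x y) \<in> borel_measurable mu" "(\<lambda>y. band e y x) \<in> borel_measurable mu" for x
    using mu_measurable[OF band_measurable(2), of e x] by (simp_all add: band_commute[of e _ x])
  have iz: "integrable mu (\<lambda>z. band e x y * band e x z * (?f y - ?f z)\<^sup>2)" if "y \<in> pball" for x y
    by (rule mu_integrable[where C="B\<^sup>2"]) (use gB[OF that] in \<open>auto\<close>)
  have inner_m: "(\<lambda>y. \<integral>z. band e x y * band e x z * (?f y - ?f z)\<^sup>2 \<partial>mu) \<in> borel_measurable mu" for x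
    by (rule mu.borel_measurable_lebesgue_integral) measurable
  have inner_B: "\<bar>(\<integral>z. band e x y * band e x z * (?f y - ?f z)\<^sup>2 \<partial>mu)\<bar> \<le> B\<^sup>2 * measure mu (pball :: 'a set)" if "y \<in> pball" for x y
  proof -
    have "\<bar>(\<integral>z. band e x y * band e x z * (?f y - ?f z)\<^sup>2 \<partial>mu)\<bar> \<le> (\<integral>z. \<bar>band e x y * band e x z * (?f y - ?f z)\<^sup>2\<bar> \<partial>mu)"
      by (rule integral_abs_bound)
    also have "\<dots> \<le> (\<integral>z. B\<^sup>2 \<partial>(mu::'a measure))"
      using iz[OF that] gB[OF that] by (intro integral_mono) auto
    also have "\<dots> = B\<^sup>2 * measure mu (pball :: 'a set)" by (simp add: mult.commute)
    finally show ?thesis .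
  qed
  have RR: "ennreal (\<integral>y. (\<integral>z. band e x y * band e x z * (?f y - ?f z)\<^sup>2 \<partial>mu) \<partial>mu)
      = (\<integral>\<^sup>+y. (\<integral>\<^sup>+z. ennreal (band e x y * band e x z * (?f y - ?f z)\<^sup>2) \<partial>mu) \<partial>mu)" for x
  proof -
    have "ennreal (\<integral>y. (\<integral>z. band e x y * band e x z * (?f y - ?f z)\<^sup>2 \<partial>mu) \<partial>mu)
      = (\<integral>\<^sup>+y. ennreal (\<integral>z. band e x y * band e x z * (?f y - ?f z)\<^sup>2 \<partial>mu) \<partial>mu)"
    proof (rule nn_integral_eq_integral[symmetric])
      show "integrable mu (\<lambda>y. \<integral>z. band e x y * band e x z * (?f y - ?f z)\<^sup>2 \<partial>mu)"
        by (rule mu_integrable[OF inner_m inner_B])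
      show "AE y in mu. 0 \<le> (\<integral>z. band e x y * band e x z * (?f y - ?f z)\<^sup>2 \<partial>mu)"
        by (intro AE_I2 integral_nonneg_AE g0)
    qed
    also have "\<dots> = (\<integral>\<^sup>+y. (\<integral>\<^sup>+z. ennreal (band e x y * band e x z * (?f y - ?f z)\<^sup>2) \<partial>mu) \<partial>mu)"
    proof (rule nn_integral_cong)
      fix y :: 'a assume "y \<in> space mu"
      thus "ennreal (\<integral>z. band e x y * band e x z * (?f y - ?f z)\<^sup>2 \<partial>mu) = (\<integral>\<^sup>+z. ennreal (band e x y * band e x z * (?f y - ?f z)\<^sup>2) \<partial>mu)"
        by (intro nn_integral_eq_integral[symmetric] iz AE_I2 g0) simp
    qed
    finally show ?thesis .
  qed
  let ?E = "\<lambda>x y z. ennreal (band e x y * band e x z * (?f y - ?f z)\<^sup>2)"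
  have E3: "(\<lambda>(xy, z). ?E (fst xy) (snd xy) z) \<in> borel_measurable ((mu \<Otimes>\<^sub>M mu) \<Otimes>\<^sub>M mu)" by measurable
  have E2: "(\<lambda>(x, y). \<integral>\<^sup>+z. ?E x y z \<partial>mu) \<in> borel_measurable (mu \<Otimes>\<^sub>M mu)"
    using mu.borel_measurable_nn_integral[OF E3] by (simp add: case_prod_beta')
  have E2': "(\<lambda>(x, z). ?E x y z) \<in> borel_measurable (mu \<Otimes>\<^sub>M mu)" for y by measurable
  \<comment> \<open>With the integral over \<open>x\<close> taken first, the weight at (y, z) is the
    overlap of their two bands, and \<open>pair_lower\<close> applies.\<close>
  have low: "ennreal (pair_const * e\<^sup>2) * ratio_variation p K \<le> (\<integral>\<^sup>+x. (\<integral>\<^sup>+y. (\<integral>\<^sup>+z. ?E x y z \<partial>mu) \<partial>mu) \<partial>mu)"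
  proof -
    have "(\<integral>\<^sup>+x. (\<integral>\<^sup>+y. (\<integral>\<^sup>+z. ?E x y z \<partial>mu) \<partial>mu) \<partial>mu) = (\<integral>\<^sup>+y. (\<integral>\<^sup>+x. (\<integral>\<^sup>+z. ?E x y z \<partial>mu) \<partial>mu) \<partial>mu)"
      by (rule mumu.Fubini'[symmetric, OF E2])
    also have "\<dots> = (\<integral>\<^sup>+y. (\<integral>\<^sup>+z. (\<integral>\<^sup>+x. ?E x y z \<partial>mu) \<partial>mu) \<partial>mu)"
      by (intro nn_integral_cong mumu.Fubini'[symmetric, OF E2'])
    also have "\<dots> \<ge> (\<integral>\<^sup>+y. (\<integral>\<^sup>+z. ennreal (pair_const * e\<^sup>2) * ennreal ((?f y - ?f z)\<^sup>2) \<partial>mu) \<partial>mu)"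
    proof (intro nn_integral_mono)
      fix y z :: 'a assume "y \<in> space mu" "z \<in> space mu"
      hence yz: "y \<in> pball" "z \<in> pball" "y \<noteq> 0" "z \<noteq> 0" by (auto simp: pball_def)
      have iW: "integrable mu (\<lambda>x. band e x y * band e x z)"
        by (rule mu_integrable[where C=1], rule borel_measurable_times[OF Wm(2) Wm(2)], simp add: band_def)
      have "ennreal (pair_const * e\<^sup>2) * ennreal ((?f y - ?f z)\<^sup>2) = ennreal (pair_const * e\<^sup>2 * (?f y - ?f z)\<^sup>2)"
        using pair_const_pos by (simp add: ennreal_mult)
      also have "\<dots> \<le> ennreal ((\<integral>x. band e x y * band e x z \<partial>mu) * (?f y - ?f z)\<^sup>2)"
        by (intro ennreal_leI mult_right_mono pair_lower[OF e yz(3,4)]) simp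
      also have "\<dots> = ennreal (\<integral>x. band e x y * band e x z * (?f y - ?f z)\<^sup>2 \<partial>mu)" by simp
      also have "\<dots> = (\<integral>\<^sup>+x. ?E x y z \<partial>mu)"
        using iW by (intro nn_integral_eq_integral[symmetric] AE_I2 g0) auto
      finally show "ennreal (pair_const * e\<^sup>2) * ennreal ((?f y - ?f z)\<^sup>2) \<le> (\<integral>\<^sup>+x. ?E x y z \<partial>mu)" .
    qed
    also have "(\<integral>\<^sup>+y. (\<integral>\<^sup>+z. ennreal (pair_const * e\<^sup>2) * ennreal ((?f y - ?f z)\<^sup>2) \<partial>mu) \<partial>mu) = ennreal (pair_const * e\<^sup>2) * ratio_variation p K"
      unfolding ratio_variation_def by (subst nn_integral_cmult[symmetric], measurable) (intro nn_integral_cong nn_integral_cmult, measurable)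
    finally show ?thesis .
  qed
  \<comment> \<open>By symmetry every \<open>y\<close> is counted with the band mass, which does not
    depend on \<open>y\<close>; the rest is the volume in polar coordinates.\<close>
  have up: "(\<integral>\<^sup>+x. (\<integral>\<^sup>+y. ennreal (band e x y * (?f y)\<^sup>2) \<partial>mu) \<partial>mu) = ennreal ?c * ennreal (lvol (mom p dotk K))"
  proof -
    have "(\<integral>\<^sup>+x. (\<integral>\<^sup>+y. ennreal (band e x y * (?f y)\<^sup>2) \<partial>mu) \<partial>mu) = (\<integral>\<^sup>+y. (\<integral>\<^sup>+x. ennreal (band e x y * (?f y)\<^sup>2) \<partial>mu) \<partial>mu)"
      by (rule mumu.Fubini'[symmetric]) measurable
    also have "\<dots> = (\<integral>\<^sup>+y. ennreal ?c * ennreal ((norm y powr p / mom p dotk K y) powr (?n / p)) \<partial>mu)"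
    proof (rule nn_integral_cong)
      fix y :: 'a assume "y \<in> space mu"
      hence y: "y \<noteq> 0" "y \<in> pball" by (auto simp: pball_def)
      have iW: "integrable mu (\<lambda>x. band e x y)" unfolding band_commute[of e _ y] by (rule band_integrable)
      have "(\<integral>\<^sup>+x. ennreal (band e x y * (?f y)\<^sup>2) \<partial>mu) = ennreal (\<integral>x. band e x y * (?f y)\<^sup>2 \<partial>mu)"
        using iW by (intro nn_integral_eq_integral AE_I2) (auto simp: band_props)
      also have "(\<integral>x. band e x y * (?f y)\<^sup>2 \<partial>mu) = ?c * (?f y)\<^sup>2"
        using band_integral[OF y(1), of e] by (simp add: band_commute[of e _ y])
      finally have I: "(\<integral>\<^sup>+x. ennreal (band e x y * (?f y)\<^sup>2) \<partial>mu) = ennreal (?c * (?f y)\<^sup>2)" .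
      have "(?f y)\<^sup>2 = \<phi> y powr (- (?n / p))"
        unfolding fdef power2_eq_square powr_add[symmetric] by (simp add: s_def)
      also have "\<dots> = (norm y powr p / mom p dotk K y) powr (?n / p)"
        using phom_pos[OF N y(1)] y(1) by (simp add: \<phi>_def powr_minus_divide powr_divide)
      finally have sq: "(?f y)\<^sup>2 = (norm y powr p / mom p dotk K y) powr (?n / p)" .
      show "(\<integral>\<^sup>+x. ennreal (band e x y * (?f y)\<^sup>2) \<partial>mu) = ennreal ?c * ennreal ((norm y powr p / mom p dotk K y) powr (?n / p))"
        unfolding I unfolding sq using c by (intro ennreal_mult) auto
    qed
    also have "\<dots> = ennreal ?c * (\<integral>\<^sup>+y. ennreal ((norm y powr p / mom p dotk K y) powr (?n / p)) \<partial>mu)"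
      by (rule nn_integral_cmult) (rule mu_measurable, measurable)
    also have "(\<integral>\<^sup>+y. ennreal ((norm y powr p / mom p dotk K y) powr (?n / p)) \<partial>mu)
       = (\<integral>\<^sup>+x. indicator pball x * ennreal ((norm x powr p / mom p dotk K x) powr (?n / p)) \<partial>lborel)"
      unfolding mu_def by (subst nn_integral_restrict_space) (auto simp: pball_borel mult.commute)
    also have "\<dots> = ennreal (lvol (mom p dotk K))" unfolding pball_def by (rule lvol_polar[OF N p0 dim2, symmetric])
    finally show ?thesis .
  qed
  have AAm: "(\<lambda>x. band_mean p K e x) \<in> borel_measurable mu"
    unfolding band_mean_def \<phi>_def[symmetric] by (intro borel_measurable_divide mu.borel_measurable_lebesgue_integral borel_measurable_const)
      (use \<phi>m in measurable)
  have Am: "(\<lambda>x. ennreal (band_mean p K e x powr (- (?n / p)))) \<in> borel_measurable mu" using AAm by measurable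
  have pt: "ennreal (band_mean p K e x powr (- (?n / p))) + ennreal (1 / (2 * ?c\<^sup>2)) * (\<integral>\<^sup>+y. (\<integral>\<^sup>+z. ?E x y z \<partial>mu) \<partial>mu)
      \<le> ennreal (1 / ?c) * (\<integral>\<^sup>+y. ennreal (band e x y * (?f y)\<^sup>2) \<partial>mu)" if "x \<in> space mu" for x
  proof -
    have x: "x \<noteq> 0" using that by (simp add: pball_def)
    have "((\<integral>y. band e x y * \<phi> y \<partial>mu) / ?c) powr (- 2 * s) + (1 / (2 * ?c\<^sup>2)) * (\<integral>y. (\<integral>z. band e x y * band e x z * (\<phi> y powr (- s) - \<phi> z powr (- s))\<^sup>2 \<partial>mu) \<partial>mu)
      \<le> (1 / ?c) * (\<integral>y. band e x y * (\<phi> y powr (- s))\<^sup>2 \<partial>mu)"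
      by (rule weighted_Jensen_variance[OF Wm(1) \<phi>m band_props(1,2) ad(3,4,1) band_integral[OF x, symmetric] c s])
    hence J: "band_mean p K e x powr (- (?n / p)) + (1 / (2 * ?c\<^sup>2)) * (\<integral>y. (\<integral>z. band e x y * band e x z * (?f y - ?f z)\<^sup>2 \<partial>mu) \<partial>mu)
      \<le> (1 / ?c) * (\<integral>y. band e x y * (?f y)\<^sup>2 \<partial>mu)"
      unfolding s2 band_mean_def \<phi>_def[symmetric] by (simp only: fdef)
    have iWf: "integrable mu (\<lambda>y. band e x y * (?f y)\<^sup>2)"
    proof (rule mu_integrable[where C="B\<^sup>2"])
      fix y :: 'a assume "y \<in> pball"
      hence "(?f y)\<^sup>2 \<le> B\<^sup>2" using f0[of y] fB by (intro power_mono) auto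
      thus "\<bar>band e x y * (?f y)\<^sup>2\<bar> \<le> B\<^sup>2" by (simp add: band_def)
    qed measurable
    have R0: "0 \<le> (\<integral>y. (\<integral>z. band e x y * band e x z * (?f y - ?f z)\<^sup>2 \<partial>mu) \<partial>mu)"
      by (intro integral_nonneg_AE AE_I2 g0)
    have "ennreal (band_mean p K e x powr (- (?n / p))) + ennreal (1 / (2 * ?c\<^sup>2)) * ennreal (\<integral>y. (\<integral>z. band e x y * band e x z * (?f y - ?f z)\<^sup>2 \<partial>mu) \<partial>mu)
      = ennreal (band_mean p K e x powr (- (?n / p)) + (1 / (2 * ?c\<^sup>2)) * (\<integral>y. (\<integral>z. band e x y * band e x z * (?f y - ?f z)\<^sup>2 \<partial>mu) \<partial>mu))"
      by (subst ennreal_plus[OF powr_ge_zero mult_nonneg_nonneg[OF _ R0]], simp, subst ennreal_mult[OF _ R0], simp, rule refl)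
    also have "\<dots> \<le> ennreal ((1 / ?c) * (\<integral>y. band e x y * (?f y)\<^sup>2 \<partial>mu))" by (rule ennreal_leI[OF J])
    also have "\<dots> = ennreal (1 / ?c) * ennreal (\<integral>y. band e x y * (?f y)\<^sup>2 \<partial>mu)" using c by (intro ennreal_mult') auto
    also have "ennreal (\<integral>y. band e x y * (?f y)\<^sup>2 \<partial>mu) = (\<integral>\<^sup>+y. ennreal (band e x y * (?f y)\<^sup>2) \<partial>mu)"
      using iWf by (intro nn_integral_eq_integral[symmetric]) (auto simp: band_props)
    finally show ?thesis unfolding RR .
  qed
  have m1: "(\<lambda>x. \<integral>\<^sup>+y. (\<integral>\<^sup>+z. ?E x y z \<partial>mu) \<partial>mu) \<in> borel_measurable mu"
    by (rule mu.borel_measurable_nn_integral[OF E2])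
  have m2: "(\<lambda>x. \<integral>\<^sup>+y. ennreal (band e x y * (?f y)\<^sup>2) \<partial>mu) \<in> borel_measurable mu"
    by (rule mu.borel_measurable_nn_integral) measurable
  \<comment> \<open>The overlap is at least \<open>pair_const * e\<^sup>2\<close>, the squared mass
    at most \<open>(2 ^ DIM('a))\<^sup>2 * e\<^sup>2\<close>; this quotient is the constant in front
    of the variation.\<close>
  have "pair_const / (2 * (2 ^ DIM('a))\<^sup>2) \<le> 1 / (2 * ?c\<^sup>2) * (pair_const * e\<^sup>2)"
  proof -
    have "pair_const / (2 * (2 ^ DIM('a))\<^sup>2) = pair_const * e\<^sup>2 / (2 * ((2 ^ DIM('a))\<^sup>2 * e\<^sup>2))" using e by simp
    also have "\<dots> \<le> pair_const * e\<^sup>2 / (2 * ?c\<^sup>2)"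
      using c2 c e pair_const_pos by (intro divide_left_mono mult_left_mono) (auto intro!: mult_pos_pos zero_less_power)
    finally show ?thesis by simp
  qed
  hence "ennreal (pair_const / (2 * (2 ^ DIM('a))\<^sup>2)) * ratio_variation p K \<le> ennreal (1 / (2 * ?c\<^sup>2) * (pair_const * e\<^sup>2)) * ratio_variation p K"
    by (intro mult_right_mono ennreal_leI) auto
  also have "\<dots> = ennreal (1 / (2 * ?c\<^sup>2)) * (ennreal (pair_const * e\<^sup>2) * ratio_variation p K)"
    using pair_const_pos by (subst ennreal_mult) (auto simp: mult.assoc)
  also have "\<dots> \<le> ennreal (1 / (2 * ?c\<^sup>2)) * (\<integral>\<^sup>+x. (\<integral>\<^sup>+y. (\<integral>\<^sup>+z. ?E x y z \<partial>mu) \<partial>mu) \<partial>mu)"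
    by (intro mult_left_mono low) simp
  finally have "(\<integral>\<^sup>+x. ennreal (band_mean p K e x powr (- (?n / p))) \<partial>mu) + ennreal (pair_const / (2 * (2 ^ DIM('a))\<^sup>2)) * ratio_variation p K
     \<le> (\<integral>\<^sup>+x. ennreal (band_mean p K e x powr (- (?n / p))) \<partial>mu) + ennreal (1 / (2 * ?c\<^sup>2)) * (\<integral>\<^sup>+x. (\<integral>\<^sup>+y. (\<integral>\<^sup>+z. ?E x y z \<partial>mu) \<partial>mu) \<partial>mu)"
    by (intro add_left_mono)
  also have "\<dots> = (\<integral>\<^sup>+x. ennreal (band_mean p K e x powr (- (?n / p))) + ennreal (1 / (2 * ?c\<^sup>2)) * (\<integral>\<^sup>+y. (\<integral>\<^sup>+z. ?E x y z \<partial>mu) \<partial>mu) \<partial>mu)"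
    by (subst nn_integral_add[OF Am borel_measurable_times_ennreal[OF borel_measurable_const m1]], subst nn_integral_cmult[OF m1]) (rule refl)
  also have "\<dots> \<le> (\<integral>\<^sup>+x. ennreal (1 / ?c) * (\<integral>\<^sup>+y. ennreal (band e x y * (?f y)\<^sup>2) \<partial>mu) \<partial>mu)"
    by (intro nn_integral_mono pt)
  also have "\<dots> = ennreal (1 / ?c) * (ennreal ?c * ennreal (lvol (mom p dotk K)))"
    unfolding up[symmetric] by (rule nn_integral_cmult[OF m2])
  also have "\<dots> = ennreal (lvol (mom p dotk K))"
    using c by (simp flip: mult.assoc ennreal_mult)
  finally show ?thesis .
qed

end

section \<open>Thin bands and the inequality for the sine kernel\<close>

lemma adm_cball:
  assumes "r > 0" "p > 0" shows "adm p (cball (0::'a::euclidean_space) r)"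
  using assms content_cball_pos[of r "0::'a"] by (intro adm_bounded) auto

lemma orthogonal_vimage_cball: "orthogonal_transformation U \<Longrightarrow> U -` cball 0 r = cball (0::'a::euclidean_space) r"
  by (auto simp: orthogonal_transformation_norm)

lemma open_AE_empty:
  fixes U :: "'a::euclidean_space set"
  assumes U: "open U" and ae: "AE y in lborel. y \<notin> U" shows "U = {}"
proof (rule ccontr)
  assume "U \<noteq> {}"
  hence "emeasure lborel U \<noteq> 0" by (rule open_emeasure_neq_0[OF U])
  moreover have "emeasure lborel U = 0" using ae U by (subst (asm) AE_iff_measurable[OF _ refl]) auto
  ultimately show False by contradiction
qed

lemma norm_powr_phom: "p > 0 \<Longrightarrow> phom p (\<lambda>x::'a::euclidean_space. norm x powr p)"
  by (rule nrm_phom) (auto simp: nrm_def norm_triangle_ineq)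

lemma lvol_cmult:
  fixes N :: "'a::euclidean_space \<Rightarrow> real"
  assumes N: "phom p N" and p: "p > 0" and c: "c > 0"
  shows "lvol (\<lambda>x. c * N x) = c powr (- (real DIM('a) / p)) * lvol N"
proof -
  have "lvol (\<lambda>x. c * N x) = measure lborel {x. N x \<le> 1 / c}"
    using c by (simp add: lvol_def field_simps)
  also have "\<dots> = (1 / c) powr (real DIM('a) / p) * lvol N"
    using c by (intro phom_sublevel_measure[OF N p]) simp
  also have "(1 / c) powr (real DIM('a) / p) = c powr (- (real DIM('a) / p))"
    using c by (simp add: powr_minus_divide powr_divide)
  finally show ?thesis .
qed

context bands3
begin

lemma band_mean_cball:
  assumes x: "x \<noteq> 0" and e: "e > 0" and a: "\<And>y :: 'a. mom p dotk (cball 0 1) y = a * norm y powr p"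
  shows "band_mean p (cball 0 1) e x = a"
proof -
  have "(\<integral>y. band e x y * (mom p dotk (cball 0 1) y / norm y powr p) \<partial>mu) = (\<integral>y. band e x y * a \<partial>mu)"
    by (rule Bochner_Integration.integral_cong) (auto simp: a pball_def)
  also have "\<dots> = band_mass e * a" using band_integral[OF x, of e] by simp
  finally show ?thesis using band_mass_pos[OF e] by (simp add: band_mean_def)
qed

text \<open>As the bands shrink, the means of \<open>mom p dotk K\<close> over them converge to a multiple of \<open>mom p pgram K\<close>.\<close>
lemma dotk_pgram_volumes:
  assumes p: "p \<ge> 1"
  obtains D \<kappa> :: real where "D > 0" "\<kappa> > 0"
    "\<And>x. mom p dotk (cball 0 1 :: 'a set) x = D * mom p pgram (cball 0 1) x"
    "\<And>K :: 'a set. adm p K \<Longrightarrow> ennreal (D powr (- (real DIM('a) / p)) * lvol (mom p pgram K)) + ennreal \<kappa> * ratio_variation p K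
       \<le> ennreal (lvol (mom p dotk K))"
proof -
  let ?B = "cball 0 1 :: 'a set" and ?q = "real DIM('a) / p"
  have p0: "p > 0" using p by simp
  have B: "adm p ?B" using p0 by (intro adm_cball) auto
  note kp = kernel_pgram[where 'a='a, OF dim2]
  obtain a where a: "a > 0" "\<And>x. mom p dotk ?B x = a * norm x powr p"
    using mom_radial[OF kernel_dotk dotk_orthogonal p B orthogonal_vimage_cball] by metis
  obtain b where b: "b > 0" "\<And>x. mom p pgram ?B x = b * norm x powr p"
    using mom_radial[OF kp pgram_orthogonal p B orthogonal_vimage_cball] by metis
  define D where "D = a / b"
  have D: "D > 0" using a b by (simp add: D_def)
  define e where "e k = inverse (real (Suc k))" for k :: nat
  have e: "0 < e k" "e k \<le> 1" for k by (simp_all add: e_def inverse_le_1_iff)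
  have elim: "e \<longlonglongrightarrow> 0" unfolding e_def[abs_def] by (rule LIMSEQ_inverse_real_of_nat)
  define \<kappa> where "\<kappa> = pair_const / (2 * (2 ^ DIM('a))\<^sup>2)"
  have \<kappa>: "\<kappa> > 0" using pair_const_pos by (simp add: \<kappa>_def)
  have b00: "b0 \<noteq> 0" using axes_unit by auto
  \<comment> \<open>The limit is identified without computing any band integral: for the unit ball
    both moments are radial, so \<open>band_mean_approx\<close> compares two known multiples of
    |x|^p.\<close>
  have DDlim: "(\<lambda>k. axis_moment p (e k)) \<longlonglongrightarrow> D"
  proof -
    define m where "m = (LINT k:?B|lborel. norm k powr p)"
    have "\<bar>axis_moment p (e k) - D\<bar> \<le> p * m / b * e k" for k
    proof -
      have "\<bar>a - axis_moment p (e k) * b\<bar> \<le> p * e k * m"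
        using band_mean_approx[OF p B b00 e(1)[of k]] unfolding band_mean_cball[OF b00 e(1) a(2)] b(2) m_def by (simp add: axes_unit)
      hence "\<bar>a - axis_moment p (e k) * b\<bar> / b \<le> p * e k * m / b" using b(1) by (intro divide_right_mono) auto
      moreover have "\<bar>a - axis_moment p (e k) * b\<bar> / b = \<bar>axis_moment p (e k) - D\<bar>"
      proof -
        have "\<bar>a - axis_moment p (e k) * b\<bar> / b = \<bar>(a - axis_moment p (e k) * b) / b\<bar>" using b(1) by (simp add: abs_divide)
        also have "(a - axis_moment p (e k) * b) / b = D - axis_moment p (e k)" using b(1) by (simp add: D_def diff_divide_distrib)
        finally show ?thesis by (simp add: abs_minus_commute)
      qed
      ultimately show ?thesis by (simp add: mult_ac)
    qed
    hence ev: "eventually (\<lambda>k. norm (axis_moment p (e k) - D) \<le> p * m / b * e k) sequentially" by simp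
    have "(\<lambda>k. p * m / b * e k) \<longlonglongrightarrow> 0" using tendsto_mult_right_zero[OF elim] .
    from Lim_null_comparison[OF ev this] show ?thesis by (simp add: LIM_zero_iff)
  qed
  have main: "ennreal (D powr (- ?q) * lvol (mom p pgram K)) + ennreal \<kappa> * ratio_variation p K \<le> ennreal (lvol (mom p dotk K))"
    if K: "adm p K" for K :: "'a set"
  proof -
    note N = mom_phom_convex(1)[OF kernel_dotk p K]
    note M = mom_phom_convex(1)[OF kp p K]
    note [measurable] = phom_borel[OF M] phom_borel[OF N]
    define m where "m = (LINT k:K|lborel. norm k powr p)"
    define R where "R x = D * (mom p pgram K x / norm x powr p)" for x
    have AAlim: "(\<lambda>k. band_mean p K (e k) x) \<longlonglongrightarrow> R x" if x: "x \<noteq> 0" for x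
    proof -
      have "eventually (\<lambda>k. norm (band_mean p K (e k) x - axis_moment p (e k) * (mom p pgram K x / norm x powr p)) \<le> p * m * e k) sequentially"
        using band_mean_approx[OF p K x e(1)] by (intro always_eventually allI) (simp add: m_def mult_ac)
      moreover have "(\<lambda>k. p * m * e k) \<longlonglongrightarrow> 0" using tendsto_mult_right_zero[OF elim] .
      ultimately have 1: "(\<lambda>k. band_mean p K (e k) x - axis_moment p (e k) * (mom p pgram K x / norm x powr p)) \<longlonglongrightarrow> 0"
        by (rule Lim_null_comparison)
      have "(\<lambda>k. axis_moment p (e k) * (mom p pgram K x / norm x powr p)) \<longlonglongrightarrow> R x"
        unfolding R_def by (intro tendsto_mult DDlim tendsto_const)
      from tendsto_add[OF 1 this] show ?thesis by simp
    qed
    have R: "R x > 0" if "x \<noteq> 0" for x using phom_pos[OF M that] D that by (simp add: R_def)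
    have Im: "(\<lambda>x. ennreal (band_mean p K (e k) x powr (- ?q))) \<in> borel_measurable mu" for k
    proof -
      have r: "(\<lambda>y. mom p dotk K y / norm y powr p) \<in> borel_measurable mu" by (rule mu_measurable) measurable
      have "(\<lambda>x. band_mean p K (e k) x) \<in> borel_measurable mu"
        unfolding band_mean_def by (intro borel_measurable_divide mu.borel_measurable_lebesgue_integral borel_measurable_const)
          (use r in measurable)
      thus ?thesis by measurable
    qed
    let ?I = "\<lambda>k. \<integral>\<^sup>+x. ennreal (band_mean p K (e k) x powr (- ?q)) \<partial>mu"
    have J: "?I k + ennreal \<kappa> * ratio_variation p K \<le> ennreal (lvol (mom p dotk K))" for k
      unfolding \<kappa>_def by (rule integrated_Jensen[OF p K e])
    have "ennreal (D powr (- ?q) * lvol (mom p pgram K)) = ennreal (D powr (- ?q)) * ennreal (lvol (mom p pgram K))"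
      by (rule ennreal_mult) (auto simp: lvol_def)
    also have "\<dots> = ennreal (D powr (- ?q)) * (\<integral>\<^sup>+x. indicator pball x * ennreal ((norm x powr p / mom p pgram K x) powr ?q) \<partial>lborel)"
      unfolding pball_def by (subst lvol_polar[OF M p0 dim2]) (rule refl)
    also have "\<dots> = (\<integral>\<^sup>+x. ennreal (D powr (- ?q)) * (indicator pball x * ennreal ((norm x powr p / mom p pgram K x) powr ?q)) \<partial>lborel)"
      by (rule nn_integral_cmult[symmetric]) (use pball_borel in measurable)
    also have "\<dots> = (\<integral>\<^sup>+x. ennreal (R x powr (- ?q)) * indicator pball x \<partial>lborel)"
    proof (rule nn_integral_cong)
      fix x :: 'a
      show "ennreal (D powr (- ?q)) * (indicator pball x * ennreal ((norm x powr p / mom p pgram K x) powr ?q))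
        = ennreal (R x powr (- ?q)) * indicator pball x"
      proof (cases "x \<in> pball")
        case True
        hence x: "x \<noteq> 0" by (simp add: pball_def)
        have "R x powr (- ?q) = D powr (- ?q) * (mom p pgram K x / norm x powr p) powr (- ?q)"
          unfolding R_def by (rule powr_mult)
        also have "(mom p pgram K x / norm x powr p) powr (- ?q) = (norm x powr p / mom p pgram K x) powr ?q"
          using phom_pos[OF M x] x by (simp add: powr_divide powr_minus_divide)
        finally have "ennreal (R x powr (- ?q)) = ennreal (D powr (- ?q)) * ennreal ((norm x powr p / mom p pgram K x) powr ?q)"
          by (simp only: ennreal_mult[OF powr_ge_zero powr_ge_zero])
        thus ?thesis using True by simp
      qed simp
    qed
    also have "\<dots> = (\<integral>\<^sup>+x. ennreal (R x powr (- ?q)) \<partial>mu)"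
      unfolding mu_def by (rule nn_integral_restrict_space[symmetric]) (simp add: pball_borel)
    \<comment> \<open>Fatou's lemma goes in the useful direction: the limit volume is bounded by the
      limit inferior of the integrals, each of which is controlled by
      \<open>integrated_Jensen\<close>.\<close>
    also have "\<dots> = (\<integral>\<^sup>+x. liminf (\<lambda>k. ennreal (band_mean p K (e k) x powr (- ?q))) \<partial>mu)"
    proof (rule nn_integral_cong)
      fix x :: 'a assume "x \<in> space mu"
      hence x: "x \<noteq> 0" by (simp add: pball_def)
      have "(\<lambda>k. ennreal (band_mean p K (e k) x powr (- ?q))) \<longlonglongrightarrow> ennreal (R x powr (- ?q))"
        using R[OF x] by (intro tendsto_ennrealI tendsto_powr AAlim[OF x] tendsto_const) auto
      thus "ennreal (R x powr (- ?q)) = liminf (\<lambda>k. ennreal (band_mean p K (e k) x powr (- ?q)))"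
        by (intro lim_imp_Liminf[symmetric]) auto
    qed
    also have "\<dots> \<le> liminf ?I" by (rule nn_integral_liminf[OF Im])
    finally have F: "ennreal (D powr (- ?q) * lvol (mom p pgram K)) \<le> liminf ?I" .
    have cV: "ennreal \<kappa> * ratio_variation p K \<le> ennreal (lvol (mom p dotk K))"
      by (rule order_trans[OF add_increasing[OF zero_le order_refl] J[of 0]])
    have fin: "ennreal \<kappa> * ratio_variation p K \<noteq> \<infinity>" using cV by (auto simp: top_unique)
    have "?I k \<le> ennreal (lvol (mom p dotk K)) - ennreal \<kappa> * ratio_variation p K" for k
    proof -
      have "?I k = (?I k + ennreal \<kappa> * ratio_variation p K) - ennreal \<kappa> * ratio_variation p K"
        using fin by (simp add: ennreal_add_diff_cancel_right)
      also have "\<dots> \<le> ennreal (lvol (mom p dotk K)) - ennreal \<kappa> * ratio_variation p K" by (rule ennreal_minus_mono[OF J order_refl])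
      finally show ?thesis .
    qed
    hence "liminf ?I \<le> ennreal (lvol (mom p dotk K)) - ennreal \<kappa> * ratio_variation p K"
      by (intro Liminf_le always_eventually) auto
    with F have "ennreal (D powr (- ?q) * lvol (mom p pgram K)) \<le> ennreal (lvol (mom p dotk K)) - ennreal \<kappa> * ratio_variation p K"
      by (rule order_trans)
    hence "ennreal (D powr (- ?q) * lvol (mom p pgram K)) + ennreal \<kappa> * ratio_variation p K
      \<le> (ennreal (lvol (mom p dotk K)) - ennreal \<kappa> * ratio_variation p K) + ennreal \<kappa> * ratio_variation p K" by (rule add_right_mono)
    also have "\<dots> = ennreal (lvol (mom p dotk K))" by (rule diff_add_cancel_ennreal[OF cV])
    finally show ?thesis .
  qed
  show ?thesis
  proof (rule that[OF D \<kappa> _ main])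
    fix x show "mom p dotk ?B x = D * mom p pgram ?B x" using b(1) by (simp add: a(2) b(2) D_def)
  qed
qed

text \<open>Vanishing variation makes the ratio almost everywhere equal to its value at one point.
  The exceptional set in the open ball is open by continuity, hence empty, and homogeneity extends
  the identity to all vectors.\<close>

lemma ratio_variation_zero_ratio:
  assumes p: "p \<ge> 1" and K: "adm p K" and V: "ratio_variation p K = 0"
  obtains \<gamma> where "\<gamma> > 0" "\<And>x. mom p dotk K x = \<gamma> * norm x powr p"
proof -
  have p0: "p > 0" using p by simp
  note N = mom_phom_convex(1)[OF kernel_dotk p K]
  note [measurable] = phom_borel[OF N]
  define s where "s = real DIM('a) / (2 * p)"
  have s: "s > 0" using p0 by (simp add: s_def)
  define \<phi> where "\<phi> y = mom p dotk K y / norm y powr p" for y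
  have \<phi>0: "\<phi> y > 0" if "y \<noteq> 0" for y using phom_pos[OF N that] that by (simp add: \<phi>_def)
  have fdef: "ratio_root p K y = \<phi> y powr (- s)" for y by (simp add: ratio_root_def \<phi>_def s_def)
  have fm [measurable]: "ratio_root p K \<in> borel_measurable mu"
    unfolding ratio_root_def[abs_def] by (rule mu_measurable) measurable
  let ?G = "\<lambda>y. \<integral>\<^sup>+z. ennreal ((ratio_root p K y - ratio_root p K z)\<^sup>2) \<partial>mu"
  have Gm: "?G \<in> borel_measurable mu" by (rule mu.borel_measurable_nn_integral) measurable
  have "AE y in mu. ?G y = 0" using V nn_integral_0_iff_AE[OF Gm] by (simp add: ratio_variation_def)
  then have "\<exists>y. y \<in> pball \<and> ?G y = 0"
  proof -
    assume ae: "AE y in mu. ?G y = 0"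
    show ?thesis
    proof (rule ccontr)
      assume no: "\<nexists>y. y \<in> pball \<and> ?G y = 0"
      have "AE y in (mu :: 'a measure). False"
        using ae AE_space[of "mu :: 'a measure"] by eventually_elim (use no in auto)
      hence "AE y in lborel. y \<notin> (pball :: 'a set)" unfolding mu_def by (subst (asm) AE_restrict_space_iff) (auto simp: pball_borel)
      hence "AE y in lborel. y \<notin> ball (0::'a) 1 - {0}" by eventually_elim (auto simp: pball_def)
      hence "ball (0::'a) 1 - {0} = {}" by (intro open_AE_empty) auto
      moreover have "(1/2) *\<^sub>R b0 \<in> ball (0::'a) 1 - {0}" using axes_unit b by auto
      ultimately show False by blast
    qed
  qed
  then obtain y where y: "y \<in> pball" "?G y = 0" by blast
  have y0: "y \<noteq> 0" using y(1) by (simp add: pball_def)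
  have "AE z in mu. ennreal ((ratio_root p K y - ratio_root p K z)\<^sup>2) = 0"
    using y(2) by (subst (asm) nn_integral_0_iff_AE) auto
  hence AEz: "AE z in mu. ratio_root p K z = ratio_root p K y" by eventually_elim simp
  define \<gamma> where "\<gamma> = \<phi> y"
  have inj: "\<phi> z = \<gamma>" if "z \<noteq> 0" "ratio_root p K z = ratio_root p K y" for z
  proof -
    have "(\<phi> z powr (- s)) powr (- 1 / s) = (\<phi> y powr (- s)) powr (- 1 / s)" using that(2) by (simp add: fdef)
    thus ?thesis unfolding powr_powr \<gamma>_def using s \<phi>0[OF that(1)] \<phi>0[OF y0] by simp
  qed
  let ?O = "(ball 0 1 - {0}) \<inter> {z. mom p dotk K z \<noteq> \<gamma> * norm z powr p}"
  have Oo: "open ?O"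
    by (intro open_Int open_Diff open_ball closed_singleton open_Collect_neq phom_cont[OF N] continuous_intros phom_cont[OF norm_powr_phom[OF p0]])
  have "?O = {}"
  proof (rule open_AE_empty[OF Oo])
    have "AE z in lborel. z \<in> pball \<longrightarrow> ratio_root p K z = ratio_root p K y"
      using AEz unfolding mu_def by (subst (asm) AE_restrict_space_iff) (auto simp: pball_borel)
    thus "AE z in lborel. z \<notin> ?O"
    proof eventually_elim
      case (elim z)
      show ?case
      proof
        assume z: "z \<in> ?O"
        hence z': "z \<in> pball" "z \<noteq> 0" by (auto simp: pball_def)
        have "\<phi> z = \<gamma>" using inj[OF z'(2)] elim z'(1) by blast
        hence "mom p dotk K z = \<gamma> * norm z powr p" using z'(2) by (simp add: \<phi>_def field_simps)
        thus False using z by simp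
      qed
    qed
  qed
  hence small: "mom p dotk K z = \<gamma> * norm z powr p" if "norm z < 1" "z \<noteq> 0" for z using that by auto
  show ?thesis
  proof (rule that)
    show "\<gamma> > 0" unfolding \<gamma>_def by (rule \<phi>0[OF y0])
    fix x :: 'a
    show "mom p dotk K x = \<gamma> * norm x powr p"
    proof (cases "x = 0")
      case False
      let ?c = "1 / (2 * norm x)"
      have c: "?c > 0" using False by simp
      have "norm (?c *\<^sub>R x) < 1" "?c *\<^sub>R x \<noteq> 0" using False by auto
      from small[OF this] have "?c powr p * mom p dotk K x = \<gamma> * (?c * norm x) powr p"
        using c by (simp only: phom_scale[OF N] norm_scaleR abs_of_pos)
      also have "\<dots> = ?c powr p * (\<gamma> * norm x powr p)" using c by (subst powr_mult) auto
      finally show ?thesis using c by (simp only: mult_cancel_left) simp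
    qed (simp add: phom_zero[OF N])
  qed
qed

text \<open>With q = n/p, D^(-q) times the sine functional of \<open>K\<close> is at most the dot
  functional of \<open>K\<close>, hence at most that of the ball, which is D^(-q) times its sine
  functional. Equality kills the variation, so the dot moment of \<open>K\<close> is radial and its
  sublevel set a ball; equality in the duality step then makes \<open>K\<close> itself a
  ball.\<close>

theorem pgram_ball:
  fixes K :: "'a set"
  assumes p: "p \<ge> 1" and K: "adm p K"
  shows "Qf p pgram K \<le> Qf p pgram (cball 0 1 :: 'a set)"
    "Qf p pgram K = Qf p pgram (cball 0 1 :: 'a set) \<Longrightarrow> \<exists>r>0. AE x in lborel. x \<in> K \<longleftrightarrow> x \<in> cball (0::'a) r"
proof -
  let ?B = "cball 0 1 :: 'a set" and ?q = "real DIM('a) / p"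
  have p0: "p > 0" using p by simp
  have B: "adm p ?B" using p0 by (intro adm_cball) auto
  note kp = kernel_pgram[where 'a='a, OF dim2]
  note k0 = adm_measure_pos[OF K]
  obtain D \<kappa> :: real where D: "D > 0" and \<kappa>: "\<kappa> > 0"
    and DB: "\<And>x. mom p dotk ?B x = D * mom p pgram ?B x"
    and vol: "\<And>K :: 'a set. adm p K \<Longrightarrow> ennreal (D powr (- ?q) * lvol (mom p pgram K)) + ennreal \<kappa> * ratio_variation p K
       \<le> ennreal (lvol (mom p dotk K))"
    using dotk_pgram_volumes[OF p] by metis
  have DBf: "mom p dotk ?B = (\<lambda>x. D * mom p pgram ?B x)" using DB by blast
  have QB: "Qf p dotk ?B = D powr (- ?q) * Qf p pgram ?B"
    unfolding Qf_def DBf lvol_cmult[OF mom_phom_convex(1)[OF kp p B] p0 D] by simp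
  have l0: "lvol (mom p dotk K) \<ge> 0" by (simp add: lvol_def)
  have "ennreal (D powr (- ?q) * lvol (mom p pgram K)) \<le> ennreal (lvol (mom p dotk K))"
    by (rule order_trans[OF add_increasing2[OF zero_le order_refl] vol[OF K]])
  hence le1: "D powr (- ?q) * lvol (mom p pgram K) \<le> lvol (mom p dotk K)" using l0 by simp
  have le2: "D powr (- ?q) * Qf p pgram K \<le> Qf p dotk K"
    using mult_left_mono[OF le1, of "measure lborel K powr (1 + ?q)"] by (simp add: Qf_def mult_ac)
  have le3: "Qf p dotk K \<le> D powr (- ?q) * Qf p pgram ?B" using Lutwak_Zhang(1)[OF p K] QB by simp
  have dp: "D powr (- ?q) > 0" using D by simp
  show "Qf p pgram K \<le> Qf p pgram ?B" using order_trans[OF le2 le3] dp by simp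
  assume eq: "Qf p pgram K = Qf p pgram ?B"
  have e1: "Qf p dotk K = D powr (- ?q) * Qf p pgram K" using le2 le3 eq by simp
  have QK: "Qf p dotk K = Qf p dotk ?B" using e1 eq QB by simp
  have kq: "measure lborel K powr (1 + ?q) > 0" using k0 by simp
  have "measure lborel K powr (1 + ?q) * lvol (mom p dotk K) = measure lborel K powr (1 + ?q) * (D powr (- ?q) * lvol (mom p pgram K))"
    using e1 by (simp add: Qf_def mult_ac)
  hence "lvol (mom p dotk K) = D powr (- ?q) * lvol (mom p pgram K)" using kq by simp
  hence "ennreal (lvol (mom p dotk K)) + ennreal \<kappa> * ratio_variation p K \<le> ennreal (lvol (mom p dotk K)) + 0" using vol[OF K] by simp
  hence "ennreal \<kappa> * ratio_variation p K = 0" by (subst (asm) ennreal_add_left_cancel_le) auto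
  hence "ratio_variation p K = 0" using \<kappa> by auto
  then obtain \<gamma> where \<gamma>: "\<gamma> > 0" "\<And>x. mom p dotk K x = \<gamma> * norm x powr p" using ratio_variation_zero_ratio[OF p K] by metis
  define s where "s = (1 / \<gamma>) powr (1 / p)"
  have s: "s > 0" using \<gamma> by (simp add: s_def)
  have sp: "s powr p = 1 / \<gamma>" unfolding s_def powr_powr using \<gamma> p0 by simp
  have powr_le: "norm x powr p \<le> c powr p \<longleftrightarrow> norm x \<le> c" if "c > 0" for c :: real and x :: 'a
    using that p0 by (meson powr_less_mono2 powr_mono2 less_le_not_le norm_ge_zero not_le less_imp_le)
  have L: "{x. mom p dotk K x \<le> 1} = cball 0 s"
  proof -
    have "mom p dotk K x \<le> 1 \<longleftrightarrow> norm x powr p \<le> s powr p" for x using \<gamma> by (simp add: sp pos_le_divide_eq mult.commute)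
    thus ?thesis by (intro set_eqI) (simp only: mem_Collect_eq mem_cball_0 powr_le[OF s])
  qed
  have "cball (0::'a) s = (\<lambda>x. s *\<^sub>R x) ` ?B"
  proof (intro set_eqI iffI)
    fix x :: 'a assume "x \<in> cball 0 s"
    hence "(1 / s) *\<^sub>R x \<in> ?B" using s by (simp add: field_simps)
    moreover have "x = s *\<^sub>R ((1 / s) *\<^sub>R x)" using s by simp
    ultimately show "x \<in> (\<lambda>x. s *\<^sub>R x) ` ?B" by blast
  qed (use s in auto)
  moreover have "s \<noteq> 0" using s by simp
  ultimately have "Qf p dotk (cball (0::'a) s) = Qf p dotk ?B"
    using Qf_ellipsoid[OF linear_scaleR_inj[OF \<open>s \<noteq> 0\<close>] p, where 'a='a] by (simp only:)
  hence "Qf p dotk K = Qf p dotk {x. mom p dotk K x \<le> 1}" using QK L by simp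
  then obtain r where r: "r > 0" "AE x in lborel. x \<in> K \<longleftrightarrow> mom p dotk (cball 0 s) x \<le> r"
    using Qf_polar(2)[OF kernel_dotk p K] L by metis
  obtain c where c: "c > 0" "\<And>x. mom p dotk (cball (0::'a) s) x = c * norm x powr p"
    using mom_radial[OF kernel_dotk dotk_orthogonal p adm_cball[OF s p0] orthogonal_vimage_cball] by metis
  define t where "t = (r / c) powr (1 / p)"
  have t: "t > 0" using r c by (simp add: t_def)
  have tp: "t powr p = r / c" unfolding t_def powr_powr using r(1) c(1) p0 by simp
  have "mom p dotk (cball 0 s) x \<le> r \<longleftrightarrow> x \<in> cball 0 t" for x :: 'a
  proof -
    have "mom p dotk (cball 0 s) x \<le> r \<longleftrightarrow> norm x powr p \<le> t powr p" using c by (simp add: tp pos_le_divide_eq mult.commute)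
    thus ?thesis by (simp only: mem_cball_0 powr_le[OF t])
  qed
  thus "\<exists>r>0. AE x in lborel. x \<in> K \<longleftrightarrow> x \<in> cball (0::'a) r" using r(2) t by auto
qed

end

section \<open>The unit ball\<close>

lemma omega_eq_unit_ball_vol: "omega s = unit_ball_vol s"
  by (simp add: omega_def unit_ball_vol_def add.commute)

text \<open>The distribution is compared after a change of sign, because sublevel sets have finite measure.\<close>
lemma nn_integral_PiM_norm:
  fixes A :: "'b set" and g :: "real \<Rightarrow> ennreal"
  assumes A: "finite A" "A \<noteq> {}" and g [measurable]: "g \<in> borel_measurable borel"
  shows "(\<integral>\<^sup>+z. g (sqrt (\<Sum>i\<in>A. (z i)\<^sup>2)) \<partial>Pi\<^sub>M A (\<lambda>_. lborel))
    = (\<integral>\<^sup>+r. g r * ennreal (real (card A) * unit_ball_vol (real (card A)) * r ^ (card A - 1)) * indicator {0..} r \<partial>lborel)"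
proof -
  let ?d = "card A" and ?P = "Pi\<^sub>M A (\<lambda>_. lborel :: real measure)"
  let ?w = "unit_ball_vol (real ?d)"
  have d: "?d > 0" using A by (simp add: card_gt_0_iff)
  let ?h = "\<lambda>r. ennreal (real ?d * ?w * (- r) ^ (?d - 1)) * indicator {..0} r"
  let ?N = "\<lambda>z. sqrt (\<Sum>i\<in>A. (z i)\<^sup>2)"
  have hm [measurable]: "?h \<in> borel_measurable borel" by measurable
  have Nm [measurable]: "(\<lambda>z. - ?N z) \<in> ?P \<rightarrow>\<^sub>M borel" by measurable
  have tail: "emeasure (distr ?P borel (\<lambda>z. - ?N z)) {x<..} = ennreal (?w * (max 0 (- x)) ^ ?d)" for x
  proof -
    have "emeasure (distr ?P borel (\<lambda>z. - ?N z)) {x<..} = emeasure ?P ({z. ?N z < - x} \<inter> space ?P)"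
      by (subst emeasure_distr) (auto intro!: arg_cong2[where f=emeasure])
    also have "\<dots> = ennreal (?w * (max 0 (- x)) ^ ?d)"
    proof (cases "x < 0")
      case True
      define r where "r = - x"
      have r: "r > 0" using True by (simp add: r_def)
      \<comment> \<open>The tails correspond to open balls, which are exhausted by closed ones;
        starting at half the radius keeps all radii positive.\<close>
      define s where "s k = r * (1 - inverse (real (Suc (Suc k))))" for k :: nat
      have s0: "s k > 0" for k using r by (simp add: s_def inverse_less_1_iff)
      have sinc: "incseq s"
        unfolding s_def by (intro incseq_SucI mult_left_mono diff_left_mono) (use r in \<open>auto intro!: le_imp_inverse_le\<close>)
      have slim: "s \<longlonglongrightarrow> r"
      proof -
        have "(\<lambda>k. inverse (real (Suc (Suc k)))) \<longlonglongrightarrow> 0" by (rule LIMSEQ_Suc[OF LIMSEQ_inverse_real_of_nat])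
        hence "(\<lambda>k. r * (1 - inverse (real (Suc (Suc k))))) \<longlonglongrightarrow> r * (1 - 0)" by (intro tendsto_intros)
        thus ?thesis by (simp add: s_def[abs_def])
      qed
      have sr: "s k < r" for k using r by (simp add: s_def)
      have U: "{z. ?N z < r} \<inter> space ?P = (\<Union>k. {z. ?N z \<le> s k} \<inter> space ?P)"
      proof (intro equalityI subsetI)
        fix z assume z: "z \<in> {z. ?N z < r} \<inter> space ?P"
        hence "eventually (\<lambda>k. ?N z < s k) sequentially" using order_tendstoD(1)[OF slim] by auto
        then obtain k where "?N z < s k" by (auto simp: eventually_sequentially)
        thus "z \<in> (\<Union>k. {z. ?N z \<le> s k} \<inter> space ?P)" using z by (auto intro: less_imp_le)
      next
        fix z assume "z \<in> (\<Union>k. {z. ?N z \<le> s k} \<inter> space ?P)"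
        thus "z \<in> {z. ?N z < r} \<inter> space ?P" using sr by (auto intro: le_less_trans)
      qed
      have "(\<lambda>k. emeasure ?P ({z. ?N z \<le> s k} \<inter> space ?P)) \<longlonglongrightarrow> emeasure ?P (\<Union>k. {z. ?N z \<le> s k} \<inter> space ?P)"
      proof (rule Lim_emeasure_incseq)
        have "{z \<in> space ?P. ?N z \<le> s k} \<in> sets ?P" for k by measurable
        moreover have "{z. ?N z \<le> s k} \<inter> space ?P = {z \<in> space ?P. ?N z \<le> s k}" for k by auto
        ultimately show "range (\<lambda>k. {z. ?N z \<le> s k} \<inter> space ?P) \<subseteq> sets ?P" by auto
        show "incseq (\<lambda>k. {z. ?N z \<le> s k} \<inter> space ?P)"
          using sinc by (auto simp: incseq_def intro: order_trans)
      qed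
      moreover have "(\<lambda>k. emeasure ?P ({z. ?N z \<le> s k} \<inter> space ?P)) = (\<lambda>k. ennreal (?w * s k ^ ?d))"
        by (intro ext emeasure_cball_aux A s0)
      moreover have "(\<lambda>k. ennreal (?w * s k ^ ?d)) \<longlonglongrightarrow> ennreal (?w * r ^ ?d)"
        by (intro tendsto_ennrealI tendsto_intros slim)
      ultimately have "emeasure ?P (\<Union>k. {z. ?N z \<le> s k} \<inter> space ?P) = ennreal (?w * r ^ ?d)"
        using LIMSEQ_unique by metis
      thus ?thesis using r unfolding r_def[symmetric] U by simp
    next
      case False
      have "- x \<le> ?N z" for z :: "'b \<Rightarrow> real"
      proof -
        have "0 \<le> ?N z" by (simp add: sum_nonneg)
        thus ?thesis using False by linarith
      qed
      hence "{z. ?N z < - x} = {}" by (auto simp: not_less)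
      thus ?thesis using False d by simp
    qed
    finally show ?thesis .
  qed
  have tail': "emeasure (density lborel ?h) {x<..} = ennreal (?w * (max 0 (- x)) ^ ?d)" for x
  proof -
    have "emeasure (density lborel ?h) {x<..} = (\<integral>\<^sup>+r. ?h r * indicator {x<..} r \<partial>lborel)"
      by (rule emeasure_density) auto
    also have "\<dots> = (\<integral>\<^sup>+r. ennreal (real ?d * ?w * (- r) ^ (?d - 1)) * indicator {min x 0..0} r \<partial>lborel)"
    proof (rule nn_integral_cong_AE)
      have "AE r in lborel. r \<noteq> x" by (rule AE_lborel_singleton)
      moreover have "AE r in lborel. r \<noteq> (0::real)" by (rule AE_lborel_singleton)
      ultimately show "AE r in lborel. ?h r * indicator {x<..} r = ennreal (real ?d * ?w * (- r) ^ (?d - 1)) * indicator {min x 0..0} r"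
        by eventually_elim (auto simp: indicator_def)
    qed
    also have "\<dots> = ennreal (- ?w * (- 0) ^ ?d - (- ?w * (- (min x 0)) ^ ?d))"
    proof (rule nn_integral_FTC_within)
      fix r :: real
      assume "r \<in> {min x 0..0}"
      thus "0 \<le> real ?d * ?w * (- r) ^ (?d - 1)" by simp
      have "((\<lambda>r. - ?w * (- r) ^ ?d) has_real_derivative - ?w * (real ?d * (- r) ^ (?d - 1) * (- 1))) (at r)"
        by (auto intro!: derivative_eq_intros)
      thus "((\<lambda>r. - ?w * (- r) ^ ?d) has_real_derivative real ?d * ?w * (- r) ^ (?d - 1)) (at r within {min x 0..0})"
        by (simp add: mult_ac has_field_derivative_at_within)
    qed auto
    also have "- ?w * (- 0) ^ ?d - (- ?w * (- (min x 0)) ^ ?d) = ?w * (max 0 (- x)) ^ ?d"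
      using d by (simp add: min_def max_def)
    finally show ?thesis .
  qed
  have eq: "distr ?P borel (\<lambda>z. - ?N z) = density lborel ?h"
  proof (rule measure_eqI_lessThan)
    fix x
    show "emeasure (distr ?P borel (\<lambda>z. - ?N z)) {x<..} < \<infinity>" unfolding tail by simp
    show "emeasure (distr ?P borel (\<lambda>z. - ?N z)) {x<..} = emeasure (density lborel ?h) {x<..}" unfolding tail tail' ..
  qed simp_all
  have "(\<integral>\<^sup>+z. g (?N z) \<partial>?P) = (\<integral>\<^sup>+r. g (- r) \<partial>(distr ?P borel (\<lambda>z. - ?N z)))"
    by (subst nn_integral_distr) auto
  also have "\<dots> = (\<integral>\<^sup>+r. ?h r * g (- r) \<partial>lborel)"
    unfolding eq by (rule nn_integral_density) auto
  also have "\<dots> = (\<integral>\<^sup>+r. ?h (- r) * g (- (- r)) \<partial>lborel)"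
    by (subst nn_integral_real_affine[where c="-1" and t=0]) auto
  also have "\<dots> = (\<integral>\<^sup>+r. g r * ennreal (real ?d * ?w * r ^ (?d - 1)) * indicator {0..} r \<partial>lborel)"
    by (intro nn_integral_cong) (auto simp: indicator_def mult_ac)
  finally show ?thesis .
qed

text \<open>Substitute t = \<open>r\<^sup>2\<close> in Euler's integral. The integrand is a radial
  weight times the length of a chord of the unit ball at distance r from the centre.\<close>

lemma Beta_integral:
  fixes m :: real
  assumes m: "m > -1"
  shows "(\<integral>\<^sup>+r. ennreal (r powr m * (2 * sqrt (1 - r\<^sup>2))) * indicator {0..1} r \<partial>lborel) = ennreal (Beta ((m + 1) / 2) (3/2))"
proof -
  have "((\<lambda>t. t powr ((m+1)/2 - 1) * (1 - t) powr (3/2 - 1)) has_integral Beta ((m+1)/2) (3/2)) {0..1}"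
    using m by (intro has_integral_Beta_real) auto
  from nn_integral_has_integral_lebesgue[OF _ this]
  have "ennreal (Beta ((m+1)/2) (3/2)) = (\<integral>\<^sup>+t. ennreal (t powr ((m-1)/2) * (1 - t) powr (1/2) * indicator {0^2..1^2} t) \<partial>lborel)"
    by (simp add: mult_ac ennreal_mult' ennreal_indicator diff_divide_distrib add_divide_distrib)
  also have "\<dots> = (\<integral>\<^sup>+x. ennreal (x\<^sup>2 powr ((m-1)/2) * (1 - x\<^sup>2) powr (1/2) * (2 * x) * indicator {0..1} x) \<partial>lborel)"
    by (subst nn_integral_substitution[where g = "\<lambda>x. x ^ 2" and g' = "\<lambda>x. 2 * x"])
       (auto intro!: derivative_eq_intros continuous_intros simp: set_borel_measurable_def)
  also have "\<dots> = (\<integral>\<^sup>+r. ennreal (r powr m * (2 * sqrt (1 - r\<^sup>2))) * indicator {0..1} r \<partial>lborel)"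
  proof (rule nn_integral_cong_AE)
    have "AE x in lborel. x \<noteq> (0::real)" by (rule AE_lborel_singleton)
    thus "AE x in lborel. ennreal (x\<^sup>2 powr ((m-1)/2) * (1 - x\<^sup>2) powr (1/2) * (2 * x) * indicator {0..1} x)
      = ennreal (x powr m * (2 * sqrt (1 - x\<^sup>2))) * indicator {0..1} x"
    proof eventually_elim
      case (elim x)
      show ?case
      proof (cases "x \<in> {0..1}")
        case True
        hence x: "x > 0" "x\<^sup>2 \<le> 1" using elim by (auto simp: abs_square_le_1)
        have "x\<^sup>2 powr ((m-1)/2) * x = (x powr 2) powr ((m-1)/2) * x powr 1" using x by simp
        also have "\<dots> = x powr m" unfolding powr_powr powr_add[symmetric] by (simp add: diff_divide_distrib)
        finally show ?thesis using True x by (simp add: powr_half_sqrt mult_ac)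
      qed simp
    qed
  qed
  finally show ?thesis ..
qed

text \<open>The right side is the sine moment of the unit ball at a unit vector: (n-1) omega_(n-1)
  is the surface area of the unit sphere in dimension n-1, and the Beta value is the radial
  integral. The quotient of the two other omegas in \<open>ctilde\<close> is what remains of the
  Gamma factors.\<close>

lemma ctilde_Beta:
  assumes n: "n \<ge> 2" and p: "p \<ge> 1"
  shows "ctilde n p * omega (real n) = (real n - 1) * omega (real n - 1) * Beta ((real n + p - 1) / 2) (3/2)" "ctilde n p > 0"
proof -
  let ?u = "(real n + p - 1) / 2" and ?v = "(real n + p) / 2"
  have u: "?u > 0" "?v > 0" using n p by auto
  have om: "omega (real n) > 0" unfolding omega_eq_unit_ball_vol by simp
  have om1: "omega (real n - 1) > 0" unfolding omega_eq_unit_ball_vol using n by simp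
  have g32: "Gamma (3/2 :: real) = sqrt pi / 2"
  proof -
    have "(1/2 :: real) \<notin> \<int>\<^sub>\<le>\<^sub>0"
    proof
      assume "(1/2 :: real) \<in> \<int>\<^sub>\<le>\<^sub>0"
      then obtain n where n: "1/2 = real_of_int n" "n \<le> 0" by (elim nonpos_Ints_cases)
      have "real_of_int n \<le> 0" using n(2) by simp
      thus False using n(1) by linarith
    qed
    from Gamma_plus1[OF this] show ?thesis using Gamma_one_half_real by simp
  qed
  have gv: "Gamma (?v + 1) = ?v * Gamma ?v" using u by (intro Gamma_plus1) (auto elim!: nonpos_Ints_cases)
  have uv: "?u + 3/2 = ?v + 1" by (simp add: field_simps)
  have B: "Beta ?u (3/2) = Gamma ?u * sqrt pi / ((real n + p) * Gamma ?v)"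
    unfolding Beta_def uv gv g32 by (simp add: field_simps)
  have o1: "omega (real n + p - 2) = pi powr ((real n + p - 2) / 2) / Gamma ?v"
    by (simp add: omega_def field_simps)
  have o2: "omega (real n + p - 3) = pi powr ((real n + p - 3) / 2) / Gamma ?u"
    by (simp add: omega_def field_simps)
  have pp: "pi powr ((real n + p - 2) / 2) = pi powr ((real n + p - 3) / 2) * sqrt pi"
    unfolding powr_half_sqrt[OF pi_ge_zero, symmetric] powr_add[symmetric] by (simp add: field_simps)
  have G: "Gamma ?u > 0" "Gamma ?v > 0" using u by (auto intro: Gamma_real_pos)
  have P: "pi powr ((real n + p - 3) / 2) > 0" by simp
  have ratio: "omega (real n + p - 2) / omega (real n + p - 3) = sqrt pi * Gamma ?u / Gamma ?v"
    unfolding o1 o2 pp using G P by (simp add: field_simps)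
  have "ctilde n p * omega (real n) = (real n - 1) * omega (real n - 1) * (omega (real n + p - 2) / omega (real n + p - 3)) / (real n + p)"
    using om by (simp add: ctilde_def mult_ac)
  also have "\<dots> = (real n - 1) * omega (real n - 1) * Beta ?u (3/2)"
    unfolding ratio B by (simp add: mult_ac)
  finally show eq: "ctilde n p * omega (real n) = (real n - 1) * omega (real n - 1) * Beta ?u (3/2)" .
  have "Beta ?u (3/2) > 0" unfolding B using G n p by simp
  hence "ctilde n p * omega (real n) > 0" unfolding eq using om1 n by simp
  thus "ctilde n p > 0" using om by (simp add: zero_less_mult_iff)
qed

text \<open>Cylindrical coordinates about the axis \<open>b\<close>: [y,b] is the distance r of y
  from the axis, and a line parallel to the axis at that distance meets the ball in a chord of
  length 2 sqrt(1 - \<open>r\<^sup>2\<close>).\<close>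

lemma mom_pgram_cball:
  assumes dim: "DIM('a::euclidean_space) \<ge> 2" and p: "p \<ge> 1"
  shows "mom p pgram (cball 0 1) (x::'a) = ctilde DIM('a) p * omega (real DIM('a)) * norm x powr p"
proof -
  have p0: "p > 0" using p by simp
  let ?B = "cball 0 1 :: 'a set" and ?n = "real DIM('a)"
  note kp = kernel_pgram[where 'a='a, OF dim]
  note [measurable] = kernel_measurable[OF kp]
  have B: "adm p ?B" using content_cball_pos[of 1 "0::'a"] p0 by (intro adm_bounded) auto
  obtain c where c: "c > 0" "\<And>x. mom p pgram ?B x = c * norm x powr p"
    by (rule mom_radial[OF kp pgram_orthogonal p B]) (auto simp: orthogonal_transformation_norm)
  obtain b :: 'a where b: "b \<in> Basis" using nonempty_Basis by blast
  let ?A = "Basis - {b}"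
  have cA: "card ?A = DIM('a) - 1" using b by simp
  have cA0: "?A \<noteq> {}" using cA dim by (metis card.empty diff_is_0_eq not_numeral_le_zero numeral_2_eq_2 Suc_1 diff_Suc_1 not_less_eq_eq)
  let ?Nz = "\<lambda>z::'a \<Rightarrow> real. sqrt (\<Sum>i\<in>?A. (z i)\<^sup>2)"
  let ?g = "\<lambda>r::real. ennreal (r powr p * (2 * sqrt (1 - r\<^sup>2))) * indicator {..1} r"
  have "ennreal c = ennreal (mom p pgram ?B b)" using b by (simp add: c(2))
  also have "\<dots> = (\<integral>\<^sup>+y. ennreal (indicator ?B y *\<^sub>R pgram y b powr p) \<partial>lborel)"
    unfolding mom_def set_lebesgue_integral_def
    using mom_integrable[OF kp p0 B, of b] by (intro nn_integral_eq_integral[symmetric]) (auto simp: set_integrable_def)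
  also have "\<dots> = (\<integral>\<^sup>+z. (\<integral>\<^sup>+t. ennreal (indicator ?B ((\<Sum>c\<in>?A. z c *\<^sub>R c) + t *\<^sub>R b) *\<^sub>R pgram ((\<Sum>c\<in>?A. z c *\<^sub>R c) + t *\<^sub>R b) b powr p) \<partial>lborel)
      \<partial>Pi\<^sub>M ?A (\<lambda>_. lborel))"
  proof (rule nn_integral_lborel_coord[OF b])
    have [measurable]: "(\<lambda>y. pgram y b) \<in> borel_measurable borel"
      unfolding pgram_def by (intro borel_measurable_continuous_onI continuous_intros)
    have [measurable]: "?B \<in> sets borel" by simp
    show "(\<lambda>y. ennreal (indicator ?B y *\<^sub>R pgram y b powr p)) \<in> borel_measurable borel" by measurable
  qed
  also have "\<dots> = (\<integral>\<^sup>+z. ?g (?Nz z) \<partial>Pi\<^sub>M ?A (\<lambda>_. lborel))"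
  proof (rule nn_integral_cong)
    fix z :: "'a \<Rightarrow> real"
    define r where "r = ?Nz z"
    have r0: "r \<ge> 0" by (simp add: r_def sum_nonneg)
    let ?w = "\<Sum>c\<in>?A. z c *\<^sub>R c"
    have wi: "?w \<bullet> i = (if i = b then 0 else z i)" if "i \<in> Basis" for i
      using that by (simp add: inner_sum_left inner_Basis if_distrib sum.delta cong: if_cong)
    have wb: "?w \<bullet> b = 0" using wi[OF b] by simp
    have ww: "?w \<bullet> ?w = r\<^sup>2"
    proof -
      have "?w \<bullet> ?w = (\<Sum>i\<in>Basis. (?w \<bullet> i) * (?w \<bullet> i))" by (rule euclidean_inner)
      also have "\<dots> = (\<Sum>i\<in>?A. (z i)\<^sup>2)"
        by (rule sum.mono_neutral_cong_right) (auto simp: wi b power2_eq_square)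
      finally show ?thesis by (simp add: r_def sum_nonneg)
    qed
    have bb: "b \<bullet> b = 1" using b by simp
    have nn: "(norm (?w + t *\<^sub>R b))\<^sup>2 = r\<^sup>2 + t\<^sup>2" for t
      unfolding power2_norm_eq_inner using ww wb bb
      by (simp add: inner_add_left inner_add_right inner_commute[of b ?w] power2_eq_square)
    have pg: "pgram (?w + t *\<^sub>R b) b = r" for t
    proof -
      have "(?w + t *\<^sub>R b) \<bullet> b = t" using wb bb by (simp add: inner_add_left)
      thus ?thesis unfolding pgram_def nn using b r0 by simp
    qed
    have mem: "?w + t *\<^sub>R b \<in> ?B \<longleftrightarrow> r\<^sup>2 + t\<^sup>2 \<le> 1" for t
      unfolding nn[symmetric] by (simp add: abs_square_le_1)
    have "(\<integral>\<^sup>+t. ennreal (indicator ?B (?w + t *\<^sub>R b) *\<^sub>R pgram (?w + t *\<^sub>R b) b powr p) \<partial>lborel)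
      = (\<integral>\<^sup>+t. ennreal (r powr p) * indicator {t. r\<^sup>2 + t\<^sup>2 \<le> 1} t \<partial>lborel)"
    proof (rule nn_integral_cong)
      fix t
      have i: "indicator ?B (?w + t *\<^sub>R b) = (indicator {t. r\<^sup>2 + t\<^sup>2 \<le> 1} t :: real)"
        using mem[of t] by (simp only: indicator_def mem_Collect_eq)
      show "ennreal (indicator ?B (?w + t *\<^sub>R b) *\<^sub>R pgram (?w + t *\<^sub>R b) b powr p)
        = ennreal (r powr p) * indicator {t. r\<^sup>2 + t\<^sup>2 \<le> 1} t"
        unfolding pg i by (simp add: indicator_def)
    qed
    also have "\<dots> = ennreal (r powr p) * emeasure lborel {t. r\<^sup>2 + t\<^sup>2 \<le> 1}"
      by (rule nn_integral_cmult_indicator) measurable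
    also have "\<dots> = ?g r"
    proof (cases "r \<le> 1")
      case True
      hence r1: "r\<^sup>2 \<le> 1" using r0 by (simp add: abs_square_le_1)
      have "{t. r\<^sup>2 + t\<^sup>2 \<le> 1} = {- sqrt (1 - r\<^sup>2)..sqrt (1 - r\<^sup>2)}"
      proof -
        have "r\<^sup>2 + t\<^sup>2 \<le> 1 \<longleftrightarrow> \<bar>t\<bar> \<le> sqrt (1 - r\<^sup>2)" for t
        proof -
          have "\<bar>t\<bar> \<le> sqrt (1 - r\<^sup>2) \<longleftrightarrow> sqrt (t\<^sup>2) \<le> sqrt (1 - r\<^sup>2)" by simp
          also have "\<dots> \<longleftrightarrow> t\<^sup>2 \<le> 1 - r\<^sup>2" by (rule real_sqrt_le_iff)
          finally show ?thesis by auto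
        qed
        thus ?thesis by (intro set_eqI) (simp only: mem_Collect_eq atLeastAtMost_iff abs_le_iff minus_le_iff conj_commute)
      qed
      thus ?thesis using True r1 by (simp add: ennreal_mult)
    next
      case False
      hence "1 < r\<^sup>2" by (simp add: one_less_power)
      hence "{t. r\<^sup>2 + t\<^sup>2 \<le> 1} = {}" by (auto simp: not_le intro: less_le_trans)
      thus ?thesis using False by simp
    qed
    finally show "(\<integral>\<^sup>+t. ennreal (indicator ?B (?w + t *\<^sub>R b) *\<^sub>R pgram (?w + t *\<^sub>R b) b powr p) \<partial>lborel) = ?g (?Nz z)"
      unfolding r_def .
  qed
  also have "\<dots> = (\<integral>\<^sup>+r. ?g r * ennreal (real (card ?A) * unit_ball_vol (real (card ?A)) * r ^ (card ?A - 1)) * indicator {0..} r \<partial>lborel)"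
    by (rule nn_integral_PiM_norm[OF _ cA0]) (simp, measurable)
  also have "\<dots> = (\<integral>\<^sup>+r. ennreal ((?n - 1) * omega (?n - 1)) * (ennreal (r powr (?n + p - 2) * (2 * sqrt (1 - r\<^sup>2))) * indicator {0..1} r) \<partial>lborel)"
  proof (rule nn_integral_cong_AE)
    have n1: "real (card ?A) = ?n - 1" using cA dim by simp
    have o0: "omega (?n - 1) \<ge> 0" unfolding omega_eq_unit_ball_vol using dim by simp
    have "AE r in lborel. r \<noteq> (0::real)" by (rule AE_lborel_singleton)
    thus "AE r in lborel. ?g r * ennreal (real (card ?A) * unit_ball_vol (real (card ?A)) * r ^ (card ?A - 1)) * indicator {0..} r
       = ennreal ((?n - 1) * omega (?n - 1)) * (ennreal (r powr (?n + p - 2) * (2 * sqrt (1 - r\<^sup>2))) * indicator {0..1} r)"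
    proof eventually_elim
      case (elim r)
      show ?case
      proof (cases "r \<in> {0..1}")
        case True
        hence r: "r > 0" "r\<^sup>2 \<le> 1" using elim by (auto simp: abs_square_le_1)
        have e: "r ^ (card ?A - 1) = r powr (?n - 2)"
        proof -
          have "card ?A - 1 + 2 = DIM('a)" using cA dim by linarith
          hence "real (card ?A - 1) + 2 = ?n" by (metis of_nat_add of_nat_numeral)
          hence "?n - 2 = real (card ?A - 1)" by linarith
          thus ?thesis by (simp only: powr_realpow[OF r(1)])
        qed
        have e2: "r powr p * r powr (?n - 2) = r powr (?n + p - 2)"
        proof -
          have "p + (?n - 2) = ?n + p - 2" by simp
          thus ?thesis by (simp only: powr_add[symmetric])
        qed
        have X0: "0 \<le> (?n - 1) * omega (?n - 1) * r powr (?n - 2)" using o0 dim by simp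
        have G0: "0 \<le> r powr p * (2 * sqrt (1 - r\<^sup>2))" using r by simp
        have "?g r * ennreal (real (card ?A) * unit_ball_vol (real (card ?A)) * r ^ (card ?A - 1)) * indicator {0..} r
          = ennreal (r powr p * (2 * sqrt (1 - r\<^sup>2))) * ennreal ((?n - 1) * omega (?n - 1) * r powr (?n - 2))"
          unfolding n1 e omega_eq_unit_ball_vol[symmetric] using True by simp
        also have "\<dots> = ennreal (r powr p * (2 * sqrt (1 - r\<^sup>2)) * ((?n - 1) * omega (?n - 1) * r powr (?n - 2)))"
          by (rule ennreal_mult[OF G0 X0, symmetric])
        also have "r powr p * (2 * sqrt (1 - r\<^sup>2)) * ((?n - 1) * omega (?n - 1) * r powr (?n - 2))
          = (?n - 1) * omega (?n - 1) * (r powr (?n + p - 2) * (2 * sqrt (1 - r\<^sup>2)))"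
          unfolding e2[symmetric] by (simp add: mult_ac)
        also have "ennreal \<dots> = ennreal ((?n - 1) * omega (?n - 1)) * ennreal (r powr (?n + p - 2) * (2 * sqrt (1 - r\<^sup>2)))"
          using r o0 dim by (intro ennreal_mult) auto
        finally show ?thesis using True by simp
      qed (auto simp: indicator_def)
    qed
  qed
  also have "\<dots> = ennreal ((?n - 1) * omega (?n - 1)) * ennreal (Beta ((?n + p - 1) / 2) (3/2))"
  proof -
    have "?n + p - 2 > -1" using dim p by simp
    from Beta_integral[OF this] show ?thesis by (subst nn_integral_cmult) (auto simp: diff_add_eq)
  qed
  also have "\<dots> = ennreal (ctilde DIM('a) p * omega ?n)"
  proof -
    have "(?n - 1) * omega (?n - 1) > 0" unfolding omega_eq_unit_ball_vol using dim by simp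
    moreover have "ctilde DIM('a) p * omega ?n > 0"
      using ctilde_Beta(2)[OF dim p] unfolding omega_eq_unit_ball_vol by simp
    ultimately have "Beta ((?n + p - 1) / 2) (3/2) > 0" unfolding ctilde_Beta(1)[OF dim p] by (rule zero_less_mult_pos[rotated])
    thus ?thesis unfolding ctilde_Beta(1)[OF dim p] using \<open>(?n - 1) * omega (?n - 1) > 0\<close> by (intro ennreal_mult[symmetric]) auto
  qed
  finally have "c = ctilde DIM('a) p * omega ?n"
    using c(1) ctilde_Beta(2)[OF dim p] by (subst (asm) ennreal_inj) (auto simp: omega_eq_unit_ball_vol)
  thus ?thesis by (simp add: c(2))
qed

section \<open>The planar case and dilations of the ball\<close>

text \<open>\<open>J\<close> is the quarter turn, and the identity is Lagrange's identity in the
  plane.\<close>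

lemma plane_rotation:
  assumes dim: "DIM('a::euclidean_space) = 2"
  obtains J :: "'a::euclidean_space \<Rightarrow> 'a" where "orthogonal_transformation J" "\<And>x y. pgram x y = dotk x (J y)"
proof -
  obtain b0 b1 :: 'a where b: "Basis = {b0, b1}" "b0 \<noteq> b1" using dim by (auto simp: card_2_iff)
  have bb: "b0 \<bullet> b0 = 1" "b1 \<bullet> b1 = 1" "b0 \<bullet> b1 = 0" "b1 \<bullet> b0 = 0"   proof -
    have m: "b0 \<in> Basis" "b1 \<in> Basis" unfolding b(1) by blast+
    show "b0 \<bullet> b0 = 1" "b1 \<bullet> b1 = 1" "b0 \<bullet> b1 = 0" "b1 \<bullet> b0 = 0" using m b(2) by (simp_all add: inner_Basis)
  qed
  have ip: "x \<bullet> y = (x \<bullet> b0) * (y \<bullet> b0) + (x \<bullet> b1) * (y \<bullet> b1)" for x y :: 'a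
    unfolding euclidean_inner[of x y] b(1) using b(2) by simp
  define J where "J x = (x \<bullet> b0) *\<^sub>R b1 - (x \<bullet> b1) *\<^sub>R b0" for x :: 'a
  have J: "J x \<bullet> b0 = - (x \<bullet> b1)" "J x \<bullet> b1 = x \<bullet> b0" for x by (simp_all add: J_def inner_diff_left bb)
  have "linear J" by (rule linearI) (simp_all add: J_def inner_add_left algebra_simps)
  moreover have "J x \<bullet> J y = x \<bullet> y" for x y by (subst (1 2) ip) (simp add: J)
  ultimately have o: "orthogonal_transformation J" by (simp add: orthogonal_transformation_def)
  have "pgram x y = dotk x (J y)" for x y
  proof -
    have "(norm x)\<^sup>2 * (norm y)\<^sup>2 - (x \<bullet> y)\<^sup>2 = (x \<bullet> J y)\<^sup>2"
      unfolding power2_norm_eq_inner ip[of x x] ip[of y y] ip[of x y] ip[of x "J y"] J by (simp add: power2_eq_square algebra_simps)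
    thus ?thesis by (simp add: pgram_def dotk_def)
  qed
  with o show ?thesis using that by blast
qed

lemma Qf_pgram_plane:
  fixes K :: "'a::euclidean_space set"
  assumes dim: "DIM('a) = 2" and p: "p \<ge> 1" and K: "adm p K"
  shows "Qf p pgram K = Qf p dotk K"
proof -
  obtain J :: "'a \<Rightarrow> 'a" where J: "orthogonal_transformation J" "\<And>x y. pgram x y = dotk x (J y)"
    using plane_rotation[OF dim] by metis
  have "mom p pgram K y = mom p dotk K (J y)" for y by (simp add: mom_def J(2))
  hence "{y. mom p pgram K y \<le> 1} = J -` {y. mom p dotk K y \<le> 1}" by auto
  hence "lvol (mom p pgram K) = lvol (mom p dotk K)"
    unfolding lvol_def
    using mpres_measure[OF mpres_orthogonal[OF J(1)] phom_sublevel_borel[OF mom_phom_convex(1)[OF kernel_dotk p K]]] by simp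
  thus ?thesis by (simp add: Qf_def)
qed

lemma Qf_pgram_cball:
  assumes dim: "DIM('a::euclidean_space) \<ge> 2" and p: "p \<ge> 1" and r: "r > 0"
  shows "Qf p pgram (cball (0::'a) r) = Qf p pgram (cball (0::'a) 1)"
proof -
  let ?n = "real DIM('a)" and ?B = "cball (0::'a) 1"
  have p0: "p > 0" using p by simp
  note kp = kernel_pgram[where 'a='a, OF dim]
  have B: "adm p ?B" using p0 by (intro adm_cball) auto
  note M = mom_phom_convex(1)[OF kp p B]
  have r0: "r \<noteq> 0" using r by simp
  have m: "mom p pgram (cball 0 r) x = r powr (?n + p) * mom p pgram ?B x" for x :: 'a
  proof -
    let ?f = "\<lambda>y. indicator (cball 0 r) y *\<^sub>R pgram y x powr p"
    have [measurable]: "(\<lambda>y. pgram y x) \<in> borel_measurable borel"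
      unfolding pgram_def by (intro borel_measurable_continuous_onI continuous_intros)
    have [measurable]: "cball 0 r \<in> sets (borel :: 'a measure)" by simp
    have fm: "?f \<in> borel_measurable borel" by measurable
    have "r powr (- ?n) * (\<integral>y. ?f y \<partial>lborel) = (\<integral>y. ?f (r *\<^sub>R y) \<partial>lborel)"
      using linear_integral[OF linear_scaleR_inj[OF r0] fm] lscale_scaleR[OF r, where 'a='a] by simp
    also have "\<dots> = (\<integral>y. r powr p * (indicator ?B y *\<^sub>R pgram y x powr p) \<partial>lborel)"
    proof (rule Bochner_Integration.integral_cong)
      fix y :: 'a
      have "pgram (r *\<^sub>R y) x = r * pgram y x"
        using kernelD(4)[OF kp, of x r y] r by (simp add: pgram_commute)
      moreover have "indicator (cball 0 r) (r *\<^sub>R y) = (indicator ?B y :: real)" using r by (simp add: indicator_def)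
      ultimately show "?f (r *\<^sub>R y) = r powr p * (indicator ?B y *\<^sub>R pgram y x powr p)"
        by (simp add: powr_mult)
    qed simp
    also have "\<dots> = r powr p * mom p pgram ?B x" by (simp add: mom_def set_lebesgue_integral_def)
    finally have e: "r powr (- ?n) * mom p pgram (cball 0 r) x = r powr p * mom p pgram ?B x"
      by (simp add: mom_def set_lebesgue_integral_def)
    have "mom p pgram (cball 0 r) x = r powr ?n * (r powr (- ?n) * mom p pgram (cball 0 r) x)"
      using r by (simp add: mult.assoc[symmetric] powr_add[symmetric])
    also have "\<dots> = r powr (?n + p) * mom p pgram ?B x" unfolding e by (simp add: powr_add mult.assoc)
    finally show ?thesis .
  qed
  have lv: "lvol (mom p pgram (cball (0::'a) r)) = (r powr (?n + p)) powr (- (?n / p)) * lvol (mom p pgram ?B)"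
    unfolding m using r by (intro lvol_cmult[OF M p0]) simp
  have mB: "measure lborel (cball (0::'a) r) = r powr ?n * measure lborel ?B"
    using r by (simp add: content_cball powr_realpow)
  have "Qf p pgram (cball (0::'a) r) = ((r powr ?n) powr (1 + ?n / p) * (r powr (?n + p)) powr (- (?n / p))) * Qf p pgram ?B"
    unfolding Qf_def lv mB powr_mult by (simp add: mult_ac)
  also have "(r powr ?n) powr (1 + ?n / p) * (r powr (?n + p)) powr (- (?n / p)) = 1"
  proof -
    have "?n * (1 + ?n / p) + (?n + p) * (- (?n / p)) = 0" using p0 by (simp add: field_simps)
    thus ?thesis unfolding powr_powr powr_add[symmetric] using r by simp
  qed
  finally show ?thesis by simp
qed

theorem pgram_inequality:
  fixes K :: "'a::euclidean_space set"
  assumes dim: "DIM('a) \<ge> 2" and p: "p \<ge> 1" and K: "adm p K"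
  shows "Qf p pgram K \<le> Qf p pgram (cball 0 1 :: 'a set)"
    "Qf p pgram K = Qf p pgram (cball 0 1 :: 'a set) \<longleftrightarrow>
      (if DIM('a) = 2 then \<exists>T :: 'a \<Rightarrow> 'a. linear T \<and> inj T \<and> (AE x in lborel. x \<in> K \<longleftrightarrow> x \<in> T ` cball 0 1)
       else \<exists>r>0. AE x in lborel. x \<in> K \<longleftrightarrow> x \<in> cball (0::'a) r)"
proof -
  have p0: "p > 0" using p by simp
  have B: "adm p (cball 0 1 :: 'a set)" using p0 by (intro adm_cball) auto
  note kp = kernel_pgram[where 'a='a, OF dim]
  have "Qf p pgram K \<le> Qf p pgram (cball 0 1 :: 'a set) \<and>
    (Qf p pgram K = Qf p pgram (cball 0 1 :: 'a set) \<longleftrightarrow>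
      (if DIM('a) = 2 then \<exists>T :: 'a \<Rightarrow> 'a. linear T \<and> inj T \<and> (AE x in lborel. x \<in> K \<longleftrightarrow> x \<in> T ` cball 0 1)
       else \<exists>r>0. AE x in lborel. x \<in> K \<longleftrightarrow> x \<in> cball (0::'a) r))"
  proof (cases "DIM('a) = 2")
    case True
    have "Qf p dotk K = Qf p dotk (cball 0 1 :: 'a set)"
      if T: "linear T" "inj T" "AE x in lborel. x \<in> K \<longleftrightarrow> x \<in> T ` cball 0 1" for T :: "'a \<Rightarrow> 'a"
    proof -
      have "compact (T ` cball 0 1)"
        by (intro compact_continuous_image linear_continuous_on linear_conv_bounded_linear[THEN iffD1] T) simp
      hence "T ` cball 0 1 \<in> sets borel" by (intro borel_closed compact_imp_closed)
      from Qf_cong_AE[OF kernel_dotk adm_borel[OF K] this T(3)] show ?thesis using Qf_ellipsoid[OF T(1,2) p] by simp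
    qed
    thus ?thesis using Lutwak_Zhang[OF p K] True
      unfolding Qf_pgram_plane[OF True p K] Qf_pgram_plane[OF True p B] by auto
  next
    case False
    hence "3 \<le> card (Basis :: 'a set)" using dim by simp
    then obtain S where S: "S \<subseteq> (Basis :: 'a set)" "card S = 3" using obtain_subset_with_card_n by metis
    then obtain b0 b1 b2 where b: "S = {b0, b1, b2}" "b0 \<noteq> b1" "b1 \<noteq> b2" "b0 \<noteq> b2" by (auto simp: card_3_iff)
    interpret bands3 b0 b1 b2 by unfold_locales (use S(1) b in auto)
    have "Qf p pgram K = Qf p pgram (cball 0 1 :: 'a set)"
      if r: "r > 0" "AE x in lborel. x \<in> K \<longleftrightarrow> x \<in> cball (0::'a) r" for r
      using Qf_cong_AE[OF kp adm_borel[OF K] _ r(2)] Qf_pgram_cball[OF dim p r(1)] by simp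
    thus ?thesis using pgram_ball[OF p K] False by auto
  qed
  thus "Qf p pgram K \<le> Qf p pgram (cball 0 1 :: 'a set)"
    "Qf p pgram K = Qf p pgram (cball 0 1 :: 'a set) \<longleftrightarrow>
      (if DIM('a) = 2 then \<exists>T :: 'a \<Rightarrow> 'a. linear T \<and> inj T \<and> (AE x in lborel. x \<in> K \<longleftrightarrow> x \<in> T ` cball 0 1)
       else \<exists>r>0. AE x in lborel. x \<in> K \<longleftrightarrow> x \<in> cball (0::'a) r)" by blast+
qed

section \<open>Normalisation and polarity\<close>

lemma Qf_pgram_unit_ball:
  assumes dim: "DIM('a::euclidean_space) \<ge> 2" and p: "p \<ge> 1"
  shows "ctilde DIM('a) p powr (real DIM('a) / p) * Qf p pgram (cball (0::'a) 1) = (omega (real DIM('a)))\<^sup>2"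
proof -
  let ?n = "real DIM('a)" and ?c = "ctilde DIM('a) p"
  let ?o = "omega ?n"
  have p0: "p > 0" using p by simp
  have o: "?o > 0" unfolding omega_eq_unit_ball_vol by simp
  have c: "?c > 0" by (rule ctilde_Beta(2)[OF dim p])
  have m: "measure lborel (cball (0::'a) 1) = ?o" unfolding omega_eq_unit_ball_vol by (simp add: content_cball)
  have mf: "mom p pgram (cball (0::'a) 1) = (\<lambda>x. ?c * ?o * norm x powr p)" using mom_pgram_cball[OF dim p] by blast
  have "norm x powr p \<le> 1 \<longleftrightarrow> norm x \<le> 1" for x :: 'a
    using powr_less_mono2[of p 1 "norm x"] powr_mono2[of p "norm x" 1] p0 by (auto simp: not_le[symmetric])
  hence l1: "lvol (\<lambda>x::'a. norm x powr p) = ?o" unfolding lvol_def m[symmetric] by (simp add: cball_def dist_norm)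
  have l: "lvol (mom p pgram (cball (0::'a) 1)) = (?c * ?o) powr (- (?n / p)) * ?o"
    using lvol_cmult[OF norm_powr_phom[OF p0, where 'a='a] p0 mult_pos_pos[OF c o]] unfolding mf l1 .
  have "?c powr (?n / p) * Qf p pgram (cball (0::'a) 1) = (?c powr (?n/p) * ?c powr (- (?n/p))) * (?o powr (1 + ?n/p) * ?o powr (- (?n/p))) * ?o"
    unfolding Qf_def l m powr_mult by (simp add: mult_ac)
  also have "\<dots> = ?o\<^sup>2" unfolding powr_add[symmetric] using c o by (simp add: power2_eq_square)
  finally show ?thesis .
qed

text \<open>The bipolar theorem for a norm: a point outside the closed unit ball is separated from
  it by a hyperplane, whose suitably scaled normal is dominated by \<open>h\<close>.\<close>

lemma polar_of_support:
  fixes h :: "'a::euclidean_space \<Rightarrow> real"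
  assumes h: "nrm h"
  shows "polar {z. \<forall>x. z \<bullet> x \<le> h x} = {x. h x \<le> 1}"
proof (intro equalityI subsetI)
  fix x assume x: "x \<in> {x. h x \<le> 1}"
  show "x \<in> polar {z. \<forall>x. z \<bullet> x \<le> h x}"
    unfolding polar_def
  proof (safe)
    fix y assume "\<forall>x. y \<bullet> x \<le> h x"
    hence "y \<bullet> x \<le> h x" by blast
    thus "x \<bullet> y \<le> 1" using x by (simp add: inner_commute)
  qed
next
  fix x assume x: "x \<in> polar {z. \<forall>x. z \<bullet> x \<le> h x}"
  show "x \<in> {x. h x \<le> 1}"
  proof (rule ccontr)
    assume nx: "x \<notin> {x. h x \<le> 1}"
    have cv: "convex {x. h x \<le> 1}"
    proof (rule convexI)
      fix x y :: 'a and u v :: real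
      assume a: "x \<in> {x. h x \<le> 1}" "y \<in> {x. h x \<le> 1}" "0 \<le> u" "0 \<le> v" "u + v = 1"
      have "h (u *\<^sub>R x + v *\<^sub>R y) \<le> u * h x + v * h y" using nrm_add[OF h, of "u *\<^sub>R x" "v *\<^sub>R y"] a by (simp add: nrm_scale[OF h])
      also have "\<dots> \<le> u * 1 + v * 1" using a by (intro add_mono mult_left_mono) auto
      finally show "u *\<^sub>R x + v *\<^sub>R y \<in> {x. h x \<le> 1}" using a by simp
    qed
    have cl: "closed {x. h x \<le> 1}" by (intro closed_Collect_le nrm_cont[OF h] continuous_intros)
    obtain a b where ab: "a \<bullet> x < b" "\<And>y. h y \<le> 1 \<Longrightarrow> a \<bullet> y > b"
      using separating_hyperplane_closed_point[OF cv cl nx] by auto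
    have b: "b < 0" using ab(2)[of 0] nrm_zero[OF h] by simp
    \<comment> \<open>The separating level is negative because the ball contains 0, so this division
      reverses the inequalities.\<close>
    define z where "z = (1 / b) *\<^sub>R a"
    have z1: "z \<bullet> y < 1" if "h y \<le> 1" for y using ab(2)[OF that] b by (simp add: z_def neg_divide_less_eq)
    have zx: "z \<bullet> x > 1" using ab(1) b by (simp add: z_def neg_less_divide_eq)
    have "z \<bullet> y \<le> h y" for y
    proof (cases "y = 0")
      case False
      have hy: "h y > 0" by (rule nrm_pos[OF h False])
      have "h ((1 / h y) *\<^sub>R y) \<le> 1" using hy by (simp add: nrm_scale[OF h])
      from z1[OF this] show ?thesis using hy by simp
    qed (simp add: nrm_zero[OF h])
    hence "x \<bullet> z \<le> 1" using x by (simp add: polar_def)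
    thus False using zx by (simp add: inner_commute)
  qed
qed

section \<open>Moments of stars\<close>

text \<open>The terms at least double from one to the next, so the sum is at most twice its last
  nonzero term, whose index satisfies 2^k <= F.\<close>

lemma dyadic_sum:
  fixes F q :: real
  assumes q: "q \<ge> 1" and F: "F \<ge> 0"
  shows "(\<Sum>k<M. if 2 ^ k \<le> F then (2 ^ Suc k) powr q else 0) \<le> 2 * 2 powr q * F powr q"
proof -
  let ?w = "\<lambda>k. ((2::real) ^ Suc k) powr q"
  have ws: "?w (Suc k) = 2 powr q * ?w k" for k by (simp only: power_Suc[of 2 "Suc k"] powr_mult)
  have wc: "?w k = 2 powr q * (2 ^ k) powr q" for k by (simp only: power_Suc powr_mult)
  have q2: "2 \<le> 2 powr q" using powr_mono[of 1 q 2] q by simp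
  have geo: "(\<Sum>k<M. ?w k) \<le> ?w M" for M
  proof (induction M)
    case (Suc M)
    have "(\<Sum>k<Suc M. ?w k) \<le> 2 * ?w M" using Suc by simp
    also have "\<dots> \<le> 2 powr q * ?w M" using q2 by (intro mult_right_mono) auto
    finally show ?case unfolding ws .
  qed simp
  show ?thesis
  proof (induction M)
    case (Suc M)
    show ?case
    proof (cases "2 ^ M \<le> F")
      case True
      have "(\<Sum>k<Suc M. if 2 ^ k \<le> F then ?w k else 0) \<le> (\<Sum>k<Suc M. ?w k)" by (intro sum_mono) simp
      also have "\<dots> \<le> 2 * ?w M" using geo[of M] by simp
      also have "\<dots> = 2 * 2 powr q * (2 ^ M) powr q" unfolding wc by simp
      also have "\<dots> \<le> 2 * 2 powr q * F powr q" using True q by (intro mult_left_mono powr_mono2) auto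
      finally show ?thesis .
    next
      case False
      thus ?thesis using Suc by simp
    qed
  qed (use F in simp)
qed

lemma radial_setD:
  assumes "x \<in> radial_set \<rho>" "x \<noteq> 0" shows "norm x \<le> \<rho> (sgn x)"
proof -
  obtain r u where ru: "x = r *\<^sub>R u" "norm u = 1" "0 \<le> r" "r \<le> \<rho> u" using assms(1) by (auto simp: radial_set_def)
  have "r > 0" using ru assms(2) by (cases "r = 0") auto
  hence "sgn x = u" "norm x = r" using ru by (auto simp: sgn_div_norm)
  thus ?thesis using ru by simp
qed

text \<open>Scaling the dyadic shells of the star back to the unit ball compares the moment of order \<open>p\<close>
  with the integral of the power \<open>n + p\<close> of the radial function.\<close>
lemma Lq_star_moment:
  fixes K :: "'a::euclidean_space set"
  assumes p: "p \<ge> 1" and star: "Lq_star (real DIM('a) + p) K" and K: "K \<in> sets lebesgue" "emeasure lebesgue K \<noteq> \<infinity>"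
  shows "(\<integral>\<^sup>+x. indicator K x * ennreal (norm x powr p) \<partial>lebesgue) < \<infinity>"
proof -
  let ?q = "real DIM('a) + p" and ?B = "cball 0 1 :: 'a set"
  obtain \<rho> where \<rho>': "\<forall>u\<in>sphere 0 1. 0 \<le> \<rho> u" and \<rho>: "integrable (lebesgue_on ?B) (\<lambda>x. \<rho> (sgn x) powr ?q)"
     "(\<lambda>x. \<rho> (sgn x)) \<in> borel_measurable (lebesgue_on ?B)" "K = radial_set \<rho>"
    using star unfolding Lq_star_def by blast
  define F where "F x = \<rho> (sgn x)" for x :: 'a
  have Fm: "F \<in> borel_measurable (lebesgue_on ?B)" using \<rho>(2) by (simp add: F_def[abs_def])
  have F0: "F x \<ge> 0" if "x \<noteq> 0" for x unfolding F_def using that \<rho>' by (simp add: norm_sgn)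
  define S where "S k = {x \<in> K. 2 ^ k < norm x \<and> norm x \<le> 2 ^ Suc k}" for k
  define H where "H k = {x \<in> ?B. x \<noteq> 0 \<and> 2 ^ k \<le> F x}" for k
  have Bm: "?B \<in> sets lebesgue" by simp
  have Hm: "H k \<in> sets lebesgue" for k
  proof -
    have "{x \<in> space (lebesgue_on ?B). 2 ^ k \<le> F x} \<in> sets (lebesgue_on ?B)" using Fm by measurable
    hence "{x \<in> ?B. 2 ^ k \<le> F x} \<in> sets lebesgue" by (simp add: sets_restrict_space_iff)
    moreover have "H k = {x \<in> ?B. 2 ^ k \<le> F x} - {0}" by (auto simp: H_def)
    moreover have "{0::'a} \<in> sets lebesgue" by simp
    ultimately show ?thesis by (metis sets.Diff)
  qed
  have Sm: "S k \<in> sets lebesgue" for k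
  proof -
    have "{x::'a. 2 ^ k < norm x \<and> norm x \<le> 2 ^ Suc k} \<in> sets borel" by measurable
    hence "{x::'a. 2 ^ k < norm x \<and> norm x \<le> 2 ^ Suc k} \<in> sets lebesgue" by simp
    moreover have "S k = K \<inter> {x. 2 ^ k < norm x \<and> norm x \<le> 2 ^ Suc k}" by (auto simp: S_def)
    ultimately show ?thesis using K(1) by (metis sets.Int)
  qed
  \<comment> \<open>Scaling by 2^(k+1) carries points of the unit ball to the shell, and a direction
    that meets the shell has radial function above 2^k. The Jacobian supplies the n in the exponent
    n + p.\<close>
  have SH: "emeasure lebesgue (S k) \<le> ennreal (2 ^ Suc k) ^ DIM('a) * emeasure lebesgue (H k)" for k
  proof -
    let ?t = "(2::real) ^ Suc k"
    have t: "?t > 0" by simp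
    have sub: "S k \<subseteq> (\<lambda>x. ?t *\<^sub>R x + 0) ` H k"
    proof
      fix x assume x: "x \<in> S k"
      hence x0: "x \<noteq> 0" and xn: "2 ^ k < norm x" "norm x \<le> ?t" "x \<in> K" by (auto simp: S_def)
      have "norm x \<le> F x" unfolding F_def using radial_setD[of x \<rho>] xn(3) \<rho>(3) x0 by simp
      moreover have "sgn ((1 / ?t) *\<^sub>R x) = sgn x" using t by (simp add: sgn_scaleR del: power_Suc)
      ultimately have "(1 / ?t) *\<^sub>R x \<in> H k" using x0 xn t by (simp add: H_def F_def del: power_Suc)
      moreover have "x = ?t *\<^sub>R ((1 / ?t) *\<^sub>R x) + 0" using t by (simp del: power_Suc)
      ultimately show "x \<in> (\<lambda>x. ?t *\<^sub>R x + 0) ` H k" by blast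
    qed
    have im: "(\<lambda>x. ?t *\<^sub>R x + 0) ` H k \<in> sets lebesgue"
    proof -
      have "(\<lambda>x. ?t *\<^sub>R x + 0) ` H k = (\<lambda>x. (1 / ?t) *\<^sub>R x) -` H k \<inter> space lebesgue"
      proof (intro equalityI subsetI)
        fix x assume "x \<in> (\<lambda>x. (1 / ?t) *\<^sub>R x) -` H k \<inter> space lebesgue"
        moreover have "x = ?t *\<^sub>R ((1 / ?t) *\<^sub>R x) + 0" using t by (simp del: power_Suc)
        ultimately show "x \<in> (\<lambda>x. ?t *\<^sub>R x + 0) ` H k" by blast
      qed (use t in \<open>auto simp del: power_Suc\<close>)
      thus ?thesis using measurable_sets[OF lebesgue_measurable_scaling Hm] by simp
    qed
    have "emeasure lebesgue (S k) \<le> emeasure lebesgue ((\<lambda>x. ?t *\<^sub>R x + 0) ` H k)" by (rule emeasure_mono[OF sub im])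
    also have "\<dots> = ennreal (2 ^ Suc k) ^ DIM('a) * emeasure lebesgue (H k)"
      unfolding emeasure_lebesgue_affine using t by (simp add: ennreal_power del: power_Suc)
    finally show ?thesis .
  qed
  let ?c = "\<lambda>k. ennreal ((2 ^ Suc k) powr p)"
  \<comment> \<open>Inside the unit ball the integrand is at most 1, so that part is paid for by the
    volume of \<open>K\<close>.\<close>
  have pt: "indicator K x * ennreal (norm x powr p) \<le> indicator K x + (\<Sum>k. ?c k * indicator (S k) x)" for x
  proof (cases "x \<in> K \<and> norm x > 1")
    case True
    obtain m where m: "norm x < 2 ^ m" using real_arch_pow[of 2 "norm x"] by auto
    define k where "k = (LEAST j. norm x \<le> 2 ^ Suc j)"
    have "(2::real) ^ m \<le> 2 ^ Suc m" by (rule power_increasing) auto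
    hence ex: "norm x \<le> 2 ^ Suc m" using m by linarith
    have k1: "norm x \<le> 2 ^ Suc k" unfolding k_def by (rule LeastI[of "\<lambda>j. norm x \<le> 2 ^ Suc j", OF ex])
    have k2: "2 ^ k < norm x"
    proof (cases k)
      case (Suc j)
      hence "\<not> norm x \<le> 2 ^ Suc j" unfolding k_def by (intro not_less_Least) simp
      thus ?thesis using Suc by simp
    qed (use True in simp)
    have xS: "x \<in> S k" using True k1 k2 by (simp add: S_def)
    have "indicator K x * ennreal (norm x powr p) \<le> ?c k * indicator (S k) x"
      using xS True k1 p by (simp add: indicator_def ennreal_leI powr_mono2 del: power_Suc)
    also have "\<dots> = (\<Sum>j\<in>{k}. ?c j * indicator (S j) x)"
      by (simp only: sum.insert finite.emptyI empty_iff not_False_eq_True sum.empty add_0_right)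
    also have "\<dots> \<le> (\<Sum>j. ?c j * indicator (S j) x)" by (rule sum_le_suminf) auto
    finally show ?thesis by (rule add_increasing[OF zero_le])
  next
    case False
    have "indicator K x * ennreal (norm x powr p) \<le> indicator K x"
    proof (cases "x \<in> K")
      case True
      hence "norm x powr p \<le> 1 powr p" using False p by (intro powr_mono2) auto
      hence "ennreal (norm x powr p) \<le> 1" by (simp add: ennreal_le_1)
      thus ?thesis using True by simp
    qed simp
    thus ?thesis by (rule add_increasing2[OF zero_le])
  qed
  have "(\<integral>\<^sup>+x. indicator K x * ennreal (norm x powr p) \<partial>lebesgue) \<le> (\<integral>\<^sup>+x. indicator K x + (\<Sum>k. ?c k * indicator (S k) x) \<partial>lebesgue)"
    by (intro nn_integral_mono pt)
  also have "\<dots> = (\<integral>\<^sup>+x. indicator K x \<partial>lebesgue) + (\<integral>\<^sup>+x. (\<Sum>k. ?c k * indicator (S k) x) \<partial>lebesgue)"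
    using K(1) Sm by (intro nn_integral_add borel_measurable_indicator borel_measurable_suminf borel_measurable_times_ennreal borel_measurable_const) auto
  also have "(\<integral>\<^sup>+x. indicator K x \<partial>lebesgue) = emeasure lebesgue K" using K(1) by simp
  also have "(\<integral>\<^sup>+x. (\<Sum>k. ?c k * indicator (S k) x) \<partial>lebesgue) = (\<Sum>k. \<integral>\<^sup>+x. ?c k * indicator (S k) x \<partial>lebesgue)"
    using Sm by (intro nn_integral_suminf borel_measurable_times_ennreal borel_measurable_const borel_measurable_indicator)
  also have "\<dots> = (\<Sum>k. ?c k * emeasure lebesgue (S k))" using Sm by (simp add: nn_integral_cmult_indicator)
  also have "\<dots> \<le> (\<Sum>k. ennreal ((2 ^ Suc k) powr ?q) * emeasure lebesgue (H k))"
  proof (rule suminf_le)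
    fix k
    have "?c k * emeasure lebesgue (S k) \<le> ?c k * (ennreal (2 ^ Suc k) ^ DIM('a) * emeasure lebesgue (H k))"
      by (rule mult_left_mono[OF SH]) simp
    also have "\<dots> = (?c k * ennreal (2 ^ Suc k) ^ DIM('a)) * emeasure lebesgue (H k)" by (rule mult.assoc[symmetric])
    also have "?c k * ennreal (2 ^ Suc k) ^ DIM('a) = ennreal ((2 ^ Suc k) powr ?q)"
    proof -
      have "ennreal (2 ^ Suc k) ^ DIM('a) = ennreal ((2 ^ Suc k) powr real DIM('a))"
        by (subst ennreal_power) (simp_all add: powr_realpow del: power_Suc)
      hence "?c k * ennreal (2 ^ Suc k) ^ DIM('a) = ennreal ((2 ^ Suc k) powr p * (2 ^ Suc k) powr real DIM('a))"
        by (simp add: ennreal_mult del: power_Suc)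
      thus ?thesis unfolding powr_add[symmetric] by (simp add: add.commute)
    qed
    finally show "?c k * emeasure lebesgue (S k) \<le> ennreal ((2 ^ Suc k) powr ?q) * emeasure lebesgue (H k)" .
  qed auto
  also have "\<dots> = (\<Sum>k. \<integral>\<^sup>+x. ennreal ((2 ^ Suc k) powr ?q) * indicator (H k) x \<partial>lebesgue)" using Hm by (simp add: nn_integral_cmult_indicator)
  also have "\<dots> = (\<integral>\<^sup>+x. (\<Sum>k. ennreal ((2 ^ Suc k) powr ?q) * indicator (H k) x) \<partial>lebesgue)"
    using Hm by (intro nn_integral_suminf[symmetric] borel_measurable_times_ennreal borel_measurable_const borel_measurable_indicator)
  also have "\<dots> \<le> (\<integral>\<^sup>+x. ennreal (2 * 2 powr ?q) * (ennreal (F x powr ?q) * indicator ?B x) \<partial>lebesgue)"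
  proof (rule nn_integral_mono)
    fix x :: 'a
    show "(\<Sum>k. ennreal ((2 ^ Suc k) powr ?q) * indicator (H k) x) \<le> ennreal (2 * 2 powr ?q) * (ennreal (F x powr ?q) * indicator ?B x)"
    proof (cases "x \<in> ?B \<and> x \<noteq> 0")
      case True
      have "(\<Sum>k<M. ennreal ((2 ^ Suc k) powr ?q) * indicator (H k) x) \<le> ennreal (2 * 2 powr ?q * F x powr ?q)" for M
      proof -
        have "(\<Sum>k<M. ennreal ((2 ^ Suc k) powr ?q) * indicator (H k) x) = (\<Sum>k<M. ennreal (if 2 ^ k \<le> F x then (2 ^ Suc k) powr ?q else 0))"
          using True by (intro sum.cong refl) (simp add: H_def indicator_def del: power_Suc)
        also have "\<dots> = ennreal (\<Sum>k<M. if 2 ^ k \<le> F x then (2 ^ Suc k) powr ?q else 0)"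
          by (rule sum_ennreal) simp
        also have "\<dots> \<le> ennreal (2 * 2 powr ?q * F x powr ?q)" using p True F0[of x] by (intro ennreal_leI dyadic_sum) auto
        finally show ?thesis .
      qed
      hence "(\<Sum>k. ennreal ((2 ^ Suc k) powr ?q) * indicator (H k) x) \<le> ennreal (2 * 2 powr ?q * F x powr ?q)"
        by (intro suminf_le_const) auto
      also have "\<dots> = ennreal (2 * 2 powr ?q) * ennreal (F x powr ?q)" by (rule ennreal_mult) auto
      finally show ?thesis using True by simp
    next
      case False
      have "indicator (H k) x = (0::ennreal)" for k using False by (auto simp: H_def)
      thus ?thesis by simp
    qed
  qed
  also have "\<dots> = (\<integral>\<^sup>+x. ennreal (2 * 2 powr ?q) * ennreal (F x powr ?q) \<partial>lebesgue_on ?B)"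
    by (subst nn_integral_restrict_space) (auto simp: mult.assoc)
  also have "\<dots> = ennreal (2 * 2 powr ?q) * (\<integral>\<^sup>+x. ennreal (F x powr ?q) \<partial>lebesgue_on ?B)"
    using Fm by (intro nn_integral_cmult) measurable
  finally have le: "(\<integral>\<^sup>+x. indicator K x * ennreal (norm x powr p) \<partial>lebesgue)
    \<le> emeasure lebesgue K + ennreal (2 * 2 powr ?q) * (\<integral>\<^sup>+x. ennreal (F x powr ?q) \<partial>lebesgue_on ?B)"
    by (simp add: add_left_mono)
  have "(\<integral>\<^sup>+x. ennreal (F x powr ?q) \<partial>lebesgue_on ?B) < \<infinity>"
    using \<rho>(1) by (simp add: integrable_iff_bounded F_def)
  hence "emeasure lebesgue K + ennreal (2 * 2 powr ?q) * (\<integral>\<^sup>+x. ennreal (F x powr ?q) \<partial>lebesgue_on ?B) < \<infinity>"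
    using K(2) by (simp add: ennreal_mult_less_top less_top)
  with le show ?thesis by (rule le_less_trans)
qed

text \<open>Positivity of \<open>vol K\<close> encodes measurability and finite volume, since
  \<open>measure\<close> is 0 otherwise. The Borel representative \<open>L\<close> is the one for
  which the moment inequalities are stated.\<close>

lemma Lq_star_adm:
  fixes K :: "'a::euclidean_space set"
  assumes p: "p \<ge> 1" and star: "Lq_star (real DIM('a) + p) K" and v: "vol K > 0"
  obtains L where "adm p L" "K \<in> sets lebesgue" "AE x in lborel. x \<in> L \<longleftrightarrow> x \<in> K" "measure lborel L = vol K"
proof -
  have Km: "K \<in> sets lebesgue" using v measure_notin_sets by (fastforce simp: vol_def)
  have Kf: "emeasure lebesgue K \<noteq> \<infinity>" using v by (auto simp: vol_def measure_def)
  define L where "L = main_part lborel K"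
  have Lb: "L \<in> sets borel" unfolding L_def using main_part_sets[OF Km] by simp
  have ae: "AE x in lborel. x \<in> L \<longleftrightarrow> x \<in> K" unfolding L_def by (rule AE_in_main_part[OF Km])
  have eL: "emeasure lborel L = emeasure lebesgue K" unfolding L_def by (rule emeasure_completion[OF Km, symmetric])
  have mL: "measure lborel L = vol K" by (simp add: vol_def measure_def eL)
  have "(\<integral>\<^sup>+x. ennreal (norm (indicator L x *\<^sub>R norm x powr p)) \<partial>lborel) = (\<integral>\<^sup>+x. indicator K x * ennreal (norm x powr p) \<partial>lborel)"
  proof (rule nn_integral_cong_AE)
    show "AE x in lborel. ennreal (norm (indicator L x *\<^sub>R norm x powr p)) = indicator K x * ennreal (norm x powr p)"
      using ae by eventually_elim (auto simp: indicator_def)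
  qed
  also have "\<dots> < \<infinity>" using Lq_star_moment[OF p star Km Kf] by (simp only: nn_integral_completion)
  finally have "set_integrable lborel L (\<lambda>x. norm x powr p)"
    unfolding set_integrable_def using Lb by (intro integrableI_bounded) auto
  hence "adm p L" unfolding adm_def using Lb eL Kf mL v by (auto simp: measure_def)
  thus ?thesis using that Km ae mL by blast
qed

lemma sine_support_mom:
  fixes K L :: "'a::euclidean_space set"
  assumes dim: "DIM('a) \<ge> 2" and L: "L \<in> sets borel" and K: "K \<in> sets lebesgue" and ae: "AE x in lborel. x \<in> L \<longleftrightarrow> x \<in> K"
  shows "sine_support p K x = (1 / (ctilde DIM('a) p * vol K) * mom p pgram L x) powr (1 / p)"
proof -
  have pm: "(\<lambda>y. pgram x y powr p) \<in> borel_measurable borel"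
    using kernel_measurable[OF kernel_pgram[where 'a='a, OF dim]] by measurable
  have "(\<integral>y. pgram x y powr p \<partial>(lebesgue_on K)) = (\<integral>y. indicator K y *\<^sub>R pgram x y powr p \<partial>lebesgue)"
    using K by (subst integral_restrict_space) auto
  also have "\<dots> = (\<integral>y. indicator L y *\<^sub>R pgram x y powr p \<partial>lebesgue)"
  proof (rule integral_cong_AE)
    have "(\<lambda>y. pgram x y powr p) \<in> borel_measurable lebesgue" by (rule measurable_completion) (use pm in simp)
    hence m: "(\<lambda>y. indicator A y *\<^sub>R pgram x y powr p) \<in> borel_measurable lebesgue" if "A \<in> sets lebesgue" for A :: "'a set"
      by (rule borel_measurable_scaleR[OF borel_measurable_indicator[OF that]])
    show "(\<lambda>y. indicator K y *\<^sub>R pgram x y powr p) \<in> borel_measurable lebesgue" by (rule m[OF K])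
    show "(\<lambda>y. indicator L y *\<^sub>R pgram x y powr p) \<in> borel_measurable lebesgue" by (rule m) (use L in simp)
    show "AE y in lebesgue. indicator K y *\<^sub>R pgram x y powr p = indicator L y *\<^sub>R pgram x y powr p"
      using AE_completion[OF ae] by eventually_elim (auto simp: indicator_def)
  qed
  also have "\<dots> = (\<integral>y. indicator L y *\<^sub>R pgram x y powr p \<partial>lborel)"
    by (intro integral_completion borel_measurable_scaleR borel_measurable_indicator) (use L pm in simp_all)
  also have "\<dots> = mom p pgram L x" by (simp add: mom_def set_lebesgue_integral_def pgram_commute)
  finally show ?thesis by (simp add: sine_support_def)
qed

text \<open>The polar body is the sublevel set of the moment at level c V(K), where c is
  \<open>ctilde\<close>. Its volume contributes V(K)^(n/p), which together with V(K) gives the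
  exponent in \<open>Qf\<close>.\<close>

lemma polar_sine_centroid_volume:
  fixes K L :: "'a::euclidean_space set"
  assumes dim: "DIM('a) \<ge> 2" and p: "p \<ge> 1" and L: "adm p L" and K: "K \<in> sets lebesgue"
    and ae: "AE x in lborel. x \<in> L \<longleftrightarrow> x \<in> K" and v: "measure lborel L = vol K"
  shows "vol K * vol (polar (sine_centroid p K)) = ctilde DIM('a) p powr (real DIM('a) / p) * Qf p pgram L"
proof -
  let ?n = "real DIM('a)" and ?c = "ctilde DIM('a) p"
  have p0: "p > 0" using p by simp
  note kp = kernel_pgram[where 'a='a, OF dim]
  note N = mom_phom_convex[OF kp p L]
  have c: "?c > 0" by (rule ctilde_Beta(2)[OF dim p])
  have v0: "vol K > 0" using adm_measure_pos[OF L] v by simp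
  let ?M = "\<lambda>x. 1 / (?c * vol K) * mom p pgram L x"
  have cv: "?c * vol K > 0" using c v0 by simp
  have sm: "sine_support p K = (\<lambda>x. ?M x powr (1 / p))" using sine_support_mom[OF dim adm_borel[OF L] K ae] by blast
  have M: "phom p ?M"
    using N(1) cv unfolding phom_def by (auto intro!: continuous_intros)
  have "convex_on UNIV ?M" using N(2) cv by (intro convex_on_cmul) auto
  hence nr: "nrm (sine_support p K)" unfolding sm by (rule phom_root_nrm[OF M p])
  have one: "t powr (1 / p) \<le> 1 \<longleftrightarrow> t \<le> 1" if "t \<ge> 0" for t :: real
    using powr_less_mono2[of "1/p" 1 t] powr_mono2[of "1/p" t 1] p0 that by (auto simp: not_le[symmetric])
  have "polar (sine_centroid p K) = {x. sine_support p K x \<le> 1}"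
    unfolding sine_centroid_def by (rule polar_of_support[OF nr])
  also have "\<dots> = {x. ?M x \<le> 1}" unfolding sm using one phom_nonneg[OF M] by blast
  also have "\<dots> = {x. mom p pgram L x \<le> ?c * vol K}" using cv by (auto simp: pos_divide_le_eq)
  finally have P: "polar (sine_centroid p K) = {x. mom p pgram L x \<le> ?c * vol K}" .
  have "vol (polar (sine_centroid p K)) = measure lborel {x. mom p pgram L x \<le> ?c * vol K}"
    unfolding vol_def P using phom_sublevel_borel[OF N(1)] by (intro measure_completion) simp
  also have "\<dots> = (?c * vol K) powr (?n / p) * lvol (mom p pgram L)" by (rule phom_sublevel_measure[OF N(1) p0 cv])
  finally have "vol K * vol (polar (sine_centroid p K)) = ?c powr (?n / p) * ((vol K powr 1 * vol K powr (?n / p)) * lvol (mom p pgram L))"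
    using v0 by (simp add: powr_mult mult_ac)
  thus ?thesis unfolding powr_add[symmetric] Qf_def v .
qed

lemma ae_eq_set_AE:
  fixes K L A :: "'a::euclidean_space set"
  assumes K: "K \<in> sets lebesgue" and A: "A \<in> sets lebesgue" and ae: "AE x in lborel. x \<in> L \<longleftrightarrow> x \<in> K"
  shows "ae_eq_set K A \<longleftrightarrow> (AE x in lborel. x \<in> L \<longleftrightarrow> x \<in> A)"
proof -
  have "(K - A) \<union> (A - K) \<in> sets lebesgue" using K A by auto
  hence "ae_eq_set K A \<longleftrightarrow> (AE x in lebesgue. x \<notin> (K - A) \<union> (A - K))"
    unfolding ae_eq_set_def by (rule AE_iff_null_sets)
  also have "\<dots> \<longleftrightarrow> (AE x in lborel. x \<notin> (K - A) \<union> (A - K))" by (rule AE_completion_iff)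
  also have "\<dots> \<longleftrightarrow> (AE x in lborel. x \<in> L \<longleftrightarrow> x \<in> A)"
  proof
    assume "AE x in lborel. x \<notin> (K - A) \<union> (A - K)"
    with ae show "AE x in lborel. x \<in> L \<longleftrightarrow> x \<in> A" by eventually_elim blast
  next
    assume "AE x in lborel. x \<in> L \<longleftrightarrow> x \<in> A"
    with ae show "AE x in lborel. x \<notin> (K - A) \<union> (A - K)" by eventually_elim blast
  qed
  finally show ?thesis .
qed

theorem theorem4p4:
  fixes K :: "'a::euclidean_space set" and p :: real
  assumes "p \<ge> 1" and "DIM('a) \<ge> 2"
    and "Lq_star (real DIM('a) + p) K" and "vol K > 0"
  shows "vol K * vol (polar (sine_centroid p K)) \<le> (omega (real DIM('a)))\<^sup>2 \<and>
    (vol K * vol (polar (sine_centroid p K)) = (omega (real DIM('a)))\<^sup>2 \<longleftrightarrow>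
      (if DIM('a) = 2 then (\<exists>L. origin_ellipsoid L \<and> ae_eq_set K L)
       else (\<exists>L. origin_ball L \<and> ae_eq_set K L)))"
proof -
  let ?n = "real DIM('a)" and ?c = "ctilde DIM('a) p powr (real DIM('a) / p)"
  note p = assms(1) and dim = assms(2)
  obtain L where L: "adm p L" "K \<in> sets lebesgue" "AE x in lborel. x \<in> L \<longleftrightarrow> x \<in> K" "measure lborel L = vol K"
    by (rule Lq_star_adm[OF assms(1,3,4)])
  have c: "?c > 0" using ctilde_Beta(2)[OF dim p] by simp
  have V: "vol K * vol (polar (sine_centroid p K)) = ?c * Qf p pgram L"
    by (rule polar_sine_centroid_volume[OF dim p L])
  have O: "(omega ?n)\<^sup>2 = ?c * Qf p pgram (cball (0::'a) 1)" by (rule Qf_pgram_unit_ball[OF dim p, symmetric])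
  have ell: "(\<exists>A. origin_ellipsoid A \<and> ae_eq_set K A) \<longleftrightarrow>
    (\<exists>T :: 'a \<Rightarrow> 'a. linear T \<and> inj T \<and> (AE x in lborel. x \<in> L \<longleftrightarrow> x \<in> T ` cball 0 1))"
  proof -
    have "ae_eq_set K (T ` cball 0 1) \<longleftrightarrow> (AE x in lborel. x \<in> L \<longleftrightarrow> x \<in> T ` cball 0 1)" if "linear T" for T :: "'a \<Rightarrow> 'a"
    proof -
      have "compact (T ` cball 0 1)"
        by (intro compact_continuous_image linear_continuous_on linear_conv_bounded_linear[THEN iffD1] that) simp
      hence "T ` cball 0 1 \<in> sets lebesgue" by (simp add: borel_closed compact_imp_closed)
      from ae_eq_set_AE[OF L(2) this L(3)] show ?thesis .
    qed
    thus ?thesis unfolding origin_ellipsoid_def by blast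
  qed
  have ball: "(\<exists>A. origin_ball A \<and> ae_eq_set K A) \<longleftrightarrow> (\<exists>r>0. AE x in lborel. x \<in> L \<longleftrightarrow> x \<in> cball (0::'a) r)"
  proof -
    have "ae_eq_set K (cball 0 r) \<longleftrightarrow> (AE x in lborel. x \<in> L \<longleftrightarrow> x \<in> cball (0::'a) r)" for r
      by (rule ae_eq_set_AE[OF L(2) _ L(3)]) simp
    thus ?thesis unfolding origin_ball_def by blast
  qed
  show ?thesis
    unfolding V O ell ball using pgram_inequality[OF dim p L(1)] c by simp
qed

end
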